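(* Let $q\ge1$ and let $f$ be a smooth compactly supported differential form on $\mathbb{R}^q$. a) The form $u(t,p)=d_tf(p)=\big(t\,\phi_{q+2}(tD)\,df\big)(p)$ satisfies, for all $t>0$ and $p\in\mathbb{R}^q$, $$u_{tt}+(q-1)\left[\frac{u_t}{t}-\frac{u}{t^2}\right]+Lu=0,$$ with initial position $u(0,p)=0$ and initial velocity $\lim_{t\to0}u_t(t,p)=df(p)$. b) The form $u(t,p)=\big(\phi_q(tD)\,df\big)(p)$ satisfies, for all $t>0$ and $p\in\mathbb{R}^q$, $$u_{tt}+(q-1)\frac{u_t}{t}+Lu=0,$$ with initial position $u(0,p)=df(p)$ and initial velocity $u_t(0,p)=0$.
   Context: $\mathcal{H}=\bigoplus_{k=0}^q\mathcal{H}_k$ is the Hilbert space of $L^2$ differential forms on $\mathbb{R}^q$ (flat metric), $d$ the exterior derivative, $d^*$ its adjoint, $D=d+d^*$ the self-adjoint Dirac operator, $L=D^2=d^*d+dd^*$ the Hodge Laplacian (on $\mathbb{R}^q$ it acts on each coefficient as $-\Delta$). For $n\ge1$, $\phi_n$ is the unique solution of $f''(r)+(n-1)f'(r)/r+f(r)=0$, $f(0)=1$, $f'(0)=0$; it is an even entire function, bounded on $\mathbb{R}$, and $\phi_n(tD)$ is defined by the functional calculus of $D$. Subscripts $t$ denote derivatives in $t$. *)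

theory Defs
  imports "HOL-Analysis.Analysis"
begin

section \<open>The space of square integrable functions\<close>

definition square_integrable :: "('a::euclidean_space \<Rightarrow> 'b::euclidean_space) \<Rightarrow> bool"
  where "square_integrable f \<longleftrightarrow>
    f \<in> borel_measurable lborel \<and> integrable lborel (\<lambda>x. (norm (f x))\<^sup>2)"

lemma square_integrable_zero: "square_integrable (\<lambda>x. 0)"
  by (simp add: square_integrable_def)

lemma square_integrable_scaleR:
  assumes "square_integrable f" shows "square_integrable (\<lambda>x. c *\<^sub>R f x)"
  using assms by (auto simp: square_integrable_def power_mult_distrib)

lemma square_integrable_add:
  assumes f: "square_integrable f" and g: "square_integrable g"
  shows "square_integrable (\<lambda>x. f x + g x)"
proof -
  have [measurable]: "f \<in> borel_measurable lborel" "g \<in> borel_measurable lborel"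
    using f g by (auto simp: square_integrable_def)
  have "integrable lborel (\<lambda>x. (norm (f x + g x))\<^sup>2)"
  proof (rule Bochner_Integration.integrable_bound)
    show "integrable lborel (\<lambda>x. 2 * (norm (f x))\<^sup>2 + 2 * (norm (g x))\<^sup>2)"
      using f g by (auto simp: square_integrable_def)
    have "(norm (f x + g x))\<^sup>2 \<le> 2 * (norm (f x))\<^sup>2 + 2 * (norm (g x))\<^sup>2" for x
    proof -
      have "(norm (f x + g x))\<^sup>2 \<le> (norm (f x) + norm (g x))\<^sup>2"
        by (intro power_mono norm_triangle_ineq) auto
      also have "\<dots> \<le> 2 * (norm (f x))\<^sup>2 + 2 * (norm (g x))\<^sup>2"
        using sum_squares_bound[of "norm (f x)" "norm (g x)"] by (simp add: power2_sum)
      finally show ?thesis .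
    qed
    then show "AE x in lborel. norm ((norm (f x + g x))\<^sup>2)
        \<le> norm (2 * (norm (f x))\<^sup>2 + 2 * (norm (g x))\<^sup>2)"
      by auto
  qed measurable
  then show ?thesis by (simp add: square_integrable_def)
qed

lemma square_integrable_inner:
  assumes f: "square_integrable f" and g: "square_integrable g"
  shows "integrable lborel (\<lambda>x. f x \<bullet> g x)"
proof -
  have [measurable]: "f \<in> borel_measurable lborel" "g \<in> borel_measurable lborel"
    using f g by (auto simp: square_integrable_def)
  show ?thesis
  proof (rule Bochner_Integration.integrable_bound)
    show "integrable lborel (\<lambda>x. (norm (f x))\<^sup>2 + (norm (g x))\<^sup>2)"
      using f g by (auto simp: square_integrable_def)
    have "\<bar>f x \<bullet> g x\<bar> \<le> (norm (f x))\<^sup>2 + (norm (g x))\<^sup>2" for x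
    proof -
      have "\<bar>f x \<bullet> g x\<bar> \<le> norm (f x) * norm (g x)" by (rule Cauchy_Schwarz_ineq2)
      also have "\<dots> \<le> 2 * norm (f x) * norm (g x)" by simp
      also have "\<dots> \<le> (norm (f x))\<^sup>2 + (norm (g x))\<^sup>2" by (rule sum_squares_bound)
      finally show ?thesis .
    qed
    then show "AE x in lborel. norm (f x \<bullet> g x) \<le> norm ((norm (f x))\<^sup>2 + (norm (g x))\<^sup>2)"
      by (auto intro!: AE_I2 order_trans[OF _ abs_ge_self])
  qed measurable
qed

definition l2_eq :: "('a::euclidean_space \<Rightarrow> 'b::euclidean_space) \<Rightarrow> ('a \<Rightarrow> 'b) \<Rightarrow> bool"
  where "l2_eq f g \<longleftrightarrow> square_integrable f \<and> square_integrable g \<and> (AE x in lborel. f x = g x)"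

quotient_type (overloaded) ('a, 'b) l2 =
    "'a::euclidean_space \<Rightarrow> 'b::euclidean_space" / partial: l2_eq
proof (rule part_equivpI)
  show "\<exists>f. l2_eq f f"
    by (rule exI[of _ "\<lambda>x. 0"]) (simp add: l2_eq_def square_integrable_zero)
  show "symp l2_eq"
    by (auto simp: symp_def l2_eq_def)
  show "transp l2_eq"
    by (auto simp: transp_def l2_eq_def)
qed

instantiation l2 :: (euclidean_space, euclidean_space) real_vector
begin

lift_definition zero_l2 :: "('a, 'b) l2" is "\<lambda>x. 0"
  by (simp add: l2_eq_def square_integrable_zero)

lift_definition plus_l2 :: "('a, 'b) l2 \<Rightarrow> ('a, 'b) l2 \<Rightarrow> ('a, 'b) l2" is "\<lambda>f g x. f x + g x"
  by (auto simp: l2_eq_def square_integrable_add)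

lift_definition scaleR_l2 :: "real \<Rightarrow> ('a, 'b) l2 \<Rightarrow> ('a, 'b) l2" is "\<lambda>c f x. c *\<^sub>R f x"
  by (auto simp: l2_eq_def square_integrable_scaleR)

lift_definition uminus_l2 :: "('a, 'b) l2 \<Rightarrow> ('a, 'b) l2" is "\<lambda>f x. - f x"
  using square_integrable_scaleR[of _ "-1"] by (auto simp: l2_eq_def)

definition minus_l2 :: "('a, 'b) l2 \<Rightarrow> ('a, 'b) l2 \<Rightarrow> ('a, 'b) l2"
  where "minus_l2 F G = F + - G"

instance
proof
  fix F G H :: "('a, 'b) l2" and a b :: real
  show "F + G + H = F + (G + H)"
    by transfer (auto simp: l2_eq_def square_integrable_add add.assoc)
  show "F + G = G + F"
    by transfer (auto simp: l2_eq_def square_integrable_add add.commute)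
  show "0 + F = F"
    by transfer (auto simp: l2_eq_def)
  show "- F + F = 0"
    by transfer (auto simp: l2_eq_def square_integrable_zero)
  show "F - G = F + - G" by (rule minus_l2_def)
  show "a *\<^sub>R (F + G) = a *\<^sub>R F + a *\<^sub>R G"
    by transfer (auto simp: l2_eq_def square_integrable_add square_integrable_scaleR scaleR_add_right)
  show "(a + b) *\<^sub>R F = a *\<^sub>R F + b *\<^sub>R F"
    by transfer (auto simp: l2_eq_def square_integrable_add square_integrable_scaleR scaleR_add_left)
  show "a *\<^sub>R b *\<^sub>R F = (a * b) *\<^sub>R F"
    by transfer (auto simp: l2_eq_def square_integrable_scaleR)
  show "1 *\<^sub>R F = F"
    by transfer (auto simp: l2_eq_def)
qed

end

instantiation l2 :: (euclidean_space, euclidean_space) real_inner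
begin

lift_definition inner_l2 :: "('a, 'b) l2 \<Rightarrow> ('a, 'b) l2 \<Rightarrow> real"
  is "\<lambda>f g. \<integral>x. f x \<bullet> g x \<partial>lborel"
proof -
  fix f f' g g' :: "'a \<Rightarrow> 'b"
  assume "l2_eq f f'" "l2_eq g g'"
  then have [measurable]: "f \<in> borel_measurable lborel" "f' \<in> borel_measurable lborel"
      "g \<in> borel_measurable lborel" "g' \<in> borel_measurable lborel"
    and "AE x in lborel. f x \<bullet> g x = f' x \<bullet> g' x"
    by (auto simp: l2_eq_def square_integrable_def)
  then show "(\<integral>x. f x \<bullet> g x \<partial>lborel) = (\<integral>x. f' x \<bullet> g' x \<partial>lborel)"
    by (intro integral_cong_AE) auto
qed

definition norm_l2 :: "('a, 'b) l2 \<Rightarrow> real" where "norm F = sqrt (F \<bullet> F)" for F :: "('a, 'b) l2"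
definition sgn_l2 :: "('a, 'b) l2 \<Rightarrow> ('a, 'b) l2" where "sgn F = F /\<^sub>R norm F" for F :: "('a, 'b) l2"
definition dist_l2 :: "('a, 'b) l2 \<Rightarrow> ('a, 'b) l2 \<Rightarrow> real"
  where "dist F G = norm (F - G)" for F G :: "('a, 'b) l2"
definition uniformity_l2 :: "(('a, 'b) l2 \<times> ('a, 'b) l2) filter"
  where "uniformity_l2 = (INF e\<in>{0<..}. principal {(F, G). dist F G < e})"
definition open_l2 :: "('a, 'b) l2 set \<Rightarrow> bool"
  where "open_l2 U \<longleftrightarrow> (\<forall>F\<in>U. \<forall>\<^sub>F (F', G) in uniformity. F' = F \<longrightarrow> G \<in> U)"

instance
proof
  fix F G H :: "('a, 'b) l2" and a :: real and U :: "('a, 'b) l2 set"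
  show "dist F G = norm (F - G)" by (rule dist_l2_def)
  show "sgn F = F /\<^sub>R norm F" by (rule sgn_l2_def)
  show "uniformity = (INF e\<in>{0<..}. principal {(F::('a, 'b) l2, G). dist F G < e})"
    by (rule uniformity_l2_def)
  show "open U \<longleftrightarrow> (\<forall>F\<in>U. \<forall>\<^sub>F (F', G) in uniformity. F' = F \<longrightarrow> G \<in> U)"
    by (rule open_l2_def)
  show "F \<bullet> G = G \<bullet> F"
    by transfer (simp add: inner_commute)
  show "(F + G) \<bullet> H = F \<bullet> H + G \<bullet> H"
    by transfer (auto simp: l2_eq_def inner_add_left square_integrable_inner
        intro!: Bochner_Integration.integral_add)
  show "(a *\<^sub>R F) \<bullet> G = a * (F \<bullet> G)"
    by transfer (simp add: inner_scaleR_left)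
  show "0 \<le> F \<bullet> F"
    by transfer simp
  show "(F \<bullet> F = 0) = (F = 0)"
  proof transfer
    fix f :: "'a \<Rightarrow> 'b" assume "l2_eq f f"
    then have f: "square_integrable f" by (simp add: l2_eq_def)
    then have "((\<integral>x. f x \<bullet> f x \<partial>lborel) = 0) \<longleftrightarrow> (AE x in lborel. f x \<bullet> f x = 0)"
      by (intro integral_nonneg_eq_0_iff_AE square_integrable_inner) auto
    with f show "((\<integral>x. f x \<bullet> f x \<partial>lborel) = 0) = l2_eq f (\<lambda>x. 0)"
      by (simp add: l2_eq_def square_integrable_zero)
  qed
  show "norm F = sqrt (F \<bullet> F)" by (rule norm_l2_def)
qed

end


section \<open>Functional calculus of self-adjoint operators\<close>

text \<open>
  A possibly unbounded operator on a Hilbert space is represented by its graph.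
  Only real functions \<open>g\<close> of an operator \<open>A\<close> are considered, so real Hilbert spaces suffice. For a
  complex-linear self-adjoint \<open>A\<close>, regarded on the underlying real Hilbert space (with the real
  part of the inner product), the spectral projections and \<open>g(A)\<close> are the usual complex ones.
\<close>

definition adjoint_op :: "('h::real_inner \<times> 'h) set \<Rightarrow> ('h \<times> 'h) set"
  where "adjoint_op T = {(x, y). \<forall>(u, v) \<in> T. v \<bullet> x = u \<bullet> y}"

definition orth_projection :: "('h::real_inner \<Rightarrow> 'h) \<Rightarrow> bool"
  where "orth_projection P \<longleftrightarrow>
    bounded_linear P \<and> (\<forall>x. P (P x) = P x) \<and> (\<forall>x y. P x \<bullet> y = x \<bullet> P y)"

definition projection_valued_measure :: "(real set \<Rightarrow> 'h::real_inner \<Rightarrow> 'h) \<Rightarrow> bool"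
  where "projection_valued_measure E \<longleftrightarrow>
    (\<forall>S \<in> sets borel. orth_projection (E S)) \<and>
    E UNIV = (\<lambda>x. x) \<and>
    (\<forall>S \<in> sets borel. \<forall>T \<in> sets borel. E (S \<inter> T) = E S \<circ> E T) \<and>
    (\<forall>A :: nat \<Rightarrow> real set. range A \<subseteq> sets borel \<longrightarrow> disjoint_family A \<longrightarrow>
       (\<forall>x. (\<lambda>i. E (A i) x) sums E (\<Union>i. A i) x))"

definition spectral_distribution :: "(real set \<Rightarrow> 'h::real_inner \<Rightarrow> 'h) \<Rightarrow> 'h \<Rightarrow> real measure"
  where "spectral_distribution E x =
    measure_of UNIV (sets borel) (\<lambda>S. ennreal (E S x \<bullet> x))"

text \<open>
  The graph of the operator \<open>\<integral> g dE\<close>: its domain consists of the \<open>x\<close> with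
  \<open>\<integral> g\<^sup>2 d\<langle>E x, x\<rangle> < \<infinity>\<close>, and its value \<open>y\<close> is given by
  \<open>\<langle>y, z\<rangle> = \<integral> g d\<langle>E x, z\<rangle>\<close> for \<open>z\<close> in the (dense) domain, the integral with respect to
  the signed measure \<open>\<langle>E x, z\<rangle>\<close> being expressed by polarization.
\<close>

definition spectral_integral_dom :: "(real set \<Rightarrow> 'h::real_inner \<Rightarrow> 'h) \<Rightarrow> (real \<Rightarrow> real) \<Rightarrow> 'h set"
  where "spectral_integral_dom E g =
    {x. integrable (spectral_distribution E x) (\<lambda>r. (g r)\<^sup>2)}"

definition spectral_integral ::
    "(real set \<Rightarrow> 'h::real_inner \<Rightarrow> 'h) \<Rightarrow> (real \<Rightarrow> real) \<Rightarrow> ('h \<times> 'h) set"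
  where "spectral_integral E g =
    {(x, y). x \<in> spectral_integral_dom E g \<and>
       (\<forall>z \<in> spectral_integral_dom E g.
          y \<bullet> z = ((\<integral>r. g r \<partial>spectral_distribution E (x + z))
                 - (\<integral>r. g r \<partial>spectral_distribution E (x - z))) / 4)}"

definition spectral_resolution ::
    "('h::real_inner \<times> 'h) set \<Rightarrow> (real set \<Rightarrow> 'h \<Rightarrow> 'h) \<Rightarrow> bool"
  where "spectral_resolution A E \<longleftrightarrow>
    projection_valued_measure E \<and> A = spectral_integral E (\<lambda>r. r)"

text \<open>
  A self-adjoint operator on a Hilbert space has exactly one spectral resolution (on Borel
  sets), so that the union below is just \<open>g(A)\<close>; it is empty if \<open>A\<close> has no spectral resolution.
\<close>

definition functional_calculus ::
    "('h::real_inner \<times> 'h) set \<Rightarrow> (real \<Rightarrow> real) \<Rightarrow> ('h \<times> 'h) set"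
  where "functional_calculus A g = (\<Union>E \<in> {E. spectral_resolution A E}. spectral_integral E g)"


section \<open>Differential forms on Euclidean space\<close>

text \<open>
  A (not necessarily homogeneous) differential form on \<open>\<real>\<^sup>q\<close> is written as
  \<open>\<Sum>\<^sub>I f\<^sub>I dx\<^sub>I\<close> with \<open>I\<close> ranging over the subsets of the index type \<open>'q\<close> and
  \<open>dx\<^sub>I = dx\<^bsub>i1\<^esub> \<and> \<dots> \<and> dx\<^bsub>ik\<^esub>\<close> for \<open>I = {i1 < \<dots> < ik}\<close>; the \<open>dx\<^sub>I\<close> are orthonormal.
  The coefficients \<open>f\<^sub>I\<close> take values in \<open>'k\<close>: real forms are the case \<open>'k = real\<close>,
  complex forms the case \<open>'k = complex\<close>.
\<close>

type_synonym ('q, 'k) form = "real ^ 'q \<Rightarrow> 'k ^ ('q set)"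

definition partial_deriv :: "'q \<Rightarrow> (real ^ 'q \<Rightarrow> 'b::real_normed_vector) \<Rightarrow> real ^ 'q \<Rightarrow> 'b"
  where "partial_deriv i f x = frechet_derivative f (at x) (axis i 1)"

primrec iter_partial_deriv ::
    "'q list \<Rightarrow> (real ^ 'q \<Rightarrow> 'b::real_normed_vector) \<Rightarrow> real ^ 'q \<Rightarrow> 'b"
  where
    "iter_partial_deriv [] f = f"
  | "iter_partial_deriv (i # is) f = partial_deriv i (iter_partial_deriv is f)"

definition smooth :: "(real ^ 'q \<Rightarrow> 'b::real_normed_vector) \<Rightarrow> bool"
  where "smooth f \<longleftrightarrow> (\<forall>is x. iter_partial_deriv is f differentiable (at x))"

definition compactly_supported :: "('a::topological_space \<Rightarrow> 'b::zero) \<Rightarrow> bool"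
  where "compactly_supported f \<longleftrightarrow> compact (closure {x. f x \<noteq> 0})"

definition insertion_sign :: "'q::{finite, linorder} \<Rightarrow> 'q set \<Rightarrow> real"
  where "insertion_sign i I = (- 1) ^ card {j \<in> I. j < i}"

text \<open>\<open>wedge_dx i \<omega> = dx\<^sub>i \<and> \<omega>\<close>, and its transpose, the contraction of \<open>\<omega>\<close> with \<open>\<partial>/\<partial>x\<^sub>i\<close>.\<close>

definition wedge_dx :: "'q::{finite, linorder} \<Rightarrow> 'k ^ ('q set) \<Rightarrow> 'k::real_vector ^ ('q set)"
  where "wedge_dx i w =
    (\<chi> I. if i \<in> I then insertion_sign i I *\<^sub>R w $ (I - {i}) else 0)"

definition contract_dx :: "'q::{finite, linorder} \<Rightarrow> 'k ^ ('q set) \<Rightarrow> 'k::real_vector ^ ('q set)"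
  where "contract_dx i w =
    (\<chi> I. if i \<notin> I then insertion_sign i I *\<^sub>R w $ (insert i I) else 0)"

lemma wedge_dx_inner: "wedge_dx i v \<bullet> w = v \<bullet> contract_dx i w"
  for v w :: "'k::real_inner ^ ('q::{finite, linorder} set)"
proof -
  have sign: "insertion_sign i (insert i I) = insertion_sign i I" for I :: "'q set"
    unfolding insertion_sign_def by (rule arg_cong[where f = "\<lambda>S. (- 1) ^ card S"]) auto
  have "wedge_dx i v \<bullet> w
      = (\<Sum>I | i \<in> I. insertion_sign i I * (v $ (I - {i}) \<bullet> w $ I))"
    unfolding inner_vec_def wedge_dx_def by (rule sum.mono_neutral_cong_right) auto
  also have "\<dots> = (\<Sum>I | i \<notin> I. insertion_sign i I * (v $ I \<bullet> w $ insert i I))"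
    by (rule sum.reindex_bij_witness[of _ "insert i" "\<lambda>I. I - {i}"])
       (auto simp: sign insert_absorb simp flip: sign[of "_ - {i}"])
  also have "\<dots> = v \<bullet> contract_dx i w"
    unfolding inner_vec_def contract_dx_def by (rule sum.mono_neutral_cong_left) auto
  finally show ?thesis .
qed

definition ext_deriv ::
    "('q::{finite, linorder}, 'k::euclidean_space) form \<Rightarrow> ('q, 'k) form"
  where "ext_deriv f x = (\<Sum>i\<in>UNIV. wedge_dx i (partial_deriv i f x))"

text \<open>The formal adjoint of \<^const>\<open>ext_deriv\<close> with respect to the flat metric.\<close>

definition codiff ::
    "('q::{finite, linorder}, 'k::euclidean_space) form \<Rightarrow> ('q, 'k) form"
  where "codiff f x = - (\<Sum>i\<in>UNIV. contract_dx i (partial_deriv i f x))"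

definition hodge_laplacian ::
    "('q::{finite, linorder}, 'k::euclidean_space) form \<Rightarrow> ('q, 'k) form"
  where "hodge_laplacian f x = codiff (ext_deriv f) x + ext_deriv (codiff f) x"

definition test_form ::
    "('q::{finite, linorder}, 'k::euclidean_space) form \<Rightarrow> bool"
  where "test_form f \<longleftrightarrow> smooth f \<and> compactly_supported f"

type_synonym ('q, 'k) l2_form = "(real ^ 'q, 'k ^ ('q set)) l2"

text \<open>
  The exterior derivative as a closed operator: \<open>dF = G\<close> in the sense of distributions. On \<open>\<real>\<^sup>q\<close>
  this is also the closure of \<^const>\<open>ext_deriv\<close> on test forms.
\<close>

definition ext_deriv_l2 ::
    "(('q::{finite, linorder}, 'k::euclidean_space) l2_form \<times> ('q, 'k) l2_form) set"
  where "ext_deriv_l2 =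
    {(F, G). \<forall>h. test_form h \<longrightarrow> G \<bullet> abs_l2 h = F \<bullet> abs_l2 (codiff h)}"

text \<open>\<open>D = d + d\<^sup>*\<close>, with the Hilbert space adjoint \<open>d\<^sup>*\<close> of \<open>d\<close>.\<close>

definition dirac ::
    "(('q::{finite, linorder}, 'k::euclidean_space) l2_form \<times> ('q, 'k) l2_form) set"
  where "dirac =
    {(F, G + H) | F G H. (F, G) \<in> ext_deriv_l2 \<and> (F, H) \<in> adjoint_op ext_deriv_l2}"

text \<open>
  \<open>w\<close> is the smooth representative of \<open>g(D) f\<close>. Elements of the Hilbert space are classes of
  forms modulo null sets; the representative is unique because it is continuous.
\<close>

definition dirac_calculus ::
    "(real \<Rightarrow> real) \<Rightarrow> ('q::{finite, linorder}, 'k::euclidean_space) form \<Rightarrow> ('q, 'k) form \<Rightarrow> bool"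
  where "dirac_calculus g f w \<longleftrightarrow>
    square_integrable f \<and> square_integrable w \<and> smooth w \<and>
    (abs_l2 f, abs_l2 w) \<in> functional_calculus dirac g"


section \<open>The functions \<open>\<phi>\<^sub>n\<close>\<close>

definition phi_solution :: "nat \<Rightarrow> (real \<Rightarrow> real) \<Rightarrow> bool"
  where "phi_solution n f \<longleftrightarrow>
    (\<exists>f' f''. (\<forall>r. (f has_real_derivative f' r) (at r)) \<and>
              (\<forall>r. (f' has_real_derivative f'' r) (at r)) \<and>
              (\<forall>r. r \<noteq> 0 \<longrightarrow> f'' r + (real n - 1) * f' r / r + f r = 0) \<and>
              f 0 = 1 \<and> f' 0 = 0)"

definition phi :: "nat \<Rightarrow> real \<Rightarrow> real"
  where "phi n = (THE f. phi_solution n f)"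

end

theory Submission
  imports Defs "HOL-Probability.Characteristic_Functions"
begin

text \<open>
  Let \<open>h = df\<close>. The mean \<open>M h(t, p)\<close> of \<open>h\<close> over the ball of radius \<open>t\<close> around \<open>p\<close> satisfies Darboux's
  equation \<open>M\<^sub>t\<^sub>t + (q + 1) M\<^sub>t / t = \<Delta> M\<close>, which comes from integrating by parts against the weights
  \<open>(1 - |y|\<^sup>2)\<^sub>+\<close> and \<open>y\<^sub>i (1 - |y|\<^sup>2)\<^sub>+\<close>. Applied to a plane wave it says that
  \<open>\<phi>\<^bsub>q+2\<^esub>(t |\<xi>|)\<close> is the mean of \<open>cos (x \<bullet> \<xi>)\<close> over that ball, hence \<open>M\<close> is the Fourier multiplier
  \<open>\<phi>\<^bsub>q+2\<^esub>(t |\<xi>|)\<close>; the sphere mean \<open>M + t M\<^sub>t / q\<close> corresponds to \<open>\<phi>\<^sub>q\<close> in the same way.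
  Then \<open>u = t M h\<close> and \<open>u = M h + t (M h)\<^sub>t / q\<close> solve the two problems, provided that such a multiplier is
  the function \<open>\<phi>\<^sub>n(tD)\<close> of the Dirac operator.

  The latter is seen with the Hartley transform, whose kernel \<open>cos + sin\<close> makes it a real, symmetric,
  isometric involution of \<open>L\<^sup>2\<close>. It turns \<open>D\<close> into \<open>X \<mapsto> \<sigma>(\<xi>) X(- \<xi>)\<close> with
  \<open>\<sigma>(\<xi>)\<^sup>2 = - |\<xi>|\<^sup>2\<close>, which is unitarily equivalent to multiplication by \<open>\<plusminus>|\<xi>|\<close>. That the domains agree
  is soft: \<open>D\<close> is symmetric and extends the self-adjoint multiplication operator, so they are equal.
\<close>

subsection \<open>The Hilbert space of square integrable functions\<close>

text \<open>\<open>functional_calculus\<close> is defined by the existence of a spectral resolution,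
  so D has to be diagonalised explicitly before any function of tD can be named. The obstacle is its
  domain, built from a weak derivative and a Hilbert space adjoint: membership in the adjoint can be
  checked only once every pair of \<open>ext_deriv_l2\<close> is known on the transform side, and
  this is what the bump functions are for. A real transform suits the setting, since the Hilbert
  space is real and the coefficients lie in an arbitrary Euclidean space. The price is that
  differentiation reflects the frequency, so the symbol of D couples \<open>\<xi>\<close> with
  \<open>- \<xi>\<close> and the diagonalisation has to undo a reflection. The solutions are built
  in physical space, where smoothness, compact support and the behaviour at t = 0 are visible; the
  transform serves only to identify them. The formula for the sphere mean S comes from polar
  coordinates: \<open>t ^ q * M\<close> has derivative \<open>q * t ^ (q - 1) * S\<close>. Taking
  \<open>M + t M\<^sub>t / q\<close> as its definition keeps surface measure out of the
  proof.\<close>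

lemma square_integrable_measurable [measurable_dest]:
  "square_integrable f \<Longrightarrow> f \<in> borel_measurable lborel"
  by (simp add: square_integrable_def)

lemma square_integrable_norm2: "square_integrable f \<Longrightarrow> integrable lborel (\<lambda>x. (norm (f x))\<^sup>2)"
  by (simp add: square_integrable_def)

lemma square_integrable_minus:
  assumes "square_integrable f" "square_integrable g"
  shows "square_integrable (\<lambda>x. f x - g x)"
  using square_integrable_add[OF assms(1) square_integrable_scaleR[OF assms(2), of "-1"]] by simp

lemma square_integrable_bound:
  fixes f :: "'a::euclidean_space \<Rightarrow> 'b::euclidean_space" and g :: "'a \<Rightarrow> 'c::euclidean_space"
  assumes g: "square_integrable g" and [measurable]: "f \<in> borel_measurable lborel"
    and le: "AE x in lborel. norm (f x) \<le> C * norm (g x)"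
  shows "square_integrable f"
  unfolding square_integrable_def
proof
  show "integrable lborel (\<lambda>x. (norm (f x))\<^sup>2)"
  proof (rule Bochner_Integration.integrable_bound)
    show "integrable lborel (\<lambda>x. C\<^sup>2 * (norm (g x))\<^sup>2)"
      using square_integrable_norm2[OF g] by simp
    show "AE x in lborel. norm ((norm (f x))\<^sup>2) \<le> norm (C\<^sup>2 * (norm (g x))\<^sup>2)"
      using le by eventually_elim (auto simp: power_mult_distrib[symmetric] intro!: power_mono)
  qed measurable
qed fact

lemma square_integrable_reflect:
  fixes f :: "'a::euclidean_space \<Rightarrow> 'b::euclidean_space"
  assumes "square_integrable f" shows "square_integrable (\<lambda>x. f (- x))"
proof -
  have [measurable]: "f \<in> borel_measurable lborel" using assms by measurable
  have d: "distr lborel borel (\<lambda>x::'a. - x) = lborel"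
    using lborel_affine[of "-1" "0::'a"] by (simp add: density_1)
  have "integrable (distr lborel borel (\<lambda>x::'a. - x)) (\<lambda>x. (norm (f x))\<^sup>2)"
    unfolding d using assms by (simp add: square_integrable_def)
  then show ?thesis by (simp add: square_integrable_def integrable_distr_eq)
qed

lemma square_integrable_rep_l2: "square_integrable (rep_l2 F)"
  using Quotient_rep_reflp[OF Quotient_l2, of F] by (simp add: l2_eq_def)

lemma measurable_rep_l2 [measurable]: "rep_l2 F \<in> borel_measurable lborel"
  using square_integrable_rep_l2[of F] by measurable

lemma abs_rep_l2 [simp]: "abs_l2 (rep_l2 F) = F"
  by (rule Quotient_abs_rep[OF Quotient_l2])

lemma abs_l2_eq_iff:
  assumes "square_integrable f" "square_integrable g"
  shows "abs_l2 f = abs_l2 g \<longleftrightarrow> (AE x in lborel. f x = g x)"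
  using Quotient_rel[OF Quotient_l2, of f g] assms by (auto simp: l2_eq_def)

lemma abs_l2_eqI:
  assumes "square_integrable f" "g \<in> borel_measurable lborel" and eq: "AE x in lborel. f x = g x"
  shows "square_integrable g" "abs_l2 f = abs_l2 g"
proof -
  show g: "square_integrable g"
    using eq by (intro square_integrable_bound[OF assms(1,2), of 1]) auto
  show "abs_l2 f = abs_l2 g" using abs_l2_eq_iff[OF assms(1) g] eq by simp
qed

lemma rep_abs_l2:
  assumes "square_integrable f" shows "AE x in lborel. rep_l2 (abs_l2 f) x = f x"
  using abs_l2_eq_iff[OF square_integrable_rep_l2 assms, of "abs_l2 f"] by simp

lemma l2_eqI: "(AE x in lborel. rep_l2 F x = rep_l2 G x) \<Longrightarrow> F = G"
  using abs_l2_eq_iff[OF square_integrable_rep_l2 square_integrable_rep_l2, of F G] by simp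

lemma abs_l2_add:
  "square_integrable f \<Longrightarrow> square_integrable g \<Longrightarrow> abs_l2 f + abs_l2 g = abs_l2 (\<lambda>x. f x + g x)"
  by (rule plus_l2.abs_eq) (auto simp: l2_eq_def)

lemma abs_l2_scaleR: "square_integrable f \<Longrightarrow> c *\<^sub>R abs_l2 f = abs_l2 (\<lambda>x. c *\<^sub>R f x)"
  by (rule scaleR_l2.abs_eq) (auto simp: l2_eq_def)

lemma abs_l2_diff:
  assumes "square_integrable f" "square_integrable g"
  shows "abs_l2 f - abs_l2 g = abs_l2 (\<lambda>x. f x - g x)"
  using abs_l2_add[OF assms(1) square_integrable_scaleR[OF assms(2), of "-1"]]
    abs_l2_scaleR[OF assms(2), of "-1"] by (metis (no_types, lifting) diff_conv_add_uminus scaleR_minus1_left ext)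

lemma abs_l2_zero: "abs_l2 (\<lambda>x. 0) = 0"
  by (simp add: zero_l2_def)

lemma abs_l2_inner:
  "square_integrable f \<Longrightarrow> square_integrable g \<Longrightarrow> abs_l2 f \<bullet> abs_l2 g = (\<integral>x. f x \<bullet> g x \<partial>lborel)"
  by (rule inner_l2.abs_eq) (auto simp: l2_eq_def)

lemma norm_abs_l2:
  "square_integrable f \<Longrightarrow> (norm (abs_l2 f))\<^sup>2 = (\<integral>x. (norm (f x))\<^sup>2 \<partial>lborel)"
  by (simp add: power2_norm_eq_inner abs_l2_inner)

lemma inner_l2_eq: "F \<bullet> G = (\<integral>x. rep_l2 F x \<bullet> rep_l2 G x \<partial>lborel)"
  using abs_l2_inner[OF square_integrable_rep_l2 square_integrable_rep_l2, of F G] by simp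

lemma rep_l2_add: "AE x in lborel. rep_l2 (F + G) x = rep_l2 F x + rep_l2 G x"
  using rep_abs_l2[OF square_integrable_add[OF square_integrable_rep_l2[of F] square_integrable_rep_l2[of G]]]
  by (simp flip: abs_l2_add add: square_integrable_rep_l2)

lemma rep_l2_diff: "AE x in lborel. rep_l2 (F - G) x = rep_l2 F x - rep_l2 G x"
  using rep_abs_l2[OF square_integrable_minus[OF square_integrable_rep_l2[of F] square_integrable_rep_l2[of G]]]
  by (simp flip: abs_l2_diff add: square_integrable_rep_l2)

lemma rep_l2_scaleR: "AE x in lborel. rep_l2 (c *\<^sub>R F) x = c *\<^sub>R rep_l2 F x"
  using rep_abs_l2[OF square_integrable_scaleR[OF square_integrable_rep_l2[of F], of c]]
  by (simp flip: abs_l2_scaleR add: square_integrable_rep_l2)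

text \<open>Dominated convergence in the L2 norm: the squared error is at most
  \<open>2 * (norm (w x))\<^sup>2 + 2 * (norm (g x))\<^sup>2\<close>, which is integrable. In the
  applications \<open>w\<close> is the function that is being truncated or restricted.\<close>

lemma tendsto_abs_l2:
  fixes f :: "nat \<Rightarrow> 'a::euclidean_space \<Rightarrow> 'b::euclidean_space" and w :: "'a \<Rightarrow> 'c::euclidean_space"
  assumes f: "\<And>n. square_integrable (f n)" and g: "square_integrable g" and w: "square_integrable w"
    and lim: "AE x in lborel. (\<lambda>n. f n x) \<longlonglongrightarrow> g x"
    and bd: "\<And>n. AE x in lborel. norm (f n x) \<le> norm (w x)"
  shows "(\<lambda>n. abs_l2 (f n)) \<longlonglongrightarrow> abs_l2 g"
proof -
  have [measurable]: "\<And>n. f n \<in> borel_measurable lborel" "g \<in> borel_measurable lborel"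
    "w \<in> borel_measurable lborel" using f g w by measurable
  have "(\<lambda>n. \<integral>x. (norm (f n x - g x))\<^sup>2 \<partial>lborel) \<longlonglongrightarrow> (\<integral>x. 0 \<partial>(lborel::'a measure))"
  proof (rule integral_dominated_convergence)
    show "integrable lborel (\<lambda>x. 2 * (norm (w x))\<^sup>2 + 2 * (norm (g x))\<^sup>2)"
      using w g by (simp add: square_integrable_def)
    show "AE x in lborel. (\<lambda>n. (norm (f n x - g x))\<^sup>2) \<longlonglongrightarrow> 0"
      using lim
    proof eventually_elim
      case (elim x)
      then have "(\<lambda>n. norm (f n x - g x)) \<longlonglongrightarrow> 0" 
        by (simp add: LIM_zero tendsto_norm_zero)
      then show ?case using tendsto_power[of _ 0 _ 2] by fastforce
    qed
    show "AE x in lborel. norm ((norm (f n x - g x))\<^sup>2) \<le> 2 * (norm (w x))\<^sup>2 + 2 * (norm (g x))\<^sup>2" for n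
      using bd[of n]
    proof eventually_elim
      case (elim x)
      have "(norm (f n x - g x))\<^sup>2 \<le> (norm (w x) + norm (g x))\<^sup>2"
        using elim norm_triangle_ineq4[of "f n x" "g x"] by (intro power_mono) auto
      also have "\<dots> \<le> 2 * (norm (w x))\<^sup>2 + 2 * (norm (g x))\<^sup>2"
        using sum_squares_bound[of "norm (w x)" "norm (g x)"] by (simp add: power2_sum)
      finally show ?case by simp
    qed
  qed measurable
  then have "(\<lambda>n. (norm (abs_l2 (f n) - abs_l2 g))\<^sup>2) \<longlonglongrightarrow> 0"
    by (simp add: abs_l2_diff norm_abs_l2 square_integrable_minus f g)
  then have "(\<lambda>n. sqrt ((norm (abs_l2 (f n) - abs_l2 g))\<^sup>2)) \<longlonglongrightarrow> sqrt 0"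
    by (rule tendsto_real_sqrt)
  then show ?thesis
    by (simp add: LIM_zero_iff tendsto_norm_zero_iff)
qed

section \<open>Completeness of the space of square integrable functions\<close>

lemma Cauchy_fast_subseq:
  fixes X :: "nat \<Rightarrow> 'h::real_normed_vector"
  assumes X: "Cauchy X" and e: "\<And>k. e k > 0"
  obtains r :: "nat \<Rightarrow> nat" where "strict_mono r"
    "\<And>k m n. m \<ge> r k \<Longrightarrow> n \<ge> r k \<Longrightarrow> norm (X m - X n) < e k"
proof -
  have "\<forall>k. \<exists>N. \<forall>m\<ge>N. \<forall>n\<ge>N. norm (X m - X n) < e k"
    using CauchyD[OF X] e by blast
  then obtain N where N: "\<And>k m n. m \<ge> N k \<Longrightarrow> n \<ge> N k \<Longrightarrow> norm (X m - X n) < e k"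
    by metis
  \<comment> \<open>Adding up all thresholds so far keeps \<open>r k\<close> above
    \<open>N k\<close>; the summand \<open>k\<close> makes the sequence strictly increasing.\<close>
  define r where "r k = k + (\<Sum>j\<le>k. N j)" for k
  have "strict_mono r" unfolding strict_mono_Suc_iff r_def by simp
  moreover have "r k \<ge> N k" for k
    using member_le_sum[of k "{..k}" N] by (simp add: r_def trans_le_add2)
  ultimately show ?thesis using N that[of r] by (meson le_trans)
qed

text \<open>The terms of the finite sum are bounded, so the increments are at most a constant times
  \<open>sqrt (1/2) ^ k\<close> and telescope absolutely. The weight \<open>2 ^ k\<close> turns a
  bound on squares, which is all that an L2 norm supplies, into summability of the norms
  themselves.\<close>

lemma convergent_if_norm_diff_le_geometric:
  fixes f :: "nat \<Rightarrow> 'b::banach"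
  assumes fin: "(\<Sum>k. ennreal (2 ^ k * (norm (f (Suc k) - f k))\<^sup>2)) \<noteq> \<infinity>"
  shows "convergent f"
proof -
  have "summable (\<lambda>k. 2 ^ k * (norm (f (Suc k) - f k))\<^sup>2)"
    using fin by (intro summable_suminf_not_top) auto
  then have "Bseq (\<lambda>k. 2 ^ k * (norm (f (Suc k) - f k))\<^sup>2)"
    by (intro convergent_imp_Bseq) (auto simp: convergent_def dest: summable_LIMSEQ_zero)
  then obtain C where C: "C > 0" "\<And>k. norm (2 ^ k * (norm (f (Suc k) - f k))\<^sup>2) \<le> C"
    by (auto simp: Bseq_def)
  have b: "norm (f (Suc k) - f k) \<le> sqrt C * (sqrt (1/2)) ^ k" for k
  proof -
    have "(norm (f (Suc k) - f k))\<^sup>2 \<le> C * (1/2) ^ k"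
      using C(2)[of k] by (simp add: field_simps power_divide)
    then have "norm (f (Suc k) - f k) \<le> sqrt (C * (1/2) ^ k)" by (rule real_le_rsqrt)
    then show ?thesis by (simp add: real_sqrt_mult real_sqrt_power)
  qed
  have "summable (\<lambda>k. sqrt C * (sqrt (1/2)) ^ k)"
    by (intro summable_mult summable_geometric) (simp add: real_sqrt_divide)
  then have "summable (\<lambda>k. f (Suc k) - f k)"
    by (rule summable_comparison_test[rotated]) (use b in auto)
  then have "convergent (\<lambda>n. \<Sum>k<n. f (Suc k) - f k)" by (simp add: summable_iff_convergent)
  then have "convergent (\<lambda>n. f n - f 0)" by (simp add: sum_lessThan_telescope)
  then show ?thesis using convergent_diff_const_right_iff by blast
qed

text \<open>Riesz-Fischer. Along a subsequence with distances below \<open>(1/4) ^ k\<close>, the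
  squared increments weighted by \<open>2 ^ k\<close> have integrals at most
  \<open>2 ^ k * (1/16) ^ k = (1/8) ^ k\<close>. Their sum is therefore finite almost everywhere,
  and the preceding lemma provides a pointwise limit.\<close>

instance l2 :: (euclidean_space, euclidean_space) complete_space
proof
  fix X :: "nat \<Rightarrow> ('a, 'b) l2" assume X: "Cauchy X"
  obtain r where r: "strict_mono r"
      "\<And>k m n. m \<ge> r k \<Longrightarrow> n \<ge> r k \<Longrightarrow> norm (X m - X n) < (1/4) ^ k"
    using Cauchy_fast_subseq[OF X, of "\<lambda>k. (1/4) ^ k"] by auto
  define f where "f k = rep_l2 (X (r k))" for k
  have sq: "square_integrable (f k)" for k by (simp add: f_def square_integrable_rep_l2)
  have [measurable]: "f k \<in> borel_measurable lborel" for k by (simp add: f_def)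
  have XF: "X (r k) = abs_l2 (f k)" for k by (simp add: f_def)
  have p16: "((1/4) ^ k)\<^sup>2 = (1/16::real) ^ k" for k
  proof -
    have "((1/4) ^ k)\<^sup>2 = ((1/4)\<^sup>2::real) ^ k" by (simp only: power_mult[symmetric] mult.commute)
    then show ?thesis by (simp add: power2_eq_square)
  qed
  have dist: "(\<integral>\<^sup>+x. ennreal ((norm (f m x - f n x))\<^sup>2) \<partial>lborel) \<le> ennreal ((1/16) ^ k)"
    if "m \<ge> k" "n \<ge> k" for m n k
  proof -
    have "r m \<ge> r k" "r n \<ge> r k" using that r(1) by (auto simp: strict_mono_less_eq)
    from r(2)[OF this] have "norm (abs_l2 (f m) - abs_l2 (f n)) < (1/4) ^ k" by (simp add: XF)
    then have "(norm (abs_l2 (f m) - abs_l2 (f n)))\<^sup>2 \<le> ((1/4) ^ k)\<^sup>2"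
      by (intro power_mono) auto
    then have "(\<integral>x. (norm (f m x - f n x))\<^sup>2 \<partial>lborel) \<le> (1/16) ^ k"
      unfolding p16 by (simp add: abs_l2_diff norm_abs_l2 square_integrable_minus sq)
    then show ?thesis
      by (subst nn_integral_eq_integral)
         (auto intro!: square_integrable_norm2 square_integrable_minus sq)
  qed
  have "(\<integral>\<^sup>+x. (\<Sum>k. ennreal (2 ^ k * (norm (f (Suc k) x - f k x))\<^sup>2)) \<partial>lborel)
      = (\<Sum>k. \<integral>\<^sup>+x. ennreal (2 ^ k * (norm (f (Suc k) x - f k x))\<^sup>2) \<partial>lborel)"
    by (rule nn_integral_suminf) measurable
  also have "\<dots> \<le> (\<Sum>k. ennreal ((1/8) ^ k))"
  proof (rule suminf_le)
    fix k
    have "(\<integral>\<^sup>+x. ennreal (2 ^ k * (norm (f (Suc k) x - f k x))\<^sup>2) \<partial>lborel)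
        = 2 ^ k * (\<integral>\<^sup>+x. ennreal ((norm (f (Suc k) x - f k x))\<^sup>2) \<partial>lborel)"
      by (subst nn_integral_cmult[symmetric]) (auto simp: ennreal_mult' ennreal_power[symmetric])
    also have "\<dots> \<le> 2 ^ k * ennreal ((1/16) ^ k)"
      by (intro mult_left_mono dist) auto
    also have "\<dots> = ennreal (2 ^ k * (1/16) ^ k)"
      by (simp add: ennreal_mult' ennreal_power[symmetric])
    also have "(2::real) ^ k * (1/16) ^ k = (1/8) ^ k"
      by (simp add: power_mult_distrib[symmetric])
    finally show "(\<integral>\<^sup>+x. ennreal (2 ^ k * (norm (f (Suc k) x - f k x))\<^sup>2) \<partial>lborel) \<le> ennreal ((1/8) ^ k)" .
  qed auto
  also have "\<dots> < \<infinity>"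
    by (subst suminf_ennreal2) (auto intro!: summable_geometric simp: ennreal_less_top)
  finally have "AE x in lborel. (\<Sum>k. ennreal (2 ^ k * (norm (f (Suc k) x - f k x))\<^sup>2)) \<noteq> \<infinity>"
    by (intro nn_integral_noteq_infinite) auto
  then have conv: "AE x in lborel. convergent (\<lambda>k. f k x)"
    by eventually_elim (rule convergent_if_norm_diff_le_geometric)
  define g where "g x = lim (\<lambda>k. f k x)" for x
  have [measurable]: "g \<in> borel_measurable lborel"
    unfolding g_def by (rule borel_measurable_lim_metric) measurable
  have lim: "AE x in lborel. (\<lambda>k. f k x) \<longlonglongrightarrow> g x"
    using conv by eventually_elim (simp add: g_def convergent_LIMSEQ_iff)
  \<comment> \<open>Fatou's lemma carries the estimate for \<open>f k - f j\<close> over to the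
    limit in \<open>j\<close>. It yields both the square integrability of \<open>g\<close> and the
    rate of convergence.\<close>
  have bound: "(\<integral>\<^sup>+x. ennreal ((norm (f k x - g x))\<^sup>2) \<partial>lborel) \<le> ennreal ((1/16) ^ k)" for k
  proof -
    have "(\<integral>\<^sup>+x. ennreal ((norm (f k x - g x))\<^sup>2) \<partial>lborel)
        = (\<integral>\<^sup>+x. liminf (\<lambda>j. ennreal ((norm (f k x - f j x))\<^sup>2)) \<partial>lborel)"
    proof (rule nn_integral_cong_AE, use lim in eventually_elim)
      fix x assume "(\<lambda>j. f j x) \<longlonglongrightarrow> g x"
      then have "(\<lambda>j. ennreal ((norm (f k x - f j x))\<^sup>2)) \<longlonglongrightarrow> ennreal ((norm (f k x - g x))\<^sup>2)"
        by (intro tendsto_ennrealI tendsto_intros)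
      then show "ennreal ((norm (f k x - g x))\<^sup>2) = liminf (\<lambda>j. ennreal ((norm (f k x - f j x))\<^sup>2))"
        by (intro lim_imp_Liminf[symmetric]) auto
    qed
    also have "\<dots> \<le> liminf (\<lambda>j. \<integral>\<^sup>+x. ennreal ((norm (f k x - f j x))\<^sup>2) \<partial>lborel)"
      by (rule nn_integral_liminf) measurable
    also have "\<dots> \<le> ennreal ((1/16) ^ k)"
      by (rule Liminf_le) (auto simp: eventually_sequentially intro!: exI[of _ k] dist)
    finally show ?thesis .
  qed
  have sqd: "square_integrable (\<lambda>x. f k x - g x)" for k
    unfolding square_integrable_def
    using bound[of k] by (auto intro!: integrableI_bounded simp: le_less_trans[OF _ ennreal_less_top])
  have sqg: "square_integrable g"
    using square_integrable_minus[OF sq[of 0] sqd[of 0]] by simp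
  have "norm (X (r k) - abs_l2 g) \<le> (1/4) ^ k" for k
  proof -
    have "(\<integral>x. (norm (f k x - g x))\<^sup>2 \<partial>lborel) \<le> (1/16) ^ k"
      using bound[of k] square_integrable_norm2[OF sqd[of k]] by (simp add: nn_integral_eq_integral)
    then have "(norm (X (r k) - abs_l2 g))\<^sup>2 \<le> ((1/4) ^ k)\<^sup>2"
      unfolding p16 by (simp add: XF abs_l2_diff sq sqg norm_abs_l2 sqd)
    then show ?thesis by (rule power2_le_imp_le) auto
  qed
  then have "(\<lambda>k. X (r k) - abs_l2 g) \<longlonglongrightarrow> 0"
    by (intro tendsto_norm_zero_cancel[OF tendsto_sandwich[OF _ _ tendsto_const LIMSEQ_realpow_zero[of "1/4"]]]) auto
  then have "(X \<circ> r) \<longlonglongrightarrow> abs_l2 g"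
    by (simp add: LIM_zero_iff o_def)
  then show "convergent X"
    using Cauchy_converges_subseq[OF X r(1)] by (auto simp: convergent_def)
qed

subsection \<open>Lebesgue measure\<close>

lemma lborel_integral_affine:
  fixes f :: "'a::euclidean_space \<Rightarrow> 'b::{banach, second_countable_topology}"
  assumes c: "c \<noteq> 0" and [measurable]: "f \<in> borel_measurable borel"
  shows "(\<integral>x. f (t + c *\<^sub>R x) \<partial>lborel) = (1 / \<bar>c\<bar> ^ DIM('a)) *\<^sub>R (\<integral>x. f x \<partial>lborel)"
    and "integrable lborel (\<lambda>x. f (t + c *\<^sub>R x)) \<longleftrightarrow> integrable lborel f"
proof -
  let ?D = "distr lborel borel (\<lambda>x::'a. t + c *\<^sub>R x)"
  have eq: "lborel = density ?D (\<lambda>_. \<bar>c\<bar> ^ DIM('a))"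
    using lborel_affine[OF c, of t] by (simp add: ennreal_power)
  have "(\<integral>x. f x \<partial>lborel) = \<bar>c\<bar> ^ DIM('a) *\<^sub>R (\<integral>x. f x \<partial>?D)"
    by (subst eq, subst integral_density) auto
  then show "(\<integral>x. f (t + c *\<^sub>R x) \<partial>lborel) = (1 / \<bar>c\<bar> ^ DIM('a)) *\<^sub>R (\<integral>x. f x \<partial>lborel)"
    using c by (simp add: integral_distr)
  have "integrable ?D f" if "integrable ?D (\<lambda>x. \<bar>c\<bar> ^ DIM('a) *\<^sub>R f x)"
    using integrable_scaleR_right[OF that, of "1 / \<bar>c\<bar> ^ DIM('a)"] c by simp
  then have "integrable lborel f \<longleftrightarrow> integrable ?D f"
    by (subst eq, subst integrable_density) auto
  then show "integrable lborel (\<lambda>x. f (t + c *\<^sub>R x)) \<longleftrightarrow> integrable lborel f"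
    by (simp add: integrable_distr_eq)
qed

lemmas lborel_integral_shift = lborel_integral_affine(1)[where c = 1, simplified]
lemmas lborel_integrable_shift = lborel_integral_affine(2)[where c = 1, simplified]
lemmas lborel_integral_reflect = lborel_integral_affine(1)[where c = "-1" and t = 0, simplified]
lemmas lborel_integrable_reflect = lborel_integral_affine(2)[where c = "-1" and t = 0, simplified]

lemma integrable_product_lborel:
  fixes f :: "'a::euclidean_space \<Rightarrow> real" and g :: "'c::euclidean_space \<Rightarrow> real"
  assumes f: "integrable lborel f" and g: "integrable lborel g"
  shows "integrable (lborel \<Otimes>\<^sub>M lborel) (\<lambda>(x, y). f x * g y)"
proof -
  have [measurable]: "f \<in> borel_measurable lborel" "g \<in> borel_measurable lborel"
    using f g by auto
  show ?thesis
  proof (rule lborel_pair.Fubini_integrable)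
    show "integrable lborel (\<lambda>x. \<integral>y. norm (case (x, y) of (x, y) \<Rightarrow> f x * g y) \<partial>lborel)"
      using f by (simp add: abs_mult)
    show "AE x in lborel. integrable lborel (\<lambda>y. case (x, y) of (x, y) \<Rightarrow> f x * g y)"
      using g by simp
  qed measurable
qed

text \<open>Fubini in the form used for all kernels here: they are dominated by a product of
  integrable functions of the separate variables.\<close>

lemma Fubini_integral_bounded:
  fixes F :: "'a::euclidean_space \<Rightarrow> 'c::euclidean_space \<Rightarrow> 'b::euclidean_space"
  assumes m [measurable]: "case_prod F \<in> borel_measurable (lborel \<Otimes>\<^sub>M lborel)"
    and f: "integrable lborel f" and g: "integrable lborel g"
    and le: "\<And>x y. norm (F x y) \<le> f x * g y"
  shows "(\<integral>y. (\<integral>x. F x y \<partial>lborel) \<partial>lborel) = (\<integral>x. (\<integral>y. F x y \<partial>lborel) \<partial>lborel)"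
proof (rule lborel_pair.Fubini_integral)
  show "integrable (lborel \<Otimes>\<^sub>M lborel) (case_prod F)"
  proof (rule Bochner_Integration.integrable_bound)
    show "integrable (lborel \<Otimes>\<^sub>M lborel) (\<lambda>(x, y). f x * g y)"
      by (rule integrable_product_lborel) fact+
    show "AE x in lborel \<Otimes>\<^sub>M lborel. norm (case x of (x, y) \<Rightarrow> F x y)
        \<le> norm (case x of (x, y) \<Rightarrow> f x * g y)"
      using le by (auto intro!: AE_I2 order_trans[OF _ abs_ge_self])
  qed measurable
qed

lemma lborel_integral_prod:
  fixes f :: "'a::euclidean_space \<Rightarrow> real \<Rightarrow> complex"
  assumes f: "\<And>b. b \<in> Basis \<Longrightarrow> integrable lborel (f b)"
  shows "integrable lborel (\<lambda>x. \<Prod>b\<in>Basis. f b (x \<bullet> b))"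
    and "(\<integral>x. (\<Prod>b\<in>Basis. f b (x \<bullet> b)) \<partial>lborel) = (\<Prod>b\<in>Basis. (\<integral>x. f b x \<partial>lborel))"
proof -
  interpret product_sigma_finite "\<lambda>b::'a. lborel :: real measure"
    by standard
  have [measurable]: "b \<in> Basis \<Longrightarrow> f b \<in> borel_measurable borel" for b
    using f[of b] by auto
  have eq: "(\<Prod>b\<in>Basis. f b ((\<Sum>b\<in>Basis. \<omega> b *\<^sub>R b) \<bullet> b)) = (\<Prod>b\<in>Basis. f b (\<omega> b))" for \<omega> :: "'a \<Rightarrow> real"
    by (rule prod.cong) (auto simp: inner_sum_left inner_Basis if_distrib sum.delta cong: if_cong)
  show "integrable lborel (\<lambda>x. \<Prod>b\<in>Basis. f b (x \<bullet> b))"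
    unfolding lborel_eq[where 'a='a]
    by (subst integrable_distr_eq) (auto simp: eq intro!: product_integrable_prod f)
  show "(\<integral>x. (\<Prod>b\<in>Basis. f b (x \<bullet> b)) \<partial>lborel) = (\<Prod>b\<in>Basis. (\<integral>x. f b x \<partial>lborel))"
    unfolding lborel_eq[where 'a='a]
    by (subst integral_distr) (auto simp: eq product_integral_prod f lborel_eq[symmetric])
qed

subsection \<open>Gaussians\<close>

lemma cis_measurable [measurable]: "cis \<in> borel_measurable borel"
  by (intro borel_measurable_continuous_onI continuous_intros)

text \<open>This is the characteristic function of the standard normal distribution with the
  normalising factor \<open>sqrt (2 * pi)\<close> moved to the other side.\<close>

lemma gauss_cis_integral_real:
  "integrable lborel (\<lambda>x::real. exp (- (x\<^sup>2 / 2)) *\<^sub>R cis (a * x))"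
  "(\<integral>x. exp (- (x\<^sup>2 / 2)) *\<^sub>R cis (a * x) \<partial>lborel) = sqrt (2 * pi) * exp (- (a\<^sup>2 / 2))"
proof -
  have i: "integrable lborel (\<lambda>x::real. exp (- (x\<^sup>2 / 2)))"
  proof -
    have "integrable lborel (\<lambda>x. sqrt (2 * pi) * std_normal_density x)"
      by simp
    then show ?thesis by (simp add: std_normal_density_def)
  qed
  show int: "integrable lborel (\<lambda>x::real. exp (- (x\<^sup>2 / 2)) *\<^sub>R cis (a * x))"
    by (rule Bochner_Integration.integrable_bound[OF i]) (auto simp: norm_mult)
  have "complex_of_real (exp (- (a\<^sup>2 / 2))) = char std_normal_distribution a"
    by (simp add: char_std_normal_distribution)
  also have "\<dots> = (\<integral>x. std_normal_density x *\<^sub>R cis (a * x) \<partial>lborel)"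
    unfolding char_def by (subst integral_density) (auto simp: cis_conv_exp mult_ac)
  also have "\<dots> = (\<integral>x. (1 / sqrt (2 * pi)) *\<^sub>R (exp (- (x\<^sup>2 / 2)) *\<^sub>R cis (a * x)) \<partial>lborel)"
    by (simp add: std_normal_density_def)
  also have "\<dots> = (1 / sqrt (2 * pi)) *\<^sub>R (\<integral>x. exp (- (x\<^sup>2 / 2)) *\<^sub>R cis (a * x) \<partial>lborel)"
    by (rule integral_scaleR_right)
  finally have "complex_of_real (exp (- (a\<^sup>2 / 2)))
      = (1 / sqrt (2 * pi)) *\<^sub>R (\<integral>x. exp (- (x\<^sup>2 / 2)) *\<^sub>R cis (a * x) \<partial>lborel)" .
  then have "sqrt (2 * pi) *\<^sub>R complex_of_real (exp (- (a\<^sup>2 / 2)))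
      = (\<integral>x. exp (- (x\<^sup>2 / 2)) *\<^sub>R cis (a * x) \<partial>lborel)"
    by simp
  then show "(\<integral>x. exp (- (x\<^sup>2 / 2)) *\<^sub>R cis (a * x) \<partial>lborel) = sqrt (2 * pi) * exp (- (a\<^sup>2 / 2))"
    by (simp add: scaleR_conv_of_real)
qed

lemma gauss_cis_integral:
  fixes a :: "'a::euclidean_space"
  shows "integrable lborel (\<lambda>x::'a. exp (- (x \<bullet> x / 2)) *\<^sub>R cis (a \<bullet> x))"
    and "(\<integral>x. exp (- (x \<bullet> x / 2)) *\<^sub>R cis (a \<bullet> x) \<partial>lborel)
      = of_real (sqrt (2 * pi) ^ DIM('a) * exp (- (a \<bullet> a / 2)))"
proof -
  have eq: "exp (- (x \<bullet> x / 2)) *\<^sub>R cis (a \<bullet> x)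
      = (\<Prod>b\<in>Basis. exp (- ((x \<bullet> b)\<^sup>2 / 2)) *\<^sub>R cis ((a \<bullet> b) * (x \<bullet> b)))" for x :: 'a
  proof -
    have "cis (\<Sum>b\<in>B. g b) = (\<Prod>b\<in>B. cis (g b))" for g :: "'a \<Rightarrow> real" and B
      by (induction B rule: infinite_finite_induct) (auto simp: cis_mult[symmetric])
    moreover have "exp (- (x \<bullet> x / 2)) = (\<Prod>b\<in>Basis. exp (- ((x \<bullet> b)\<^sup>2 / 2)))"
      by (subst euclidean_inner) (simp add: exp_sum[symmetric] sum_negf[symmetric] sum_divide_distrib power2_eq_square)
    ultimately show ?thesis
      by (subst (2) euclidean_inner) (simp add: scaleR_conv_of_real prod.distrib)
  qed
  show "integrable lborel (\<lambda>x::'a. exp (- (x \<bullet> x / 2)) *\<^sub>R cis (a \<bullet> x))"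
    unfolding eq by (rule lborel_integral_prod) (rule gauss_cis_integral_real)
  have "(\<integral>x. exp (- (x \<bullet> x / 2)) *\<^sub>R cis (a \<bullet> x) \<partial>lborel)
      = (\<Prod>b\<in>Basis. sqrt (2 * pi) * exp (- ((a \<bullet> b)\<^sup>2 / 2)))"
    unfolding eq by (subst lborel_integral_prod(2)) (auto simp: gauss_cis_integral_real)
  also have "(\<Prod>b\<in>Basis. sqrt (2 * pi) * exp (- ((a \<bullet> b)\<^sup>2 / 2))) = sqrt (2 * pi) ^ DIM('a) * exp (- (a \<bullet> a / 2))"
    by (subst euclidean_inner)
       (simp add: prod.distrib exp_sum[symmetric] sum_negf[symmetric] sum_divide_distrib power2_eq_square)
  finally show "(\<integral>x. exp (- (x \<bullet> x / 2)) *\<^sub>R cis (a \<bullet> x) \<partial>lborel)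
      = of_real (sqrt (2 * pi) ^ DIM('a) * exp (- (a \<bullet> a / 2)))" by simp
qed

lemma gauss_cos_integral:
  fixes a :: "'a::euclidean_space"
  shows "(\<integral>x. exp (- (x \<bullet> x / 2)) * cos (a \<bullet> x) \<partial>lborel) = sqrt (2 * pi) ^ DIM('a) * exp (- (a \<bullet> a / 2))"
proof -
  have "(\<integral>x. exp (- (x \<bullet> x / 2)) * cos (a \<bullet> x) \<partial>lborel)
      = Re (\<integral>x. exp (- (x \<bullet> x / 2)) *\<^sub>R cis (a \<bullet> x) \<partial>lborel)"
    by (subst integral_Re[symmetric, OF gauss_cis_integral(1)]) simp
  then show ?thesis by (simp add: gauss_cis_integral)
qed

lemma integrable_gauss:
  assumes "e \<noteq> 0"
  shows "integrable lborel (\<lambda>x::'a::euclidean_space. exp (- (e\<^sup>2 * (x \<bullet> x) / 2)))"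
proof -
  have "integrable lborel (\<lambda>x::'a. exp (- (x \<bullet> x / 2)))"
    using integrable_norm[OF gauss_cis_integral(1)[of "0::'a"]] by simp
  then show ?thesis
    using lborel_integral_affine(2)[OF assms, of "\<lambda>x::'a. exp (- (x \<bullet> x / 2))" 0]
    by (simp add: power2_eq_square mult.assoc)
qed

lemma gauss_cos_integral_scaled:
  fixes a :: "'a::euclidean_space"
  assumes "e > 0"
  shows "(\<integral>x. exp (- (e\<^sup>2 * (x \<bullet> x) / 2)) * cos (a \<bullet> x) \<partial>lborel)
    = sqrt (2 * pi) ^ DIM('a) / e ^ DIM('a) * exp (- (a \<bullet> a / (2 * e\<^sup>2)))"
proof -
  have "(\<integral>x. exp (- (e\<^sup>2 * (x \<bullet> x) / 2)) * cos (a \<bullet> x) \<partial>lborel)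
      = (\<integral>x. exp (- ((0 + e *\<^sub>R x) \<bullet> (0 + e *\<^sub>R x) / 2)) * cos ((a /\<^sub>R e) \<bullet> (0 + e *\<^sub>R x)) \<partial>lborel)"
  proof -
    have "(a /\<^sub>R e) \<bullet> (0 + e *\<^sub>R x) = a \<bullet> x" for x using assms by simp
    then show ?thesis by (simp only:) (simp add: power2_eq_square mult.assoc)
  qed
  also have "\<dots> = (1 / e ^ DIM('a)) * (\<integral>x. exp (- (x \<bullet> x / 2)) * cos ((a /\<^sub>R e) \<bullet> x) \<partial>lborel)"
    using assms by (subst lborel_integral_affine(1)) auto
  also have "\<dots> = (1 / e ^ DIM('a)) * (sqrt (2 * pi) ^ DIM('a) * exp (- ((a /\<^sub>R e) \<bullet> (a /\<^sub>R e) / 2)))"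
    by (simp only: gauss_cos_integral)
  finally show ?thesis using assms by (simp add: power2_eq_square divide_simps)
qed

subsection \<open>The Hartley transform of integrable functions\<close>

definition cas :: "real \<Rightarrow> real" where "cas x = cos x + sin x"

text \<open>With arguments linear in \<open>\<xi>\<close>, the sine term is odd and drops out
  against an even weight. What is left depends on the difference only, as for the Fourier
  kernel.\<close>

lemma cas_mult: "cas x * cas y = cos (x - y) + sin (x + y)"
  unfolding cas_def by (simp add: cos_diff sin_add algebra_simps)

lemma cas_add: "cas (x + y) = cas x * cos y + cas (- x) * sin y"
  unfolding cas_def by (simp add: cos_add sin_add algebra_simps)

lemma abs_cas_le: "\<bar>cas x\<bar> \<le> 2"
  unfolding cas_def using abs_cos_le_one[of x] abs_sin_le_one[of x] by linarith

lemma cas_measurable [measurable]: "cas \<in> borel_measurable borel"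
  unfolding cas_def by measurable

text \<open>The sign change of the argument is the source of every reflection \<open>- \<xi>\<close>
  in the transform of a derivative.\<close>

lemma cas_has_real_derivative: "(cas has_real_derivative cas (- x)) (at x)"
  unfolding cas_def by (auto intro!: derivative_eq_intros)

text \<open>By \<open>cas_mult\<close> the integrand is an even Gaussian times a cosine of
  \<open>(y - x) \<bullet> \<xi>\<close> plus an odd part. Regularised Hartley inversion is thereby
  a convolution with a Gaussian of width \<open>e\<close>.\<close>

lemma gauss_cas_integral:
  fixes x y :: "'a::euclidean_space"
  assumes e: "e > 0"
  shows "integrable lborel (\<lambda>\<xi>. exp (- (e\<^sup>2 * (\<xi> \<bullet> \<xi>) / 2)) * (cas (x \<bullet> \<xi>) * cas (y \<bullet> \<xi>)))"
    and "(\<integral>\<xi>. exp (- (e\<^sup>2 * (\<xi> \<bullet> \<xi>) / 2)) * (cas (x \<bullet> \<xi>) * cas (y \<bullet> \<xi>)) \<partial>lborel)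
    = sqrt (2 * pi) ^ DIM('a) / e ^ DIM('a) * exp (- ((y - x) \<bullet> (y - x) / (2 * e\<^sup>2)))"
proof -
  let ?G = "\<lambda>\<xi>::'a. exp (- (e\<^sup>2 * (\<xi> \<bullet> \<xi>) / 2))"
  have G: "integrable lborel ?G" using e by (intro integrable_gauss) auto
  have ic: "integrable lborel (\<lambda>\<xi>. ?G \<xi> * cos ((y - x) \<bullet> \<xi>))"
    and is': "integrable lborel (\<lambda>\<xi>. ?G \<xi> * sin ((x + y) \<bullet> \<xi>))"
    by (rule Bochner_Integration.integrable_bound[OF G]; force simp: abs_mult)+
  have "(\<integral>\<xi>. ?G \<xi> * sin ((x + y) \<bullet> \<xi>) \<partial>lborel) = 0"
    using lborel_integral_reflect[of "\<lambda>\<xi>. ?G \<xi> * sin ((x + y) \<bullet> \<xi>)"] by simp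
  moreover have "?G \<xi> * (cas (x \<bullet> \<xi>) * cas (y \<bullet> \<xi>))
      = ?G \<xi> * cos ((y - x) \<bullet> \<xi>) + ?G \<xi> * sin ((x + y) \<bullet> \<xi>)" for \<xi>
    using cos_minus[of "x \<bullet> \<xi> - y \<bullet> \<xi>"]
    by (simp add: cas_mult inner_diff_left inner_add_left algebra_simps)
  ultimately show "integrable lborel (\<lambda>\<xi>. ?G \<xi> * (cas (x \<bullet> \<xi>) * cas (y \<bullet> \<xi>)))"
    "(\<integral>\<xi>. ?G \<xi> * (cas (x \<bullet> \<xi>) * cas (y \<bullet> \<xi>)) \<partial>lborel)
      = sqrt (2 * pi) ^ DIM('a) / e ^ DIM('a) * exp (- ((y - x) \<bullet> (y - x) / (2 * e\<^sup>2)))"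
    using ic is' e by (simp_all add: gauss_cos_integral_scaled)
qed

text \<open>The factor is \<open>2 * pi\<close> to the power -DIM/2, which makes the transform an
  isometry and its own inverse. The kernel is real, so values in any Euclidean space are
  allowed.\<close>

definition hartley :: "('a::euclidean_space \<Rightarrow> 'b::euclidean_space) \<Rightarrow> 'a \<Rightarrow> 'b"
  where "hartley f \<xi> = (1 / sqrt (2 * pi) ^ DIM('a)) *\<^sub>R (\<integral>x. cas (x \<bullet> \<xi>) *\<^sub>R f x \<partial>lborel)"

lemma integrable_cas:
  fixes f :: "'a::euclidean_space \<Rightarrow> 'b::euclidean_space"
  assumes "integrable lborel f"
  shows "integrable lborel (\<lambda>x. cas (x \<bullet> \<xi>) *\<^sub>R f x)"
proof -
  have [measurable]: "f \<in> borel_measurable lborel" using assms by auto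
  show ?thesis
  proof (rule Bochner_Integration.integrable_bound)
    show "integrable lborel (\<lambda>x. 2 * norm (f x))" using assms by auto
    show "AE x in lborel. norm (cas (x \<bullet> \<xi>) *\<^sub>R f x) \<le> norm (2 * norm (f x))"
      by (auto intro!: mult_right_mono abs_cas_le)
  qed measurable
qed

lemma integrable_cas':
  fixes f :: "'a::euclidean_space \<Rightarrow> 'b::euclidean_space"
  shows "integrable lborel f \<Longrightarrow> integrable lborel (\<lambda>x. cas (\<xi> \<bullet> x) *\<^sub>R f x)"
  using integrable_cas[of f \<xi>] by (simp add: inner_commute)

lemma hartley_measurable [measurable]:
  fixes f :: "'a::euclidean_space \<Rightarrow> 'b::euclidean_space"
  assumes [measurable]: "f \<in> borel_measurable borel"
  shows "hartley f \<in> borel_measurable borel"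
  unfolding hartley_def by measurable

lemma norm_hartley_le:
  fixes f :: "'a::euclidean_space \<Rightarrow> 'b::euclidean_space"
  assumes f: "integrable lborel f"
  shows "norm (hartley f \<xi>) \<le> 2 / sqrt (2 * pi) ^ DIM('a) * (\<integral>x. norm (f x) \<partial>lborel)"
proof -
  have "norm (\<integral>x. cas (x \<bullet> \<xi>) *\<^sub>R f x \<partial>lborel) \<le> (\<integral>x. 2 * norm (f x) \<partial>lborel)"
    by (rule order_trans[OF integral_norm_bound integral_mono])
       (use f integrable_norm[OF integrable_cas[OF f]] in \<open>auto intro!: mult_right_mono abs_cas_le\<close>)
  then show ?thesis by (simp add: hartley_def field_simps)
qed

lemma hartley_bounded:
  fixes f :: "'a::euclidean_space \<Rightarrow> 'b::euclidean_space"
  assumes f: "integrable lborel f"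
  obtains B where "B \<ge> 0" "\<And>\<xi>. norm (hartley f \<xi>) \<le> B"
  using norm_hartley_le[OF f] norm_ge_zero order_trans by metis

lemma hartley_add:
  assumes "integrable lborel f" "integrable lborel g"
  shows "hartley (\<lambda>x. f x + g x) \<xi> = hartley f \<xi> + hartley g \<xi>"
  unfolding hartley_def using assms by (simp add: scaleR_add_right integrable_cas)

lemma hartley_linear:
  assumes f: "integrable lborel f" and "linear T"
  shows "hartley (\<lambda>x. T (f x)) \<xi> = T (hartley f \<xi>)"
proof -
  have T: "bounded_linear T" using assms(2) by (rule linear_conv_bounded_linear[THEN iffD1])
  have "(\<integral>x. cas (x \<bullet> \<xi>) *\<^sub>R T (f x) \<partial>lborel) = T (\<integral>x. cas (x \<bullet> \<xi>) *\<^sub>R f x \<partial>lborel)"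
    by (simp only: integral_bounded_linear[OF T integrable_cas[OF f], symmetric] linear_scale[OF assms(2)])
  then show ?thesis
    unfolding hartley_def by (simp add: linear_scale[OF assms(2)])
qed

text \<open>The kernel \<open>cas (x \<bullet> \<xi>)\<close> is symmetric in its two variables; the
  rest is Fubini.\<close>

lemma hartley_symmetric:
  fixes f g :: "'a::euclidean_space \<Rightarrow> 'b::euclidean_space"
  assumes f: "integrable lborel f" and g: "integrable lborel g"
  shows "(\<integral>\<xi>. hartley f \<xi> \<bullet> g \<xi> \<partial>lborel) = (\<integral>x. f x \<bullet> hartley g x \<partial>lborel)"
proof -
  have [measurable]: "f \<in> borel_measurable borel" "g \<in> borel_measurable borel" using f g by auto
  have "(\<integral>\<xi>. (\<integral>x. cas (x \<bullet> \<xi>) *\<^sub>R f x \<partial>lborel) \<bullet> g \<xi> \<partial>lborel)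
      = (\<integral>\<xi>. (\<integral>x. cas (x \<bullet> \<xi>) * (f x \<bullet> g \<xi>) \<partial>lborel) \<partial>lborel)"
    by (simp flip: integral_inner_left add: integrable_cas f)
  also have "\<dots> = (\<integral>x. (\<integral>\<xi>. cas (x \<bullet> \<xi>) * (f x \<bullet> g \<xi>) \<partial>lborel) \<partial>lborel)"
  proof (rule Fubini_integral_bounded)
    show "integrable lborel (\<lambda>x. 2 * norm (f x))" "integrable lborel (\<lambda>x. norm (g x))"
      using f g by auto
    show "norm (cas (x \<bullet> \<xi>) * (f x \<bullet> g \<xi>)) \<le> 2 * norm (f x) * norm (g \<xi>)" for x \<xi>
      using mult_mono[OF abs_cas_le Cauchy_Schwarz_ineq2] by (simp add: abs_mult mult.assoc)
  qed measurable
  also have "\<dots> = (\<integral>x. f x \<bullet> (\<integral>\<xi>. cas (x \<bullet> \<xi>) *\<^sub>R g \<xi> \<partial>lborel) \<partial>lborel)"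
    by (simp flip: integral_inner_right add: integrable_cas' g)
  finally show ?thesis
    by (simp add: hartley_def inner_commute[of _ "x::'a" for x])
qed

text \<open>Inversion with a Gaussian cutoff. The transform of an integrable function is merely
  bounded, and the cutoff is what makes the outer integral converge absolutely.\<close>

lemma hartley_gauss_hartley:
  fixes f :: "'a::euclidean_space \<Rightarrow> 'b::euclidean_space"
  assumes f: "integrable lborel f" and e: "e > 0"
  shows "hartley (\<lambda>\<xi>. exp (- (e\<^sup>2 * (\<xi> \<bullet> \<xi>) / 2)) *\<^sub>R hartley f \<xi>) x
    = (1 / sqrt (2 * pi) ^ DIM('a)) *\<^sub>R (\<integral>z. exp (- (z \<bullet> z / 2)) *\<^sub>R f (x + e *\<^sub>R z) \<partial>lborel)"
proof -
  have [measurable]: "f \<in> borel_measurable borel" using f by auto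
  let ?C = "sqrt (2 * pi) ^ DIM('a)"
  let ?G = "\<lambda>\<xi>::'a. exp (- (e\<^sup>2 * (\<xi> \<bullet> \<xi>) / 2))"
  have "hartley (\<lambda>\<xi>. ?G \<xi> *\<^sub>R hartley f \<xi>) x
      = (1 / ?C\<^sup>2) *\<^sub>R (\<integral>\<xi>. (\<integral>y. (?G \<xi> * (cas (x \<bullet> \<xi>) * cas (y \<bullet> \<xi>))) *\<^sub>R f y \<partial>lborel) \<partial>lborel)"
  proof -
    have "(\<integral>\<xi>. cas (\<xi> \<bullet> x) *\<^sub>R (?G \<xi> *\<^sub>R hartley f \<xi>) \<partial>lborel)
       = (\<integral>\<xi>. (1 / ?C) *\<^sub>R (\<integral>y. (?G \<xi> * (cas (x \<bullet> \<xi>) * cas (y \<bullet> \<xi>))) *\<^sub>R f y \<partial>lborel) \<partial>lborel)"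
      by (rule Bochner_Integration.integral_cong)
         (simp_all flip: integral_scaleR_right add: hartley_def mult_ac inner_commute)
    then show ?thesis unfolding hartley_def[of _ x] by (simp add: power2_eq_square)
  qed
  also have "(\<integral>\<xi>. (\<integral>y. (?G \<xi> * (cas (x \<bullet> \<xi>) * cas (y \<bullet> \<xi>))) *\<^sub>R f y \<partial>lborel) \<partial>lborel)
      = (\<integral>y. (\<integral>\<xi>. (?G \<xi> * (cas (x \<bullet> \<xi>) * cas (y \<bullet> \<xi>))) *\<^sub>R f y \<partial>lborel) \<partial>lborel)"
  proof (rule Fubini_integral_bounded)
    show "integrable lborel (\<lambda>y. norm (f y))" using f by auto
    \<comment> \<open>The 4 bounds a product of two values of \<open>cas\<close>.\<close>
    show "integrable lborel (\<lambda>\<xi>. 4 * ?G \<xi>)" using e integrable_gauss[of e] by auto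
    show "norm ((?G \<xi> * (cas (x \<bullet> \<xi>) * cas (y \<bullet> \<xi>))) *\<^sub>R f y) \<le> norm (f y) * (4 * ?G \<xi>)" for y \<xi>
      using mult_mono[OF abs_cas_le abs_cas_le, of "x \<bullet> \<xi>" "y \<bullet> \<xi>"]
      by (simp add: abs_mult mult_ac)
         (intro mult_left_mono, auto)
  qed measurable
  also have "\<dots> = (\<integral>y. (?C / e ^ DIM('a) * exp (- ((y - x) \<bullet> (y - x) / (2 * e\<^sup>2)))) *\<^sub>R f y \<partial>lborel)"
    by (simp add: gauss_cas_integral[OF e] integral_scaleR_left)
  \<comment> \<open>Substitute \<open>y = x + e *\<^sub>R z\<close>. The Jacobian cancels the factor
    \<open>1 / e ^ DIM('a)\<close> of the kernel, so the total mass of the average does not depend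
    on \<open>e\<close>.\<close>
  also have "\<dots> = e ^ DIM('a) *\<^sub>R (\<integral>z. (?C / e ^ DIM('a) * exp (- ((e *\<^sub>R z) \<bullet> (e *\<^sub>R z) / (2 * e\<^sup>2)))) *\<^sub>R f (x + e *\<^sub>R z) \<partial>lborel)"
    using e lborel_integral_affine(1)[of e "\<lambda>y. (?C / e ^ DIM('a) * exp (- ((y - x) \<bullet> (y - x) / (2 * e\<^sup>2)))) *\<^sub>R f y" x]
    by simp
  also have "\<dots> = ?C *\<^sub>R (\<integral>z. exp (- (z \<bullet> z / 2)) *\<^sub>R f (x + e *\<^sub>R z) \<partial>lborel)"
    using e by (simp flip: integral_scaleR_right add: power2_eq_square)
  finally show ?thesis
    by (simp add: power2_eq_square)
qed

subsection \<open>Translations and mollification in the mean\<close>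

text \<open>Outer regularity replaces \<open>A\<close> by an open set \<open>U\<close> of nearly the
  same measure. For open sets the claim is dominated convergence, since small translations of a
  point of \<open>U\<close> stay in \<open>U\<close>.\<close>

lemma translation_continuous_L1_indicator:
  fixes A :: "'a::euclidean_space set"
  assumes A: "A \<in> sets borel" "emeasure lborel A < \<infinity>" and z: "z \<longlonglongrightarrow> 0"
  shows "(\<lambda>n. \<integral>x. \<bar>indicator A (x + z n) - indicator A x :: real\<bar> \<partial>lborel) \<longlonglongrightarrow> 0"
proof (rule LIMSEQ_I)
  fix e :: real assume e: "e > 0"
  obtain U where U: "open U" "A \<subseteq> U" "emeasure lborel (U - A) < ennreal (e/4)"
    using outer_regular_lborel[OF A(1), of "e/4"] e by auto
  have [measurable]: "A \<in> sets borel" "U \<in> sets borel" using U A by auto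
  have UA: "emeasure lborel (U - A) < \<infinity>" using U(3) by (auto simp: less_top[symmetric])
  have Ufin: "emeasure lborel U < \<infinity>"
  proof -
    have "U = A \<union> (U - A)" using U(2) by auto
    then have "emeasure lborel U \<le> emeasure lborel A + emeasure lborel (U - A)"
      using emeasure_subadditive[of A lborel "U - A"] by simp
    also have "\<dots> < \<infinity>" using A(2) UA by simp
    finally show ?thesis .
  qed
  have iA: "integrable lborel (indicator A :: 'a \<Rightarrow> real)" and iU: "integrable lborel (indicator U :: 'a \<Rightarrow> real)"
    and iUA: "integrable lborel (indicator (U - A) :: 'a \<Rightarrow> real)"
    using A(2) Ufin UA by (auto simp: integrable_indicator_iff)
  have s: "integrable lborel (\<lambda>x. f (x + c))" "(\<integral>x. f (x + c) \<partial>lborel) = (\<integral>x. f x \<partial>lborel)"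
    if "integrable lborel f" for c and f :: "'a \<Rightarrow> real"
    using that lborel_integral_shift[of f c] lborel_integrable_shift[of f c] by (auto simp: add.commute)
  have iUU: "integrable lborel (\<lambda>x. indicator U (x + c) * indicator U x :: real)" for c
    by (rule Bochner_Integration.integrable_bound[OF iU]) (auto simp: indicator_def)
  have dU: "measure lborel (U - A) < e/4"
    using U(3) UA e by (simp add: emeasure_eq_ennreal_measure ennreal_less_iff)
  \<comment> \<open>The second factor \<open>indicator U x\<close> removes the points outside
    \<open>U\<close>, where the translates need not converge.\<close>
  have "(\<lambda>n. \<integral>x. indicator U (x + z n) * indicator U x \<partial>lborel) \<longlonglongrightarrow> (\<integral>x. (indicator U x :: real) \<partial>lborel)"
  proof (rule integral_dominated_convergence[where w = "indicator U"])
    show "AE x in lborel. (\<lambda>n. indicator U (x + z n) * indicator U x) \<longlonglongrightarrow> (indicator U x :: real)"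
    proof (rule AE_I2, rule tendsto_eventually)
      fix x :: 'a
      show "\<forall>\<^sub>F n in sequentially. indicator U (x + z n) * indicator U x = (indicator U x :: real)"
      proof (cases "x \<in> U")
        case True
        have "(\<lambda>n. x + z n) \<longlonglongrightarrow> x + 0" by (intro tendsto_intros z)
        then have "\<forall>\<^sub>F n in sequentially. x + z n \<in> U"
          using U(1) True by (intro topological_tendstoD) auto
        then show ?thesis by eventually_elim (simp add: True)
      qed simp
    qed
  qed (use iU in \<open>auto simp: indicator_def\<close>)
  from tendstoD[OF this, of "e/8"] e obtain N where
    N: "\<And>n. n \<ge> N \<Longrightarrow> \<bar>(\<integral>x. indicator U (x + z n) * indicator U x \<partial>lborel) - (\<integral>x. (indicator U x :: real) \<partial>lborel)\<bar> < e/8"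
    by (auto simp: eventually_sequentially dist_real_def)
  have "norm ((\<integral>x. \<bar>indicator A (x + z n) - indicator A x :: real\<bar> \<partial>lborel) - 0) < e" if "n \<ge> N" for n
  proof -
    \<comment> \<open>Passing from \<open>A\<close> to \<open>U\<close> costs the first two terms;
      the bracket is the indicator of the symmetric difference of \<open>U\<close> and its
      translate. The integrals are below \<open>2 * (e/4)\<close> and
      \<open>2 * (e/8)\<close>.\<close>
    let ?R = "\<lambda>x. indicator (U - A) (x + z n) + indicator (U - A) x
      + (indicator U (x + z n) + indicator U x - 2 * (indicator U (x + z n) * indicator U x)) :: real"
    have "(\<integral>x. \<bar>indicator A (x + z n) - indicator A x :: real\<bar> \<partial>lborel) \<le> (\<integral>x. ?R x \<partial>lborel)"
    proof (rule integral_mono)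
      show "integrable lborel (\<lambda>x. \<bar>indicator A (x + z n) - indicator A x :: real\<bar>)"
        by (intro integrable_abs Bochner_Integration.integrable_diff s iA)
      show "integrable lborel ?R"
        by (intro Bochner_Integration.integrable_diff Bochner_Integration.integrable_add s iU iUA
            integrable_mult_right iUU)
      show "\<bar>indicator A (x + z n) - indicator A x :: real\<bar> \<le> ?R x" for x
        using U(2) by (auto simp: indicator_def)
    qed
    also have "\<dots> = 2 * measure lborel (U - A)
      + (2 * measure lborel U - 2 * (\<integral>x. indicator U (x + z n) * indicator U x \<partial>lborel))"
      using iU iUA iUU by (simp add: s)
    also have "\<dots> < e"
      using N[OF that] dU unfolding abs_less_iff by simp
    finally show ?thesis by simp
  qed
  then show "\<exists>N. \<forall>n\<ge>N. norm ((\<integral>x. \<bar>indicator A (x + z n) - indicator A x :: real\<bar> \<partial>lborel) - 0) < e"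
    by blast
qed

text \<open>Induction over integrable functions. In the limit step translation invariance makes the
  approximation error the same for all translates, so it is controlled before \<open>n\<close> is
  chosen.\<close>

lemma translation_continuous_L1:
  fixes f :: "'a::euclidean_space \<Rightarrow> 'b::euclidean_space"
  assumes f: "integrable lborel f" and z: "z \<longlonglongrightarrow> 0"
  shows "(\<lambda>n. \<integral>x. norm (f (x + z n) - f x) \<partial>lborel) \<longlonglongrightarrow> 0"
  using f
proof (induction rule: integrable_induct)
  case (base A c)
  have "(\<lambda>n. (\<integral>x. \<bar>indicator A (x + z n) - indicator A x :: real\<bar> \<partial>lborel) * norm c) \<longlonglongrightarrow> 0 * norm c"
    by (intro tendsto_intros translation_continuous_L1_indicator z) (use base in auto)
  then show ?case
    by (simp flip: scaleR_diff_left integral_mult_left_zero)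
next
  case (add f g)
  have s: "integrable lborel (\<lambda>x. h (x + c))"
    if "integrable lborel h" for c and h :: "'a \<Rightarrow> 'b"
    using that lborel_integrable_shift[of h c] by (auto simp: add.commute)
  have i: "integrable lborel (\<lambda>x. norm (f (x + c) - f x))" "integrable lborel (\<lambda>x. norm (g (x + c) - g x))" for c
    using add s by auto
  show ?case
  proof (rule tendsto_sandwich[OF _ _ tendsto_const])
    show "(\<lambda>n. (\<integral>x. norm (f (x + z n) - f x) \<partial>lborel) + (\<integral>x. norm (g (x + z n) - g x) \<partial>lborel)) \<longlonglongrightarrow> 0"
      using tendsto_add[OF add(3,4)] by simp
    have "(\<integral>x. norm (f (x + z n) + g (x + z n) - (f x + g x)) \<partial>lborel)
      \<le> (\<integral>x. norm (f (x + z n) - f x) + norm (g (x + z n) - g x) \<partial>lborel)" for n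
    proof (rule integral_mono)
      show "integrable lborel (\<lambda>x. norm (f (x + z n) + g (x + z n) - (f x + g x)))"
        using add s by (intro integrable_norm Bochner_Integration.integrable_diff Bochner_Integration.integrable_add) auto
      show "norm (f (x + z n) + g (x + z n) - (f x + g x)) \<le> norm (f (x + z n) - f x) + norm (g (x + z n) - g x)" for x
        by (rule norm_diff_triangle_ineq)
    qed (use i in auto)
    then show "\<forall>\<^sub>F n in sequentially. (\<integral>x. norm (f (x + z n) + g (x + z n) - (f x + g x)) \<partial>lborel)
      \<le> (\<integral>x. norm (f (x + z n) - f x) \<partial>lborel) + (\<integral>x. norm (g (x + z n) - g x) \<partial>lborel)"
      by (simp add: i)
  qed simp
next
  case (lim f s)
  have [measurable]: "f \<in> borel_measurable borel" "s i \<in> borel_measurable borel" for i using lim by auto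
  have sh: "integrable lborel (\<lambda>x. h (x + c))" "(\<integral>x. norm (h (x + c)) \<partial>lborel) = (\<integral>x. norm (h x) \<partial>lborel)"
    if "integrable lborel h" for c and h :: "'a \<Rightarrow> 'b"
    using that lborel_integrable_shift[of h c] lborel_integral_shift[of "\<lambda>x. norm (h x)" c]
    by (auto simp: add.commute)
  have conv: "(\<lambda>i. \<integral>x. norm (s i x - f x) \<partial>lborel) \<longlonglongrightarrow> (\<integral>x. 0 \<partial>(lborel::'a measure))"
  proof (rule integral_dominated_convergence)
    \<comment> \<open>The induction rule supplies approximants bounded by
      \<open>2 * norm (f x)\<close>, hence the majorant with 3.\<close>
    show "integrable lborel (\<lambda>x. 3 * norm (f x))" using lim by auto
    show "AE x in lborel. (\<lambda>i. norm (s i x - f x)) \<longlonglongrightarrow> 0"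
      by (auto intro!: AE_I2 tendsto_norm_zero LIM_zero[OF lim.hyps(2)])
    show "AE x in lborel. norm (norm (s i x - f x)) \<le> 3 * norm (f x)" for i
    proof (rule AE_I2)
      fix x :: 'a
      have "norm (s i x) \<le> 2 * norm (f x)" using lim.hyps(3) by simp
      then show "norm (norm (s i x - f x)) \<le> 3 * norm (f x)"
        using norm_triangle_ineq4[of "s i x" "f x"] by simp
    qed
  qed measurable
  show ?case
  proof (rule LIMSEQ_I)
    fix e :: real assume e: "e > 0"
    obtain i where i: "(\<integral>x. norm (s i x - f x) \<partial>lborel) < e/3"
      using order_tendstoD(2)[OF conv, of "e/3"] e by (auto dest: eventually_happens)
    obtain N where N: "\<And>n. n \<ge> N \<Longrightarrow> (\<integral>x. norm (s i (x + z n) - s i x) \<partial>lborel) < e/3"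
      using order_tendstoD(2)[OF lim.IH[of i], of "e/3"] e by (auto simp: eventually_sequentially)
    have id: "integrable lborel (\<lambda>x. s i x - f x)" using lim by auto
    have "norm ((\<integral>x. norm (f (x + z n) - f x) \<partial>lborel) - 0) < e" if "n \<ge> N" for n
    proof -
      have "(\<integral>x. norm (f (x + z n) - f x) \<partial>lborel)
        \<le> (\<integral>x. norm (s i (x + z n) - s i x) + norm (s i (x + z n) - f (x + z n)) + norm (s i x - f x) \<partial>lborel)"
      proof (rule integral_mono)
        show "norm (f (x + z n) - f x) \<le> norm (s i (x + z n) - s i x) + norm (s i (x + z n) - f (x + z n)) + norm (s i x - f x)" for x
        proof -
          have eq: "f (x + z n) - f x = (s i (x + z n) - s i x) - (s i (x + z n) - f (x + z n)) + (s i x - f x)" by simp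
          show ?thesis unfolding eq
            by (rule norm_triangle_le) (intro add_right_mono norm_triangle_ineq4)
        qed
        show "integrable lborel (\<lambda>x. norm (f (x + z n) - f x))"
          using lim sh by auto
        show "integrable lborel (\<lambda>x. norm (s i (x + z n) - s i x) + norm (s i (x + z n) - f (x + z n)) + norm (s i x - f x))"
          by (intro Bochner_Integration.integrable_add integrable_norm Bochner_Integration.integrable_diff sh lim)
      qed
      also have "\<dots> = (\<integral>x. norm (s i (x + z n) - s i x) \<partial>lborel) + (\<integral>x. norm (s i x - f x) \<partial>lborel) + (\<integral>x. norm (s i x - f x) \<partial>lborel)"
      proof -
        have "integrable lborel (\<lambda>x. norm (s i (x + z n) - s i x))"
          by (intro integrable_norm Bochner_Integration.integrable_diff sh lim)
        then show ?thesis
          using id sh(1)[OF id, of "z n"] by (simp add: sh(2)[OF id, of "z n"])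
      qed
      also have "\<dots> < e" using N[OF that] i by simp
      finally show ?thesis by simp
    qed
    then show "\<exists>N. \<forall>n\<ge>N. norm ((\<integral>x. norm (f (x + z n) - f x) \<partial>lborel) - 0) < e" by blast
  qed
qed

text \<open>By Tonelli the L1 error is at most the Gaussian average over \<open>z\<close> of the L1
  distance between \<open>f\<close> and its translate by \<open>e n *\<^sub>R z\<close>. That
  distance tends to 0 for each \<open>z\<close> and is bounded by twice the norm of
  \<open>f\<close>.\<close>

lemma gauss_mean_approximation_L1:
  fixes f :: "'a::euclidean_space \<Rightarrow> 'b::euclidean_space"
  assumes f: "integrable lborel f" and e: "e \<longlonglongrightarrow> 0"
  shows "(\<lambda>n. \<integral>\<^sup>+x. norm ((1 / sqrt (2 * pi) ^ DIM('a)) *\<^sub>R (\<integral>z. exp (- (z \<bullet> z / 2)) *\<^sub>R f (x + e n *\<^sub>R z) \<partial>lborel) - f x) \<partial>lborel) \<longlonglongrightarrow> 0"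
proof -
  have [measurable]: "f \<in> borel_measurable borel" using f by auto
  define \<gamma> where "\<gamma> z = exp (- (z \<bullet> z / 2)) / sqrt (2 * pi) ^ DIM('a)" for z :: 'a
  have [measurable]: "\<gamma> \<in> borel_measurable borel" unfolding \<gamma>_def by measurable
  have \<gamma>0: "\<gamma> z \<ge> 0" for z by (simp add: \<gamma>_def)
  have i\<gamma>: "integrable lborel \<gamma>" and \<gamma>1: "(\<integral>z. \<gamma> z \<partial>lborel) = 1"
    using integrable_gauss[of 1, where 'a='a] gauss_cos_integral[of "0::'a"] by (auto simp: \<gamma>_def[abs_def])
  have sh: "integrable lborel (\<lambda>x. f (x + c))" "(\<integral>x. norm (f (x + c)) \<partial>lborel) = (\<integral>x. norm (f x) \<partial>lborel)" for c
    using f lborel_integrable_shift[of f c] lborel_integral_shift[of "\<lambda>x. norm (f x)" c]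
    by (auto simp: add.commute)
  have eq: "(1 / sqrt (2 * pi) ^ DIM('a)) *\<^sub>R (\<integral>z. exp (- (z \<bullet> z / 2)) *\<^sub>R f (x + e n *\<^sub>R z) \<partial>lborel)
    = (\<integral>z. \<gamma> z *\<^sub>R f (x + e n *\<^sub>R z) \<partial>lborel)" for x n
    by (simp flip: integral_scaleR_right add: \<gamma>_def)
  define h where "h n z = (\<integral>x. norm (f (x + e n *\<^sub>R z) - f x) \<partial>lborel)" for n z
  have [measurable]: "h n \<in> borel_measurable borel" for n unfolding h_def by measurable
  have h0: "h n z \<ge> 0" for n z by (simp add: h_def)
  have hb: "h n z \<le> 2 * (\<integral>x. norm (f x) \<partial>lborel)" for n z
  proof -
    have "h n z \<le> (\<integral>x. norm (f (x + e n *\<^sub>R z)) + norm (f x) \<partial>lborel)"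
      unfolding h_def using f sh(1) by (intro integral_mono) (auto intro!: norm_triangle_ineq4 integrable_norm)
    also have "\<dots> = 2 * (\<integral>x. norm (f x) \<partial>lborel)" using sh f by (simp add: sh integrable_norm)
    finally show ?thesis .
  qed
  have ih: "integrable lborel (\<lambda>z. \<gamma> z * h n z)" for n
    by (rule Bochner_Integration.integrable_bound[of _ "\<lambda>z. \<gamma> z * (2 * (\<integral>x. norm (f x) \<partial>lborel))"])
       (use i\<gamma> hb h0 \<gamma>0 in \<open>auto simp: abs_mult intro!: mult_left_mono\<close>)
  have lim: "(\<lambda>n. \<integral>z. \<gamma> z * h n z \<partial>lborel) \<longlonglongrightarrow> (\<integral>z. 0 \<partial>(lborel::'a measure))"
  proof (rule integral_dominated_convergence)
    show "integrable lborel (\<lambda>z. \<gamma> z * (2 * (\<integral>x. norm (f x) \<partial>lborel)))" using i\<gamma> by simp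
    show "AE z in lborel. (\<lambda>n. \<gamma> z * h n z) \<longlonglongrightarrow> 0"
    proof (rule AE_I2)
      fix z :: 'a
      have "(\<lambda>n. e n *\<^sub>R z) \<longlonglongrightarrow> 0 *\<^sub>R z" by (intro tendsto_intros e)
      then have "(\<lambda>n. \<gamma> z * h n z) \<longlonglongrightarrow> \<gamma> z * 0"
        unfolding h_def by (intro tendsto_intros translation_continuous_L1 f) simp
      then show "(\<lambda>n. \<gamma> z * h n z) \<longlonglongrightarrow> 0" by simp
    qed
    show "AE z in lborel. norm (\<gamma> z * h n z) \<le> \<gamma> z * (2 * (\<integral>x. norm (f x) \<partial>lborel))" for n
      using hb h0 \<gamma>0 by (auto simp: abs_mult intro!: mult_left_mono)
  qed measurable
  have bound: "(\<integral>\<^sup>+x. norm ((\<integral>z. \<gamma> z *\<^sub>R f (x + e n *\<^sub>R z) \<partial>lborel) - f x) \<partial>lborel) \<le> ennreal (\<integral>z. \<gamma> z * h n z \<partial>lborel)" for n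
  proof -
    have pt: "ennreal (norm ((\<integral>z. \<gamma> z *\<^sub>R f (x + e n *\<^sub>R z) \<partial>lborel) - f x))
      \<le> (\<integral>\<^sup>+z. ennreal (\<gamma> z * norm (f (x + e n *\<^sub>R z) - f x)) \<partial>lborel)" for x
    proof (cases "integrable lborel (\<lambda>z. \<gamma> z *\<^sub>R (f (x + e n *\<^sub>R z) - f x))")
      case True
      have i2: "integrable lborel (\<lambda>z. \<gamma> z *\<^sub>R f x)" using i\<gamma> by simp
      have i1: "integrable lborel (\<lambda>z. \<gamma> z *\<^sub>R f (x + e n *\<^sub>R z))"
        using Bochner_Integration.integrable_add[OF True i2] by (simp add: scaleR_diff_right)
      have "(\<integral>z. \<gamma> z *\<^sub>R f (x + e n *\<^sub>R z) \<partial>lborel) - f x = (\<integral>z. \<gamma> z *\<^sub>R (f (x + e n *\<^sub>R z) - f x) \<partial>lborel)"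
        using i1 i2 \<gamma>1 i\<gamma> by (simp add: scaleR_diff_right integral_scaleR_left)
      then have "ennreal (norm ((\<integral>z. \<gamma> z *\<^sub>R f (x + e n *\<^sub>R z) \<partial>lborel) - f x))
        \<le> (\<integral>\<^sup>+z. norm (\<gamma> z *\<^sub>R (f (x + e n *\<^sub>R z) - f x)) \<partial>lborel)"
        using integral_norm_bound_ennreal[OF True] by simp
      then show ?thesis using \<gamma>0 by simp
    next
      \<comment> \<open>If the inner integrand is not integrable, the Bochner integral says nothing,
        but the bound on the right is infinite.\<close>
      case False
      then have "(\<integral>\<^sup>+z. ennreal (\<gamma> z * norm (f (x + e n *\<^sub>R z) - f x)) \<partial>lborel) = \<infinity>"
        using \<gamma>0 by (auto simp: integrable_iff_bounded less_top[symmetric])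
      then show ?thesis by simp
    qed
    have "(\<integral>\<^sup>+x. norm ((\<integral>z. \<gamma> z *\<^sub>R f (x + e n *\<^sub>R z) \<partial>lborel) - f x) \<partial>lborel)
      \<le> (\<integral>\<^sup>+x. \<integral>\<^sup>+z. ennreal (\<gamma> z * norm (f (x + e n *\<^sub>R z) - f x)) \<partial>lborel \<partial>lborel)"
      by (intro nn_integral_mono pt)
    also have "\<dots> = (\<integral>\<^sup>+z. \<integral>\<^sup>+x. ennreal (\<gamma> z * norm (f (x + e n *\<^sub>R z) - f x)) \<partial>lborel \<partial>lborel)"
      by (rule lborel_pair.Fubini') measurable
    also have "\<dots> = (\<integral>\<^sup>+z. ennreal (\<gamma> z * h n z) \<partial>lborel)"
      by (rule nn_integral_cong, subst nn_integral_eq_integral)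
         (use sh f \<gamma>0 in \<open>auto simp: h_def intro!: integrable_norm\<close>)
    also have "\<dots> = ennreal (\<integral>z. \<gamma> z * h n z \<partial>lborel)"
      by (rule nn_integral_eq_integral[OF ih]) (use h0 \<gamma>0 in auto)
    finally show ?thesis .
  qed
  have "(\<lambda>n. ennreal (\<integral>z. \<gamma> z * h n z \<partial>lborel)) \<longlonglongrightarrow> 0"
    using tendsto_ennrealI[OF lim] by simp
  then show ?thesis
    unfolding eq by (rule tendsto_sandwich[OF _ _ tendsto_const, rotated 2]) (use bound in auto)
qed

subsection \<open>Injectivity and the Plancherel theorem\<close>

text \<open>If the transform vanishes, so do all its regularised inversions, and these converge to
  \<open>f\<close> in L1.\<close>

lemma hartley_injective:
  fixes f :: "'a::euclidean_space \<Rightarrow> 'b::euclidean_space"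
  assumes f: "integrable lborel f" and 0: "\<And>\<xi>. hartley f \<xi> = 0"
  shows "AE x in lborel. f x = 0"
proof -
  have [measurable]: "f \<in> borel_measurable borel" using f by auto
  have "(\<integral>\<^sup>+x. norm (0 - f x) \<partial>lborel) = 0"
  proof (rule LIMSEQ_unique)
    have "(1 / sqrt (2 * pi) ^ DIM('a)) *\<^sub>R (\<integral>z. exp (- (z \<bullet> z / 2)) *\<^sub>R f (x + (1 / real (Suc n)) *\<^sub>R z) \<partial>lborel) = 0" for x n
      using hartley_gauss_hartley[OF f, of "1 / real (Suc n)" x]
      by (simp add: 0 hartley_def[of "\<lambda>\<xi>. 0"])
    then show "(\<lambda>n::nat. \<integral>\<^sup>+x. norm (0 - f x) \<partial>lborel) \<longlonglongrightarrow> 0"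
      using gauss_mean_approximation_L1[OF f LIMSEQ_inverse_real_of_nat] by (simp add: inverse_eq_divide)
  qed simp
  then have "AE x in lborel. ennreal (norm (0 - f x)) = 0"
    by (subst (asm) nn_integral_0_iff_AE) auto
  then show ?thesis by simp
qed

text \<open>Symmetry turns the integral of
  \<open>G n \<xi> * (norm (hartley f \<xi>))\<^sup>2\<close> into the pairing of \<open>f\<close>
  with the Gaussian mean \<open>g n\<close>. As \<open>g n\<close> tends to \<open>f\<close> in L1
  and \<open>f\<close> is bounded, the pairings converge to the squared norm of \<open>f\<close>;
  monotone convergence then gives integrability and value at once.\<close>

lemma hartley_plancherel:
  fixes f :: "'a::euclidean_space \<Rightarrow> 'b::euclidean_space"
  assumes f: "integrable lborel f" and M: "\<And>x. norm (f x) \<le> M"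
  shows "square_integrable (hartley f)"
    and "(\<integral>\<xi>. (norm (hartley f \<xi>))\<^sup>2 \<partial>lborel) = (\<integral>x. (norm (f x))\<^sup>2 \<partial>lborel)"
proof -
  have [measurable]: "f \<in> borel_measurable borel" using f by auto
  have M0: "M \<ge> 0" using M norm_ge_zero order_trans by blast
  define e where "e n = 1 / real (Suc n)" for n
  have e0: "e n > 0" for n by (simp add: e_def)
  have elim: "e \<longlonglongrightarrow> 0" using LIMSEQ_inverse_real_of_nat by (simp add: e_def[abs_def] inverse_eq_divide)
  define G where "G n \<xi> = exp (- ((e n)\<^sup>2 * (\<xi> \<bullet> \<xi>) / 2))" for n and \<xi> :: 'a
  have iG: "integrable lborel (G n)" for n
    unfolding G_def using e0[of n] by (intro integrable_gauss) auto
  have G0: "G n \<xi> \<ge> 0" for n \<xi> by (simp add: G_def)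
  obtain B where B: "B \<ge> 0" "\<And>\<xi>. norm (hartley f \<xi>) \<le> B" using hartley_bounded[OF f] by blast
  have iGh: "integrable lborel (\<lambda>\<xi>. G n \<xi> *\<^sub>R hartley f \<xi>)" for n
  proof (rule Bochner_Integration.integrable_bound)
    show "integrable lborel (\<lambda>\<xi>. G n \<xi> * B)" using iG by simp
    show "AE \<xi> in lborel. norm (G n \<xi> *\<^sub>R hartley f \<xi>) \<le> norm (G n \<xi> * B)"
      using B G0 by (auto simp: abs_mult intro!: mult_left_mono)
    show "(\<lambda>\<xi>. G n \<xi> *\<^sub>R hartley f \<xi>) \<in> borel_measurable lborel" unfolding G_def by measurable
  qed
  define g where "g n x = hartley (\<lambda>\<xi>. G n \<xi> *\<^sub>R hartley f \<xi>) x" for n x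
  have [measurable]: "g n \<in> borel_measurable borel" for n
    unfolding g_def using iGh by (intro hartley_measurable) auto
  define C where "C n = 2 / sqrt (2 * pi) ^ DIM('a) * (\<integral>x. norm (G n x *\<^sub>R hartley f x) \<partial>lborel)" for n
  have C: "norm (g n x) \<le> C n" for n x
    unfolding C_def g_def by (rule norm_hartley_le[OF iGh])
  have ig: "integrable lborel (\<lambda>x. f x \<bullet> g n x)" for n
  proof (rule Bochner_Integration.integrable_bound)
    show "integrable lborel (\<lambda>x. norm (f x) * C n)" using f by simp
    show "AE x in lborel. norm (f x \<bullet> g n x) \<le> norm (norm (f x) * C n)"
    proof (rule AE_I2)
      fix x
      have "\<bar>f x \<bullet> g n x\<bar> \<le> norm (f x) * C n"
        by (rule order_trans[OF Cauchy_Schwarz_ineq2]) (use C[of n] in \<open>auto intro!: mult_left_mono\<close>)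
      then show "norm (f x \<bullet> g n x) \<le> norm (norm (f x) * C n)" by simp
    qed
  qed measurable
  have I: "(\<integral>\<xi>. G n \<xi> * (norm (hartley f \<xi>))\<^sup>2 \<partial>lborel) = (\<integral>x. f x \<bullet> g n x \<partial>lborel)" for n
    using hartley_symmetric[OF f iGh[of n]]
    by (simp add: g_def power2_norm_eq_inner)
  have if2: "integrable lborel (\<lambda>x. f x \<bullet> f x)"
    by (rule Bochner_Integration.integrable_bound[of _ "\<lambda>x. M * norm (f x)"])
       (use f M M0 in \<open>auto simp: power2_norm_eq_inner[symmetric] power2_eq_square abs_mult intro!: mult_right_mono\<close>)
  have "(\<lambda>n. \<integral>x. f x \<bullet> g n x \<partial>lborel) \<longlonglongrightarrow> (\<integral>x. f x \<bullet> f x \<partial>lborel)"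
  proof -
    have "(\<lambda>n. \<integral>\<^sup>+x. norm (g n x - f x) \<partial>lborel) \<longlonglongrightarrow> 0"
      unfolding g_def G_def hartley_gauss_hartley[OF f e0] by (rule gauss_mean_approximation_L1[OF f elim])
    then have L: "(\<lambda>n. ennreal M * (\<integral>\<^sup>+x. norm (g n x - f x) \<partial>lborel)) \<longlonglongrightarrow> ennreal M * 0"
      by (intro ennreal_tendsto_cmult) auto
    have le: "ennreal \<bar>(\<integral>x. f x \<bullet> g n x \<partial>lborel) - (\<integral>x. f x \<bullet> f x \<partial>lborel)\<bar>
      \<le> ennreal M * (\<integral>\<^sup>+x. norm (g n x - f x) \<partial>lborel)" for n
    proof -
      have id: "integrable lborel (\<lambda>x. f x \<bullet> g n x - f x \<bullet> f x)" using ig if2 by auto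
      have "ennreal \<bar>(\<integral>x. f x \<bullet> g n x \<partial>lborel) - (\<integral>x. f x \<bullet> f x \<partial>lborel)\<bar>
        \<le> (\<integral>\<^sup>+x. norm (f x \<bullet> g n x - f x \<bullet> f x) \<partial>lborel)"
        using integral_norm_bound_ennreal[OF id] ig if2 by simp
      also have "\<dots> \<le> (\<integral>\<^sup>+x. ennreal M * norm (g n x - f x) \<partial>lborel)"
      proof (rule nn_integral_mono)
        fix x
        have "\<bar>f x \<bullet> (g n x - f x)\<bar> \<le> M * norm (g n x - f x)"
          by (rule order_trans[OF Cauchy_Schwarz_ineq2]) (intro mult_right_mono M, simp)
        then show "ennreal (norm (f x \<bullet> g n x - f x \<bullet> f x)) \<le> ennreal M * ennreal (norm (g n x - f x))"
          using M0 by (simp add: ennreal_mult[symmetric] inner_diff_right)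
      qed
      also have "\<dots> = ennreal M * (\<integral>\<^sup>+x. norm (g n x - f x) \<partial>lborel)"
        by (rule nn_integral_cmult) measurable
      finally show ?thesis .
    qed
    have "(\<lambda>n. ennreal \<bar>(\<integral>x. f x \<bullet> g n x \<partial>lborel) - (\<integral>x. f x \<bullet> f x \<partial>lborel)\<bar>) \<longlonglongrightarrow> 0"
      by (rule tendsto_sandwich[OF _ _ tendsto_const]) (use le L in auto)
    then have "(\<lambda>n. enn2real (ennreal \<bar>(\<integral>x. f x \<bullet> g n x \<partial>lborel) - (\<integral>x. f x \<bullet> f x \<partial>lborel)\<bar>)) \<longlonglongrightarrow> enn2real 0"
      by (intro tendsto_enn2real) auto
    then show ?thesis by (simp add: tendsto_rabs_zero_iff LIM_zero_iff)
  qed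
  then have lim: "(\<lambda>n. \<integral>\<xi>. G n \<xi> * (norm (hartley f \<xi>))\<^sup>2 \<partial>lborel) \<longlonglongrightarrow> (\<integral>x. (norm (f x))\<^sup>2 \<partial>lborel)"
    unfolding I by (simp add: power2_norm_eq_inner)
  have iI: "integrable lborel (\<lambda>\<xi>. G n \<xi> * (norm (hartley f \<xi>))\<^sup>2)" for n
  proof (rule Bochner_Integration.integrable_bound)
    show "integrable lborel (\<lambda>\<xi>. G n \<xi> * B\<^sup>2)" using iG by simp
    show "AE \<xi> in lborel. norm (G n \<xi> * (norm (hartley f \<xi>))\<^sup>2) \<le> norm (G n \<xi> * B\<^sup>2)"
      using B G0 by (auto simp: abs_mult intro!: mult_left_mono power_mono)
    show "(\<lambda>\<xi>. G n \<xi> * (norm (hartley f \<xi>))\<^sup>2) \<in> borel_measurable lborel" unfolding G_def by measurable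
  qed
  \<comment> \<open>The widths \<open>e n\<close> decrease, so the cutoffs increase to 1.\<close>
  have mono: "AE \<xi> in lborel. mono (\<lambda>n. G n \<xi> * (norm (hartley f \<xi>))\<^sup>2)"
  proof (intro AE_I2 monoI mult_right_mono)
    fix \<xi> :: 'a and m n :: nat assume "m \<le> n"
    then have "e n \<le> e m" by (simp add: e_def frac_le)
    then have "(e n)\<^sup>2 \<le> (e m)\<^sup>2" using e0[of n] by (intro power_mono) auto
    then show "G m \<xi> \<le> G n \<xi>" by (simp add: G_def mult_right_mono)
  qed simp
  have pt: "AE \<xi> in lborel. (\<lambda>n. G n \<xi> * (norm (hartley f \<xi>))\<^sup>2) \<longlonglongrightarrow> (norm (hartley f \<xi>))\<^sup>2"
  proof (rule AE_I2)
    fix \<xi> :: 'a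
    have "(\<lambda>n. G n \<xi>) \<longlonglongrightarrow> exp (- (0\<^sup>2 * (\<xi> \<bullet> \<xi>) / 2))"
      unfolding G_def by (intro tendsto_intros elim) auto
    then have "(\<lambda>n. G n \<xi> * (norm (hartley f \<xi>))\<^sup>2) \<longlonglongrightarrow> 1 * (norm (hartley f \<xi>))\<^sup>2"
      by (intro tendsto_mult tendsto_const) simp
    then show "(\<lambda>n. G n \<xi> * (norm (hartley f \<xi>))\<^sup>2) \<longlonglongrightarrow> (norm (hartley f \<xi>))\<^sup>2" by simp
  qed
  have m: "(\<lambda>\<xi>. (norm (hartley f \<xi>))\<^sup>2) \<in> borel_measurable lborel" by measurable
  show "square_integrable (hartley f)"
    using integrable_monotone_convergence[OF iI mono pt lim m] by (simp add: square_integrable_def)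
  show "(\<integral>\<xi>. (norm (hartley f \<xi>))\<^sup>2 \<partial>lborel) = (\<integral>x. (norm (f x))\<^sup>2 \<partial>lborel)"
    using integral_monotone_convergence[OF iI mono pt lim m] .
qed

subsection \<open>The Hartley transform on square integrable functions\<close>

text \<open>The dense class on which the transform is an honest integral and Plancherel's identity
  is already available.\<close>

definition bounded_integrable :: "('a::euclidean_space \<Rightarrow> 'b::euclidean_space) \<Rightarrow> bool"
  where "bounded_integrable f \<longleftrightarrow> integrable lborel f \<and> (\<exists>M. \<forall>x. norm (f x) \<le> M)"

lemma bounded_integrable_imp_integrable: "bounded_integrable f \<Longrightarrow> integrable lborel f"
  by (simp add: bounded_integrable_def)

lemma bounded_integrable_imp_square_integrable:
  assumes "bounded_integrable f" shows "square_integrable f"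
proof -
  obtain M where f: "integrable lborel f" and M: "\<And>x. norm (f x) \<le> M"
    using assms by (auto simp: bounded_integrable_def)
  have M0: "M \<ge> 0" using M norm_ge_zero order_trans by blast
  have [measurable]: "f \<in> borel_measurable borel" using f by auto
  have "integrable lborel (\<lambda>x. (norm (f x))\<^sup>2)"
    by (rule Bochner_Integration.integrable_bound[of _ "\<lambda>x. M * norm (f x)"])
       (use f M M0 in \<open>auto simp: power2_eq_square abs_mult intro!: mult_right_mono\<close>)
  then show ?thesis by (simp add: square_integrable_def)
qed

lemma bounded_integrable_diff:
  assumes "bounded_integrable f" "bounded_integrable g"
  shows "bounded_integrable (\<lambda>x. f x - g x)"
proof -
  obtain M N where "\<And>x. norm (f x) \<le> M" "\<And>x. norm (g x) \<le> N"
    using assms by (auto simp: bounded_integrable_def)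
  then have "norm (f x - g x) \<le> M + N" for x
    by (intro order_trans[OF norm_triangle_ineq4 add_mono])
  then show ?thesis using assms by (auto simp: bounded_integrable_def)
qed

lemma square_integrable_hartley: "bounded_integrable f \<Longrightarrow> square_integrable (hartley f)"
  using hartley_plancherel(1) by (auto simp: bounded_integrable_def)

lemma norm_hartley_diff:
  assumes f: "bounded_integrable f" and g: "bounded_integrable g"
  shows "norm (abs_l2 (hartley f) - abs_l2 (hartley g)) = norm (abs_l2 f - abs_l2 g)"
proof -
  have fg: "bounded_integrable (\<lambda>x. f x - g x)" using f g by (rule bounded_integrable_diff)
  have "hartley f \<xi> - hartley g \<xi> = hartley (\<lambda>x. f x - g x) \<xi>" for \<xi>
    using f g unfolding hartley_def bounded_integrable_def
    by (simp add: scaleR_diff_right integrable_cas)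
  moreover have "norm (abs_l2 (hartley (\<lambda>x. f x - g x))) = norm (abs_l2 (\<lambda>x. f x - g x))"
    using fg hartley_plancherel(2) square_integrable_hartley[OF fg]
      bounded_integrable_imp_square_integrable[OF fg]
    by (intro power2_eq_imp_eq[of "norm _" "norm _"]) (auto simp: norm_abs_l2 bounded_integrable_def)
  ultimately show ?thesis
    using f g by (simp add: abs_l2_diff square_integrable_hartley bounded_integrable_imp_square_integrable)
qed

section \<open>Extension of the transform from bounded integrable functions to all of L2\<close>

definition truncation :: "nat \<Rightarrow> ('a::euclidean_space \<Rightarrow> 'b::euclidean_space) \<Rightarrow> 'a \<Rightarrow> 'b"
  where "truncation n f x = (if norm x \<le> real n \<and> norm (f x) \<le> real n then f x else 0)"

lemma bounded_integrable_truncation: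
  fixes f :: "'a::euclidean_space \<Rightarrow> 'b::euclidean_space"
  assumes [measurable]: "f \<in> borel_measurable lborel"
  shows "bounded_integrable (truncation n f)"
  unfolding bounded_integrable_def
proof
  show "integrable lborel (truncation n f)"
  proof (rule Bochner_Integration.integrable_bound)
    show "integrable lborel (\<lambda>x. indicator (cball 0 (real n)) x * real n)"
      using emeasure_lborel_cball_finite[of 0 "real n"] by auto
    show "truncation n f \<in> borel_measurable lborel"
      unfolding truncation_def by measurable
    show "AE x in lborel. norm (truncation n f x) \<le> norm (indicator (cball 0 (real n)) x * real n)"
      by (auto simp: truncation_def)
  qed
  show "\<exists>M. \<forall>x. norm (truncation n f x) \<le> M"
    by (intro exI[of _ "real n"]) (auto simp: truncation_def)
qed

lemma tendsto_truncation:
  fixes f :: "'a::euclidean_space \<Rightarrow> 'b::euclidean_space"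
  assumes f: "square_integrable f"
  shows "(\<lambda>n. abs_l2 (truncation n f)) \<longlonglongrightarrow> abs_l2 f"
proof (rule tendsto_abs_l2)
  show "square_integrable (truncation n f)" for n
    using f by (intro bounded_integrable_imp_square_integrable bounded_integrable_truncation)
      (rule square_integrable_measurable)
  show "AE x in lborel. (\<lambda>n. truncation n f x) \<longlonglongrightarrow> f x"
  proof (rule AE_I2, rule tendsto_eventually)
    fix x
    have "\<forall>\<^sub>F n in sequentially. n \<ge> nat \<lceil>norm x\<rceil> + nat \<lceil>norm (f x)\<rceil>"
      by (rule eventually_ge_at_top)
    then show "\<forall>\<^sub>F n in sequentially. truncation n f x = f x"
    proof eventually_elim
      case (elim n)
      then have "norm x \<le> real n" "norm (f x) \<le> real n"
        using real_nat_ceiling_ge[of "norm x"] real_nat_ceiling_ge[of "norm (f x)"] by linarith+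
      then show ?case by (simp add: truncation_def)
    qed
  qed
  show "AE x in lborel. norm (truncation n f x) \<le> norm (f x)" for n
    by (auto simp: truncation_def)
qed (use f in auto)

lemma l2_eqI_bounded_integrable:
  fixes F G :: "('a::euclidean_space, 'b::euclidean_space) l2"
  assumes "\<And>g. bounded_integrable g \<Longrightarrow> F \<bullet> abs_l2 g = G \<bullet> abs_l2 g"
  shows "F = G"
proof -
  let ?R = "rep_l2 (F - G)"
  have "(F - G) \<bullet> abs_l2 (truncation n ?R) = 0" for n
    using assms[OF bounded_integrable_truncation[of ?R n]] by (simp add: inner_diff_left)
  moreover have "(\<lambda>n. (F - G) \<bullet> abs_l2 (truncation n ?R)) \<longlonglongrightarrow> (F - G) \<bullet> abs_l2 ?R"
    by (intro tendsto_intros tendsto_truncation square_integrable_rep_l2)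
  ultimately have "(F - G) \<bullet> (F - G) = 0"
    by (simp add: LIMSEQ_const_iff)
  then show ?thesis by simp
qed

text \<open>Extension by continuity along one fixed approximating sequence. The limit exists because
  the transform is isometric on bounded integrable functions and the space is complete.\<close>

definition hartley_l2 :: "('a::euclidean_space, 'b::euclidean_space) l2 \<Rightarrow> ('a, 'b) l2"
  where "hartley_l2 F = lim (\<lambda>n. abs_l2 (hartley (truncation n (rep_l2 F))))"

lemma hartley_l2_LIMSEQ: "(\<lambda>n. abs_l2 (hartley (truncation n (rep_l2 F)))) \<longlonglongrightarrow> hartley_l2 F"
proof -
  have "convergent (\<lambda>n. abs_l2 (truncation n (rep_l2 F)))"
    using tendsto_truncation[OF square_integrable_rep_l2] by (auto simp: convergent_def)
  then have "Cauchy (\<lambda>n. abs_l2 (truncation n (rep_l2 F)))"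
    by (rule convergent_Cauchy)
  then have "Cauchy (\<lambda>n. abs_l2 (hartley (truncation n (rep_l2 F))))"
    by (simp add: Cauchy_def dist_norm norm_hartley_diff bounded_integrable_truncation)
  then show ?thesis
    unfolding hartley_l2_def by (simp add: Cauchy_convergent_iff convergent_LIMSEQ_iff)
qed

lemma hartley_l2_inner_abs:
  assumes g: "bounded_integrable g"
  shows "hartley_l2 F \<bullet> abs_l2 g = F \<bullet> abs_l2 (hartley g)"
proof (rule LIMSEQ_unique)
  show "(\<lambda>n. abs_l2 (hartley (truncation n (rep_l2 F))) \<bullet> abs_l2 g) \<longlonglongrightarrow> hartley_l2 F \<bullet> abs_l2 g"
    by (intro tendsto_intros hartley_l2_LIMSEQ)
  have "(\<lambda>n. abs_l2 (truncation n (rep_l2 F)) \<bullet> abs_l2 (hartley g)) \<longlonglongrightarrow> abs_l2 (rep_l2 F) \<bullet> abs_l2 (hartley g)"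
    by (intro tendsto_intros tendsto_truncation square_integrable_rep_l2)
  moreover have "abs_l2 (truncation n (rep_l2 F)) \<bullet> abs_l2 (hartley g)
      = abs_l2 (hartley (truncation n (rep_l2 F))) \<bullet> abs_l2 g" for n
    using g bounded_integrable_truncation[of "rep_l2 F" n]
    by (simp add: abs_l2_inner square_integrable_hartley bounded_integrable_imp_square_integrable
        hartley_symmetric bounded_integrable_imp_integrable)
  ultimately show "(\<lambda>n. abs_l2 (hartley (truncation n (rep_l2 F))) \<bullet> abs_l2 g) \<longlonglongrightarrow> F \<bullet> abs_l2 (hartley g)"
    by simp
qed

lemma norm_hartley_l2: "norm (hartley_l2 F) = norm F"
proof (rule LIMSEQ_unique)
  show "(\<lambda>n. norm (abs_l2 (hartley (truncation n (rep_l2 F))))) \<longlonglongrightarrow> norm (hartley_l2 F)"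
    by (intro tendsto_intros hartley_l2_LIMSEQ)
  have "(\<lambda>n. norm (abs_l2 (truncation n (rep_l2 F)))) \<longlonglongrightarrow> norm (abs_l2 (rep_l2 F))"
    by (intro tendsto_intros tendsto_truncation square_integrable_rep_l2)
  moreover have "norm (abs_l2 (hartley f)) = norm (abs_l2 f)" if "bounded_integrable f" for f :: "'a \<Rightarrow> 'b"
  proof -
    have "bounded_integrable (\<lambda>x::'a. 0::'b)" by (auto simp: bounded_integrable_def)
    moreover have "hartley (\<lambda>x::'a. 0::'b) = (\<lambda>\<xi>. 0)"
      by (simp add: fun_eq_iff hartley_def)
    ultimately show ?thesis
      using norm_hartley_diff[OF that, of "\<lambda>x. 0"] by (simp add: abs_l2_zero)
  qed
  ultimately show "(\<lambda>n. norm (abs_l2 (hartley (truncation n (rep_l2 F))))) \<longlonglongrightarrow> norm F"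
    by (simp add: bounded_integrable_truncation)
qed

text \<open>Pairing with bounded integrable \<open>g\<close> moves the transform onto
  \<open>g\<close> on both sides, and such \<open>g\<close> separate points. The truncations of the
  chosen representative never have to be compared with \<open>f\<close> itself.\<close>

lemma hartley_l2_abs:
  assumes f: "bounded_integrable f"
  shows "hartley_l2 (abs_l2 f) = abs_l2 (hartley f)"
proof (rule l2_eqI_bounded_integrable)
  fix g :: "'a \<Rightarrow> 'b" assume g: "bounded_integrable g"
  show "hartley_l2 (abs_l2 f) \<bullet> abs_l2 g = abs_l2 (hartley f) \<bullet> abs_l2 g"
    using f g by (simp add: hartley_l2_inner_abs abs_l2_inner square_integrable_hartley
        bounded_integrable_imp_square_integrable hartley_symmetric bounded_integrable_imp_integrable)
qed

lemma hartley_l2_symmetric: "hartley_l2 F \<bullet> G = F \<bullet> hartley_l2 G"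
proof (rule LIMSEQ_unique)
  show "(\<lambda>n. F \<bullet> abs_l2 (hartley (truncation n (rep_l2 G)))) \<longlonglongrightarrow> F \<bullet> hartley_l2 G"
    by (intro tendsto_intros hartley_l2_LIMSEQ)
  have "(\<lambda>n. hartley_l2 F \<bullet> abs_l2 (truncation n (rep_l2 G))) \<longlonglongrightarrow> hartley_l2 F \<bullet> abs_l2 (rep_l2 G)"
    by (intro tendsto_intros tendsto_truncation square_integrable_rep_l2)
  then show "(\<lambda>n. F \<bullet> abs_l2 (hartley (truncation n (rep_l2 G)))) \<longlonglongrightarrow> hartley_l2 F \<bullet> G"
    by (simp add: hartley_l2_inner_abs bounded_integrable_truncation)
qed

text \<open>Truncation is not additive, so linearity is read off from symmetry instead: pairing with
  an arbitrary element moves the transform to the other side.\<close>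

lemma hartley_l2_add: "hartley_l2 (F + G) = hartley_l2 F + hartley_l2 G"
  by (rule vector_eq_ldot[THEN iffD1]) (simp add: inner_add_right flip: hartley_l2_symmetric)

lemma hartley_l2_scaleR: "hartley_l2 (c *\<^sub>R F) = c *\<^sub>R hartley_l2 F"
  by (rule vector_eq_ldot[THEN iffD1]) (simp flip: hartley_l2_symmetric)

lemma hartley_l2_inner: "hartley_l2 F \<bullet> hartley_l2 G = F \<bullet> G"
proof -
  have "(norm (hartley_l2 (F + G)))\<^sup>2 = (norm (F + G))\<^sup>2" by (simp add: norm_hartley_l2)
  moreover have "(norm (hartley_l2 F))\<^sup>2 = (norm F)\<^sup>2" "(norm (hartley_l2 G))\<^sup>2 = (norm G)\<^sup>2"
    by (simp_all add: norm_hartley_l2)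
  ultimately show ?thesis
    by (simp add: power2_norm_eq_inner hartley_l2_add inner_add_left inner_add_right inner_commute)
qed

text \<open>A symmetric isometry is an involution, as \<open>hartley_l2 (hartley_l2 F) \<bullet> G =
  hartley_l2 F \<bullet> hartley_l2 G = F \<bullet> G\<close>. This is the inversion theorem on
  L2.\<close>

lemma hartley_l2_involution [simp]: "hartley_l2 (hartley_l2 F) = F"
  by (rule vector_eq_ldot[THEN iffD1]) (metis hartley_l2_inner hartley_l2_symmetric)

subsection \<open>Operators unitarily equivalent to multiplication by a function\<close>

definition restrict_l2 :: "'a set \<Rightarrow> ('a::euclidean_space, 'b::euclidean_space) l2 \<Rightarrow> ('a, 'b) l2"
  where "restrict_l2 A F = abs_l2 (\<lambda>x. indicator A x *\<^sub>R rep_l2 F x)"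

lemma square_integrable_indicator:
  fixes f :: "'a::euclidean_space \<Rightarrow> 'b::euclidean_space"
  assumes f: "square_integrable f" and [measurable]: "A \<in> sets borel"
  shows "square_integrable (\<lambda>x. indicator A x *\<^sub>R f x)"
proof (rule square_integrable_bound[OF f])
  have [measurable]: "f \<in> borel_measurable borel" using square_integrable_measurable[OF f] by simp
  show "(\<lambda>x. indicator A x *\<^sub>R f x) \<in> borel_measurable lborel" by measurable
  show "AE x in lborel. norm (indicator A x *\<^sub>R f x) \<le> 1 * norm (f x)"
    by (auto simp: indicator_def)
qed

lemma rep_restrict_l2:
  "A \<in> sets borel \<Longrightarrow> AE x in lborel. rep_l2 (restrict_l2 A F) x = indicator A x *\<^sub>R rep_l2 F x"
  unfolding restrict_l2_def by (intro rep_abs_l2 square_integrable_indicator square_integrable_rep_l2)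

lemma restrict_l2_add:
  assumes "A \<in> sets borel"
  shows "restrict_l2 A (F + G) = restrict_l2 A F + restrict_l2 A G"
proof (rule l2_eqI)
  show "AE x in lborel. rep_l2 (restrict_l2 A (F + G)) x = rep_l2 (restrict_l2 A F + restrict_l2 A G) x"
    using rep_restrict_l2[OF assms, of "F + G"] rep_restrict_l2[OF assms, of F]
      rep_restrict_l2[OF assms, of G] rep_l2_add[of F G] rep_l2_add[of "restrict_l2 A F" "restrict_l2 A G"]
    by eventually_elim (simp add: scaleR_add_right)
qed

lemma restrict_l2_scaleR:
  assumes "A \<in> sets borel"
  shows "restrict_l2 A (c *\<^sub>R F) = c *\<^sub>R restrict_l2 A F"
proof (rule l2_eqI)
  show "AE x in lborel. rep_l2 (restrict_l2 A (c *\<^sub>R F)) x = rep_l2 (c *\<^sub>R restrict_l2 A F) x"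
    using rep_restrict_l2[OF assms, of "c *\<^sub>R F"] rep_restrict_l2[OF assms, of F]
      rep_l2_scaleR[of c F] rep_l2_scaleR[of c "restrict_l2 A F"]
    by eventually_elim simp
qed

lemma restrict_l2_Int:
  assumes "A \<in> sets borel" "B \<in> sets borel"
  shows "restrict_l2 (A \<inter> B) F = restrict_l2 A (restrict_l2 B F)"
proof (rule l2_eqI)
  have "A \<inter> B \<in> sets borel" using assms by auto
  from rep_restrict_l2[OF this, of F] rep_restrict_l2[OF assms(2), of F]
    rep_restrict_l2[OF assms(1), of "restrict_l2 B F"]
  show "AE x in lborel. rep_l2 (restrict_l2 (A \<inter> B) F) x = rep_l2 (restrict_l2 A (restrict_l2 B F)) x"
    by eventually_elim (simp add: indicator_inter_arith)
qed

lemma restrict_l2_UNIV [simp]: "restrict_l2 UNIV F = F"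
  by (simp add: restrict_l2_def)

lemma restrict_l2_inner:
  assumes "A \<in> sets borel"
  shows "restrict_l2 A F \<bullet> G = (\<integral>x. indicator A x * (rep_l2 F x \<bullet> rep_l2 G x) \<partial>lborel)"
proof -
  have [measurable]: "A \<in> sets borel" by fact
  show ?thesis
    unfolding inner_l2_eq
    by (rule integral_cong_AE, measurable)
       (use rep_restrict_l2[OF assms, of F] in eventually_elim, simp)
qed

lemma restrict_l2_symmetric:
  assumes "A \<in> sets borel" shows "restrict_l2 A F \<bullet> G = F \<bullet> restrict_l2 A G"
  using restrict_l2_inner[OF assms, of F G] restrict_l2_inner[OF assms, of G F]
  by (simp add: inner_commute)

lemma norm_restrict_l2_le:
  assumes "A \<in> sets borel" shows "norm (restrict_l2 A F) \<le> norm F"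
proof -
  have "(norm (restrict_l2 A F))\<^sup>2 = restrict_l2 A F \<bullet> F"
    using restrict_l2_symmetric[OF assms, of "restrict_l2 A F" F] restrict_l2_Int[OF assms assms, of F]
    by (simp add: power2_norm_eq_inner)
  also have "\<dots> \<le> norm (restrict_l2 A F) * norm F" by (rule norm_cauchy_schwarz)
  finally show ?thesis
    by (cases "norm (restrict_l2 A F) = 0") (auto simp: power2_eq_square)
qed

text \<open>By disjointness the partial sums are restrictions to finite unions, whose indicators
  converge pointwise; dominated convergence does the rest.\<close>

lemma restrict_l2_sums:
  fixes F :: "('a::euclidean_space, 'b::euclidean_space) l2"
  assumes A: "\<And>i::nat. A i \<in> sets borel" and disj: "disjoint_family A"
  shows "(\<lambda>i. restrict_l2 (A i) F) sums restrict_l2 (\<Union>i. A i) F"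
proof -
  have partial: "(\<Sum>i<n. restrict_l2 (A i) F) = restrict_l2 (\<Union>i<n. A i) F" for n
  proof (induction n)
    case 0 then show ?case by (simp add: restrict_l2_def abs_l2_zero)
  next
    case (Suc n)
    let ?B = "\<Union>i<n. A i"
    have B: "?B \<in> sets borel" "?B \<union> A n \<in> sets borel" using A by auto
    have "A i \<inter> A n = {}" if "i < n" for i
      using that by (intro disjoint_family_onD[OF disj]) auto
    then have d: "?B \<inter> A n = {}" by blast
    have "restrict_l2 ?B F + restrict_l2 (A n) F = restrict_l2 (?B \<union> A n) F"
    proof (rule l2_eqI)
      show "AE x in lborel. rep_l2 (restrict_l2 ?B F + restrict_l2 (A n) F) x = rep_l2 (restrict_l2 (?B \<union> A n) F) x"
        using rep_l2_add[of "restrict_l2 ?B F" "restrict_l2 (A n) F"] rep_restrict_l2[OF B(1), of F]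
          rep_restrict_l2[OF A, of n F] rep_restrict_l2[OF B(2), of F]
      proof eventually_elim
        case (elim x)
        have "indicator (?B \<union> A n) x = (indicator ?B x + indicator (A n) x :: real)"
          by (rule indicator_disj_union) (rule d)
        then show ?case using elim by (simp add: scaleR_add_left)
      qed
    qed
    moreover have "(\<Union>i<Suc n. A i) = ?B \<union> A n" by (auto simp: less_Suc_eq)
    ultimately show ?case using Suc by simp
  qed
  have "(\<lambda>n. restrict_l2 (\<Union>i<n. A i) F) \<longlonglongrightarrow> restrict_l2 (\<Union>i. A i) F"
    unfolding restrict_l2_def
  proof (rule tendsto_abs_l2)
    show "square_integrable (\<lambda>x. indicator (\<Union>i<n. A i) x *\<^sub>R rep_l2 F x)" for n
      using A by (intro square_integrable_indicator square_integrable_rep_l2) auto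
    show "square_integrable (\<lambda>x. indicator (\<Union>i. A i) x *\<^sub>R rep_l2 F x)"
      using A by (intro square_integrable_indicator square_integrable_rep_l2) auto
    show "square_integrable (rep_l2 F)" by (rule square_integrable_rep_l2)
    show "AE x in lborel. (\<lambda>n. indicator (\<Union>i<n. A i) x *\<^sub>R rep_l2 F x) \<longlonglongrightarrow> indicator (\<Union>i. A i) x *\<^sub>R rep_l2 F x"
    proof (rule AE_I2, rule tendsto_scaleR[OF _ tendsto_const])
      fix x
      show "(\<lambda>n. indicator (\<Union>i<n. A i) x :: real) \<longlonglongrightarrow> indicator (\<Union>i. A i) x"
        by (rule LIMSEQ_indicator_UN)
    qed
    show "AE x in lborel. norm (indicator (\<Union>i<n. A i) x *\<^sub>R rep_l2 F x) \<le> norm (rep_l2 F x)" for n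
      by (auto simp: indicator_def)
  qed
  then show ?thesis by (simp add: sums_def partial)
qed

text \<open>The test elements \<open>Z = 1\<^bsub>{|g| \<le> n}\<^esub> (Y - g X)\<close> show that multiplication by \<open>g\<close> is self-adjoint.\<close>

lemma multiplication_weak_imp_AE:
  fixes g :: "'a::euclidean_space \<Rightarrow> real" and X Y :: "'a \<Rightarrow> 'b::euclidean_space"
  assumes X: "square_integrable X" and Y: "square_integrable Y" and g [measurable]: "g \<in> borel_measurable borel"
    and weak: "\<And>Z. square_integrable Z \<Longrightarrow> square_integrable (\<lambda>x. g x *\<^sub>R Z x)
      \<Longrightarrow> (\<integral>x. g x * (X x \<bullet> Z x) \<partial>lborel) = (\<integral>x. Y x \<bullet> Z x \<partial>lborel)"
  shows "AE x in lborel. Y x = g x *\<^sub>R X x"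
proof -
  have [measurable]: "X \<in> borel_measurable borel" "Y \<in> borel_measurable borel"
    using square_integrable_measurable X Y by auto
  have "AE x in lborel. \<bar>g x\<bar> \<le> real n \<longrightarrow> Y x = g x *\<^sub>R X x" for n
  proof -
    define I where "I x = (indicator {x. \<bar>g x\<bar> \<le> real n} x :: real)" for x
    have [measurable]: "I \<in> borel_measurable borel" unfolding I_def by measurable
    define Z where "Z x = I x *\<^sub>R (Y x - g x *\<^sub>R X x)" for x
    have IgX: "square_integrable (\<lambda>x. (I x * g x) *\<^sub>R X x)"
      by (rule square_integrable_bound[OF X, of _ "real n"])
         (auto simp: I_def indicator_def intro!: mult_right_mono)
    have IY: "square_integrable (\<lambda>x. I x *\<^sub>R Y x)"
      by (rule square_integrable_bound[OF Y, of _ 1]) (auto simp: I_def indicator_def)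
    have Z: "square_integrable Z"
      using square_integrable_minus[OF IY IgX] by (simp add: Z_def[abs_def] scaleR_diff_right)
    have Zeq: "g x *\<^sub>R Z x = (I x * g x) *\<^sub>R Z x" for x
      by (simp add: Z_def I_def indicator_def)
    have "Z \<in> borel_measurable lborel" using Z by (rule square_integrable_measurable)
    then have [measurable]: "Z \<in> borel_measurable borel" by simp
    have gZ: "square_integrable (\<lambda>x. g x *\<^sub>R Z x)"
      unfolding Zeq
      by (rule square_integrable_bound[OF Z, of _ "real n"])
         (auto simp: I_def indicator_def intro!: mult_right_mono)
    have "(\<integral>x. Z x \<bullet> Z x \<partial>lborel) = (\<integral>x. Y x \<bullet> Z x - X x \<bullet> (g x *\<^sub>R Z x) \<partial>lborel)"
    proof (rule Bochner_Integration.integral_cong[OF refl])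
      fix x
      have "I x *\<^sub>R Z x = Z x" by (simp add: Z_def I_def indicator_def)
      then have "Z x \<bullet> Z x = (Y x - g x *\<^sub>R X x) \<bullet> Z x"
        by (metis Z_def inner_scaleR_left inner_scaleR_right)
      then show "Z x \<bullet> Z x = Y x \<bullet> Z x - X x \<bullet> (g x *\<^sub>R Z x)" by (simp add: inner_diff_left)
    qed
    also have "\<dots> = (\<integral>x. Y x \<bullet> Z x \<partial>lborel) - (\<integral>x. X x \<bullet> (g x *\<^sub>R Z x) \<partial>lborel)"
      by (rule Bochner_Integration.integral_diff) (intro square_integrable_inner X Y Z gZ)+
    also have "\<dots> = 0" using weak[OF Z gZ] by simp
    finally have "AE x in lborel. Z x \<bullet> Z x = 0"
      by (subst (asm) integral_nonneg_eq_0_iff_AE) (auto intro!: square_integrable_inner Z)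
    then show ?thesis
      by eventually_elim (auto simp: Z_def I_def indicator_def split: if_splits)
  qed
  then have "AE x in lborel. \<forall>n. \<bar>g x\<bar> \<le> real n \<longrightarrow> Y x = g x *\<^sub>R X x"
    unfolding AE_all_countable by (rule allI)
  then show ?thesis
  proof eventually_elim
    case (elim x)
    obtain n :: nat where "\<bar>g x\<bar> \<le> real n" using real_arch_simple by blast
    with elim show ?case by blast
  qed
qed

text \<open>\<open>K\<close> is unitary and the operator in mind is \<open>K'\<close> after
  multiplication by \<open>m\<close> after \<open>K\<close>. Carrying the inverse as a parameter
  reduces unitarity to algebraic identities.\<close>

locale multiplication_representation =
  fixes K :: "'h::real_inner \<Rightarrow> ('a::euclidean_space, 'b::euclidean_space) l2"
    and K' :: "('a, 'b) l2 \<Rightarrow> 'h"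
    and m :: "'a \<Rightarrow> real"
  assumes K_add: "K (x + y) = K x + K y"
    and K_scaleR: "K (c *\<^sub>R x) = c *\<^sub>R K x"
    and K_K' [simp]: "K (K' F) = F"
    and K'_K [simp]: "K' (K x) = x"
    and K_inner: "K x \<bullet> K y = x \<bullet> y"
    and m_measurable [measurable]: "m \<in> borel_measurable borel"
begin

definition projection :: "real set \<Rightarrow> 'h \<Rightarrow> 'h"
  where "projection S x = K' (restrict_l2 (m -` S) (K x))"

lemma vimage_m [measurable]: "S \<in> sets borel \<Longrightarrow> m -` S \<in> sets borel"
  using measurable_sets[OF m_measurable, of S] by simp

lemma K_projection: "K (projection S x) = restrict_l2 (m -` S) (K x)"
  by (simp add: projection_def)

lemma K_eqI: "K x = K y \<Longrightarrow> x = y"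
  by (metis K'_K)

lemma K_diff: "K (x - y) = K x - K y"
  using K_add[of x "- y"] K_scaleR[of "-1" y] by simp

lemma norm_K: "norm (K x) = norm x"
  by (simp add: norm_eq_sqrt_inner K_inner)

lemma projection_valued_measure_projection: "projection_valued_measure projection"
  unfolding projection_valued_measure_def
proof (intro conjI ballI allI impI)
  fix S :: "real set" assume S: "S \<in> sets borel"
  show "orth_projection (projection S)"
    unfolding orth_projection_def
  proof (intro conjI allI)
    show "bounded_linear (projection S)"
    proof (rule bounded_linear_intro[where K = 1])
      show "projection S (x + y) = projection S x + projection S y" for x y
        by (rule K_eqI) (simp add: K_projection K_add restrict_l2_add vimage_m S)
      show "projection S (r *\<^sub>R x) = r *\<^sub>R projection S x" for r x
        by (rule K_eqI) (simp add: K_projection K_scaleR restrict_l2_scaleR vimage_m S)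
      show "norm (projection S x) \<le> norm x * 1" for x
        using norm_restrict_l2_le[OF vimage_m[OF S], of "K x"]
        by (simp add: norm_K flip: K_projection)
    qed
    show "projection S (projection S x) = projection S x" for x
      using restrict_l2_Int[OF vimage_m[OF S] vimage_m[OF S], of "K x"]
      by (intro K_eqI) (simp add: K_projection)
    show "projection S x \<bullet> y = x \<bullet> projection S y" for x y
      using restrict_l2_symmetric[OF vimage_m[OF S], of "K x" "K y"]
      by (simp add: K_inner flip: K_projection)
  qed
  show "projection (S \<inter> T) = projection S \<circ> projection T" if "T \<in> sets borel" for T
    using restrict_l2_Int[OF vimage_m[OF S] vimage_m[OF that]]
    by (intro ext K_eqI) (simp add: K_projection)
next
  show "projection UNIV = (\<lambda>x. x)" by (simp add: fun_eq_iff projection_def)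
next
  fix A :: "nat \<Rightarrow> real set" and x :: 'h
  assume A: "range A \<subseteq> sets borel" and disj: "disjoint_family A"
  have "(\<lambda>i. restrict_l2 (m -` A i) (K x)) sums restrict_l2 (\<Union>i. m -` A i) (K x)"
    by (rule restrict_l2_sums) (use A disj in \<open>auto simp: disjoint_family_on_def intro!: vimage_m\<close>)
  then have lim: "(\<lambda>n. (\<Sum>i<n. restrict_l2 (m -` A i) (K x)) - restrict_l2 (\<Union>i. m -` A i) (K x)) \<longlonglongrightarrow> 0"
    by (simp add: sums_def LIM_zero)
  have K_sum: "K (\<Sum>i<n. projection (A i) x) = (\<Sum>i<n. restrict_l2 (m -` A i) (K x))" for n
    using K_scaleR[of 0] by (induction n) (auto simp: K_add K_projection)
  have "K ((\<Sum>i<n. projection (A i) x) - projection (\<Union>i. A i) x)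
      = (\<Sum>i<n. restrict_l2 (m -` A i) (K x)) - restrict_l2 (\<Union>i. m -` A i) (K x)" for n
    by (simp add: K_diff K_sum K_projection vimage_UN)
  then have nrm: "norm ((\<Sum>i<n. projection (A i) x) - projection (\<Union>i. A i) x)
      = norm ((\<Sum>i<n. restrict_l2 (m -` A i) (K x)) - restrict_l2 (\<Union>i. m -` A i) (K x))" for n
    by (metis norm_K)
  have "(\<lambda>n. (\<Sum>i<n. projection (A i) x) - projection (\<Union>i. A i) x) \<longlonglongrightarrow> 0"
    by (rule tendsto_norm_zero_cancel, unfold nrm, rule tendsto_norm_zero[OF lim])
  then show "(\<lambda>i. projection (A i) x) sums projection (\<Union>i. A i) x"
    unfolding sums_def by (rule LIM_zero_cancel)
qed

text \<open>The set function of \<open>spectral_distribution\<close> is the image under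
  \<open>m\<close> of the measure with density \<open>norm (K x)\<close> squared. Knowing that it
  comes from a measure is what prevents \<open>measure_of\<close> from falling back to the zero
  measure.\<close>

lemma spectral_distribution_projection:
  "spectral_distribution projection x
    = distr (density lborel (\<lambda>\<xi>. ennreal (rep_l2 (K x) \<xi> \<bullet> rep_l2 (K x) \<xi>))) borel m"
proof -
  let ?X = "rep_l2 (K x)"
  let ?D = "distr (density lborel (\<lambda>\<xi>. ennreal (?X \<xi> \<bullet> ?X \<xi>))) borel m"
  have "spectral_distribution projection x = measure_of UNIV (sets borel) (emeasure ?D)"
    unfolding spectral_distribution_def
  proof (rule measure_of_eq)
    fix S :: "real set" assume "S \<in> sigma_sets UNIV (sets borel)"
    then have S: "S \<in> sets borel" using sets.sigma_sets_eq[of "borel :: real measure"] by (simp only: space_borel)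
    have "projection S x \<bullet> x = (\<integral>\<xi>. indicator (m -` S) \<xi> * (?X \<xi> \<bullet> ?X \<xi>) \<partial>lborel)"
      using restrict_l2_inner[OF vimage_m[OF S], of "K x" "K x"] by (simp add: K_inner flip: K_projection)
    also have "ennreal \<dots> = (\<integral>\<^sup>+\<xi>. ennreal (indicator (m -` S) \<xi> * (?X \<xi> \<bullet> ?X \<xi>)) \<partial>lborel)"
    proof (rule nn_integral_eq_integral[symmetric])
      show "integrable lborel (\<lambda>\<xi>. indicator (m -` S) \<xi> * (?X \<xi> \<bullet> ?X \<xi>))"
        using square_integrable_inner[OF square_integrable_indicator[OF square_integrable_rep_l2 vimage_m[OF S], of "K x"] square_integrable_rep_l2[of "K x"]]
        by simp
    qed auto
    also have "\<dots> = (\<integral>\<^sup>+\<xi>. ennreal (?X \<xi> \<bullet> ?X \<xi>) * indicator (m -` S) \<xi> \<partial>lborel)"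
      by (rule nn_integral_cong) (auto simp: indicator_def)
    also have "\<dots> = emeasure ?D S"
      using S vimage_m[OF S] by (subst emeasure_distr) (auto simp: emeasure_density)
    finally show "ennreal (projection S x \<bullet> x) = emeasure ?D S" .
  qed auto
  also have "\<dots> = ?D"
    using measure_of_of_measure[of ?D] by simp
  finally show ?thesis .
qed

lemma integral_spectral_distribution:
  fixes g :: "real \<Rightarrow> real"
  assumes [measurable]: "g \<in> borel_measurable borel"
  shows "(\<integral>r. g r \<partial>spectral_distribution projection x)
      = (\<integral>\<xi>. (rep_l2 (K x) \<xi> \<bullet> rep_l2 (K x) \<xi>) * g (m \<xi>) \<partial>lborel)"
    and "integrable (spectral_distribution projection x) g
      \<longleftrightarrow> integrable lborel (\<lambda>\<xi>. (rep_l2 (K x) \<xi> \<bullet> rep_l2 (K x) \<xi>) * g (m \<xi>))"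
  unfolding spectral_distribution_projection
proof -
  let ?D = "density lborel (\<lambda>\<xi>. ennreal (rep_l2 (K x) \<xi> \<bullet> rep_l2 (K x) \<xi>))"
  have m: "m \<in> measurable ?D borel" "(\<lambda>\<xi>. g (m \<xi>)) \<in> borel_measurable lborel"
    "(\<lambda>\<xi>. rep_l2 (K x) \<xi> \<bullet> rep_l2 (K x) \<xi>) \<in> borel_measurable lborel"
    using m_measurable measurable_compose[OF m_measurable assms]
    by (simp_all only: measurable_density_eq1 measurable_lborel1) measurable
  show "(\<integral>r. g r \<partial>distr ?D borel m) = (\<integral>\<xi>. (rep_l2 (K x) \<xi> \<bullet> rep_l2 (K x) \<xi>) * g (m \<xi>) \<partial>lborel)"
    unfolding integral_distr[OF m(1) assms]
    by (subst integral_density[OF m(2,3)]) (simp_all only: AE_I2 inner_ge_zero real_scaleR_def)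
  show "integrable (distr ?D borel m) g \<longleftrightarrow> integrable lborel (\<lambda>\<xi>. (rep_l2 (K x) \<xi> \<bullet> rep_l2 (K x) \<xi>) * g (m \<xi>))"
    unfolding integrable_distr_eq[OF m(1) assms]
    by (subst integrable_density[OF m(2,3)]) (simp_all only: AE_I2 inner_ge_zero real_scaleR_def)
qed

lemma spectral_integral_dom_iff:
  assumes [measurable]: "g \<in> borel_measurable borel"
  shows "x \<in> spectral_integral_dom projection g \<longleftrightarrow> square_integrable (\<lambda>\<xi>. g (m \<xi>) *\<^sub>R rep_l2 (K x) \<xi>)"
proof -
  have eq: "(norm (g (m \<xi>) *\<^sub>R rep_l2 (K x) \<xi>))\<^sup>2 = (rep_l2 (K x) \<xi> \<bullet> rep_l2 (K x) \<xi>) * (g (m \<xi>))\<^sup>2" for \<xi>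
    by (simp add: power_mult_distrib power2_norm_eq_inner)
  show ?thesis
    unfolding spectral_integral_dom_def square_integrable_def eq
    using integral_spectral_distribution(2)[of "\<lambda>r. (g r)\<^sup>2" x] by simp
qed

text \<open>The squares cancel and the mixed terms add up four times. All products are integrable
  because \<open>X\<close>, \<open>Z\<close> and their multiples by \<open>g\<close> of
  \<open>m\<close> are square integrable.\<close>

lemma spectral_integral_polarization:
  fixes g :: "real \<Rightarrow> real"
  assumes g [measurable]: "g \<in> borel_measurable borel"
    and x: "x \<in> spectral_integral_dom projection g" and z: "z \<in> spectral_integral_dom projection g"
  shows "((\<integral>r. g r \<partial>spectral_distribution projection (x + z)) - (\<integral>r. g r \<partial>spectral_distribution projection (x - z))) / 4
    = (\<integral>\<xi>. g (m \<xi>) * (rep_l2 (K x) \<xi> \<bullet> rep_l2 (K z) \<xi>) \<partial>lborel)"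
proof -
  let ?X = "rep_l2 (K x)" and ?Z = "rep_l2 (K z)" and ?g = "\<lambda>\<xi>. g (m \<xi>)"
  have gX: "square_integrable (\<lambda>\<xi>. ?g \<xi> *\<^sub>R ?X \<xi>)" and gZ: "square_integrable (\<lambda>\<xi>. ?g \<xi> *\<^sub>R ?Z \<xi>)"
    using x z by (simp_all add: spectral_integral_dom_iff)
  note X = square_integrable_rep_l2[of "K x"] and Z = square_integrable_rep_l2[of "K z"]
  have iXX: "integrable lborel (\<lambda>\<xi>. ?g \<xi> * (?X \<xi> \<bullet> ?X \<xi>))"
    and iXZ: "integrable lborel (\<lambda>\<xi>. ?g \<xi> * (?X \<xi> \<bullet> ?Z \<xi>))"
    and iZZ: "integrable lborel (\<lambda>\<xi>. ?g \<xi> * (?Z \<xi> \<bullet> ?Z \<xi>))"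
    using square_integrable_inner[OF gX X] square_integrable_inner[OF gX Z] square_integrable_inner[OF gZ Z]
    by simp_all
  have pt: "((a + b) \<bullet> (a + b)) * c = c * (a \<bullet> a) + 2 * (c * (a \<bullet> b)) + c * (b \<bullet> b)"
    "((a - b) \<bullet> (a - b)) * c = c * (a \<bullet> a) - 2 * (c * (a \<bullet> b)) + c * (b \<bullet> b)" for a b :: 'b and c :: real
    by (simp_all add: inner_add_left inner_add_right inner_diff_left inner_diff_right inner_commute[of b a] algebra_simps)
  have "(\<integral>r. g r \<partial>spectral_distribution projection (x + z))
    = (\<integral>\<xi>. ?g \<xi> * (?X \<xi> \<bullet> ?X \<xi>) + 2 * (?g \<xi> * (?X \<xi> \<bullet> ?Z \<xi>)) + ?g \<xi> * (?Z \<xi> \<bullet> ?Z \<xi>) \<partial>lborel)"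
    unfolding integral_spectral_distribution(1)[OF g]
    by (rule integral_cong_AE, measurable)
       (use rep_l2_add[of "K x" "K z"] in eventually_elim, simp only: K_add pt)
  moreover have "(\<integral>r. g r \<partial>spectral_distribution projection (x - z))
    = (\<integral>\<xi>. ?g \<xi> * (?X \<xi> \<bullet> ?X \<xi>) - 2 * (?g \<xi> * (?X \<xi> \<bullet> ?Z \<xi>)) + ?g \<xi> * (?Z \<xi> \<bullet> ?Z \<xi>) \<partial>lborel)"
    unfolding integral_spectral_distribution(1)[OF g]
    by (rule integral_cong_AE, measurable)
       (use rep_l2_diff[of "K x" "K z"] in eventually_elim, simp only: K_diff pt)
  ultimately show ?thesis using iXX iXZ iZZ by simp
qed

text \<open>The operator \<open>\<integral> g dE\<close> is multiplication by \<open>g\<close> of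
  \<open>m\<close>, domain included. In the direction from left to right the defining identity is
  known only weakly, against the domain; \<open>multiplication_weak_imp_AE\<close> upgrades it to a
  pointwise one.\<close>

theorem spectral_integral_iff:
  fixes g :: "real \<Rightarrow> real"
  assumes g [measurable]: "g \<in> borel_measurable borel"
  shows "(x, y) \<in> spectral_integral projection g
    \<longleftrightarrow> (AE \<xi> in lborel. rep_l2 (K y) \<xi> = g (m \<xi>) *\<^sub>R rep_l2 (K x) \<xi>)"
    (is "_ \<longleftrightarrow> ?A")
proof
  assume A: ?A
  have "square_integrable (\<lambda>\<xi>. g (m \<xi>) *\<^sub>R rep_l2 (K x) \<xi>)"
    by (rule abs_l2_eqI(1)[OF square_integrable_rep_l2 _ A]) measurable
  then have x: "x \<in> spectral_integral_dom projection g" by (simp add: spectral_integral_dom_iff)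
  have "y \<bullet> z = (\<integral>\<xi>. g (m \<xi>) * (rep_l2 (K x) \<xi> \<bullet> rep_l2 (K z) \<xi>) \<partial>lborel)" for z
  proof -
    have "y \<bullet> z = (\<integral>\<xi>. rep_l2 (K y) \<xi> \<bullet> rep_l2 (K z) \<xi> \<partial>lborel)"
      by (simp add: K_inner flip: inner_l2_eq)
    also have "\<dots> = (\<integral>\<xi>. g (m \<xi>) * (rep_l2 (K x) \<xi> \<bullet> rep_l2 (K z) \<xi>) \<partial>lborel)"
      by (rule integral_cong_AE, measurable) (use A in eventually_elim, simp)
    finally show ?thesis .
  qed
  then show "(x, y) \<in> spectral_integral projection g"
    unfolding spectral_integral_def
    by (intro CollectI case_prodI conjI ballI x) (rule trans[OF _ spectral_integral_polarization[OF g x, symmetric]])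
next
  assume "(x, y) \<in> spectral_integral projection g"
  then have x: "x \<in> spectral_integral_dom projection g"
    and y': "\<forall>z \<in> spectral_integral_dom projection g. y \<bullet> z
      = ((\<integral>r. g r \<partial>spectral_distribution projection (x + z)) - (\<integral>r. g r \<partial>spectral_distribution projection (x - z))) / 4"
    unfolding spectral_integral_def by blast+
  have y: "y \<bullet> z = (\<integral>\<xi>. g (m \<xi>) * (rep_l2 (K x) \<xi> \<bullet> rep_l2 (K z) \<xi>) \<partial>lborel)"
    if z: "z \<in> spectral_integral_dom projection g" for z
    by (rule trans[OF bspec[OF y' z] spectral_integral_polarization[OF g x z]])
  show ?A
  proof (rule multiplication_weak_imp_AE)
    fix Z :: "'a \<Rightarrow> 'b" assume Z: "square_integrable Z" "square_integrable (\<lambda>\<xi>. g (m \<xi>) *\<^sub>R Z \<xi>)"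
    have [measurable]: "Z \<in> borel_measurable borel" using square_integrable_measurable[OF Z(1)] by simp
    let ?z = "K' (abs_l2 Z)"
    have ae: "AE \<xi> in lborel. rep_l2 (K ?z) \<xi> = Z \<xi>" using rep_abs_l2[OF Z(1)] by simp
    have "square_integrable (\<lambda>\<xi>. g (m \<xi>) *\<^sub>R rep_l2 (K ?z) \<xi>)"
      by (rule abs_l2_eqI(1)[OF Z(2)], measurable) (use ae in eventually_elim, simp)
    then have "y \<bullet> ?z = (\<integral>\<xi>. g (m \<xi>) * (rep_l2 (K x) \<xi> \<bullet> rep_l2 (K ?z) \<xi>) \<partial>lborel)"
      by (intro y) (simp add: spectral_integral_dom_iff)
    also have "\<dots> = (\<integral>\<xi>. g (m \<xi>) * (rep_l2 (K x) \<xi> \<bullet> Z \<xi>) \<partial>lborel)"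
      by (rule integral_cong_AE, measurable) (use ae in eventually_elim, simp)
    finally have "y \<bullet> ?z = (\<integral>\<xi>. g (m \<xi>) * (rep_l2 (K x) \<xi> \<bullet> Z \<xi>) \<partial>lborel)" .
    moreover have "y \<bullet> ?z = (\<integral>\<xi>. rep_l2 (K y) \<xi> \<bullet> rep_l2 (K ?z) \<xi> \<partial>lborel)"
      by (simp only: K_inner flip: inner_l2_eq)
    moreover have "\<dots> = (\<integral>\<xi>. rep_l2 (K y) \<xi> \<bullet> Z \<xi> \<partial>lborel)"
      by (rule integral_cong_AE, measurable) (use ae in eventually_elim, simp)
    ultimately show "(\<integral>\<xi>. g (m \<xi>) * (rep_l2 (K x) \<xi> \<bullet> Z \<xi>) \<partial>lborel) = (\<integral>\<xi>. rep_l2 (K y) \<xi> \<bullet> Z \<xi> \<partial>lborel)"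
      by simp
  qed (auto intro: square_integrable_rep_l2)
qed

text \<open>A self-adjoint operator has no proper symmetric extension: symmetry of \<open>A\<close>,
  tested on pairs of the multiplication operator, is exactly the weak identity of
  \<open>multiplication_weak_imp_AE\<close>. Hence one inclusion suffices to determine
  \<open>A\<close>.\<close>

lemma symmetric_extension_eq:
  assumes sub: "\<And>x y. (AE \<xi> in lborel. rep_l2 (K y) \<xi> = m \<xi> *\<^sub>R rep_l2 (K x) \<xi>) \<Longrightarrow> (x, y) \<in> A"
    and sym: "\<And>x y u v. (x, y) \<in> A \<Longrightarrow> (u, v) \<in> A \<Longrightarrow> y \<bullet> u = x \<bullet> v"
  shows "spectral_resolution A projection"
proof -
  have "(x, y) \<in> A \<longleftrightarrow> (x, y) \<in> spectral_integral projection (\<lambda>r. r)" for x y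
  proof
    assume "(x, y) \<in> spectral_integral projection (\<lambda>r. r)"
    then show "(x, y) \<in> A" by (intro sub) (simp add: spectral_integral_iff)
  next
    assume xy: "(x, y) \<in> A"
    have "AE \<xi> in lborel. rep_l2 (K y) \<xi> = m \<xi> *\<^sub>R rep_l2 (K x) \<xi>"
    proof (rule multiplication_weak_imp_AE)
      fix Z :: "'a \<Rightarrow> 'b" assume Z: "square_integrable Z" and mZ: "square_integrable (\<lambda>\<xi>. m \<xi> *\<^sub>R Z \<xi>)"
      have [measurable]: "Z \<in> borel_measurable borel" using square_integrable_measurable[OF Z(1)] by simp
      let ?u = "K' (abs_l2 Z)" and ?v = "K' (abs_l2 (\<lambda>\<xi>. m \<xi> *\<^sub>R Z \<xi>))"
      have u: "AE \<xi> in lborel. rep_l2 (K ?u) \<xi> = Z \<xi>" and v: "AE \<xi> in lborel. rep_l2 (K ?v) \<xi> = m \<xi> *\<^sub>R Z \<xi>"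
        using rep_abs_l2[OF Z] rep_abs_l2[OF mZ] by simp_all
      have "(?u, ?v) \<in> A"
        by (rule sub) (use u v in eventually_elim, simp)
      from sym[OF xy this] have "K y \<bullet> K ?u = K x \<bullet> K ?v" by (simp only: K_inner)
      moreover have "K y \<bullet> K ?u = (\<integral>\<xi>. rep_l2 (K y) \<xi> \<bullet> Z \<xi> \<partial>lborel)"
        unfolding inner_l2_eq by (rule integral_cong_AE, measurable) (use u in eventually_elim, simp)
      moreover have "K x \<bullet> K ?v = (\<integral>\<xi>. m \<xi> * (rep_l2 (K x) \<xi> \<bullet> Z \<xi>) \<partial>lborel)"
        unfolding inner_l2_eq by (rule integral_cong_AE, measurable) (use v in eventually_elim, simp)
      ultimately show "(\<integral>\<xi>. m \<xi> * (rep_l2 (K x) \<xi> \<bullet> Z \<xi>) \<partial>lborel) = (\<integral>\<xi>. rep_l2 (K y) \<xi> \<bullet> Z \<xi> \<partial>lborel)"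
        by simp
    qed (auto intro: square_integrable_rep_l2)
    then show "(x, y) \<in> spectral_integral projection (\<lambda>r. r)" by (simp add: spectral_integral_iff)
  qed
  then have "A = spectral_integral projection (\<lambda>r. r)"
    by (intro set_eqI) (metis surj_pair)
  with projection_valued_measure_projection show ?thesis
    unfolding spectral_resolution_def by (rule conjI)
qed

end

subsection \<open>Smooth functions\<close>

text \<open>Smoothness is the largest class of differentiable functions that is closed under partial
  derivatives. Later smoothness proofs only exhibit an invariant class and never compute a higher
  derivative.\<close>

lemma smooth_coinduct [consumes 1, case_names differentiable partial_deriv]:
  fixes f :: "real ^ 'q \<Rightarrow> 'b::real_normed_vector"
  assumes "P f" and d: "\<And>f x. P f \<Longrightarrow> f differentiable (at x)"
    and p: "\<And>f i. P f \<Longrightarrow> P (partial_deriv i f)"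
  shows "smooth f"
proof -
  have "P (iter_partial_deriv is f)" for "is"
    by (induction "is") (use assms(1) p in auto)
  then show ?thesis using d by (auto simp: smooth_def)
qed

lemma smooth_imp_differentiable: "smooth f \<Longrightarrow> f differentiable (at x)"
  unfolding smooth_def by (drule spec[of _ "[]"]) simp

lemma smooth_partial_deriv: "smooth f \<Longrightarrow> smooth (partial_deriv i f)"
proof -
  have "iter_partial_deriv is (partial_deriv i f) = iter_partial_deriv (is @ [i]) f" for "is"
    by (induction "is") auto
  then show "smooth f \<Longrightarrow> smooth (partial_deriv i f)" by (simp add: smooth_def)
qed

lemma partial_deriv_eq:
  "(f has_derivative f') (at x) \<Longrightarrow> partial_deriv i f x = f' (axis i 1)"
  unfolding partial_deriv_def by (drule frechet_derivative_at) simp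

lemma sum_axis_scaleR [simp]: "(\<Sum>j\<in>UNIV. (axis i (1::real)) $ j *\<^sub>R a j) = a i"
  for a :: "'q::finite \<Rightarrow> 'b::real_vector"
  by (simp add: axis_def if_distrib[of "\<lambda>c. c *\<^sub>R _"] cong: if_cong)

lemma has_derivative_partial_deriv:
  fixes f :: "real ^ 'q \<Rightarrow> 'b::real_normed_vector"
  assumes "f differentiable (at x)"
  shows "(f has_derivative (\<lambda>v. \<Sum>i\<in>UNIV. v $ i *\<^sub>R partial_deriv i f x)) (at x)"
proof -
  have eq: "frechet_derivative f (at x) v = (\<Sum>i\<in>UNIV. v $ i *\<^sub>R partial_deriv i f x)" for v
  proof -
    have "frechet_derivative f (at x) v = frechet_derivative f (at x) (\<Sum>i\<in>UNIV. v $ i *\<^sub>R axis i 1)"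
      using basis_expansion[of v] by (simp add: scalar_mult_eq_scaleR)
    then show ?thesis
      using linear_frechet_derivative[OF assms]
      by (simp add: linear_sum linear_scale partial_deriv_def)
  qed
  have "frechet_derivative f (at x) = (\<lambda>v. \<Sum>i\<in>UNIV. v $ i *\<^sub>R partial_deriv i f x)"
    using eq by (rule ext)
  then show ?thesis using assms frechet_derivative_works[of f "at x"] by simp
qed

lemma smooth_has_derivative:
  fixes f :: "real ^ 'q \<Rightarrow> 'b::real_normed_vector"
  shows "smooth f \<Longrightarrow> (f has_derivative (\<lambda>v. \<Sum>i\<in>UNIV. v $ i *\<^sub>R partial_deriv i f x)) (at x)"
  by (intro has_derivative_partial_deriv smooth_imp_differentiable)

lemma smooth_continuous: "smooth f \<Longrightarrow> continuous_on S f"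
  by (intro continuous_at_imp_continuous_on ballI differentiable_imp_continuous_within smooth_imp_differentiable)

lemma partial_deriv_linear:
  fixes f :: "real ^ 'q \<Rightarrow> 'b::euclidean_space" and T :: "'b \<Rightarrow> 'c::real_normed_vector"
  assumes f: "f differentiable (at x)" and T: "linear T"
  shows "(\<lambda>x. T (f x)) differentiable (at x)"
    and "partial_deriv i (\<lambda>x. T (f x)) x = T (partial_deriv i f x)"
proof -
  have bl: "bounded_linear T" using T by (rule linear_conv_bounded_linear[THEN iffD1])
  have d: "((\<lambda>x. T (f x)) has_derivative (\<lambda>v. T (\<Sum>i\<in>UNIV. v $ i *\<^sub>R partial_deriv i f x))) (at x)"
    by (rule bounded_linear.has_derivative[OF bl has_derivative_partial_deriv[OF f]])
  show "(\<lambda>x. T (f x)) differentiable (at x)" using d by (rule differentiableI)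
  show "partial_deriv i (\<lambda>x. T (f x)) x = T (partial_deriv i f x)"
    by (simp add: partial_deriv_eq[OF d])
qed

lemma smooth_linear:
  fixes f :: "real ^ 'q \<Rightarrow> 'b::euclidean_space" and T :: "'b \<Rightarrow> 'c::real_normed_vector"
  assumes f: "smooth f" and T: "linear T"
  shows "smooth (\<lambda>x. T (f x))"
proof -
  have "\<exists>h. smooth h \<and> (\<lambda>x. T (f x)) = (\<lambda>x. T (h x))" using f by auto
  then show ?thesis
  proof (induction rule: smooth_coinduct)
    case (differentiable f x)
    then show ?case using T by (auto intro: partial_deriv_linear smooth_imp_differentiable)
  next
    case (partial_deriv f i)
    then obtain h where h: "smooth h" "f = (\<lambda>x. T (h x))" by auto
    then have "partial_deriv i f = (\<lambda>x. T (partial_deriv i h x))"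
      using T by (auto intro!: partial_deriv_linear smooth_imp_differentiable)
    then show ?case using h(1) smooth_partial_deriv by blast
  qed
qed

lemma partial_deriv_add:
  assumes f: "f differentiable (at x)" and g: "g differentiable (at x)"
  shows "partial_deriv i (\<lambda>x. f x + g x) x = partial_deriv i f x + partial_deriv i g x"
  using partial_deriv_eq[OF has_derivative_add[OF has_derivative_partial_deriv[OF f] has_derivative_partial_deriv[OF g]]]
  by simp

lemma smooth_add:
  fixes f g :: "real ^ 'q \<Rightarrow> 'b::real_normed_vector"
  assumes "smooth f" "smooth g"
  shows "smooth (\<lambda>x. f x + g x)"
proof -
  have "\<exists>h k. smooth h \<and> smooth k \<and> (\<lambda>x. f x + g x) = (\<lambda>x. h x + k x)" using assms by auto
  then show ?thesis
  proof (induction rule: smooth_coinduct)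
    case (differentiable f x)
    then show ?case by (auto intro: differentiable_add smooth_imp_differentiable)
  next
    case (partial_deriv f i)
    then obtain h k where h: "smooth h" "smooth k" "f = (\<lambda>x. h x + k x)" by auto
    then have "partial_deriv i f = (\<lambda>x. partial_deriv i h x + partial_deriv i k x)"
      by (auto intro!: partial_deriv_add smooth_imp_differentiable)
    then show ?case using h(1,2) smooth_partial_deriv by blast
  qed
qed

lemma partial_deriv_const: "partial_deriv i (\<lambda>x. c) x = 0"
  using partial_deriv_eq[OF has_derivative_const[of c "at x"]] by simp

lemma smooth_const: "smooth (\<lambda>x. c)"
proof (rule smooth_coinduct[where P = "\<lambda>f. \<exists>c. f = (\<lambda>x. c)"])
  show "\<exists>c. partial_deriv i f = (\<lambda>x. c)" if "\<exists>c. f = (\<lambda>x. c)" for f :: "real ^ 'a \<Rightarrow> 'b" and i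
    using that by (intro exI[of _ 0]) (auto simp: partial_deriv_const)
qed auto

lemma smooth_sum:
  fixes f :: "'i \<Rightarrow> real ^ 'q \<Rightarrow> 'b::real_normed_vector"
  assumes "\<And>i. i \<in> I \<Longrightarrow> smooth (f i)"
  shows "smooth (\<lambda>x. \<Sum>i\<in>I. f i x)"
  using assms by (induction I rule: infinite_finite_induct) (auto intro: smooth_const smooth_add)

lemma partial_deriv_sum:
  fixes f :: "'i \<Rightarrow> real ^ 'q \<Rightarrow> 'b::real_normed_vector"
  assumes "\<And>i. i \<in> I \<Longrightarrow> smooth (f i)"
  shows "partial_deriv j (\<lambda>x. \<Sum>i\<in>I. f i x) x = (\<Sum>i\<in>I. partial_deriv j (f i) x)"
  using assms
  by (induction I rule: infinite_finite_induct)
     (auto simp: partial_deriv_const partial_deriv_add smooth_imp_differentiable smooth_sum)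

lemma smooth_scaleR_const:
  fixes f :: "real ^ 'q \<Rightarrow> 'b::euclidean_space"
  shows "smooth f \<Longrightarrow> smooth (\<lambda>x. c *\<^sub>R f x)"
  by (rule smooth_linear) (auto intro: linear_scale_self linear_compose_scale_right linear_id)

subsection \<open>Compactly supported smooth functions\<close>

lemma compactly_supported_iff:
  fixes f :: "'a::heine_borel \<Rightarrow> 'b::zero"
  shows "compactly_supported f \<longleftrightarrow> bounded {x. f x \<noteq> 0}"
  unfolding compactly_supported_def compact_eq_bounded_closed
  using bounded_closure[of "{x. f x \<noteq> 0}"] bounded_subset[OF _ closure_subset, of "{x. f x \<noteq> 0}"] closed_closure
  by blast

lemma compactly_supportedE:
  fixes f :: "'a::{heine_borel, real_normed_vector} \<Rightarrow> 'b::zero"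
  assumes "compactly_supported f"
  obtains R where "\<And>x. norm x > R \<Longrightarrow> f x = 0"
proof -
  obtain R where "\<forall>x\<in>{x. f x \<noteq> 0}. norm x \<le> R"
    using assms unfolding compactly_supported_iff bounded_iff by blast
  then show ?thesis by (intro that[of R]) force
qed

lemma compactly_supportedI:
  fixes f :: "'a::{heine_borel, real_normed_vector} \<Rightarrow> 'b::zero"
  assumes "\<And>x. norm x > R \<Longrightarrow> f x = 0"
  shows "compactly_supported f"
  unfolding compactly_supported_iff bounded_iff by (rule exI[of _ R]) (use assms linorder_not_less in blast)

lemma compactly_supported_partial_deriv:
  fixes f :: "real ^ 'q \<Rightarrow> 'b::real_normed_vector"
  assumes "compactly_supported f" shows "compactly_supported (partial_deriv i f)"
proof -
  obtain R where R: "\<And>x. norm x > R \<Longrightarrow> f x = 0" using compactly_supportedE[OF assms] by blast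
  show ?thesis
  proof (rule compactly_supportedI[of R])
    fix x :: "real ^ 'q" assume x: "norm x > R"
    have "open {x :: real ^ 'q. norm x > R}" by (intro open_Collect_less continuous_intros)
    then have "(f has_derivative (\<lambda>v. 0)) (at x)"
      by (rule has_derivative_transform_within_open[where f = "\<lambda>x. 0", rotated]) (use x R in auto)
    then show "partial_deriv i f x = 0" by (simp add: partial_deriv_eq)
  qed
qed

lemma compactly_supported_sum:
  fixes f :: "'i \<Rightarrow> 'a::{heine_borel, real_normed_vector} \<Rightarrow> 'b::comm_monoid_add"
  assumes "finite I" "\<And>i. i \<in> I \<Longrightarrow> compactly_supported (f i)"
  shows "compactly_supported (\<lambda>x. \<Sum>i\<in>I. f i x)"
proof -
  have "{x. (\<Sum>i\<in>I. f i x) \<noteq> 0} \<subseteq> (\<Union>i\<in>I. {x. f i x \<noteq> 0})"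
    by (auto intro: sum.neutral)
  moreover have "bounded (\<Union>i\<in>I. {x. f i x \<noteq> 0})"
    using assms by (intro bounded_UN) (auto simp: compactly_supported_iff)
  ultimately show ?thesis by (simp add: compactly_supported_iff bounded_subset)
qed

lemma compactly_supported_linear:
  fixes f :: "'a::heine_borel \<Rightarrow> 'b::real_vector"
  assumes "compactly_supported f" "linear T"
  shows "compactly_supported (\<lambda>x. T (f x))"
proof -
  have "{x. T (f x) \<noteq> 0} \<subseteq> {x. f x \<noteq> 0}" using linear_0[OF assms(2)] by auto
  then show ?thesis using assms(1) by (auto simp: compactly_supported_iff intro: bounded_subset)
qed

lemma bounded_integrable_if_compact_support:
  fixes f :: "'a::euclidean_space \<Rightarrow> 'b::euclidean_space"
  assumes f: "continuous_on UNIV f" and c: "compactly_supported f"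
  shows "bounded_integrable f"
proof -
  obtain R where R: "\<And>x. norm x > R \<Longrightarrow> f x = 0" using compactly_supportedE[OF c] by blast
  have [measurable]: "f \<in> borel_measurable borel" using f by (rule borel_measurable_continuous_onI)
  have "compact (f ` cball 0 R)"
    using f by (intro compact_continuous_image compact_cball) (auto intro: continuous_on_subset)
  then obtain M where M: "M > 0" "\<And>x. norm x \<le> R \<Longrightarrow> norm (f x) \<le> M"
    using compact_imp_bounded[of "f ` cball 0 R"] by (auto simp: bounded_pos)
  have M': "norm (f x) \<le> M" for x using M R[of x] by (cases "norm x \<le> R") auto
  have "integrable lborel f"
  proof (rule Bochner_Integration.integrable_bound)
    show "integrable lborel (\<lambda>x. indicator (cball 0 R) x * M)"
      using emeasure_lborel_cball_finite[of 0 R] by auto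
    show "AE x in lborel. norm (f x) \<le> norm (indicator (cball 0 R) x * M)"
      using M M' R by (auto simp: indicator_def)
  qed measurable
  then show ?thesis using M' by (auto simp: bounded_integrable_def)
qed

lemma bounded_integrable_smooth:
  fixes f :: "real ^ 'q \<Rightarrow> 'b::euclidean_space"
  shows "smooth f \<Longrightarrow> compactly_supported f \<Longrightarrow> bounded_integrable f"
  by (intro bounded_integrable_if_compact_support smooth_continuous)

text \<open>The set where two continuous functions differ is open, and a nonempty open set is not
  negligible.\<close>

lemma continuous_AE_eq:
  fixes f g :: "'a::euclidean_space \<Rightarrow> 'b::t2_space"
  assumes "continuous_on UNIV f" "continuous_on UNIV g" and ae: "AE x in lborel. f x = g x"
  shows "f = g"
proof (rule ccontr)
  assume "f \<noteq> g"
  then have "{x. f x \<noteq> g x} \<noteq> {}" by auto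
  moreover have "open {x. f x \<noteq> g x}" using assms by (intro open_Collect_neq)
  ultimately have "\<not> negligible {x. f x \<noteq> g x}" by (rule open_not_negligible[rotated])
  moreover have "negligible {x. f x \<noteq> g x}"
    using AE_completion[OF ae] by (simp add: negligible_iff_null_sets completion.AE_iff_null_sets AE_iff_null_sets)
  ultimately show False by simp
qed

subsection \<open>Integration by parts\<close>

lemma has_vector_derivative_along:
  fixes f :: "'a::real_normed_vector \<Rightarrow> 'b::real_normed_vector"
  assumes "(f has_derivative f') (at x)"
  shows "((\<lambda>t. f (x + t *\<^sub>R e)) has_vector_derivative f' e) (at 0)"
proof -
  have "((\<lambda>t::real. x + t *\<^sub>R e) has_derivative (\<lambda>t. t *\<^sub>R e)) (at 0)"
    by (auto intro!: derivative_eq_intros)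
  moreover have "(f has_derivative f') (at (x + 0 *\<^sub>R e))" using assms by simp
  ultimately have "((\<lambda>t. f (x + t *\<^sub>R e)) has_derivative (\<lambda>t. f' (t *\<^sub>R e))) (at 0)"
    by (rule has_derivative_compose)
  then show ?thesis
    using has_derivative_linear[OF assms] by (simp add: has_vector_derivative_def linear_scale)
qed

text \<open>The difference quotients of \<open>g\<close> in the direction \<open>e\<close> have integral \<open>0\<close> by translation invariance.\<close>

lemma integral_directional_derivative_eq_0:
  fixes g g' :: "'a::euclidean_space \<Rightarrow> 'b::euclidean_space"
  assumes int: "integrable lborel g" and supp: "\<And>x. norm x > R \<Longrightarrow> g x = 0"
    and lip: "\<And>x y. norm x \<le> R + 2 * norm e \<Longrightarrow> norm y \<le> R + 2 * norm e \<Longrightarrow> norm (g x - g y) \<le> C * norm (x - y)"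
    and g' [measurable]: "g' \<in> borel_measurable borel"
    and der: "AE x in lborel. ((\<lambda>t. g (x + t *\<^sub>R e)) has_vector_derivative g' x) (at 0)"
  shows "(\<integral>x. g' x \<partial>lborel) = 0"
proof -
  have [measurable]: "g \<in> borel_measurable borel" using int by auto
  define h where "h n = inverse (real (Suc n))" for n
  have h: "h n > 0" "h n \<le> 1" for n by (auto simp: h_def inverse_eq_divide)
  have hlim: "h \<longlonglongrightarrow> 0" unfolding h_def using LIMSEQ_inverse_real_of_nat by simp
  define D where "D n x = (g (x + h n *\<^sub>R e) - g x) /\<^sub>R h n" for n x
  have sh: "integrable lborel (\<lambda>x. g (x + c))" "(\<integral>x. g (x + c) \<partial>lborel) = (\<integral>x. g x \<partial>lborel)" for c
    using int lborel_integrable_shift[of g c] lborel_integral_shift[of g c] by (auto simp: add.commute)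
  have D0: "(\<integral>x. D n x \<partial>lborel) = 0" for n
    unfolding D_def using int sh by simp
  have "(\<lambda>n. \<integral>x. D n x \<partial>lborel) \<longlonglongrightarrow> (\<integral>x. g' x \<partial>lborel)"
  proof (rule integral_dominated_convergence)
    \<comment> \<open>The quotient at \<open>x\<close> involves \<open>x\<close> and
      \<open>x + h n *\<^sub>R e\<close> with \<open>h n \<le> 1\<close>. It vanishes once
      \<open>norm x\<close> exceeds \<open>R + norm e\<close>; otherwise both points lie in the ball
      of radius \<open>R + 2 * norm e\<close>, where \<open>lip\<close> applies.\<close>
    show "integrable lborel (\<lambda>x::'a. indicator (cball 0 (R + norm e)) x * (\<bar>C\<bar> * norm e))"
      using emeasure_lborel_cball_finite[of 0 "R + norm e"] by auto
    show "AE x in lborel. norm (D n x) \<le> indicator (cball 0 (R + norm e)) x * (\<bar>C\<bar> * norm e)" for n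
    proof (rule AE_I2)
      fix x :: 'a
      have he: "norm (h n *\<^sub>R e) \<le> norm e" using h[of n] by (simp add: mult_left_le_one_le)
      show "norm (D n x) \<le> indicator (cball 0 (R + norm e)) x * (\<bar>C\<bar> * norm e)"
      proof (cases "norm x \<le> R + norm e")
        case True
        then have "norm (x + h n *\<^sub>R e) \<le> R + 2 * norm e"
          using norm_triangle_ineq[of x "h n *\<^sub>R e"] he by linarith
        then have "norm (g (x + h n *\<^sub>R e) - g x) \<le> C * norm (h n *\<^sub>R e)"
          using lip[of "x + h n *\<^sub>R e" x] True norm_ge_zero[of e] by simp
        also have "\<dots> \<le> \<bar>C\<bar> * (h n * norm e)"
          using h[of n] by (simp add: mult_right_mono)
        finally have "norm (D n x) \<le> \<bar>C\<bar> * norm e"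
          using h[of n] by (simp add: D_def divide_simps mult_ac)
        then show ?thesis using True by simp
      next
        case False
        then have "norm (x + h n *\<^sub>R e) > R"
          using norm_triangle_ineq4[of "x + h n *\<^sub>R e" "h n *\<^sub>R e"] he by simp
        moreover have "norm x > R" using False norm_ge_zero[of e] by linarith
        ultimately show ?thesis using False by (simp add: D_def supp)
      qed
    qed
    show "AE x in lborel. (\<lambda>n. D n x) \<longlonglongrightarrow> g' x"
      using der
    proof eventually_elim
      case (elim x)
      then have "((\<lambda>t. norm (g (x + t *\<^sub>R e) - g x - t *\<^sub>R g' x) / norm t) \<longlongrightarrow> 0) (at 0)"
        by (simp add: has_vector_derivative_def has_derivative_at)
      moreover have "filterlim h (at 0) sequentially"
        using hlim h(1) by (auto simp: filterlim_at less_imp_neq[symmetric] intro!: always_eventually)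
      ultimately have "(\<lambda>n. norm (g (x + h n *\<^sub>R e) - g x - h n *\<^sub>R g' x) / norm (h n)) \<longlonglongrightarrow> 0"
        by (rule filterlim_compose)
      moreover have "norm (g (x + h n *\<^sub>R e) - g x - h n *\<^sub>R g' x) / norm (h n) = norm (D n x - g' x)" for n
      proof -
        have "D n x - g' x = (g (x + h n *\<^sub>R e) - g x - h n *\<^sub>R g' x) /\<^sub>R h n"
          using h(1)[of n] by (simp add: D_def scaleR_diff_right)
        then show ?thesis using h(1)[of n] by (simp add: divide_inverse mult.commute)
      qed
      ultimately have "(\<lambda>n. norm (D n x - g' x)) \<longlonglongrightarrow> 0" by simp
      then show ?case by (simp add: tendsto_norm_zero_iff LIM_zero_iff)
    qed
    show "D n \<in> borel_measurable lborel" for n unfolding D_def by measurable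
  qed measurable
  then show ?thesis by (simp add: D0 LIMSEQ_const_iff)
qed

lemma lipschitz_cball_if_C1:
  fixes g :: "real ^ 'q \<Rightarrow> 'b::euclidean_space"
  assumes der: "\<And>x. (g has_derivative (\<lambda>v. \<Sum>i\<in>UNIV. v $ i *\<^sub>R g' i x)) (at x)"
    and cont: "\<And>i. continuous_on UNIV (g' i)"
  obtains C where "C \<ge> 0" "\<And>x y. norm x \<le> r \<Longrightarrow> norm y \<le> r \<Longrightarrow> norm (g x - g y) \<le> C * norm (x - y)"
proof -
  have "bounded (g' i ` cball 0 r)" for i
    by (intro compact_imp_bounded compact_continuous_image compact_cball continuous_on_subset[OF cont]) auto
  then have "\<forall>i. \<exists>B. \<forall>x\<in>cball 0 r. norm (g' i x) \<le> B"
    by (simp add: bounded_iff)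
  then obtain B where "\<forall>i. \<forall>x\<in>cball 0 r. norm (g' i x) \<le> B i" by metis
  then have B: "norm (g' i x) \<le> B i" if "norm x \<le> r" for i x using that by simp
  define C where "C = (\<Sum>i\<in>UNIV. \<bar>B i\<bar>)"
  show ?thesis
  proof (rule that[of C])
    show "C \<ge> 0" unfolding C_def by (intro sum_nonneg) auto
    fix x y :: "real ^ 'q" assume xy: "norm x \<le> r" "norm y \<le> r"
    show "norm (g x - g y) \<le> C * norm (x - y)"
    proof (rule differentiable_bound[where S = "cball 0 r"])
      show "onorm (\<lambda>v. \<Sum>i\<in>UNIV. v $ i *\<^sub>R g' i x) \<le> C" if "x \<in> cball 0 r" for x
      proof (rule onorm_le)
        fix v :: "real ^ 'q"
        have "norm (\<Sum>i\<in>UNIV. v $ i *\<^sub>R g' i x) \<le> (\<Sum>i\<in>UNIV. \<bar>B i\<bar> * norm v)"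
        proof (rule sum_norm_le)
          fix i
          have "norm (v $ i *\<^sub>R g' i x) = norm (g' i x) * \<bar>v $ i\<bar>" by simp
          also have "\<dots> \<le> \<bar>B i\<bar> * norm v"
            using B[of x i] that component_le_norm_cart[of v i] by (intro mult_mono) auto
          finally show "norm (v $ i *\<^sub>R g' i x) \<le> \<bar>B i\<bar> * norm v" .
        qed
        then show "norm (\<Sum>i\<in>UNIV. v $ i *\<^sub>R g' i x) \<le> C * norm v"
          by (simp add: C_def sum_distrib_right)
      qed
    qed (use xy der in \<open>auto intro: has_derivative_at_withinI\<close>)
  qed
qed

lemma integral_partial_eq_0:
  fixes g :: "real ^ 'q \<Rightarrow> 'b::euclidean_space"
  assumes der: "\<And>x. (g has_derivative (\<lambda>v. \<Sum>i\<in>UNIV. v $ i *\<^sub>R g' i x)) (at x)"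
    and cont: "\<And>i. continuous_on UNIV (g' i)"
    and c: "compactly_supported g"
  shows "(\<integral>x. g' i x \<partial>lborel) = 0"
proof -
  obtain R where R: "\<And>x. norm x > R \<Longrightarrow> g x = 0" using compactly_supportedE[OF c] by blast
  obtain C where C: "\<And>x y. norm x \<le> R + 2 * norm (axis i 1 :: real ^ 'q) \<Longrightarrow> norm y \<le> R + 2 * norm (axis i 1 :: real ^ 'q) \<Longrightarrow> norm (g x - g y) \<le> C * norm (x - y)"
    using lipschitz_cball_if_C1[OF der cont] by blast
  have "continuous_on UNIV g"
    by (intro continuous_at_imp_continuous_on ballI has_derivative_continuous[OF der])
  then have "integrable lborel g"
    using bounded_integrable_if_compact_support[OF _ c] by (simp add: bounded_integrable_def)
  from this R C show ?thesis
  proof (rule integral_directional_derivative_eq_0)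
    show "AE x in lborel. ((\<lambda>t. g (x + t *\<^sub>R axis i 1)) has_vector_derivative g' i x) (at 0)"
      using has_vector_derivative_along[OF der, of _ "axis i 1"] by simp
  qed (use cont in \<open>auto intro: borel_measurable_continuous_onI\<close>)
qed

subsection \<open>The Hartley transform of derivatives\<close>

text \<open>Integration by parts moves the derivative to the kernel, where \<open>cas\<close> turns
  into \<open>cas\<close> of the negative argument. A single derivative is thus multiplication
  combined with a reflection.\<close>

lemma hartley_partial_deriv:
  fixes f :: "real ^ 'q \<Rightarrow> 'b::euclidean_space"
  assumes f: "smooth f" "compactly_supported f"
  shows "hartley (partial_deriv i f) \<xi> = - (\<xi> $ i) *\<^sub>R hartley f (- \<xi>)"
proof -
  let ?g' = "\<lambda>i x. cas (x \<bullet> \<xi>) *\<^sub>R partial_deriv i f x + (cas (- (x \<bullet> \<xi>)) * \<xi> $ i) *\<^sub>R f x"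
  have contcas: "continuous_on UNIV (\<lambda>x::real ^ 'q. cas (x \<bullet> \<xi>))"
    "continuous_on UNIV (\<lambda>x::real ^ 'q. cas (- (x \<bullet> \<xi>)))"
    unfolding cas_def by (intro continuous_intros)+
  have "(\<integral>x. ?g' i x \<partial>lborel) = 0"
  proof (rule integral_partial_eq_0)
    fix x :: "real ^ 'q"
    have "((\<lambda>x. x \<bullet> \<xi>) has_derivative (\<lambda>v. v \<bullet> \<xi>)) (at x)"
      by (auto intro!: derivative_eq_intros)
    from has_derivative_compose[OF this cas_has_real_derivative[unfolded has_field_derivative_def]]
    have "((\<lambda>x. cas (x \<bullet> \<xi>)) has_derivative (\<lambda>v. cas (- (x \<bullet> \<xi>)) * (v \<bullet> \<xi>))) (at x)" .
    from has_derivative_scaleR[OF this smooth_has_derivative[OF f(1), of x]]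
    have "((\<lambda>x. cas (x \<bullet> \<xi>) *\<^sub>R f x) has_derivative
      (\<lambda>v. cas (x \<bullet> \<xi>) *\<^sub>R (\<Sum>i\<in>UNIV. v $ i *\<^sub>R partial_deriv i f x) + (cas (- (x \<bullet> \<xi>)) * (v \<bullet> \<xi>)) *\<^sub>R f x)) (at x)" .
    also have "(\<lambda>v. cas (x \<bullet> \<xi>) *\<^sub>R (\<Sum>i\<in>UNIV. v $ i *\<^sub>R partial_deriv i f x) + (cas (- (x \<bullet> \<xi>)) * (v \<bullet> \<xi>)) *\<^sub>R f x)
      = (\<lambda>v. \<Sum>i\<in>UNIV. v $ i *\<^sub>R ?g' i x)"
    proof -
      have "(c * (v \<bullet> \<xi>)) *\<^sub>R y = (\<Sum>i\<in>UNIV. v $ i *\<^sub>R ((c * \<xi> $ i) *\<^sub>R y))" for c v and y :: 'b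
        by (simp add: inner_vec_def sum_distrib_left scaleR_sum_left mult_ac)
      moreover have "c *\<^sub>R (\<Sum>i\<in>UNIV. v $ i *\<^sub>R p i) = (\<Sum>i\<in>UNIV. v $ i *\<^sub>R (c *\<^sub>R p i))"
        for c and v :: "real ^ 'q" and p :: "'q \<Rightarrow> 'b"
        by (simp add: scaleR_sum_right mult.commute)
      ultimately show ?thesis
        by (intro ext) (simp only: scaleR_add_right sum.distrib)
    qed
    finally show "((\<lambda>x. cas (x \<bullet> \<xi>) *\<^sub>R f x) has_derivative (\<lambda>v. \<Sum>i\<in>UNIV. v $ i *\<^sub>R ?g' i x)) (at x)" .
  next
    show "continuous_on UNIV (?g' i)" for i
      by (intro continuous_on_add continuous_on_scaleR continuous_on_mult continuous_on_const
          smooth_continuous[OF smooth_partial_deriv] smooth_continuous[OF f(1)] contcas f(1))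
    have "{x. cas (x \<bullet> \<xi>) *\<^sub>R f x \<noteq> 0} \<subseteq> {x. f x \<noteq> 0}" by auto
    then show "compactly_supported (\<lambda>x. cas (x \<bullet> \<xi>) *\<^sub>R f x)"
      using f(2) by (auto simp: compactly_supported_iff intro: bounded_subset)
  qed
  moreover have i1: "integrable lborel (\<lambda>x. cas (x \<bullet> \<xi>) *\<^sub>R partial_deriv i f x)"
    by (intro integrable_cas bounded_integrable_imp_integrable bounded_integrable_smooth
        smooth_partial_deriv compactly_supported_partial_deriv f)
  moreover have i2: "integrable lborel (\<lambda>x. \<xi> $ i *\<^sub>R (cas (x \<bullet> (- \<xi>)) *\<^sub>R f x))"
    by (intro integrable_scaleR_right integrable_cas bounded_integrable_imp_integrable bounded_integrable_smooth f)
  ultimately have "(\<integral>x. cas (x \<bullet> \<xi>) *\<^sub>R partial_deriv i f x \<partial>lborel) + \<xi> $ i *\<^sub>R (\<integral>x. cas (x \<bullet> (- \<xi>)) *\<^sub>R f x \<partial>lborel) = 0"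
    by (subst integral_scaleR_right[symmetric], subst Bochner_Integration.integral_add[symmetric]) (simp_all add: mult.commute)
  then have "(\<integral>x. cas (x \<bullet> \<xi>) *\<^sub>R partial_deriv i f x \<partial>lborel) = - (\<xi> $ i *\<^sub>R (\<integral>x. cas (x \<bullet> (- \<xi>)) *\<^sub>R f x \<partial>lborel))"
    by (simp only: eq_neg_iff_add_eq_0)
  then show ?thesis
    unfolding hartley_def by simp
qed

text \<open>Schwarz's theorem through the transform. Two reflections cancel, so both mixed
  derivatives have the transform \<open>- (\<xi> $ i * \<xi> $ j) *\<^sub>R hartley f \<xi>\<close>;
  injectivity and continuity give equality everywhere.\<close>

lemma partial_deriv_commute:
  fixes f :: "real ^ 'q \<Rightarrow> 'b::euclidean_space"
  assumes f: "smooth f" "compactly_supported f"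
  shows "partial_deriv i (partial_deriv j f) = partial_deriv j (partial_deriv i f)"
proof (rule continuous_AE_eq)
  note fd = f smooth_partial_deriv compactly_supported_partial_deriv
  show "continuous_on UNIV (partial_deriv i (partial_deriv j f))" "continuous_on UNIV (partial_deriv j (partial_deriv i f))"
    by (intro smooth_continuous fd)+
  have bi: "integrable lborel (partial_deriv i (partial_deriv j f))" for i j
    by (intro bounded_integrable_imp_integrable bounded_integrable_smooth fd)
  have "AE x in lborel. partial_deriv i (partial_deriv j f) x - partial_deriv j (partial_deriv i f) x = 0"
  proof (rule hartley_injective)
    show "integrable lborel (\<lambda>x. partial_deriv i (partial_deriv j f) x - partial_deriv j (partial_deriv i f) x)"
      using bi by auto
    fix \<xi>
    have h: "hartley (partial_deriv i (partial_deriv j f)) \<xi> = - (\<xi> $ i * \<xi> $ j) *\<^sub>R hartley f \<xi>" for i j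
      by (simp add: hartley_partial_deriv fd)
    have "hartley (\<lambda>x. partial_deriv i (partial_deriv j f) x - partial_deriv j (partial_deriv i f) x) \<xi>
      = hartley (partial_deriv i (partial_deriv j f)) \<xi> - hartley (partial_deriv j (partial_deriv i f)) \<xi>"
      unfolding hartley_def by (simp add: scaleR_diff_right integrable_cas bi)
    then show "hartley (\<lambda>x. partial_deriv i (partial_deriv j f) x - partial_deriv j (partial_deriv i f) x) \<xi> = 0"
      by (simp add: h mult.commute)
  qed
  then show "AE x in lborel. partial_deriv i (partial_deriv j f) x = partial_deriv j (partial_deriv i f) x"
    by eventually_elim simp
qed

subsection \<open>A bump function\<close>

text \<open>The functions \<open>s ^ - k * exp (- 1 / s)\<close> for positive \<open>s\<close>,
  extended by 0. The exponent \<open>k\<close> is there because the derivatives of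
  \<open>exp (- 1 / s)\<close> stay within the span of this family.\<close>

definition flat_power :: "nat \<Rightarrow> real \<Rightarrow> real"
  where "flat_power k s = (if s > 0 then inverse s ^ k * exp (- inverse s) else 0)"

text \<open>Raise \<open>x \<le> exp x\<close> with \<open>x = 1 / (n * s)\<close> to the power
  \<open>n = k + 2\<close>. Two powers more than \<open>k\<close> leave a factor
  \<open>s\<^sup>2\<close>, which is enough for a vanishing derivative at 0.\<close>

lemma flat_power_le:
  assumes "s > 0" shows "flat_power k s \<le> real (k + 2) ^ (k + 2) * s\<^sup>2"
proof -
  let ?n = "k + 2"
  have "inverse s / real ?n \<le> exp (inverse s / real ?n)"
    using exp_ge_add_one_self[of "inverse s / real ?n"] by linarith
  then have "(inverse s / real ?n) ^ ?n \<le> exp (inverse s / real ?n) ^ ?n"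
    using assms by (intro power_mono) auto
  also have "\<dots> = exp (real ?n * (inverse s / real ?n))" by (rule exp_of_nat_mult[symmetric])
  also have "real ?n * (inverse s / real ?n) = inverse s" by simp
  finally have "(inverse s / real ?n) ^ ?n \<le> exp (inverse s)" .
  moreover have "y ^ n * exp (- y) \<le> N ^ n" if "(y / N) ^ n \<le> exp y" "N > 0" for y N :: real and n
    using that by (simp add: exp_minus power_divide field_simps)
  ultimately have "inverse s ^ ?n * exp (- inverse s) \<le> real ?n ^ ?n"
    by fastforce
  then have "flat_power k s * (inverse s)\<^sup>2 \<le> real ?n ^ ?n"
    using assms by (simp add: flat_power_def power2_eq_square mult_ac)
  then show ?thesis using assms by (simp add: divide_simps power2_eq_square mult_ac)
qed

lemma flat_power_nonneg: "flat_power k s \<ge> 0"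
  by (simp add: flat_power_def)

lemma flat_power_has_real_derivative:
  "(flat_power k has_real_derivative (- real k * flat_power (k + 1) s + flat_power (k + 2) s)) (at s)"
proof (cases s "0::real" rule: linorder_cases)
  case less
  have "((\<lambda>x. 0) has_real_derivative 0) (at s)" by simp
  then have "(flat_power k has_real_derivative 0) (at s)"
    by (rule has_field_derivative_transform_within_open[of _ _ _ "{..<0}"]) (use less in \<open>auto simp: flat_power_def\<close>)
  then show ?thesis using less by (simp add: flat_power_def)
next
  case equal
  define C where "C = real (k + 2) ^ (k + 2)"
  \<comment> \<open>At the gluing point the difference quotient is at most
    \<open>C * \<bar>h\<bar>\<close> by the quadratic bound.\<close>
  have "((\<lambda>h. flat_power k h / h) \<longlongrightarrow> 0) (at 0)"
  proof (rule Lim_null_comparison)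
    show "\<forall>\<^sub>F h in at 0. norm (flat_power k h / h) \<le> C * \<bar>h\<bar>"
    proof (rule always_eventually, rule allI)
      fix h :: real
      show "norm (flat_power k h / h) \<le> C * \<bar>h\<bar>"
      proof (cases "h > 0")
        case True
        then show ?thesis using flat_power_le[of h k] flat_power_nonneg[of k h]
          by (simp add: C_def divide_simps power2_eq_square mult_ac)
      next
        case False
        have "C \<ge> 0" by (simp add: C_def)
        then show ?thesis using False by (simp add: flat_power_def mult_nonneg_nonpos)
      qed
    qed
    show "((\<lambda>h. C * \<bar>h\<bar>) \<longlongrightarrow> 0) (at 0)"
      by (rule tendsto_eq_intros | simp)+
  qed
  then show ?thesis using equal by (simp add: DERIV_def flat_power_def)
next
  case greater
  have "((\<lambda>x. inverse x ^ k * exp (- inverse x)) has_real_derivative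
      (- real k * (inverse s ^ (k + 1) * exp (- inverse s)) + inverse s ^ (k + 2) * exp (- inverse s))) (at s)"
  proof -
    have s: "s \<noteq> 0" using greater by simp
    have "((\<lambda>x. inverse x ^ k) has_real_derivative real k * (- (inverse s ^ Suc (Suc 0)) * inverse s ^ (k - Suc 0))) (at s)"
      by (rule DERIV_power[OF DERIV_inverse[OF s]])
    also have "real k * (- (inverse s ^ Suc (Suc 0)) * inverse s ^ (k - Suc 0)) = - real k * inverse s ^ (k + 1)"
      by (cases k) (auto simp: algebra_simps)
    finally have p: "((\<lambda>x. inverse x ^ k) has_real_derivative - real k * inverse s ^ (k + 1)) (at s)" .
    have e: "((\<lambda>x. exp (- inverse x)) has_real_derivative exp (- inverse s) * inverse s ^ 2) (at s)"
      using s by (auto intro!: derivative_eq_intros simp: power2_eq_square)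
    show ?thesis
      using DERIV_mult[OF p e] by (simp add: power2_eq_square mult_ac)
  qed
  then have "(flat_power k has_real_derivative
      (- real k * (inverse s ^ (k + 1) * exp (- inverse s)) + inverse s ^ (k + 2) * exp (- inverse s))) (at s)"
    by (rule has_field_derivative_transform_within_open[of _ _ _ "{0<..}"]) (use greater in \<open>auto simp: flat_power_def\<close>)
  then show ?thesis using greater by (simp add: flat_power_def)
qed

text \<open>An algebra of functions generated so as to be closed under partial derivatives; it
  serves as the invariant class for \<open>smooth_coinduct\<close>.\<close>

inductive_set bump_algebra :: "(real ^ 'q \<Rightarrow> real) set"
  where
    const: "(\<lambda>x. c) \<in> bump_algebra"
  | component: "(\<lambda>x. x $ i) \<in> bump_algebra"
  | add: "f \<in> bump_algebra \<Longrightarrow> g \<in> bump_algebra \<Longrightarrow> (\<lambda>x. f x + g x) \<in> bump_algebra"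
  | mult: "f \<in> bump_algebra \<Longrightarrow> g \<in> bump_algebra \<Longrightarrow> (\<lambda>x. f x * g x) \<in> bump_algebra"
  | flat: "f \<in> bump_algebra \<Longrightarrow> (\<lambda>x. flat_power k (f x)) \<in> bump_algebra"

lemma bump_algebra_derivative:
  fixes f :: "real ^ 'q \<Rightarrow> real"
  assumes "f \<in> bump_algebra"
  shows "\<exists>g. (\<forall>i. g i \<in> bump_algebra) \<and> (\<forall>x. (f has_derivative (\<lambda>v. \<Sum>i\<in>UNIV. v $ i *\<^sub>R g i x)) (at x))"
  using assms
proof induction
  case (const c)
  show ?case by (rule exI[of _ "\<lambda>i x. 0"]) (auto intro: bump_algebra.const)
next
  case (component i)
  have "((\<lambda>x. x $ i) has_derivative (\<lambda>v. \<Sum>j\<in>UNIV. v $ j *\<^sub>R (if j = i then 1 else 0))) (at x)" for x :: "real ^ 'q"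
    by (simp add: if_distrib cong: if_cong) (auto intro!: derivative_eq_intros bounded_linear.has_derivative[OF bounded_linear_vec_nth])
  then show ?case
    by (intro exI[of _ "\<lambda>j x. if j = i then 1 else 0"]) (auto intro: bump_algebra.const)
next
  case (add f g)
  then obtain f' g' where f': "\<forall>i. f' i \<in> bump_algebra" "\<forall>x. (f has_derivative (\<lambda>v. \<Sum>i\<in>UNIV. v $ i *\<^sub>R f' i x)) (at x)"
    and g': "\<forall>i. g' i \<in> bump_algebra" "\<forall>x. (g has_derivative (\<lambda>v. \<Sum>i\<in>UNIV. v $ i *\<^sub>R g' i x)) (at x)" by auto
  have "((\<lambda>x. f x + g x) has_derivative (\<lambda>v. \<Sum>i\<in>UNIV. v $ i *\<^sub>R (f' i x + g' i x))) (at x)" for x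
    using has_derivative_add[OF f'(2)[rule_format, of x] g'(2)[rule_format, of x]]
    by (simp add: sum.distrib distrib_left)
  then show ?case using f'(1) g'(1)
    by (intro exI[of _ "\<lambda>i x. f' i x + g' i x"]) (auto intro: bump_algebra.add)
next
  case (mult f g)
  then obtain f' g' where f': "\<forall>i. f' i \<in> bump_algebra" "\<forall>x. (f has_derivative (\<lambda>v. \<Sum>i\<in>UNIV. v $ i *\<^sub>R f' i x)) (at x)"
    and g': "\<forall>i. g' i \<in> bump_algebra" "\<forall>x. (g has_derivative (\<lambda>v. \<Sum>i\<in>UNIV. v $ i *\<^sub>R g' i x)) (at x)" by auto
  have "((\<lambda>x. f x * g x) has_derivative (\<lambda>v. \<Sum>i\<in>UNIV. v $ i *\<^sub>R (f x * g' i x + f' i x * g x))) (at x)" for x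
    using has_derivative_mult[OF f'(2)[rule_format, of x] g'(2)[rule_format, of x]]
    by (simp add: sum.distrib distrib_left sum_distrib_left sum_distrib_right mult_ac)
  moreover have "(\<lambda>x. f x * g' i x + f' i x * g x) \<in> bump_algebra" for i
    by (intro bump_algebra.add bump_algebra.mult mult f'(1)[rule_format] g'(1)[rule_format])
  ultimately show ?case
    by (intro exI[of _ "\<lambda>i x. f x * g' i x + f' i x * g x"]) blast
next
  case (flat f k)
  then obtain f' where f': "\<forall>i. f' i \<in> bump_algebra" "\<forall>x. (f has_derivative (\<lambda>v. \<Sum>i\<in>UNIV. v $ i *\<^sub>R f' i x)) (at x)" by auto
  let ?d = "\<lambda>x. - real k * flat_power (k + 1) (f x) + flat_power (k + 2) (f x)"
  have "((\<lambda>x. flat_power k (f x)) has_derivative (\<lambda>v. \<Sum>i\<in>UNIV. v $ i *\<^sub>R (?d x * f' i x))) (at x)" for x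
  proof -
    have "((\<lambda>x. flat_power k (f x)) has_derivative (\<lambda>v. ?d x * (\<Sum>i\<in>UNIV. v $ i *\<^sub>R f' i x))) (at x)"
      using has_derivative_compose[OF f'(2)[rule_format, of x] flat_power_has_real_derivative[of k "f x", unfolded has_field_derivative_def]]
      by simp
    then show ?thesis by (simp add: sum_distrib_left sum_distrib_right mult_ac)
  qed
  moreover have "(\<lambda>x. ?d x * f' i x) \<in> bump_algebra" for i
    using f'(1) flat(1) by (intro bump_algebra.mult bump_algebra.add bump_algebra.flat bump_algebra.const) auto
  ultimately show ?case by (intro exI[of _ "\<lambda>i x. ?d x * f' i x"]) blast
qed

lemma bump_algebra_smooth:
  assumes "f \<in> bump_algebra" shows "smooth f"
  using assms
proof (rule smooth_coinduct[where P = "\<lambda>f. f \<in> bump_algebra"])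
  fix f :: "real ^ 'a \<Rightarrow> real" and x assume "f \<in> bump_algebra"
  then show "f differentiable (at x)" using bump_algebra_derivative[of f] by (auto simp: differentiable_def)
next
  fix f :: "real ^ 'a \<Rightarrow> real" and i assume "f \<in> bump_algebra"
  then obtain g where g: "\<forall>i. g i \<in> bump_algebra" "\<forall>x. (f has_derivative (\<lambda>v. \<Sum>i\<in>UNIV. v $ i *\<^sub>R g i x)) (at x)"
    using bump_algebra_derivative by blast
  have "partial_deriv i f = g i"
    using partial_deriv_eq[OF g(2)[rule_format]] by (auto simp: fun_eq_iff simp del: real_scaleR_def)
  then show "partial_deriv i f \<in> bump_algebra" using g(1) by simp
qed

text \<open>The parameter \<open>c\<close> is the inverse square of the radius of the support, so
  \<open>c = n\<^sup>2\<close> gives a bump of radius \<open>1 / n\<close> around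
  \<open>a\<close>.\<close>

definition bump :: "real \<Rightarrow> real ^ 'q \<Rightarrow> real ^ 'q \<Rightarrow> real"
  where "bump c a x = flat_power 0 (1 - c * ((x - a) \<bullet> (x - a)))"

lemma bump_smooth: "smooth (bump c a)"
proof -
  have "(\<lambda>x. 1 + (- c) * (\<Sum>i\<in>UNIV. (x $ i + - (a $ i)) * (x $ i + - (a $ i)))) \<in> bump_algebra"
  proof -
    have sum: "(\<lambda>x. \<Sum>i\<in>I. F i x) \<in> bump_algebra" if "finite I" "\<And>i. F i \<in> bump_algebra"
      for F :: "'a \<Rightarrow> real ^ 'a \<Rightarrow> real" and I
      using that(1) by induction (auto intro: bump_algebra.const bump_algebra.add that(2))
    show ?thesis
      by (intro bump_algebra.add bump_algebra.mult bump_algebra.const bump_algebra.component sum) auto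
  qed
  then have "(\<lambda>x. flat_power 0 (1 + (- c) * (\<Sum>i\<in>UNIV. (x $ i + - (a $ i)) * (x $ i + - (a $ i))))) \<in> bump_algebra"
    by (rule bump_algebra.flat)
  also have "(\<lambda>x. flat_power 0 (1 + (- c) * (\<Sum>i\<in>UNIV. (x $ i + - (a $ i)) * (x $ i + - (a $ i))))) = bump c a"
    by (simp add: fun_eq_iff bump_def inner_vec_def)
  finally show ?thesis by (rule bump_algebra_smooth)
qed

lemma bump_nonneg: "bump c a x \<ge> 0"
  by (simp add: bump_def flat_power_nonneg)

lemma bump_eq_0:
  assumes "c > 0" "norm (x - a) \<ge> 1 / sqrt c" shows "bump c a x = 0"
proof -
  have "(1 / sqrt c)\<^sup>2 \<le> (norm (x - a))\<^sup>2" using assms by (intro power_mono) auto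
  then have "1 \<le> c * ((x - a) \<bullet> (x - a))"
    using assms by (simp add: power_divide power2_norm_eq_inner field_simps)
  then show ?thesis by (simp add: bump_def flat_power_def)
qed

lemma bump_compactly_supported:
  assumes "c > 0" shows "compactly_supported (bump c a)"
proof (rule compactly_supportedI[of "norm a + 1 / sqrt c"])
  fix x :: "real ^ 'a" assume "norm x > norm a + 1 / sqrt c"
  then have "norm (x - a) \<ge> 1 / sqrt c" using norm_triangle_ineq2[of x a] by linarith
  then show "bump c a x = 0" using assms by (intro bump_eq_0)
qed

lemma bump_shift: "bump c a (x + a) = bump c 0 x" "bump c 0 (- x) = bump c 0 x"
  by (simp_all add: bump_def)

subsection \<open>Clifford relations\<close>

lemma insertion_sign_square [simp]: "insertion_sign i I * insertion_sign i I = 1"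
  by (simp add: insertion_sign_def flip: power_mult_distrib)

lemma insertion_sign_insert:
  assumes "i \<notin> I"
  shows "insertion_sign j (insert i I) = (if i < j then - insertion_sign j I else insertion_sign j I)"
proof (cases "i < j")
  case True
  then have "{l \<in> insert i I. l < j} = insert i {l \<in> I. l < j}" by auto
  then show ?thesis using True assms by (simp add: insertion_sign_def)
next
  case False
  then have "{l \<in> insert i I. l < j} = {l \<in> I. l < j}" by auto
  then show ?thesis using False by (simp add: insertion_sign_def)
qed

lemma insertion_sign_remove:
  assumes "i \<in> I"
  shows "insertion_sign j (I - {i}) = (if i < j then - insertion_sign j I else insertion_sign j I)"
  using insertion_sign_insert[of i "I - {i}" j] assms by (auto simp: insert_absorb split: if_splits)

lemma linear_wedge_dx: "linear (wedge_dx i)"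
  by (rule linearI) (auto simp: wedge_dx_def vec_eq_iff scaleR_add_right)

lemma linear_contract_dx: "linear (contract_dx i)"
  by (rule linearI) (auto simp: contract_dx_def vec_eq_iff scaleR_add_right)

text \<open>Removing one index changes the insertion sign of the other only if it is the smaller
  one. For distinct indices this happens in exactly one of the two orders.\<close>

lemma wedge_dx_anticommute: "wedge_dx i (wedge_dx j w) = - wedge_dx j (wedge_dx i w)"
proof -
  have "wedge_dx i (wedge_dx j w) $ I = - (wedge_dx j (wedge_dx i w) $ I)" for I
  proof (cases "i \<in> I \<and> j \<in> I \<and> i \<noteq> j")
    case True
    then have "I - {i} - {j} = I - {j} - {i}" "i < j \<longleftrightarrow> \<not> j < i" "j \<noteq> i" by auto
    then show ?thesis using True by (simp add: wedge_dx_def insertion_sign_remove)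
  next
    case False
    then show ?thesis by (auto simp: wedge_dx_def)
  qed
  then show ?thesis by (simp add: vec_eq_iff)
qed

text \<open>The canonical anticommutation relations. For \<open>i = j\<close> exactly one of the two
  summands is nonzero at each \<open>I\<close>, depending on \<open>i \<in> I\<close>; for distinct
  indices both are nonzero at the same sets \<open>I\<close> up to the value of \<open>w\<close>,
  with opposite signs.\<close>

lemma wedge_contract_dx:
  "wedge_dx i (contract_dx j w) + contract_dx j (wedge_dx i w) = (if i = j then w else 0)"
proof -
  have "wedge_dx i (contract_dx j w) $ I + contract_dx j (wedge_dx i w) $ I = (if i = j then w $ I else 0)" for I
  proof (cases "i = j")
    case True
    show ?thesis
    proof (cases "i \<in> I")
      case True
      then show ?thesis using \<open>i = j\<close>
        by (simp add: wedge_dx_def contract_dx_def insertion_sign_remove insert_absorb)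
    next
      case False
      then show ?thesis using \<open>i = j\<close>
        by (simp add: wedge_dx_def contract_dx_def insertion_sign_insert)
    qed
  next
    case ne: False
    show ?thesis
    proof (cases "i \<in> I \<and> j \<notin> I")
      case True
      then have "insert j (I - {i}) = insert j I - {i}" "i < j \<longleftrightarrow> \<not> j < i" using ne by auto
      then show ?thesis using True ne
        by (simp add: wedge_dx_def contract_dx_def insertion_sign_remove insertion_sign_insert)
    next
      case False
      then show ?thesis using ne by (auto simp: wedge_dx_def contract_dx_def)
    qed
  qed
  then show ?thesis by (simp add: vec_eq_iff)
qed

section \<open>Exterior and interior multiplication by a covector: the symbols of d and its
  adjoint\<close>

definition wedge_vec :: "real ^ ('q::{finite, linorder}) \<Rightarrow> 'k ^ ('q set) \<Rightarrow> 'k::real_vector ^ ('q set)"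
  where "wedge_vec \<xi> w = (\<Sum>i\<in>UNIV. \<xi> $ i *\<^sub>R wedge_dx i w)"

definition contract_vec :: "real ^ ('q::{finite, linorder}) \<Rightarrow> 'k ^ ('q set) \<Rightarrow> 'k::real_vector ^ ('q set)"
  where "contract_vec \<xi> w = (\<Sum>i\<in>UNIV. \<xi> $ i *\<^sub>R contract_dx i w)"

lemma linear_wedge_vec: "linear (wedge_vec \<xi>)"
  unfolding wedge_vec_def
  by (rule linearI) (simp_all add: linear_add[OF linear_wedge_dx] linear_scale[OF linear_wedge_dx]
      scaleR_add_right sum.distrib scaleR_sum_right mult.commute)

lemma linear_contract_vec: "linear (contract_vec \<xi>)"
  unfolding contract_vec_def
  by (rule linearI) (simp_all add: linear_add[OF linear_contract_dx] linear_scale[OF linear_contract_dx]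
      scaleR_add_right sum.distrib scaleR_sum_right mult.commute)

lemma wedge_vec_uminus [simp]: "wedge_vec (- \<xi>) w = - wedge_vec \<xi> w"
  by (simp add: wedge_vec_def sum_negf)

lemma contract_vec_uminus [simp]: "contract_vec (- \<xi>) w = - contract_vec \<xi> w"
  by (simp add: contract_vec_def sum_negf)

lemma wedge_vec_inner: "wedge_vec \<xi> v \<bullet> w = v \<bullet> contract_vec \<xi> w"
  for v w :: "'k::real_inner ^ ('q::{finite, linorder} set)"
  by (simp add: wedge_vec_def contract_vec_def inner_sum_left inner_sum_right wedge_dx_inner)

text \<open>Swapping the summation indices turns the double sum into its own negative.\<close>

lemma wedge_vec_wedge_vec: "wedge_vec \<xi> (wedge_vec \<xi> w) = 0"
proof -
  have eq: "wedge_vec \<xi> (wedge_vec \<xi> w) = (\<Sum>i\<in>UNIV. \<Sum>j\<in>UNIV. (\<xi> $ i * \<xi> $ j) *\<^sub>R wedge_dx i (wedge_dx j w))"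
    by (simp add: wedge_vec_def linear_sum[OF linear_wedge_dx] linear_scale[OF linear_wedge_dx] scaleR_sum_right)
  also have "\<dots> = (\<Sum>j\<in>UNIV. \<Sum>i\<in>UNIV. (\<xi> $ i * \<xi> $ j) *\<^sub>R wedge_dx i (wedge_dx j w))"
    by (rule sum.swap)
  also have "\<dots> = (\<Sum>j\<in>UNIV. \<Sum>i\<in>UNIV. - ((\<xi> $ j * \<xi> $ i) *\<^sub>R wedge_dx j (wedge_dx i w)))"
  proof (intro sum.cong refl)
    fix i j
    show "(\<xi> $ i * \<xi> $ j) *\<^sub>R wedge_dx i (wedge_dx j w) = - ((\<xi> $ j * \<xi> $ i) *\<^sub>R wedge_dx j (wedge_dx i w))"
      by (subst wedge_dx_anticommute) (simp add: mult.commute)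
  qed
  also have "\<dots> = - wedge_vec \<xi> (wedge_vec \<xi> w)"
    unfolding eq by (simp add: sum_negf)
  finally show ?thesis
    by (metis add.right_inverse real_vector.scale_eq_0_iff scaleR_2 zero_neq_numeral)
qed

text \<open>Transpose of the preceding identity.\<close>

lemma contract_vec_contract_vec: "contract_vec \<xi> (contract_vec \<xi> w) = 0"
  for w :: "'k::real_inner ^ ('q::{finite, linorder} set)"
proof -
  have "v \<bullet> contract_vec \<xi> (contract_vec \<xi> w) = v \<bullet> 0" for v
    by (simp add: wedge_vec_wedge_vec flip: wedge_vec_inner)
  then show ?thesis using vector_eq_ldot by blast
qed

lemma wedge_contract_vec: "wedge_vec \<xi> (contract_vec \<xi> w) + contract_vec \<xi> (wedge_vec \<xi> w) = (\<xi> \<bullet> \<xi>) *\<^sub>R w"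
proof -
  have 1: "wedge_vec \<xi> (contract_vec \<xi> w) = (\<Sum>i\<in>UNIV. \<Sum>j\<in>UNIV. (\<xi> $ i * \<xi> $ j) *\<^sub>R wedge_dx i (contract_dx j w))"
    by (simp add: wedge_vec_def contract_vec_def linear_sum[OF linear_wedge_dx] linear_scale[OF linear_wedge_dx] scaleR_sum_right)
  have "contract_vec \<xi> (wedge_vec \<xi> w) = (\<Sum>j\<in>UNIV. \<Sum>i\<in>UNIV. (\<xi> $ j * \<xi> $ i) *\<^sub>R contract_dx j (wedge_dx i w))"
    by (simp add: wedge_vec_def contract_vec_def linear_sum[OF linear_contract_dx] linear_scale[OF linear_contract_dx] scaleR_sum_right)
  also have "\<dots> = (\<Sum>i\<in>UNIV. \<Sum>j\<in>UNIV. (\<xi> $ i * \<xi> $ j) *\<^sub>R contract_dx j (wedge_dx i w))"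
    by (subst sum.swap) (simp add: mult.commute)
  finally have "wedge_vec \<xi> (contract_vec \<xi> w) + contract_vec \<xi> (wedge_vec \<xi> w)
    = (\<Sum>i\<in>UNIV. \<Sum>j\<in>UNIV. (\<xi> $ i * \<xi> $ j) *\<^sub>R (wedge_dx i (contract_dx j w) + contract_dx j (wedge_dx i w)))"
    unfolding 1 by (simp add: sum.distrib scaleR_add_right)
  also have "\<dots> = (\<Sum>i\<in>UNIV. (\<xi> $ i * \<xi> $ i) *\<^sub>R w)"
    unfolding wedge_contract_dx by (simp add: if_distrib cong: if_cong)
  also have "\<dots> = (\<xi> \<bullet> \<xi>) *\<^sub>R w"
    by (simp add: inner_vec_def scaleR_sum_left)
  finally show ?thesis .
qed

text \<open>Pairing the Clifford relation with \<open>w\<close> itself. It bounds each symbol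
  separately by \<open>norm \<xi>\<close>.\<close>

lemma norm_wedge_contract_vec:
  fixes w :: "'k::real_inner ^ ('q::{finite, linorder} set)"
  shows "(norm (wedge_vec \<xi> w))\<^sup>2 + (norm (contract_vec \<xi> w))\<^sup>2 = (norm \<xi>)\<^sup>2 * (norm w)\<^sup>2"
proof -
  have "wedge_vec \<xi> w \<bullet> wedge_vec \<xi> w + contract_vec \<xi> w \<bullet> contract_vec \<xi> w
    = w \<bullet> contract_vec \<xi> (wedge_vec \<xi> w) + wedge_vec \<xi> (contract_vec \<xi> w) \<bullet> w"
    by (simp only: wedge_vec_inner)
  also have "\<dots> = w \<bullet> ((\<xi> \<bullet> \<xi>) *\<^sub>R w)"
    unfolding wedge_contract_vec[symmetric] by (simp add: inner_add_right inner_commute)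
  finally show ?thesis by (simp add: power2_norm_eq_inner)
qed

lemma norm_wedge_vec_le: "norm (wedge_vec \<xi> w) \<le> norm \<xi> * norm w"
  and norm_contract_vec_le: "norm (contract_vec \<xi> w) \<le> norm \<xi> * norm w"
  for w :: "'k::real_inner ^ ('q::{finite, linorder} set)"
proof -
  have "(norm (wedge_vec \<xi> w))\<^sup>2 \<le> (norm \<xi> * norm w)\<^sup>2" "(norm (contract_vec \<xi> w))\<^sup>2 \<le> (norm \<xi> * norm w)\<^sup>2"
    using norm_wedge_contract_vec[of \<xi> w] zero_le_power2[of "norm (wedge_vec \<xi> w)"]
      zero_le_power2[of "norm (contract_vec \<xi> w)"]
    unfolding power_mult_distrib by linarith+
  then show "norm (wedge_vec \<xi> w) \<le> norm \<xi> * norm w" "norm (contract_vec \<xi> w) \<le> norm \<xi> * norm w"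
    by (auto intro!: power2_le_imp_le)
qed

lemma measurable_wedge_contract_vec:
  fixes X :: "real ^ ('q::{finite, linorder}) \<Rightarrow> 'k::euclidean_space ^ ('q set)"
  assumes X: "X \<in> borel_measurable borel"
  shows "(\<lambda>\<xi>. wedge_vec \<xi> (X \<xi>)) \<in> borel_measurable borel"
    and "(\<lambda>\<xi>. contract_vec \<xi> (X \<xi>)) \<in> borel_measurable borel"
proof -
  have "(\<lambda>\<xi>. T (X \<xi>)) \<in> borel_measurable borel" if "linear T" for T :: "'k ^ ('q set) \<Rightarrow> 'k ^ ('q set)"
    using measurable_compose[OF X borel_measurable_continuous_onI[OF linear_continuous_on[of T]]] that
    by (simp add: linear_conv_bounded_linear)
  from this[OF linear_wedge_dx] this[OF linear_contract_dx]
  have [measurable]: "(\<lambda>\<xi>. wedge_dx i (X \<xi>)) \<in> borel_measurable borel"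
    "(\<lambda>\<xi>. contract_dx i (X \<xi>)) \<in> borel_measurable borel" for i
    by blast+
  have [measurable]: "(\<lambda>\<xi> :: (real, 'q) vec. \<xi> $ i) \<in> borel_measurable borel" for i
    by (intro borel_measurable_continuous_onI continuous_intros)
  show "(\<lambda>\<xi>. wedge_vec \<xi> (X \<xi>)) \<in> borel_measurable borel"
    "(\<lambda>\<xi>. contract_vec \<xi> (X \<xi>)) \<in> borel_measurable borel"
    unfolding wedge_vec_def contract_vec_def by measurable
qed

subsection \<open>Test forms\<close>

lemma test_form_partial_deriv: "test_form f \<Longrightarrow> smooth (partial_deriv i f) \<and> compactly_supported (partial_deriv i f)"
  by (simp add: test_form_def smooth_partial_deriv compactly_supported_partial_deriv)

lemma test_form_ext_deriv:
  assumes "test_form f" shows "test_form (ext_deriv f)"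
proof -
  have "ext_deriv f = (\<lambda>x. \<Sum>i\<in>UNIV. wedge_dx i (partial_deriv i f x))"
    by (simp add: fun_eq_iff ext_deriv_def)
  then show ?thesis
    using test_form_partial_deriv[OF assms]
    by (simp add: test_form_def smooth_sum smooth_linear linear_wedge_dx compactly_supported_sum compactly_supported_linear)
qed

lemma codiff_eq: "codiff f = (\<lambda>x. \<Sum>i\<in>UNIV. - contract_dx i (partial_deriv i f x))"
  by (simp add: fun_eq_iff codiff_def sum_negf)

lemma linear_minus_contract_dx: "linear (\<lambda>v. - contract_dx i v)"
  using linear_contract_dx[of i] by (rule linear_compose_neg)

lemma test_form_codiff:
  assumes "test_form f" shows "test_form (codiff f)"
proof -
  have "smooth (\<lambda>x. - contract_dx i (partial_deriv i f x))"
    "compactly_supported (\<lambda>x. - contract_dx i (partial_deriv i f x))" for i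
    using test_form_partial_deriv[OF assms, of i] smooth_linear[OF _ linear_minus_contract_dx]
      compactly_supported_linear[OF _ linear_minus_contract_dx] by blast+
  then show ?thesis
    unfolding codiff_eq test_form_def by (simp add: smooth_sum compactly_supported_sum)
qed

lemma bounded_integrable_test_form: "test_form f \<Longrightarrow> bounded_integrable f"
  by (simp add: test_form_def bounded_integrable_smooth)

text \<open>Because mixed derivatives commute, the two double sums can be paired index by index. The
  anticommutator of \<open>wedge_dx i\<close> and \<open>contract_dx j\<close> then keeps only the
  diagonal.\<close>

theorem hodge_laplacian_eq:
  assumes f: "test_form f"
  shows "hodge_laplacian f x = - (\<Sum>i\<in>UNIV. partial_deriv i (partial_deriv i f) x)"
proof -
  let ?d = "\<lambda>i j. partial_deriv i (partial_deriv j f) x"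
  have s: "smooth (partial_deriv i f)" for i using test_form_partial_deriv[OF f] by blast
  have comm: "?d i j = ?d j i" for i j
    using partial_deriv_commute[of f i j] f by (simp add: test_form_def)
  have 1: "partial_deriv j (ext_deriv f) x = (\<Sum>i\<in>UNIV. wedge_dx i (?d j i))" for j
  proof -
    have "partial_deriv j (\<lambda>x. \<Sum>i\<in>UNIV. wedge_dx i (partial_deriv i f x)) x
      = (\<Sum>i\<in>UNIV. partial_deriv j (\<lambda>x. wedge_dx i (partial_deriv i f x)) x)"
      by (intro partial_deriv_sum smooth_linear[OF s linear_wedge_dx])
    then show ?thesis
      by (simp add: ext_deriv_def[abs_def] partial_deriv_linear(2)[OF smooth_imp_differentiable[OF s] linear_wedge_dx])
  qed
  have 2: "partial_deriv j (codiff f) x = (\<Sum>i\<in>UNIV. - contract_dx i (?d j i))" for j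
  proof -
    have "partial_deriv j (\<lambda>x. \<Sum>i\<in>UNIV. - contract_dx i (partial_deriv i f x)) x
      = (\<Sum>i\<in>UNIV. partial_deriv j (\<lambda>x. - contract_dx i (partial_deriv i f x)) x)"
      by (intro partial_deriv_sum smooth_linear[OF s linear_minus_contract_dx])
    then show ?thesis
      by (simp only: codiff_eq partial_deriv_linear(2)[OF smooth_imp_differentiable[OF s] linear_minus_contract_dx])
  qed
  have "codiff (ext_deriv f) x = - (\<Sum>j\<in>UNIV. \<Sum>i\<in>UNIV. contract_dx j (wedge_dx i (?d j i)))"
    unfolding codiff_def[of "ext_deriv f"] 1 by (simp only: linear_sum[OF linear_contract_dx])
  moreover have "ext_deriv (codiff f) x = - (\<Sum>i\<in>UNIV. \<Sum>j\<in>UNIV. wedge_dx i (contract_dx j (?d i j)))"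
    unfolding ext_deriv_def[of "codiff f"] 2
    by (simp only: linear_sum[OF linear_wedge_dx] linear_neg[OF linear_wedge_dx] sum_negf)
  moreover have "(\<Sum>j\<in>UNIV. \<Sum>i\<in>UNIV. contract_dx j (wedge_dx i (?d j i)))
    = (\<Sum>i\<in>UNIV. \<Sum>j\<in>UNIV. contract_dx j (wedge_dx i (?d i j)))"
    by (subst sum.swap) (simp only: comm)
  ultimately have "hodge_laplacian f x
    = - (\<Sum>i\<in>UNIV. \<Sum>j\<in>UNIV. wedge_dx i (contract_dx j (?d i j)) + contract_dx j (wedge_dx i (?d i j)))"
    unfolding hodge_laplacian_def by (simp only: sum.distrib) simp
  also have "\<dots> = - (\<Sum>i\<in>UNIV. \<Sum>j\<in>UNIV. if i = j then ?d i j else 0)"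
    by (simp only: wedge_contract_dx)
  finally show ?thesis by simp
qed

lemma hartley_sum:
  fixes f :: "'i \<Rightarrow> 'a::euclidean_space \<Rightarrow> 'b::euclidean_space"
  assumes "\<And>i. i \<in> I \<Longrightarrow> integrable lborel (f i)"
  shows "hartley (\<lambda>x. \<Sum>i\<in>I. f i x) \<xi> = (\<Sum>i\<in>I. hartley (f i) \<xi>)"
  unfolding hartley_def using assms
  by (simp add: scaleR_sum_right integrable_cas Bochner_Integration.integral_sum)

text \<open>The minus sign in \<open>codiff\<close> cancels the one from the transform of a
  derivative.\<close>

lemma hartley_codiff:
  fixes f :: "('q::{finite, linorder}, 'k::euclidean_space) form"
  assumes f: "test_form f"
  shows "hartley (codiff f) \<xi> = contract_vec \<xi> (hartley f (- \<xi>))"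
proof -
  have i: "integrable lborel (partial_deriv i f)" for i
    using test_form_partial_deriv[OF f] by (intro bounded_integrable_imp_integrable bounded_integrable_smooth) blast+
  have bl: "bounded_linear (\<lambda>v :: ('k, 'q set) vec. - contract_dx i v)" for i
    using linear_minus_contract_dx[of i] by (rule linear_conv_bounded_linear[THEN iffD1])
  have "hartley (codiff f) \<xi> = (\<Sum>i\<in>UNIV. hartley (\<lambda>x. - contract_dx i (partial_deriv i f x)) \<xi>)"
    unfolding codiff_eq by (intro hartley_sum integrable_bounded_linear[OF bl i])
  also have "\<dots> = (\<Sum>i\<in>UNIV. - contract_dx i (- (\<xi> $ i) *\<^sub>R hartley f (- \<xi>)))"
    using f by (simp only: hartley_linear[OF i linear_minus_contract_dx] hartley_partial_deriv test_form_def)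
  also have "\<dots> = contract_vec \<xi> (hartley f (- \<xi>))"
    by (simp only: contract_vec_def linear_scale[OF linear_contract_dx]) simp
  finally show ?thesis .
qed

text \<open>Translating a general function mixes the values of its transform at \<open>\<xi>\<close>
  and \<open>- \<xi>\<close>. For an even function the sine integral vanishes and only the factor
  \<open>cas (a \<bullet> \<xi>)\<close> remains.\<close>

lemma hartley_bump:
  fixes a :: "real ^ 'q"
  assumes c: "c > 0"
  shows "hartley (bump c a) \<xi> = cas (a \<bullet> \<xi>) * hartley (bump c 0) \<xi>"
proof -
  let ?b = "bump c (0 :: real ^ 'q)"
  have ib: "integrable lborel (bump c a)" for a :: "real ^ 'q"
    by (intro bounded_integrable_imp_integrable bounded_integrable_smooth bump_smooth bump_compactly_supported c)
  have m: "bump c a \<in> borel_measurable borel" for a :: "real ^ 'q"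
    using ib[of a] by auto
  note [measurable] = m
  have isin: "integrable lborel (\<lambda>x. sin (x \<bullet> \<xi>) * ?b x)" and icos: "integrable lborel (\<lambda>x. cos (x \<bullet> \<xi>) * ?b x)"
    by (rule Bochner_Integration.integrable_bound[OF ib[of 0]];
        force simp: abs_mult intro: mult_left_le_one_le)+
  have sin0: "(\<integral>x. sin (x \<bullet> \<xi>) * ?b x \<partial>lborel) = 0"
  proof -
    have "(\<integral>x. sin ((- x) \<bullet> \<xi>) * ?b (- x) \<partial>lborel) = (\<integral>x. sin (x \<bullet> \<xi>) * ?b x \<partial>lborel)"
      by (rule lborel_integral_reflect) measurable
    then show ?thesis by (simp add: bump_shift)
  qed
  have gen: "(\<integral>x. cas ((x + a) \<bullet> \<xi>) * ?b x \<partial>lborel) = cas (a \<bullet> \<xi>) * (\<integral>x. cos (x \<bullet> \<xi>) * ?b x \<partial>lborel)" for a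
  proof -
    have "(\<integral>x. cas ((x + a) \<bullet> \<xi>) * ?b x \<partial>lborel)
      = (\<integral>x. cas (a \<bullet> \<xi>) * (cos (x \<bullet> \<xi>) * ?b x) + cas (- (a \<bullet> \<xi>)) * (sin (x \<bullet> \<xi>) * ?b x) \<partial>lborel)"
      by (rule Bochner_Integration.integral_cong[OF refl])
         (simp add: inner_add_left add.commute[of "_ \<bullet> _" "a \<bullet> _"] cas_add distrib_right mult.assoc)
    also have "\<dots> = cas (a \<bullet> \<xi>) * (\<integral>x. cos (x \<bullet> \<xi>) * ?b x \<partial>lborel)"
      using isin icos sin0 by simp
    finally show ?thesis .
  qed
  have "(\<integral>x. cas (x \<bullet> \<xi>) * bump c a x \<partial>lborel) = (\<integral>x. cas ((a + x) \<bullet> \<xi>) * bump c a (a + x) \<partial>lborel)"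
    by (rule lborel_integral_shift[symmetric]) measurable
  also have "\<dots> = (\<integral>x. cas ((x + a) \<bullet> \<xi>) * ?b x \<partial>lborel)"
    by (simp only: add.commute[of a] bump_shift)
  finally show ?thesis
    using gen[of a] gen[of 0] by (simp add: hartley_def cas_def)
qed

text \<open>The support has radius \<open>1 / n\<close>, so for \<open>norm \<xi> < n\<close> the
  phase \<open>x \<bullet> \<xi>\<close> stays in [-1, 1] and its cosine is at least
  \<open>cos 1 > 0\<close>. Letting \<open>n\<close> grow reaches every frequency.\<close>

lemma hartley_bump_pos:
  fixes \<xi> :: "real ^ 'q"
  assumes n: "real n > norm \<xi>"
  shows "hartley (bump ((real n)\<^sup>2) 0) \<xi> > 0"
proof -
  have n0: "real n > 0" using n norm_ge_zero[of \<xi>] by linarith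
  let ?b = "bump ((real n)\<^sup>2) (0 :: real ^ 'q)"
  have c: "(real n)\<^sup>2 > 0" using n0 by simp
  have ib: "integrable lborel ?b"
    by (intro bounded_integrable_imp_integrable bounded_integrable_smooth bump_smooth bump_compactly_supported c)
  have [measurable]: "?b \<in> borel_measurable borel" using ib by auto
  have icas: "integrable lborel (\<lambda>x. cas (x \<bullet> \<xi>) * ?b x)" and icas': "integrable lborel (\<lambda>x. cas (- (x \<bullet> \<xi>)) * ?b x)"
    using integrable_cas[OF ib, of \<xi>] integrable_cas[OF ib, of "- \<xi>"] by simp_all
  have eq: "2 * (\<integral>x. cas (x \<bullet> \<xi>) * ?b x \<partial>lborel) = (\<integral>x. 2 * cos (x \<bullet> \<xi>) * ?b x \<partial>lborel)"
  proof -
    have "(\<integral>x. cas ((- x) \<bullet> \<xi>) * ?b (- x) \<partial>lborel) = (\<integral>x. cas (x \<bullet> \<xi>) * ?b x \<partial>lborel)"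
      by (rule lborel_integral_reflect) measurable
    then have "2 * (\<integral>x. cas (x \<bullet> \<xi>) * ?b x \<partial>lborel) = (\<integral>x. cas (x \<bullet> \<xi>) * ?b x + cas (- (x \<bullet> \<xi>)) * ?b x \<partial>lborel)"
      using icas icas' by (simp add: bump_shift)
    also have "\<dots> = (\<integral>x. 2 * cos (x \<bullet> \<xi>) * ?b x \<partial>lborel)"
      by (rule Bochner_Integration.integral_cong[OF refl]) (simp add: cas_def algebra_simps)
    finally show ?thesis .
  qed
  have icos: "integrable lborel (\<lambda>x. 2 * cos (x \<bullet> \<xi>) * ?b x)"
    by (rule Bochner_Integration.integrable_bound[of _ "\<lambda>x. 2 * ?b x"])
       (use ib in \<open>auto simp: abs_mult intro!: mult_left_le_one_le\<close>)
  have le: "(\<integral>x. 2 * cos 1 * ?b x \<partial>lborel) \<le> (\<integral>x. 2 * cos (x \<bullet> \<xi>) * ?b x \<partial>lborel)"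
  proof (rule integral_mono[OF _ icos])
    show "integrable lborel (\<lambda>x. 2 * cos 1 * ?b x)" using ib by simp
    fix x :: "real ^ 'q"
    show "2 * cos 1 * ?b x \<le> 2 * cos (x \<bullet> \<xi>) * ?b x"
    proof (cases "norm x < 1 / real n")
      case True
      have "\<bar>x \<bullet> \<xi>\<bar> \<le> norm x * norm \<xi>" by (rule Cauchy_Schwarz_ineq2)
      also have "\<dots> \<le> (1 / real n) * real n" using True n by (intro mult_mono) auto
      finally have "\<bar>x \<bullet> \<xi>\<bar> \<le> 1" using n0 by simp
      then have "cos 1 \<le> cos \<bar>x \<bullet> \<xi>\<bar>"
        using pi_gt3 by (intro cos_monotone_0_pi_le) auto
      then show ?thesis using bump_nonneg[of "(real n)\<^sup>2" 0 x] by (simp add: mult_right_mono)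
    next
      case False
      then have "?b x = 0" using n0 by (intro bump_eq_0) (auto simp: real_sqrt_abs)
      then show ?thesis by simp
    qed
  qed
  have pos: "(\<integral>x. ?b x \<partial>lborel) > 0"
  proof -
    have "(\<integral>x. ?b x \<partial>lborel) \<noteq> 0"
    proof
      assume "(\<integral>x. ?b x \<partial>lborel) = 0"
      then have "AE x in lborel. ?b x = 0"
        using integral_nonneg_eq_0_iff_AE[OF ib AE_I2[OF bump_nonneg]] by simp
      then have "?b = (\<lambda>x. 0)"
        by (intro continuous_AE_eq smooth_continuous bump_smooth continuous_on_const)
      then have "?b 0 = 0" by simp
      then show False by (simp add: bump_def flat_power_def)
    qed
    moreover have "(\<integral>x. ?b x \<partial>lborel) \<ge> 0" by (intro integral_nonneg_AE AE_I2 bump_nonneg)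
    ultimately show ?thesis by linarith
  qed
  have "cos (1::real) > 0" using pi_gt3 by (intro cos_gt_zero) auto
  with pos have "0 < (\<integral>x. 2 * cos 1 * ?b x \<partial>lborel)" by simp
  with le have "0 < (\<integral>x. 2 * cos (x \<bullet> \<xi>) * ?b x \<partial>lborel)" by linarith
  then show ?thesis using eq by (simp add: hartley_def)
qed

subsection \<open>The exterior derivative on the Hartley side\<close>

lemma integrable_reflect:
  fixes f :: "'a::euclidean_space \<Rightarrow> 'b::euclidean_space"
  assumes "integrable lborel f"
  shows "integrable lborel (\<lambda>x. f (- x))" "(\<integral>x. f (- x) \<partial>lborel) = (\<integral>x. f x \<partial>lborel)"
proof -
  have "f \<in> borel_measurable borel" using assms by auto
  from lborel_integrable_reflect[OF this] lborel_integral_reflect[OF this] assms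
  show "integrable lborel (\<lambda>x. f (- x))" "(\<integral>x. f (- x) \<partial>lborel) = (\<integral>x. f x \<partial>lborel)" by simp_all
qed

lemma AE_lborel_reflect:
  assumes "AE x in (lborel :: 'a::euclidean_space measure). P x"
  shows "AE x in (lborel :: 'a measure). P (- x)"
proof -
  have d: "distr lborel borel (\<lambda>x::'a. - x) = lborel"
    using lborel_affine[of "-1" "0::'a"] by (simp add: density_1)
  have "AE x in distr lborel borel (\<lambda>x::'a. - x). P x" using assms by (simp only: d)
  then show ?thesis by (rule AE_distrD[rotated]) simp
qed

text \<open>Transpose the contraction pointwise, then substitute \<open>- \<xi>\<close>; the sign is
  that of \<open>wedge_vec (- \<xi>)\<close>. Integrability is inherited from the left-hand
  integrand, since \<open>wedge_vec \<xi> (X (- \<xi>))\<close> may fail to be square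
  integrable.\<close>

lemma integral_hartley_codiff:
  fixes X :: "(real ^ ('q::{finite, linorder})) \<Rightarrow> ('k::euclidean_space ^ ('q set))"
  assumes X: "square_integrable X" and h: "test_form h"
  shows "integrable lborel (\<lambda>\<xi>. wedge_vec \<xi> (X (- \<xi>)) \<bullet> hartley h \<xi>)"
    and "(\<integral>\<xi>. X \<xi> \<bullet> hartley (codiff h) \<xi> \<partial>lborel) = - (\<integral>\<xi>. wedge_vec \<xi> (X (- \<xi>)) \<bullet> hartley h \<xi> \<partial>lborel)"
proof -
  have eq: "X \<xi> \<bullet> hartley (codiff h) \<xi> = wedge_vec \<xi> (X \<xi>) \<bullet> hartley h (- \<xi>)" for \<xi>
    by (simp only: hartley_codiff[OF h] wedge_vec_inner)
  have "integrable lborel (\<lambda>\<xi>. X \<xi> \<bullet> hartley (codiff h) \<xi>)"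
    by (intro square_integrable_inner X square_integrable_hartley bounded_integrable_test_form test_form_codiff h)
  from integrable_reflect[OF this]
  have i: "integrable lborel (\<lambda>\<xi>. - (wedge_vec \<xi> (X (- \<xi>)) \<bullet> hartley h \<xi>))"
    and j: "(\<integral>\<xi>. - (wedge_vec \<xi> (X (- \<xi>)) \<bullet> hartley h \<xi>) \<partial>lborel) = (\<integral>\<xi>. X \<xi> \<bullet> hartley (codiff h) \<xi> \<partial>lborel)"
    by (simp_all only: eq wedge_vec_uminus inner_minus_left minus_minus)
  show "integrable lborel (\<lambda>\<xi>. wedge_vec \<xi> (X (- \<xi>)) \<bullet> hartley h \<xi>)"
    using integrable_minus[OF i] by simp
  show "(\<integral>\<xi>. X \<xi> \<bullet> hartley (codiff h) \<xi> \<partial>lborel) = - (\<integral>\<xi>. wedge_vec \<xi> (X (- \<xi>)) \<bullet> hartley h \<xi> \<partial>lborel)"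
    using j by simp
qed

lemma hartley_l2_inner_test:
  assumes "bounded_integrable h"
  shows "F \<bullet> abs_l2 h = (\<integral>\<xi>. rep_l2 (hartley_l2 F) \<xi> \<bullet> hartley h \<xi> \<partial>lborel)"
proof -
  have "F \<bullet> abs_l2 h = hartley_l2 F \<bullet> abs_l2 (hartley h)"
    using hartley_l2_inner[of F "abs_l2 h"] by (simp only: hartley_l2_abs[OF assms])
  also have "\<dots> = abs_l2 (rep_l2 (hartley_l2 F)) \<bullet> abs_l2 (hartley h)" by simp
  also have "\<dots> = (\<integral>\<xi>. rep_l2 (hartley_l2 F) \<xi> \<bullet> hartley h \<xi> \<partial>lborel)"
    by (intro abs_l2_inner square_integrable_rep_l2 square_integrable_hartley assms)
  finally show ?thesis .
qed

text \<open>The functions \<open>bump c a\<close> are the translates of an even function, whose Hartley transform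
  is \<open>cas (a \<bullet> \<xi>)\<close> times a fixed one: testing against all of them gives a vanishing Hartley transform.\<close>

lemma ext_deriv_l2_imp_hartley:
  fixes u v :: "('q::{finite, linorder}, 'k::euclidean_space) l2_form"
  assumes uv: "(u, v) \<in> ext_deriv_l2"
  shows "AE \<xi> in lborel. rep_l2 (hartley_l2 v) \<xi> = - wedge_vec \<xi> (rep_l2 (hartley_l2 u) (- \<xi>))"
proof -
  let ?X = "rep_l2 (hartley_l2 u)" and ?Y = "rep_l2 (hartley_l2 v)"
  \<comment> \<open>The defect of the claimed identity. It is orthogonal to the transforms of all
    test forms but may grow with \<open>\<xi>\<close>, so it cannot be transformed directly.\<close>
  define k where "k \<xi> = ?Y \<xi> + wedge_vec \<xi> (?X (- \<xi>))" for \<xi>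
  have X: "square_integrable ?X" and Y: "square_integrable ?Y" by (rule square_integrable_rep_l2)+
  have test: "integrable lborel (\<lambda>\<xi>. k \<xi> \<bullet> hartley h \<xi>)" "(\<integral>\<xi>. k \<xi> \<bullet> hartley h \<xi> \<partial>lborel) = 0"
    if h: "test_form h" for h
  proof -
    have i: "integrable lborel (\<lambda>\<xi>. ?Y \<xi> \<bullet> hartley h \<xi>)"
      by (intro square_integrable_inner Y square_integrable_hartley bounded_integrable_test_form h)
    note j = integral_hartley_codiff[OF X h]
    have "(\<integral>\<xi>. ?Y \<xi> \<bullet> hartley h \<xi> \<partial>lborel) = v \<bullet> abs_l2 h"
      by (rule hartley_l2_inner_test[symmetric]) (intro bounded_integrable_test_form h)
    also have "\<dots> = u \<bullet> abs_l2 (codiff h)"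
      using uv h by (auto simp: ext_deriv_l2_def)
    also have "\<dots> = (\<integral>\<xi>. ?X \<xi> \<bullet> hartley (codiff h) \<xi> \<partial>lborel)"
      by (rule hartley_l2_inner_test) (intro bounded_integrable_test_form test_form_codiff h)
    finally have eq: "(\<integral>\<xi>. ?Y \<xi> \<bullet> hartley h \<xi> \<partial>lborel) = - (\<integral>\<xi>. wedge_vec \<xi> (?X (- \<xi>)) \<bullet> hartley h \<xi> \<partial>lborel)"
      unfolding j(2) .
    show "integrable lborel (\<lambda>\<xi>. k \<xi> \<bullet> hartley h \<xi>)"
      unfolding k_def inner_add_left using i j(1) by (rule Bochner_Integration.integrable_add)
    show "(\<integral>\<xi>. k \<xi> \<bullet> hartley h \<xi> \<partial>lborel) = 0"
      unfolding k_def inner_add_left Bochner_Integration.integral_add[OF i j(1)] eq by simp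
  qed
  have ae: "AE \<xi> in lborel. hartley (bump ((real n)\<^sup>2) 0) \<xi> *\<^sub>R k \<xi> = 0" if n: "n > 0" for n
  proof -
    let ?c = "(real n)\<^sup>2"
    define b where "b \<xi> = hartley (bump ?c 0) \<xi>" for \<xi> :: "(real, 'q) vec"
    have c: "?c > 0" using n by simp
    have tf: "test_form (\<lambda>x. bump ?c a x *\<^sub>R e)" for a :: "(real, 'q) vec" and e :: "('k, 'q set) vec"
    proof -
      have l: "linear (\<lambda>r. r *\<^sub>R e)" by (rule linearI) (simp_all add: scaleR_add_left)
      show ?thesis unfolding test_form_def
        by (intro conjI smooth_linear[OF bump_smooth l] compactly_supported_linear[OF bump_compactly_supported[OF c] l])
    qed
    have hb: "hartley (\<lambda>x. bump ?c a x *\<^sub>R e) \<xi> = (cas (a \<bullet> \<xi>) * b \<xi>) *\<^sub>R e" for a \<xi> and e :: "('k, 'q set) vec"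
    proof -
      have l: "linear (\<lambda>r. r *\<^sub>R e)" by (rule linearI) (simp_all add: scaleR_add_left)
      have "integrable lborel (bump ?c a)"
        by (intro bounded_integrable_imp_integrable bounded_integrable_smooth bump_smooth bump_compactly_supported c)
      moreover have "hartley (bump ?c a) \<xi> = cas (a \<bullet> \<xi>) * b \<xi>"
        unfolding b_def by (rule hartley_bump[OF c])
      ultimately show ?thesis using hartley_linear[OF _ l] by metis
    qed
    \<comment> \<open>Each component of this product is a pairing of \<open>k\<close> with the
      transform of a test form, hence integrable.\<close>
    have int: "integrable lborel (\<lambda>\<xi>. b \<xi> *\<^sub>R k \<xi>)"
    proof -
      have eq: "(\<lambda>\<xi>. b \<xi> *\<^sub>R k \<xi>) = (\<lambda>\<xi>. \<Sum>e\<in>Basis. (k \<xi> \<bullet> hartley (\<lambda>x. bump ?c 0 x *\<^sub>R e) \<xi>) *\<^sub>R e)"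
      proof
        fix \<xi>
        have "b \<xi> *\<^sub>R k \<xi> = b \<xi> *\<^sub>R (\<Sum>e\<in>Basis. (k \<xi> \<bullet> e) *\<^sub>R e)"
          by (simp only: euclidean_representation)
        also have "\<dots> = (\<Sum>e\<in>Basis. (k \<xi> \<bullet> hartley (\<lambda>x. bump ?c 0 x *\<^sub>R e) \<xi>) *\<^sub>R e)"
          unfolding hb by (simp add: cas_def scaleR_sum_right)
        finally show "b \<xi> *\<^sub>R k \<xi> = (\<Sum>e\<in>Basis. (k \<xi> \<bullet> hartley (\<lambda>x. bump ?c 0 x *\<^sub>R e) \<xi>) *\<^sub>R e)" .
      qed
      show ?thesis unfolding eq
        by (intro Bochner_Integration.integrable_sum integrable_scaleR_left test tf)
    qed
    have "AE \<xi> in lborel. b \<xi> *\<^sub>R k \<xi> = 0"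
    proof (rule hartley_injective[OF int])
      fix a
      \<comment> \<open>The kernel at the point \<open>a\<close> together with \<open>b\<close> is
        the transform of the bump centred at \<open>a\<close>, so \<open>test\<close>
        applies.\<close>
      have "hartley (\<lambda>\<xi>. b \<xi> *\<^sub>R k \<xi>) a \<bullet> e = 0" for e
      proof -
        have "(\<integral>\<xi>. cas (\<xi> \<bullet> a) *\<^sub>R (b \<xi> *\<^sub>R k \<xi>) \<partial>lborel) \<bullet> e = (\<integral>\<xi>. (cas (\<xi> \<bullet> a) *\<^sub>R (b \<xi> *\<^sub>R k \<xi>)) \<bullet> e \<partial>lborel)"
          by (rule integral_inner_left[symmetric]) (rule integrable_cas[OF int])
        also have "\<dots> = (\<integral>\<xi>. k \<xi> \<bullet> hartley (\<lambda>x. bump ?c a x *\<^sub>R e) \<xi> \<partial>lborel)"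
          unfolding hb by (simp add: inner_commute[of a] mult.assoc)
        also have "\<dots> = 0" by (rule test(2)[OF tf])
        finally show ?thesis by (simp add: hartley_def)
      qed
      then show "hartley (\<lambda>\<xi>. b \<xi> *\<^sub>R k \<xi>) a = 0" using inner_eq_zero_iff by blast
    qed
    then show ?thesis by (simp only: b_def)
  qed
  \<comment> \<open>The exceptional sets are countably many. At a given \<open>\<xi>\<close> any
    integer above \<open>norm \<xi>\<close> gives a positive factor that can be cancelled.\<close>
  have "AE \<xi> in lborel. \<forall>n. n > 0 \<longrightarrow> hartley (bump ((real n)\<^sup>2) 0) \<xi> *\<^sub>R k \<xi> = 0"
    unfolding AE_all_countable using ae by (auto intro: AE_mp)
  then show ?thesis
  proof eventually_elim
    case (elim \<xi>)
    obtain n :: nat where n: "norm \<xi> < real n" using reals_Archimedean2 by blast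
    then have "n > 0" using norm_ge_zero[of \<xi>] by (intro gr0I) auto
    then have "k \<xi> = 0" using elim[rule_format, of n] hartley_bump_pos[OF n] by simp
    then show ?case by (simp add: k_def eq_neg_iff_add_eq_0)
  qed
qed

lemma hartley_imp_ext_deriv_l2:
  fixes x :: "('q::{finite, linorder}, 'k::euclidean_space) l2_form"
  assumes sq: "square_integrable (\<lambda>\<xi>. - wedge_vec \<xi> (rep_l2 (hartley_l2 x) (- \<xi>)))" (is "square_integrable ?G")
  shows "(x, hartley_l2 (abs_l2 ?G)) \<in> ext_deriv_l2"
proof -
  let ?X = "rep_l2 (hartley_l2 x)"
  have X: "square_integrable ?X" by (rule square_integrable_rep_l2)
  have "hartley_l2 (abs_l2 ?G) \<bullet> abs_l2 h = x \<bullet> abs_l2 (codiff h)" if h: "test_form h" for h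
  proof -
    have bh: "bounded_integrable h" by (rule bounded_integrable_test_form[OF h])
    have "hartley_l2 (abs_l2 ?G) \<bullet> abs_l2 h = abs_l2 ?G \<bullet> abs_l2 (hartley h)"
      by (rule hartley_l2_inner_abs[OF bh])
    also have "\<dots> = (\<integral>\<xi>. ?G \<xi> \<bullet> hartley h \<xi> \<partial>lborel)"
      by (intro abs_l2_inner sq square_integrable_hartley bh)
    also have "\<dots> = (\<integral>\<xi>. ?X \<xi> \<bullet> hartley (codiff h) \<xi> \<partial>lborel)"
      unfolding integral_hartley_codiff(2)[OF X h] inner_minus_left by (rule Bochner_Integration.integral_minus)
    also have "\<dots> = x \<bullet> abs_l2 (codiff h)"
      by (rule hartley_l2_inner_test[symmetric]) (intro bounded_integrable_test_form test_form_codiff h)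
    finally show ?thesis .
  qed
  then show ?thesis by (simp add: ext_deriv_l2_def)
qed

text \<open>Membership in the adjoint is tested against every pair of \<open>ext_deriv_l2\<close>;
  such pairs are known on the transform side by \<open>ext_deriv_l2_imp_hartley\<close>.
  Transposition and reflection then produce the contraction with a positive sign.\<close>

lemma hartley_imp_adjoint_ext_deriv_l2:
  fixes x :: "('q::{finite, linorder}, 'k::euclidean_space) l2_form"
  assumes sq: "square_integrable (\<lambda>\<xi>. contract_vec \<xi> (rep_l2 (hartley_l2 x) (- \<xi>)))" (is "square_integrable ?G")
  shows "(x, hartley_l2 (abs_l2 ?G)) \<in> adjoint_op ext_deriv_l2"
proof -
  let ?X = "rep_l2 (hartley_l2 x)"
  have "v \<bullet> x = u \<bullet> hartley_l2 (abs_l2 ?G)" if uv: "(u, v) \<in> ext_deriv_l2" for u v :: "('q, 'k) l2_form"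
  proof -
    let ?U = "rep_l2 (hartley_l2 u)" and ?V = "rep_l2 (hartley_l2 v)"
    have V: "AE \<xi> in lborel. ?V \<xi> = - wedge_vec \<xi> (?U (- \<xi>))" by (rule ext_deriv_l2_imp_hartley[OF uv])
    have i: "integrable lborel (\<lambda>\<xi>. ?U \<xi> \<bullet> ?G \<xi>)"
      by (intro square_integrable_inner square_integrable_rep_l2 sq)
    have [measurable]: "?G \<in> borel_measurable borel" using square_integrable_measurable[OF sq] by simp
    have [measurable]: "(\<lambda>\<xi>. - \<xi>) \<in> borel_measurable (borel :: (real, 'q) vec measure)" by simp
    have "v \<bullet> x = hartley_l2 v \<bullet> hartley_l2 x" by (simp only: hartley_l2_inner)
    also have "\<dots> = (\<integral>\<xi>. ?V \<xi> \<bullet> ?X \<xi> \<partial>lborel)" by (rule inner_l2_eq)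
    also have "\<dots> = (\<integral>\<xi>. ?U (- \<xi>) \<bullet> ?G (- \<xi>) \<partial>lborel)"
    proof (rule integral_cong_AE)
      show "AE \<xi> in lborel. ?V \<xi> \<bullet> ?X \<xi> = ?U (- \<xi>) \<bullet> ?G (- \<xi>)"
        using V
      proof eventually_elim
        case (elim \<xi>)
        have "?V \<xi> \<bullet> ?X \<xi> = - (?U (- \<xi>) \<bullet> contract_vec \<xi> (?X \<xi>))"
          by (simp only: elim inner_minus_left wedge_vec_inner)
        then show ?case by (simp only: contract_vec_uminus inner_minus_right minus_minus)
      qed
    qed measurable
    also have "\<dots> = (\<integral>\<xi>. ?U \<xi> \<bullet> ?G \<xi> \<partial>lborel)" by (rule integrable_reflect(2)[OF i])
    also have "\<dots> = abs_l2 ?U \<bullet> abs_l2 ?G"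
      by (rule abs_l2_inner[symmetric]) (intro square_integrable_rep_l2 sq)+
    also have "\<dots> = u \<bullet> hartley_l2 (abs_l2 ?G)" by (simp only: abs_rep_l2 hartley_l2_symmetric)
    finally show ?thesis .
  qed
  then show ?thesis by (auto simp: adjoint_op_def)
qed

text \<open>Pair the d-part of each element with the adjoint part of the other; both equalities are
  instances of the definition of the adjoint.\<close>

lemma dirac_symmetric:
  assumes "(x, y) \<in> dirac" "(u, v) \<in> dirac"
  shows "y \<bullet> u = x \<bullet> v"
proof -
  obtain G H where y: "y = G + H" "(x, G) \<in> ext_deriv_l2" "(x, H) \<in> adjoint_op ext_deriv_l2"
    using assms(1) unfolding dirac_def by blast
  obtain G' H' where v: "v = G' + H'" "(u, G') \<in> ext_deriv_l2" "(u, H') \<in> adjoint_op ext_deriv_l2"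
    using assms(2) unfolding dirac_def by blast
  have "G \<bullet> u = x \<bullet> H'" using v(3) y(2) unfolding adjoint_op_def by blast
  moreover have "G' \<bullet> x = u \<bullet> H" using y(3) v(2) unfolding adjoint_op_def by blast
  ultimately show ?thesis
    unfolding y(1) v(1) inner_add_left inner_add_right by (simp only: inner_commute add.commute)
qed

text \<open>The two images are orthogonal because contraction squares to 0, so the norms add by
  Pythagoras.\<close>

lemma norm_dirac_symbol:
  fixes w :: "'k::real_inner ^ ('q::{finite, linorder} set)"
  shows "norm (contract_vec \<xi> w - wedge_vec \<xi> w) = norm \<xi> * norm w"
proof (rule power2_eq_imp_eq)
  have "wedge_vec \<xi> w \<bullet> contract_vec \<xi> w = 0"
    by (simp add: wedge_vec_inner contract_vec_contract_vec)
  then have "(norm (contract_vec \<xi> w - wedge_vec \<xi> w))\<^sup>2 = (norm (wedge_vec \<xi> w))\<^sup>2 + (norm (contract_vec \<xi> w))\<^sup>2"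
    by (simp add: power2_norm_eq_inner inner_diff_left inner_diff_right inner_commute)
  then show "(norm (contract_vec \<xi> w - wedge_vec \<xi> w))\<^sup>2 = (norm \<xi> * norm w)\<^sup>2"
    by (simp add: norm_wedge_contract_vec power_mult_distrib)
qed simp_all

text \<open>\<open>dirac\<close> asks for the domains of d and of its adjoint separately. By
  \<open>norm_dirac_symbol\<close> the full symbol has norm \<open>norm \<xi> * norm w\<close>,
  which dominates either part, so square integrability of the sum is inherited by both.\<close>

lemma hartley_imp_dirac:
  fixes x y :: "('q::{finite, linorder}, 'k::euclidean_space) l2_form"
  assumes ae: "AE \<xi> in lborel. rep_l2 (hartley_l2 y) \<xi>
    = contract_vec \<xi> (rep_l2 (hartley_l2 x) (- \<xi>)) - wedge_vec \<xi> (rep_l2 (hartley_l2 x) (- \<xi>))"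
  shows "(x, y) \<in> dirac"
proof -
  let ?X = "rep_l2 (hartley_l2 x)" and ?Y = "rep_l2 (hartley_l2 y)"
  have Y: "square_integrable ?Y" by (rule square_integrable_rep_l2)
  have mX: "(\<lambda>\<xi>. ?X (- \<xi>)) \<in> borel_measurable borel"
    using square_integrable_measurable[OF square_integrable_reflect[OF square_integrable_rep_l2[of "hartley_l2 x"]]] by simp
  note m = measurable_wedge_contract_vec[OF mX]
  have nY: "AE \<xi> in lborel. norm \<xi> * norm (?X (- \<xi>)) = norm (?Y \<xi>)"
    using ae
  proof eventually_elim
    case (elim \<xi>)
    show ?case unfolding elim
      by (rule norm_dirac_symbol[symmetric])
  qed
  have sqC: "square_integrable (\<lambda>\<xi>. contract_vec \<xi> (?X (- \<xi>)))"
  proof (rule square_integrable_bound[OF Y])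
    show "AE \<xi> in lborel. norm (contract_vec \<xi> (?X (- \<xi>))) \<le> 1 * norm (?Y \<xi>)"
      using nY
    proof eventually_elim
      case (elim \<xi>)
      show ?case using norm_contract_vec_le[of \<xi> "?X (- \<xi>)"] unfolding elim by simp
    qed
  qed (use m in simp)
  have sqW: "square_integrable (\<lambda>\<xi>. - wedge_vec \<xi> (?X (- \<xi>)))"
  proof (rule square_integrable_bound[OF Y])
    show "AE \<xi> in lborel. norm (- wedge_vec \<xi> (?X (- \<xi>))) \<le> 1 * norm (?Y \<xi>)"
      using nY
    proof eventually_elim
      case (elim \<xi>)
      show ?case using norm_wedge_vec_le[of \<xi> "?X (- \<xi>)"] unfolding elim by simp
    qed
  qed (use m in simp)
  let ?G = "hartley_l2 (abs_l2 (\<lambda>\<xi>. - wedge_vec \<xi> (?X (- \<xi>))))"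
  let ?H = "hartley_l2 (abs_l2 (\<lambda>\<xi>. contract_vec \<xi> (?X (- \<xi>))))"
  have "hartley_l2 y = abs_l2 ?Y" by simp
  also have "\<dots> = abs_l2 (\<lambda>\<xi>. - wedge_vec \<xi> (?X (- \<xi>)) + contract_vec \<xi> (?X (- \<xi>)))"
    using ae by (subst abs_l2_eq_iff[OF Y square_integrable_add[OF sqW sqC]]) (simp add: add.commute)
  also have "\<dots> = abs_l2 (\<lambda>\<xi>. - wedge_vec \<xi> (?X (- \<xi>))) + abs_l2 (\<lambda>\<xi>. contract_vec \<xi> (?X (- \<xi>)))"
    by (rule abs_l2_add[OF sqW sqC, symmetric])
  finally have "y = ?G + ?H" using hartley_l2_involution[of y] by (simp only: hartley_l2_add)
  moreover have "(x, ?G) \<in> ext_deriv_l2" by (rule hartley_imp_ext_deriv_l2[OF sqW])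
  moreover have "(x, ?H) \<in> adjoint_op ext_deriv_l2" by (rule hartley_imp_adjoint_ext_deriv_l2[OF sqC])
  ultimately show ?thesis unfolding dirac_def by blast
qed

subsection \<open>Spectral resolution of the Dirac operator\<close>

text \<open>
  On the Hartley side the Dirac operator is \<open>X \<mapsto> (\<lambda>\<xi>. \<sigma>(\<xi>) X(- \<xi>))\<close> with
  \<open>\<sigma>(\<xi>) = contract_vec \<xi> - wedge_vec \<xi>\<close> and \<open>\<sigma>(\<xi>)\<^sup>2 = - |\<xi>|\<^sup>2\<close>. With
  \<open>s(\<xi>) = sgn \<xi>\<^sub>i\<close> the operator \<open>T X = (\<lambda>\<xi>. s(\<xi>) \<sigma>(\<xi>) X(- \<xi>) / |\<xi>|)\<close> satisfies
  \<open>T\<^sup>2 = -1 = - T\<^sup>* T\<close>, and conjugation by the unitary \<open>(1 + T) / \<surd>2\<close> turns the Dirac operator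
  into multiplication by \<open>s(\<xi>) |\<xi>|\<close>.
\<close>

definition dirac_phase :: "'q \<Rightarrow> real ^ ('q::{finite, linorder}) \<Rightarrow> 'k ^ ('q set) \<Rightarrow> 'k::real_vector ^ ('q set)"
  where "dirac_phase i \<xi> w = (sgn (\<xi> $ i) / norm \<xi>) *\<^sub>R (contract_vec \<xi> w - wedge_vec \<xi> w)"

text \<open>Symbol and sign are both odd. The sign factor exists for this reason: with an even phase
  the reflection drops out of the square of T, which is then -1 and not +1.\<close>

lemma dirac_phase_uminus [simp]: "dirac_phase i (- \<xi>) w = dirac_phase i \<xi> w"
proof -
  have eq: "contract_vec (- \<xi>) w - wedge_vec (- \<xi>) w = - (contract_vec \<xi> w - wedge_vec \<xi> w)"
    by simp
  show ?thesis
    unfolding dirac_phase_def eq norm_minus_cancel vector_uminus_component sgn_minus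
    by (simp del: minus_diff_eq)
qed

lemma linear_dirac_phase: "linear (dirac_phase i \<xi>)"
  unfolding dirac_phase_def
  by (intro linear_compose_scale_right linear_compose_sub linear_contract_vec linear_wedge_vec)

lemma dirac_phase_inner: "dirac_phase i \<xi> v \<bullet> w = - (v \<bullet> dirac_phase i \<xi> w)"
  for v w :: "'k::real_inner ^ ('q::{finite, linorder} set)"
proof -
  have "contract_vec \<xi> v \<bullet> w = v \<bullet> wedge_vec \<xi> w"
    using wedge_vec_inner[of \<xi> w v] by (simp only: inner_commute)
  then have "(contract_vec \<xi> v - wedge_vec \<xi> v) \<bullet> w = - (v \<bullet> (contract_vec \<xi> w - wedge_vec \<xi> w))"
    by (simp only: inner_diff_left inner_diff_right wedge_vec_inner minus_diff_eq)
  then show ?thesis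
    unfolding dirac_phase_def inner_scaleR_left inner_scaleR_right by simp
qed

lemma dirac_phase_square:
  fixes w :: "'k::real_inner ^ ('q::{finite, linorder} set)"
  assumes "\<xi> $ i \<noteq> 0"
  shows "dirac_phase i \<xi> (dirac_phase i \<xi> w) = - w"
proof -
  let ?s = "\<lambda>w. contract_vec \<xi> w - wedge_vec \<xi> w"
  have "?s (?s w) = - (wedge_vec \<xi> (contract_vec \<xi> w) + contract_vec \<xi> (wedge_vec \<xi> w))"
    by (simp add: linear_diff[OF linear_contract_vec] linear_diff[OF linear_wedge_vec]
        contract_vec_contract_vec wedge_vec_wedge_vec)
  then have "?s (?s w) = - ((norm \<xi>)\<^sup>2 *\<^sub>R w)" by (simp only: wedge_contract_vec power2_norm_eq_inner)
  moreover have "dirac_phase i \<xi> (dirac_phase i \<xi> w) = ((sgn (\<xi> $ i) / norm \<xi>) * (sgn (\<xi> $ i) / norm \<xi>)) *\<^sub>R ?s (?s w)"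
    by (simp only: dirac_phase_def linear_scale[OF linear_contract_vec] linear_scale[OF linear_wedge_vec]
        scaleR_scaleR flip: scaleR_diff_right)
  moreover have "norm \<xi> \<noteq> 0" using assms by auto
  then have "((sgn (\<xi> $ i) / norm \<xi>) * (sgn (\<xi> $ i) / norm \<xi>)) * (norm \<xi>)\<^sup>2 = 1"
    using assms by (simp add: power2_eq_square sgn_if)
  ultimately show ?thesis by (simp only: scaleR_minus_right scaleR_scaleR scaleR_one)
qed

lemma norm_dirac_phase_le: "norm (dirac_phase i \<xi> w) \<le> norm w"
  for w :: "'k::real_inner ^ ('q::{finite, linorder} set)"
  unfolding dirac_phase_def norm_scaleR norm_dirac_symbol by (simp add: sgn_if)

lemma square_integrable_dirac_phase:
  fixes X :: "real ^ ('q::{finite, linorder}) \<Rightarrow> 'k::euclidean_space ^ ('q set)"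
  assumes X: "square_integrable X"
  shows "square_integrable (\<lambda>\<xi>. dirac_phase i \<xi> (X (- \<xi>)))"
proof -
  note R = square_integrable_reflect[OF X]
  have m: "(\<lambda>\<xi>. X (- \<xi>)) \<in> borel_measurable borel"
    using square_integrable_measurable[OF R] by simp
  note [measurable] = measurable_wedge_contract_vec[OF m]
  have [measurable]: "(\<lambda>\<xi> :: (real, 'q) vec. \<xi> $ i) \<in> borel_measurable borel"
    by (intro borel_measurable_continuous_onI continuous_intros)
  have [measurable]: "(sgn :: real \<Rightarrow> real) \<in> borel_measurable borel"
    by (simp only: sgn_if[abs_def]) measurable
  show ?thesis
  proof (rule square_integrable_bound[OF R])
    show "AE \<xi> in lborel. norm (dirac_phase i \<xi> (X (- \<xi>))) \<le> 1 * norm (X (- \<xi>))"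
      using norm_dirac_phase_le by (intro AE_I2) simp
    show "(\<lambda>\<xi>. dirac_phase i \<xi> (X (- \<xi>))) \<in> borel_measurable lborel"
      unfolding dirac_phase_def by measurable
  qed
qed

text \<open>The operator \<open>(1 + c T) / \<surd>2\<close>. Keeping \<open>c\<close> as a
  parameter covers the unitary for \<open>c = 1\<close> and its inverse for
  \<open>c = - 1\<close>.\<close>

definition phase_l2 :: "real \<Rightarrow> 'q \<Rightarrow> ('q::{finite, linorder}, 'k::euclidean_space) l2_form \<Rightarrow> ('q, 'k) l2_form"
  where "phase_l2 c i F = abs_l2 (\<lambda>\<xi>. (1 / sqrt 2) *\<^sub>R (rep_l2 F \<xi> + c *\<^sub>R dirac_phase i \<xi> (rep_l2 F (- \<xi>))))"

lemma square_integrable_phase: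
  fixes F :: "('q::{finite, linorder}, 'k::euclidean_space) l2_form"
  shows "square_integrable (\<lambda>\<xi>. (1 / sqrt 2) *\<^sub>R (rep_l2 F \<xi> + c *\<^sub>R dirac_phase i \<xi> (rep_l2 F (- \<xi>))))"
  by (intro square_integrable_scaleR square_integrable_add square_integrable_rep_l2 square_integrable_dirac_phase)

lemma rep_phase_l2:
  "AE \<xi> in lborel. rep_l2 (phase_l2 c i F) \<xi> = (1 / sqrt 2) *\<^sub>R (rep_l2 F \<xi> + c *\<^sub>R dirac_phase i \<xi> (rep_l2 F (- \<xi>)))"
  unfolding phase_l2_def by (rule rep_abs_l2[OF square_integrable_phase])

lemma rep_phase_l2_reflect:
  "AE \<xi> in lborel. rep_l2 (phase_l2 c i F) (- \<xi>) = (1 / sqrt 2) *\<^sub>R (rep_l2 F (- \<xi>) + c *\<^sub>R dirac_phase i \<xi> (rep_l2 F \<xi>))"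
  using AE_lborel_reflect[OF rep_phase_l2[of c i F]] by simp

text \<open>On this hyperplane \<open>sgn\<close> is 0 and the phase vanishes, so the relation for
  the square of T holds only off it.\<close>

lemma AE_component_nonzero: "AE \<xi> in lborel. (\<xi> :: real ^ 'q) $ i \<noteq> 0"
proof -
  have "negligible {x :: (real, 'q) vec. axis i 1 \<bullet> x = 0}"
    by (rule negligible_hyperplane) simp
  moreover have "closed {x :: (real, 'q) vec. axis i 1 \<bullet> x = 0}" by (rule closed_hyperplane)
  then have "{x :: (real, 'q) vec. axis i 1 \<bullet> x = 0} \<in> sets lborel" by simp
  ultimately have "{x :: (real, 'q) vec. axis i 1 \<bullet> x = 0} \<in> null_sets lborel"
    by (simp only: negligible_iff_null_sets null_sets_completion_iff)
  then show ?thesis by (rule AE_I') (auto simp: inner_axis')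
qed

text \<open>As T squares to -1, \<open>(1 - c T) (1 + c T) = 1 + c\<^sup>2 = 2\<close>.\<close>

lemma phase_l2_inverse:
  assumes c: "c * c = 1"
  shows "phase_l2 (- c) i (phase_l2 c i F) = F"
proof (rule l2_eqI)
  show "AE \<xi> in lborel. rep_l2 (phase_l2 (- c) i (phase_l2 c i F)) \<xi> = rep_l2 F \<xi>"
    using rep_phase_l2[of "- c" i "phase_l2 c i F"] rep_phase_l2[of c i F] rep_phase_l2_reflect[of c i F]
      AE_component_nonzero[of i]
  proof eventually_elim
    case (elim \<xi>)
    let ?x = "rep_l2 F \<xi>" and ?y = "rep_l2 F (- \<xi>)" and ?T = "dirac_phase i \<xi>" and ?r = "1 / sqrt 2"
    have "?T (?r *\<^sub>R (?y + c *\<^sub>R ?T ?x)) = ?r *\<^sub>R (?T ?y - c *\<^sub>R ?x)"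
      by (simp add: dirac_phase_square[OF elim(4)] linear_scale[OF linear_dirac_phase] linear_add[OF linear_dirac_phase])
    then have "rep_l2 (phase_l2 (- c) i (phase_l2 c i F)) \<xi>
      = ?r *\<^sub>R (?r *\<^sub>R (?x + c *\<^sub>R ?T ?y) + (- c) *\<^sub>R (?r *\<^sub>R (?T ?y - c *\<^sub>R ?x)))"
      by (simp only: elim(1-3))
    also have "\<dots> = (?r * ?r) *\<^sub>R ((1 + c * c) *\<^sub>R ?x)"
      by (simp add: scaleR_add_right scaleR_diff_right scaleR_add_left mult_ac)
    also have "\<dots> = ?x" using c by simp
    finally show ?case .
  qed
qed

lemma phase_l2_add: "phase_l2 c i (F + G) = phase_l2 c i F + phase_l2 c i G"
proof (rule l2_eqI)
  show "AE \<xi> in lborel. rep_l2 (phase_l2 c i (F + G)) \<xi> = rep_l2 (phase_l2 c i F + phase_l2 c i G) \<xi>"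
    using rep_phase_l2[of c i "F + G"] rep_phase_l2[of c i F] rep_phase_l2[of c i G]
      rep_l2_add[of "phase_l2 c i F" "phase_l2 c i G"] rep_l2_add[of F G] AE_lborel_reflect[OF rep_l2_add[of F G]]
    by eventually_elim (simp add: linear_add[OF linear_dirac_phase] scaleR_add_right)
qed

lemma phase_l2_scaleR: "phase_l2 c i (a *\<^sub>R F) = a *\<^sub>R phase_l2 c i F"
proof (rule l2_eqI)
  show "AE \<xi> in lborel. rep_l2 (phase_l2 c i (a *\<^sub>R F)) \<xi> = rep_l2 (a *\<^sub>R phase_l2 c i F) \<xi>"
    using rep_phase_l2[of c i "a *\<^sub>R F"] rep_phase_l2[of c i F]
      rep_l2_scaleR[of a "phase_l2 c i F"] rep_l2_scaleR[of a F] AE_lborel_reflect[OF rep_l2_scaleR[of a F]]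
    by eventually_elim (simp add: linear_scale[OF linear_dirac_phase] scaleR_add_right mult_ac)
qed

text \<open>T is skew: the phase is pointwise skew, and being even it is unaffected by the
  substitution that moves the reflection to the other factor.\<close>

lemma phase_l2_adjoint: "phase_l2 c i F \<bullet> G = F \<bullet> phase_l2 (- c) i G"
proof -
  let ?x = "rep_l2 F" and ?y = "rep_l2 G" and ?T = "dirac_phase i" and ?r = "1 / sqrt 2"
  have sT: "square_integrable (\<lambda>\<xi>. ?T \<xi> (rep_l2 H (- \<xi>)))" for H :: "('a, 'b) l2_form"
    by (intro square_integrable_dirac_phase square_integrable_rep_l2)
  have i0: "integrable lborel (\<lambda>\<xi>. ?x \<xi> \<bullet> ?y \<xi>)"
    and i1: "integrable lborel (\<lambda>\<xi>. ?T \<xi> (?x (- \<xi>)) \<bullet> ?y \<xi>)"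
    and i2: "integrable lborel (\<lambda>\<xi>. ?x \<xi> \<bullet> ?T \<xi> (?y (- \<xi>)))"
    by (intro square_integrable_inner square_integrable_rep_l2 sT)+
  have "(\<integral>\<xi>. ?T \<xi> (?x (- \<xi>)) \<bullet> ?y \<xi> \<partial>lborel) = (\<integral>\<xi>. ?T (- \<xi>) (?x (- (- \<xi>))) \<bullet> ?y (- \<xi>) \<partial>lborel)"
    by (rule integrable_reflect(2)[OF i1, symmetric])
  also have "\<dots> = (\<integral>\<xi>. - (?x \<xi> \<bullet> ?T \<xi> (?y (- \<xi>))) \<partial>lborel)"
    by (simp only: minus_minus dirac_phase_uminus dirac_phase_inner)
  finally have swap: "(\<integral>\<xi>. ?T \<xi> (?x (- \<xi>)) \<bullet> ?y \<xi> \<partial>lborel) = - (\<integral>\<xi>. ?x \<xi> \<bullet> ?T \<xi> (?y (- \<xi>)) \<partial>lborel)"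
    by simp
  have "phase_l2 c i F \<bullet> G = phase_l2 c i F \<bullet> abs_l2 ?y" by simp
  also have "\<dots> = (\<integral>\<xi>. (?r *\<^sub>R (?x \<xi> + c *\<^sub>R ?T \<xi> (?x (- \<xi>)))) \<bullet> ?y \<xi> \<partial>lborel)"
    unfolding phase_l2_def by (rule abs_l2_inner[OF square_integrable_phase square_integrable_rep_l2])
  also have "\<dots> = ?r * ((\<integral>\<xi>. ?x \<xi> \<bullet> ?y \<xi> \<partial>lborel) + c * (\<integral>\<xi>. ?T \<xi> (?x (- \<xi>)) \<bullet> ?y \<xi> \<partial>lborel))"
    using i0 i1 by (simp add: inner_add_left)
  also have "\<dots> = (\<integral>\<xi>. ?x \<xi> \<bullet> (?r *\<^sub>R (?y \<xi> + (- c) *\<^sub>R ?T \<xi> (?y (- \<xi>)))) \<partial>lborel)"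
    unfolding swap using i0 i2 by (simp add: inner_add_right inner_diff_right)
  also have "\<dots> = abs_l2 ?x \<bullet> phase_l2 (- c) i G"
    unfolding phase_l2_def by (rule abs_l2_inner[OF square_integrable_rep_l2 square_integrable_phase, symmetric])
  finally show ?thesis by simp
qed

text \<open>On the transform side D is \<open>m T\<close> with \<open>m\<close> odd. Since T
  contains the reflection, \<open>T m = - m T\<close>, and together with
  \<open>T\<^sup>2 = - 1\<close> this gives \<open>(1 + T) m T (1 - T) = 2 m\<close>. An even
  \<open>g\<close> sees only \<open>norm \<xi>\<close>, so its multiplier commutes with T and is
  unchanged by the conjugation.\<close>

theorem functional_calculus_dirac:
  fixes x y :: "('q::{finite, linorder}, 'k::euclidean_space) l2_form"
  assumes g: "g \<in> borel_measurable borel" and even: "\<And>r. g (- r) = g r"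
    and ae: "AE \<xi> in lborel. rep_l2 (hartley_l2 y) \<xi> = g (norm \<xi>) *\<^sub>R rep_l2 (hartley_l2 x) \<xi>"
  shows "(x, y) \<in> functional_calculus dirac g"
proof -
  \<comment> \<open>Any coordinate will do: its sign distinguishes \<open>\<xi>\<close> from
    \<open>- \<xi>\<close> off a null set.\<close>
  define i :: 'q where "i = undefined"
  define m where "m \<xi> = sgn (\<xi> $ i) * norm \<xi>" for \<xi> :: "(real, 'q) vec"
  define K where "K F = phase_l2 1 i (hartley_l2 F)" for F :: "('q, 'k) l2_form"
  define K' where "K' F = hartley_l2 (phase_l2 (- 1) i F)" for F :: "('q, 'k) l2_form"
  have [measurable]: "(\<lambda>\<xi> :: (real, 'q) vec. \<xi> $ i) \<in> borel_measurable borel"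
    by (intro borel_measurable_continuous_onI continuous_intros)
  have [measurable]: "(sgn :: real \<Rightarrow> real) \<in> borel_measurable borel"
    by (simp only: sgn_if[abs_def]) measurable
  interpret multiplication_representation K K' m
  proof
    fix x y F and c :: real
    show "K (x + y) = K x + K y" by (simp add: K_def hartley_l2_add phase_l2_add)
    show "K (c *\<^sub>R x) = c *\<^sub>R K x" by (simp add: K_def hartley_l2_scaleR phase_l2_scaleR)
    show "K (K' F) = F" using phase_l2_inverse[of "- 1" i F] by (simp add: K_def K'_def)
    show "K' (K x) = x" using phase_l2_inverse[of 1 i "hartley_l2 x"] by (simp add: K_def K'_def)
    have "K x \<bullet> K y = hartley_l2 x \<bullet> hartley_l2 y"
      using phase_l2_inverse[of 1 i "hartley_l2 y"] by (simp add: K_def phase_l2_adjoint)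
    then show "K x \<bullet> K y = x \<bullet> y" by (simp only: hartley_l2_inner)
    show "m \<in> borel_measurable borel" unfolding m_def by measurable
  qed
  have "spectral_resolution dirac projection"
  proof (rule symmetric_extension_eq)
    show "y \<bullet> u = x \<bullet> v" if "(x, y) \<in> dirac" "(u, v) \<in> dirac" for x y u v :: "('q, 'k) l2_form"
      using that by (rule dirac_symmetric)
    fix x y
    assume K: "AE \<xi> in lborel. rep_l2 (K y) \<xi> = m \<xi> *\<^sub>R rep_l2 (K x) \<xi>"
    let ?A = "rep_l2 (K x)" and ?T = "dirac_phase i" and ?r = "1 / sqrt 2"
    have x: "hartley_l2 x = phase_l2 (- 1) i (K x)" and y: "hartley_l2 y = phase_l2 (- 1) i (K y)"
      unfolding K_def by (simp_all only: phase_l2_inverse mult_1)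
    show "(x, y) \<in> dirac"
    proof (rule hartley_imp_dirac)
      show "AE \<xi> in lborel. rep_l2 (hartley_l2 y) \<xi>
        = contract_vec \<xi> (rep_l2 (hartley_l2 x) (- \<xi>)) - wedge_vec \<xi> (rep_l2 (hartley_l2 x) (- \<xi>))"
        unfolding x y using rep_phase_l2_reflect[of "- 1" i "K x"] rep_phase_l2[of "- 1" i "K y"]
          K AE_lborel_reflect[OF K] AE_component_nonzero[of i]
      proof eventually_elim
        case (elim \<xi>)
        have n0: "norm \<xi> \<noteq> 0" using elim(5) by auto
        have symbol: "contract_vec \<xi> w - wedge_vec \<xi> w = m \<xi> *\<^sub>R ?T \<xi> w" for w :: "('k, 'q set) vec"
        proof -
          have "m \<xi> * (sgn (\<xi> $ i) / norm \<xi>) = 1" using n0 elim(5) by (simp add: m_def sgn_if)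
          then show ?thesis by (simp only: dirac_phase_def scaleR_scaleR scaleR_one)
        qed
        have m: "m (- \<xi>) = - m \<xi>" by (simp add: m_def sgn_if)
        have "contract_vec \<xi> (rep_l2 (phase_l2 (- 1) i (K x)) (- \<xi>)) - wedge_vec \<xi> (rep_l2 (phase_l2 (- 1) i (K x)) (- \<xi>))
          = m \<xi> *\<^sub>R ?T \<xi> (?r *\<^sub>R (?A (- \<xi>) + (- 1) *\<^sub>R ?T \<xi> (?A \<xi>)))"
          unfolding symbol elim(1) ..
        \<comment> \<open>Both rules enter here: \<open>- T\<^sup>2 = 1\<close> in the first term,
          and a sign change when \<open>m\<close> is moved past the reflection in the
          second.\<close>
        also have "\<dots> = ?r *\<^sub>R (m \<xi> *\<^sub>R ?A \<xi> + (- 1) *\<^sub>R ?T \<xi> (m (- \<xi>) *\<^sub>R ?A (- \<xi>)))"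
          by (simp add: dirac_phase_square[OF elim(5)] m linear_scale[OF linear_dirac_phase] linear_diff[OF linear_dirac_phase]
              linear_neg[OF linear_dirac_phase] scaleR_add_right mult.commute add.commute)
        also have "\<dots> = rep_l2 (phase_l2 (- 1) i (K y)) \<xi>"
          unfolding elim(2) elim(3) elim(4) ..
        finally show ?case by (rule sym)
      qed
    qed
  qed
  moreover have "(x, y) \<in> spectral_integral projection g"
    unfolding spectral_integral_iff[OF g] K_def
    using rep_phase_l2[of 1 i "hartley_l2 x"] rep_phase_l2[of 1 i "hartley_l2 y"] ae AE_lborel_reflect[OF ae]
      AE_component_nonzero[of i]
  proof eventually_elim
    case (elim \<xi>)
    have "g (m \<xi>) = g (norm \<xi>)" using elim(5) even by (simp add: m_def sgn_if)
    then show ?case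
      unfolding elim(1-4)
      by (simp add: linear_scale[OF linear_dirac_phase] scaleR_add_right mult.commute)
  qed
  ultimately show ?thesis
    unfolding functional_calculus_def by blast
qed

lemma dirac_calculusI:
  fixes f w :: "('q::{finite, linorder}, 'k::euclidean_space) form"
  assumes g: "g \<in> borel_measurable borel" and even: "\<And>r. g (- r) = g r"
    and f: "test_form f" and w: "test_form w"
    and eq: "\<And>\<xi>. hartley w \<xi> = g (norm \<xi>) *\<^sub>R hartley f \<xi>"
  shows "dirac_calculus g f w"
proof -
  note bf = bounded_integrable_test_form[OF f] and bw = bounded_integrable_test_form[OF w]
  have "AE \<xi> in lborel. rep_l2 (hartley_l2 (abs_l2 w)) \<xi> = g (norm \<xi>) *\<^sub>R rep_l2 (hartley_l2 (abs_l2 f)) \<xi>"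
    unfolding hartley_l2_abs[OF bf] hartley_l2_abs[OF bw]
    using rep_abs_l2[OF square_integrable_hartley[OF bf]] rep_abs_l2[OF square_integrable_hartley[OF bw]]
    by eventually_elim (simp only: eq)
  then have "(abs_l2 f, abs_l2 w) \<in> functional_calculus dirac g"
    by (rule functional_calculus_dirac[OF g even])
  then show ?thesis
    using w bounded_integrable_imp_square_integrable[OF bf] bounded_integrable_imp_square_integrable[OF bw]
    by (simp add: dirac_calculus_def test_form_def)
qed

subsection \<open>Weighted means over balls\<close>

definition weight :: "(real ^ 'q \<Rightarrow> real) \<Rightarrow> bool"
  where "weight \<omega> \<longleftrightarrow> \<omega> \<in> borel_measurable borel \<and> (\<exists>B. \<forall>y. \<bar>\<omega> y\<bar> \<le> B) \<and> (\<forall>y. norm y > 1 \<longrightarrow> \<omega> y = 0)"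

text \<open>An unnormalised mean over the ball of radius \<open>\<bar>t\<bar>\<close> in rescaled
  variables. The domain of integration is fixed and \<open>t\<close> enters only through the
  argument of \<open>h\<close>, so \<open>t = 0\<close> is an ordinary value.\<close>

definition wmean :: "(real ^ 'q \<Rightarrow> real) \<Rightarrow> (real ^ 'q \<Rightarrow> 'b::euclidean_space) \<Rightarrow> real \<Rightarrow> real ^ 'q \<Rightarrow> 'b"
  where "wmean \<omega> h t p = (\<integral>y. \<omega> y *\<^sub>R h (p + t *\<^sub>R y) \<partial>lborel)"

lemma weight_mult_continuous:
  fixes f :: "real ^ 'q \<Rightarrow> real"
  assumes w: "weight \<omega>" and f: "continuous_on UNIV f"
  shows "weight (\<lambda>y. \<omega> y * f y)"
proof -
  obtain B where B: "\<And>y. \<bar>\<omega> y\<bar> \<le> B" using w unfolding weight_def by blast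
  have "bounded (f ` cball 0 1)"
    by (intro compact_imp_bounded compact_continuous_image compact_cball continuous_on_subset[OF f]) auto
  then obtain M where M: "\<forall>y\<in>cball 0 1. \<bar>f y\<bar> \<le> M" by (auto simp: bounded_iff)
  have "\<bar>\<omega> y * f y\<bar> \<le> B * M" for y
  proof (cases "norm y \<le> 1")
    case True
    then have "\<bar>f y\<bar> \<le> M" using M by simp
    then show ?thesis unfolding abs_mult using B[of y] by (intro mult_mono) auto
  next
    case False
    then have "\<omega> y = 0" using w by (simp add: weight_def)
    moreover have "0 \<le> B * M" using B[of 0] M[rule_format, of 0] by (intro mult_nonneg_nonneg) auto
    ultimately show ?thesis by simp
  qed
  moreover have "f \<in> borel_measurable borel" using f by (rule borel_measurable_continuous_onI)
  ultimately show ?thesis using w unfolding weight_def by (intro conjI exI[of _ "B * M"]) auto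
qed

lemma weight_integrable:
  fixes g :: "real ^ 'q \<Rightarrow> 'b::euclidean_space"
  assumes w: "weight \<omega>" and g: "continuous_on UNIV g"
  shows "integrable lborel (\<lambda>y. \<omega> y *\<^sub>R g y)"
proof -
  have "continuous_on UNIV (\<lambda>y. norm (g y))" using g by (intro continuous_intros)
  from weight_mult_continuous[OF w this]
  obtain C where C: "\<And>y. \<bar>\<omega> y * norm (g y)\<bar> \<le> C" unfolding weight_def by blast
  have [measurable]: "\<omega> \<in> borel_measurable borel" "g \<in> borel_measurable borel"
    using w g by (auto simp: weight_def intro: borel_measurable_continuous_onI)
  show ?thesis
  proof (rule Bochner_Integration.integrable_bound)
    show "integrable lborel (\<lambda>y :: (real, 'q) vec. indicator (cball 0 1) y * C)"
      using emeasure_lborel_cball_finite[of "0 :: (real, 'q) vec" 1] by auto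
    show "AE y in lborel. norm (\<omega> y *\<^sub>R g y) \<le> norm (indicator (cball 0 1) y * C)"
    proof (rule AE_I2)
      fix y :: "(real, 'q) vec"
      show "norm (\<omega> y *\<^sub>R g y) \<le> norm (indicator (cball 0 1) y * C)"
      proof (cases "norm y \<le> 1")
        case True
        then show ?thesis using C[of y] by (simp add: abs_mult)
      next
        case False
        then show ?thesis using w by (simp add: weight_def)
      qed
    qed
  qed measurable
qed

lemma wmean_integrable:
  fixes h :: "real ^ 'q \<Rightarrow> 'b::euclidean_space"
  assumes "weight \<omega>" "smooth h"
  shows "integrable lborel (\<lambda>y. \<omega> y *\<^sub>R h (p + t *\<^sub>R y))"
proof (rule weight_integrable[OF assms(1)])
  have "continuous_on UNIV (\<lambda>y. p + t *\<^sub>R y)" by (intro continuous_intros)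
  then show "continuous_on UNIV (\<lambda>y. h (p + t *\<^sub>R y))"
    by (rule continuous_on_compose2[OF smooth_continuous[OF assms(2), of UNIV]]) simp
qed

lemma wmean_add_weight:
  assumes "weight \<omega>" "weight \<omega>'" "smooth h"
  shows "wmean (\<lambda>y. a * \<omega> y + b * \<omega>' y) h t p = a *\<^sub>R wmean \<omega> h t p + b *\<^sub>R wmean \<omega>' h t p"
proof -
  have "wmean (\<lambda>y. a * \<omega> y + b * \<omega>' y) h t p
    = (\<integral>y. a *\<^sub>R (\<omega> y *\<^sub>R h (p + t *\<^sub>R y)) + b *\<^sub>R (\<omega>' y *\<^sub>R h (p + t *\<^sub>R y)) \<partial>lborel)"
    unfolding wmean_def by (simp add: scaleR_add_left)
  also have "\<dots> = a *\<^sub>R wmean \<omega> h t p + b *\<^sub>R wmean \<omega>' h t p"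
    unfolding wmean_def integral_scaleR_right[symmetric]
    by (intro Bochner_Integration.integral_add integrable_scaleR_right wmean_integrable assms)
  finally show ?thesis .
qed

lemma wmean_sum:
  assumes "weight \<omega>" "\<And>i. i \<in> I \<Longrightarrow> smooth (h i)"
  shows "wmean \<omega> (\<lambda>x. \<Sum>i\<in>I. h i x) t p = (\<Sum>i\<in>I. wmean \<omega> (h i) t p)"
  unfolding wmean_def scaleR_sum_right
  by (intro Bochner_Integration.integral_sum wmean_integrable assms)

text \<open>The partial derivatives are uniformly continuous on the ball of radius
  \<open>r + 1\<close>, which contains \<open>x + v\<close> for small \<open>v\<close>; the mean
  value inequality does the rest.\<close>

lemma uniformly_differentiable:
  fixes h :: "real ^ 'q \<Rightarrow> 'b::euclidean_space"
  assumes h: "smooth h" and e: "e > 0"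
  obtains d where "d > 0" "\<And>x v. norm x \<le> r \<Longrightarrow> norm v < d
    \<Longrightarrow> norm (h (x + v) - h x - (\<Sum>i\<in>UNIV. v $ i *\<^sub>R partial_deriv i h x)) \<le> e * norm v"
proof -
  let ?h' = "\<lambda>i. partial_deriv i h"
  \<comment> \<open>One share for each coordinate of the gradient.\<close>
  define e' where "e' = e / real CARD('q)"
  have e': "e' > 0" using e by (simp add: e'_def)
  have "uniformly_continuous_on (cball 0 (r + 1)) (?h' i)" for i
    by (intro compact_uniformly_continuous compact_cball smooth_continuous smooth_partial_deriv h)
  then have "\<forall>i. \<exists>d>0. \<forall>x\<in>cball 0 (r + 1). \<forall>x'\<in>cball 0 (r + 1). dist x' x < d \<longrightarrow> dist (?h' i x') (?h' i x) < e'"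
    using e' unfolding uniformly_continuous_on_def by blast
  then obtain D where D: "\<And>i. D i > 0"
    "\<And>i x x'. x \<in> cball 0 (r + 1) \<Longrightarrow> x' \<in> cball 0 (r + 1) \<Longrightarrow> dist x' x < D i \<Longrightarrow> dist (?h' i x') (?h' i x) < e'"
    by metis
  define d where "d = min 1 (Min (range D))"
  have dD: "d \<le> D i" for i unfolding d_def by (auto intro: min.coboundedI2)
  have d: "d > 0" "d \<le> 1" using D(1) by (auto simp: d_def)
  show ?thesis
  proof (rule that[OF d(1)])
    fix x v :: "(real, 'q) vec" assume x: "norm x \<le> r" and v: "norm v < d"
    \<comment> \<open>Subtracting the linear part at \<open>x\<close> leaves a function whose
      derivative near \<open>x\<close> is small.\<close>
    define k where "k x' = h x' - (\<Sum>i\<in>UNIV. x' $ i *\<^sub>R ?h' i x)" for x'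
    have "norm (k (x + v) - k x) \<le> e * norm ((x + v) - x)"
    proof (rule differentiable_bound[where S = "ball x d"])
      fix x' assume x': "x' \<in> ball x d"
      have lin: "((\<lambda>x'. \<Sum>i\<in>UNIV. x' $ i *\<^sub>R ?h' i x) has_derivative (\<lambda>v. \<Sum>i\<in>UNIV. v $ i *\<^sub>R ?h' i x)) (at x')"
        by (intro has_derivative_sum has_derivative_scaleR_left bounded_linear.has_derivative[OF bounded_linear_vec_nth] has_derivative_ident)
      have "(k has_derivative (\<lambda>v. (\<Sum>i\<in>UNIV. v $ i *\<^sub>R ?h' i x') - (\<Sum>i\<in>UNIV. v $ i *\<^sub>R ?h' i x))) (at x')"
        unfolding k_def by (intro has_derivative_diff smooth_has_derivative h lin)
      then show "(k has_derivative (\<lambda>v. \<Sum>i\<in>UNIV. v $ i *\<^sub>R (?h' i x' - ?h' i x))) (at x' within ball x d)"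
        unfolding scaleR_diff_right sum_subtractf by (rule has_derivative_at_withinI)
      show "onorm (\<lambda>v. \<Sum>i\<in>UNIV. v $ i *\<^sub>R (?h' i x' - ?h' i x)) \<le> e"
      proof (rule onorm_le)
        fix w :: "(real, 'q) vec"
        have nx': "norm x' \<le> r + 1"
          using x x' d norm_triangle_ineq2[of x' x] by (simp add: dist_norm norm_minus_commute)
        have "norm (\<Sum>i\<in>UNIV. w $ i *\<^sub>R (?h' i x' - ?h' i x)) \<le> (\<Sum>i\<in>(UNIV :: 'q set). norm w * e')"
        proof (rule sum_norm_le)
          fix i
          have "dist (?h' i x') (?h' i x) < e'"
            using x nx' x' dD[of i] by (intro D(2)) (auto simp: dist_commute)
          then show "norm (w $ i *\<^sub>R (?h' i x' - ?h' i x)) \<le> norm w * e'"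
            unfolding norm_scaleR dist_norm real_norm_def
            using component_le_norm_cart[of w i] by (intro mult_mono) auto
        qed
        also have "\<dots> = e * norm w" by (simp add: e'_def)
        finally show "norm (\<Sum>i\<in>UNIV. w $ i *\<^sub>R (?h' i x' - ?h' i x)) \<le> e * norm w" .
      qed
    qed (use v d in \<open>auto simp: dist_norm\<close>)
    moreover have "k (x + v) - k x = h (x + v) - h x - (\<Sum>i\<in>UNIV. v $ i *\<^sub>R ?h' i x)"
      by (simp add: k_def scaleR_add_left sum.distrib)
    ultimately show "norm (h (x + v) - h x - (\<Sum>i\<in>UNIV. v $ i *\<^sub>R ?h' i x)) \<le> e * norm v" by simp
  qed
qed

text \<open>One rule for differentiation in the centre, where \<open>\<Lambda> y v = v\<close>, and
  in the radius, where \<open>\<Lambda> y s = s *\<^sub>R y\<close>. Uniform differentiability on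
  the compact image of the unit ball bounds the remainder before integration.\<close>

lemma has_derivative_weighted_integral:
  fixes h :: "real ^ 'q \<Rightarrow> 'b::euclidean_space" and \<gamma> :: "'z::euclidean_space \<Rightarrow> real ^ 'q \<Rightarrow> real ^ 'q"
  assumes w: "weight \<omega>" and h: "smooth h"
    and \<gamma>: "\<And>\<zeta> y. \<gamma> (z + \<zeta>) y = \<gamma> z y + \<Lambda> y \<zeta>"
    and c\<gamma>: "\<And>z. continuous_on UNIV (\<gamma> z)" and c\<Lambda>: "\<And>\<zeta>. continuous_on UNIV (\<lambda>y. \<Lambda> y \<zeta>)"
    and lin: "\<And>y. linear (\<Lambda> y)" and bd: "\<And>y \<zeta>. norm y \<le> 1 \<Longrightarrow> norm (\<Lambda> y \<zeta>) \<le> norm \<zeta>"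
  shows "((\<lambda>z. \<integral>y. \<omega> y *\<^sub>R h (\<gamma> z y) \<partial>lborel) has_derivative
    (\<lambda>\<zeta>. \<integral>y. \<omega> y *\<^sub>R (\<Sum>i\<in>UNIV. \<Lambda> y \<zeta> $ i *\<^sub>R partial_deriv i h (\<gamma> z y)) \<partial>lborel)) (at z)"
proof -
  let ?D = "\<lambda>\<zeta> y. \<Sum>i\<in>UNIV. \<Lambda> y \<zeta> $ i *\<^sub>R partial_deriv i h (\<gamma> z y)"
  have ch: "continuous_on UNIV (\<lambda>y. h (\<gamma> z y))" for z
    by (rule continuous_on_compose2[OF smooth_continuous[OF h, of UNIV] c\<gamma>]) auto
  have cd: "continuous_on UNIV (\<lambda>y. partial_deriv i h (\<gamma> z y))" for i
    by (rule continuous_on_compose2[OF smooth_continuous[OF smooth_partial_deriv[OF h], of UNIV] c\<gamma>]) auto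
  have cont_comp: "continuous_on UNIV (\<lambda>y. \<Lambda> y \<zeta> $ i)" for \<zeta> i
    by (rule bounded_linear.continuous_on[OF bounded_linear_vec_nth c\<Lambda>])
  have cD: "continuous_on UNIV (?D \<zeta>)" for \<zeta>
    by (intro continuous_on_sum continuous_on_scaleR cont_comp c\<Lambda> cd)
  have ih: "integrable lborel (\<lambda>y. \<omega> y *\<^sub>R h (\<gamma> z y))" for z by (rule weight_integrable[OF w ch])
  have iD: "integrable lborel (\<lambda>y. \<omega> y *\<^sub>R ?D \<zeta> y)" for \<zeta> by (rule weight_integrable[OF w cD])
  have i1: "integrable lborel (\<lambda>y. \<bar>\<omega> y\<bar>)"
    using integrable_norm[OF weight_integrable[OF w continuous_on_const[of UNIV "1::real"]]] by simp
  define A where "A = (\<integral>y. \<bar>\<omega> y\<bar> \<partial>lborel)"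
  have A: "A \<ge> 0" unfolding A_def by (intro integral_nonneg_AE) auto
  have "bounded (\<gamma> z ` cball 0 1)"
    by (intro compact_imp_bounded compact_continuous_image compact_cball continuous_on_subset[OF c\<gamma>]) auto
  then obtain r where "\<forall>x\<in>\<gamma> z ` cball 0 1. norm x \<le> r" unfolding bounded_iff by blast
  then have r: "norm (\<gamma> z y) \<le> r" if "norm y \<le> 1" for y using that by simp
  show ?thesis
    unfolding has_derivative_at_alt
  proof (intro conjI allI impI)
    have "linear (\<lambda>\<zeta>. \<integral>y. \<omega> y *\<^sub>R ?D \<zeta> y \<partial>lborel)"
    proof (rule linearI)
      fix \<zeta> \<zeta>' and c :: real
      have "?D (\<zeta> + \<zeta>') y = ?D \<zeta> y + ?D \<zeta>' y" for y
        by (simp add: linear_add[OF lin] scaleR_add_left sum.distrib)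
      then show "(\<integral>y. \<omega> y *\<^sub>R ?D (\<zeta> + \<zeta>') y \<partial>lborel) = (\<integral>y. \<omega> y *\<^sub>R ?D \<zeta> y \<partial>lborel) + (\<integral>y. \<omega> y *\<^sub>R ?D \<zeta>' y \<partial>lborel)"
        using Bochner_Integration.integral_add[OF iD[of \<zeta>] iD[of \<zeta>']] by (simp only: scaleR_add_right)
      have "?D (c *\<^sub>R \<zeta>) y = c *\<^sub>R ?D \<zeta> y" for y
        by (simp add: linear_scale[OF lin] scaleR_sum_right)
      then show "(\<integral>y. \<omega> y *\<^sub>R ?D (c *\<^sub>R \<zeta>) y \<partial>lborel) = c *\<^sub>R (\<integral>y. \<omega> y *\<^sub>R ?D \<zeta> y \<partial>lborel)"
        unfolding integral_scaleR_right[symmetric] by (simp only: scaleR_left_commute)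
    qed
    then show "bounded_linear (\<lambda>\<zeta>. \<integral>y. \<omega> y *\<^sub>R ?D \<zeta> y \<partial>lborel)"
      by (rule linear_conv_bounded_linear[THEN iffD1])
  next
    fix e :: real assume e: "e > 0"
    \<comment> \<open>\<open>A + 1\<close> in place of \<open>A\<close> guards against a weight that
      vanishes almost everywhere.\<close>
    have eA: "e / (A + 1) > 0" using e A by simp
    obtain d where d: "d > 0" and unif: "\<And>x v. norm x \<le> r \<Longrightarrow> norm v < d
      \<Longrightarrow> norm (h (x + v) - h x - (\<Sum>i\<in>UNIV. v $ i *\<^sub>R partial_deriv i h x)) \<le> (e / (A + 1)) * norm v"
      using uniformly_differentiable[OF h eA, of r] by blast
    show "\<exists>d>0. \<forall>x. norm (x - z) < d \<longrightarrow> norm ((\<integral>y. \<omega> y *\<^sub>R h (\<gamma> x y) \<partial>lborel)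
        - (\<integral>y. \<omega> y *\<^sub>R h (\<gamma> z y) \<partial>lborel) - (\<integral>y. \<omega> y *\<^sub>R ?D (x - z) y \<partial>lborel)) \<le> e * norm (x - z)"
    proof (intro exI[of _ d] conjI allI impI d)
      fix x assume x: "norm (x - z) < d"
      let ?\<zeta> = "x - z" and ?R = "\<lambda>y. h (\<gamma> x y) - h (\<gamma> z y) - ?D (x - z) y"
      have pt: "norm (\<omega> y *\<^sub>R ?R y) \<le> (e / (A + 1) * norm ?\<zeta>) * \<bar>\<omega> y\<bar>" for y
      proof (cases "norm y \<le> 1")
        case True
        have "norm (?R y) \<le> (e / (A + 1)) * norm (\<Lambda> y ?\<zeta>)"
          using unif[OF r[OF True], of "\<Lambda> y ?\<zeta>"] \<gamma>[of ?\<zeta> y] bd[OF True, of ?\<zeta>] x by simp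
        also have "\<dots> \<le> (e / (A + 1)) * norm ?\<zeta>"
          using bd[OF True, of ?\<zeta>] e A by (intro mult_left_mono) auto
        finally have "\<bar>\<omega> y\<bar> * norm (?R y) \<le> \<bar>\<omega> y\<bar> * ((e / (A + 1)) * norm ?\<zeta>)"
          by (rule mult_left_mono) simp
        then show ?thesis by (simp only: norm_scaleR real_norm_def mult.commute)
      next
        case False
        then show ?thesis using w by (simp add: weight_def)
      qed
      have "(\<integral>y. \<omega> y *\<^sub>R h (\<gamma> x y) \<partial>lborel) - (\<integral>y. \<omega> y *\<^sub>R h (\<gamma> z y) \<partial>lborel) - (\<integral>y. \<omega> y *\<^sub>R ?D ?\<zeta> y \<partial>lborel)
        = (\<integral>y. \<omega> y *\<^sub>R ?R y \<partial>lborel)"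
        unfolding scaleR_diff_right
        by (subst Bochner_Integration.integral_diff[OF Bochner_Integration.integrable_diff[OF ih ih] iD],
            subst Bochner_Integration.integral_diff[OF ih ih]) (rule refl)
      also have "norm \<dots> \<le> (\<integral>y. norm (\<omega> y *\<^sub>R ?R y) \<partial>lborel)" by (rule integral_norm_bound)
      also have "\<dots> \<le> (\<integral>y. (e / (A + 1) * norm ?\<zeta>) * \<bar>\<omega> y\<bar> \<partial>lborel)"
      proof (rule integral_mono[OF _ _ pt])
        show "integrable lborel (\<lambda>y. norm (\<omega> y *\<^sub>R ?R y))"
          unfolding scaleR_diff_right
          by (intro integrable_norm Bochner_Integration.integrable_diff ih iD)
        show "integrable lborel (\<lambda>y. (e / (A + 1) * norm ?\<zeta>) * \<bar>\<omega> y\<bar>)" using i1 by simp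
      qed
      also have "\<dots> = (e / (A + 1) * norm ?\<zeta>) * A" unfolding A_def by (rule integral_mult_right_zero)
      also have "\<dots> \<le> e * norm ?\<zeta>"
      proof -
        have "e * norm ?\<zeta> * (A / (A + 1)) \<le> e * norm ?\<zeta> * 1"
          using e A by (intro mult_left_mono) auto
        then show ?thesis by (simp add: mult_ac)
      qed
      finally show "norm ((\<integral>y. \<omega> y *\<^sub>R h (\<gamma> x y) \<partial>lborel)
        - (\<integral>y. \<omega> y *\<^sub>R h (\<gamma> z y) \<partial>lborel) - (\<integral>y. \<omega> y *\<^sub>R ?D (x - z) y \<partial>lborel)) \<le> e * norm (x - z)" .
    qed
  qed
qed

lemma wmean_has_derivative:
  fixes h :: "real ^ 'q \<Rightarrow> 'b::euclidean_space"
  assumes w: "weight \<omega>" and h: "smooth h"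
  shows "(wmean \<omega> h t has_derivative (\<lambda>v. \<Sum>i\<in>UNIV. v $ i *\<^sub>R wmean \<omega> (partial_deriv i h) t p)) (at p)"
proof -
  have "((\<lambda>p. \<integral>y. \<omega> y *\<^sub>R h (p + t *\<^sub>R y) \<partial>lborel) has_derivative
    (\<lambda>v. \<integral>y. \<omega> y *\<^sub>R (\<Sum>i\<in>UNIV. v $ i *\<^sub>R partial_deriv i h (p + t *\<^sub>R y)) \<partial>lborel)) (at p)"
    by (rule has_derivative_weighted_integral[OF w h, where \<Lambda> = "\<lambda>y v. v"])
       (auto intro!: continuous_intros linear_ident)
  moreover have "(\<integral>y. \<omega> y *\<^sub>R (\<Sum>i\<in>UNIV. v $ i *\<^sub>R partial_deriv i h (p + t *\<^sub>R y)) \<partial>lborel)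
    = (\<Sum>i\<in>UNIV. v $ i *\<^sub>R wmean \<omega> (partial_deriv i h) t p)" for v
  proof -
    have "(\<integral>y. \<omega> y *\<^sub>R (\<Sum>i\<in>UNIV. v $ i *\<^sub>R partial_deriv i h (p + t *\<^sub>R y)) \<partial>lborel)
      = (\<integral>y. (\<Sum>i\<in>UNIV. v $ i *\<^sub>R (\<omega> y *\<^sub>R partial_deriv i h (p + t *\<^sub>R y))) \<partial>lborel)"
      by (simp only: scaleR_sum_right scaleR_left_commute)
    also have "\<dots> = (\<Sum>i\<in>UNIV. \<integral>y. v $ i *\<^sub>R (\<omega> y *\<^sub>R partial_deriv i h (p + t *\<^sub>R y)) \<partial>lborel)"
      by (intro Bochner_Integration.integral_sum integrable_scaleR_right wmean_integrable w smooth_partial_deriv h)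
    finally show ?thesis by (simp only: wmean_def integral_scaleR_right)
  qed
  ultimately show ?thesis by (simp only: wmean_def[abs_def])
qed

lemma partial_deriv_wmean:
  fixes h :: "real ^ 'q \<Rightarrow> 'b::euclidean_space"
  assumes "weight \<omega>" "smooth h"
  shows "partial_deriv i (wmean \<omega> h t) = wmean \<omega> (partial_deriv i h) t"
  using partial_deriv_eq[OF wmean_has_derivative[OF assms]] by (intro ext) (simp only: sum_axis_scaleR)

lemma smooth_wmean:
  fixes h :: "real ^ 'q \<Rightarrow> 'b::euclidean_space"
  assumes w: "weight \<omega>" and h: "smooth h"
  shows "smooth (wmean \<omega> h t)"
proof (rule smooth_coinduct[where P = "\<lambda>f. \<exists>h. smooth h \<and> f = wmean \<omega> h t"])
  fix f :: "(real, 'q) vec \<Rightarrow> 'b" and x i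
  assume "\<exists>h. smooth h \<and> f = wmean \<omega> h t"
  then obtain k where k: "smooth k" "f = wmean \<omega> k t" by blast
  show "f differentiable (at x)"
    unfolding k(2) by (rule differentiableI[OF wmean_has_derivative[OF w k(1)]])
  show "\<exists>h. smooth h \<and> partial_deriv i f = wmean \<omega> h t"
    unfolding k(2) partial_deriv_wmean[OF w k(1)] using smooth_partial_deriv[OF k(1)] by blast
qed (use h in blast)

lemma compactly_supported_wmean:
  fixes h :: "real ^ 'q \<Rightarrow> 'b::euclidean_space"
  assumes w: "weight \<omega>" and c: "compactly_supported h"
  shows "compactly_supported (wmean \<omega> h t)"
proof -
  obtain R where R: "\<And>x. norm x > R \<Longrightarrow> h x = 0" using compactly_supportedE[OF c] by blast
  show ?thesis
  proof (rule compactly_supportedI[of "R + \<bar>t\<bar>"])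
    fix p :: "(real, 'q) vec" assume p: "norm p > R + \<bar>t\<bar>"
    have "\<omega> y *\<^sub>R h (p + t *\<^sub>R y) = 0" for y
    proof (cases "norm y \<le> 1")
      case True
      have "\<bar>t\<bar> * norm y \<le> \<bar>t\<bar>" using True by (simp add: mult_left_le)
      then have "norm (p + t *\<^sub>R y) > R"
        using norm_triangle_ineq4[of "p + t *\<^sub>R y" "t *\<^sub>R y"] p by simp
      then show ?thesis using R by simp
    next
      case False
      then show ?thesis using w by (simp add: weight_def)
    qed
    then show "wmean \<omega> h t p = 0" by (simp only: wmean_def Bochner_Integration.integral_zero)
  qed
qed

lemma wmean_has_vector_derivative:
  fixes h :: "real ^ 'q \<Rightarrow> 'b::euclidean_space"
  assumes w: "weight \<omega>" and h: "smooth h"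
  shows "((\<lambda>t. wmean \<omega> h t p) has_vector_derivative
    (\<Sum>i\<in>UNIV. wmean (\<lambda>y. \<omega> y * y $ i) (partial_deriv i h) t p)) (at t)"
proof -
  have wi: "weight (\<lambda>y. \<omega> y * y $ i)" for i by (intro weight_mult_continuous w continuous_intros)
  have "((\<lambda>t. \<integral>y. \<omega> y *\<^sub>R h (p + t *\<^sub>R y) \<partial>lborel) has_derivative
    (\<lambda>s. \<integral>y. \<omega> y *\<^sub>R (\<Sum>i\<in>UNIV. (s *\<^sub>R y) $ i *\<^sub>R partial_deriv i h (p + t *\<^sub>R y)) \<partial>lborel)) (at t)"
  proof (rule has_derivative_weighted_integral[OF w h, where \<Lambda> = "\<lambda>y s. s *\<^sub>R y"])
    show "p + (t + s) *\<^sub>R y = p + t *\<^sub>R y + s *\<^sub>R y" for s and y :: "(real, 'q) vec"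
      by (simp add: scaleR_add_left)
    show "norm (s *\<^sub>R y) \<le> norm s" if "norm y \<le> 1" for s and y :: "(real, 'q) vec"
      using that by (simp add: mult_left_le)
    show "linear (\<lambda>s :: real. s *\<^sub>R y)" for y :: "(real, 'q) vec"
      by (rule linearI) (simp_all add: scaleR_add_left)
  qed (intro continuous_intros)+
  moreover have "(\<integral>y. \<omega> y *\<^sub>R (\<Sum>i\<in>UNIV. (s *\<^sub>R y) $ i *\<^sub>R partial_deriv i h (p + t *\<^sub>R y)) \<partial>lborel)
    = s *\<^sub>R (\<Sum>i\<in>UNIV. wmean (\<lambda>y. \<omega> y * y $ i) (partial_deriv i h) t p)" for s
  proof -
    have "(\<integral>y. \<omega> y *\<^sub>R (\<Sum>i\<in>UNIV. (s *\<^sub>R y) $ i *\<^sub>R partial_deriv i h (p + t *\<^sub>R y)) \<partial>lborel)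
      = (\<integral>y. s *\<^sub>R (\<Sum>i\<in>UNIV. (\<omega> y * y $ i) *\<^sub>R partial_deriv i h (p + t *\<^sub>R y)) \<partial>lborel)"
      by (simp add: scaleR_sum_right mult_ac)
    also have "\<dots> = s *\<^sub>R (\<Sum>i\<in>UNIV. \<integral>y. (\<omega> y * y $ i) *\<^sub>R partial_deriv i h (p + t *\<^sub>R y) \<partial>lborel)"
      unfolding integral_scaleR_right
      by (subst Bochner_Integration.integral_sum) (intro wmean_integrable wi smooth_partial_deriv h refl)+
    finally show ?thesis by (simp only: wmean_def)
  qed
  ultimately show ?thesis by (simp only: wmean_def has_vector_derivative_def)
qed

text \<open>The weights of interest have a corner on the unit sphere, so only a Lipschitz bound and
  a derivative almost everywhere along the axis are asked for. The radius 3 is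
  \<open>R + 2 * norm e\<close> for \<open>R = 1\<close> and a unit vector. The chain rule supplies
  the factor \<open>t\<close>.\<close>

lemma wmean_integration_by_parts:
  fixes k :: "real ^ 'q \<Rightarrow> 'b::euclidean_space"
  assumes w: "weight \<omega>" and w': "weight \<omega>'" and k: "smooth k"
    and lip: "\<And>x y. norm x \<le> 3 \<Longrightarrow> norm y \<le> 3 \<Longrightarrow> \<bar>\<omega> x - \<omega> y\<bar> \<le> C * norm (x - y)"
    and der: "AE y in lborel. ((\<lambda>s. \<omega> (y + s *\<^sub>R axis i 1)) has_real_derivative \<omega>' y) (at 0)"
  shows "wmean \<omega>' k t p = - t *\<^sub>R wmean \<omega> (partial_deriv i k) t p"
proof -
  let ?e = "axis i 1 :: (real, 'q) vec"
  define kk where "kk y = k (p + t *\<^sub>R y)" for y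
  define kk' where "kk' j y = t *\<^sub>R partial_deriv j k (p + t *\<^sub>R y)" for j y
  have dkk: "(kk has_derivative (\<lambda>v. \<Sum>j\<in>UNIV. v $ j *\<^sub>R kk' j y)) (at y)" for y
  proof -
    have "((\<lambda>y. p + t *\<^sub>R y) has_derivative (\<lambda>v. t *\<^sub>R v)) (at y)"
      by (auto intro!: derivative_eq_intros)
    from has_derivative_compose[OF this smooth_has_derivative[OF k]]
    have "(kk has_derivative (\<lambda>v. \<Sum>j\<in>UNIV. (t *\<^sub>R v) $ j *\<^sub>R partial_deriv j k (p + t *\<^sub>R y))) (at y)"
      by (simp only: kk_def[abs_def])
    then show ?thesis by (simp add: kk'_def mult.commute)
  qed
  have caff: "continuous_on UNIV (\<lambda>y. p + t *\<^sub>R y)" by (intro continuous_intros)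
  have ckk: "continuous_on UNIV kk"
    unfolding kk_def by (rule continuous_on_compose2[OF smooth_continuous[OF k, of UNIV] caff]) simp
  have ckk': "continuous_on UNIV (kk' j)" for j
    unfolding kk'_def
    by (intro continuous_on_scaleR continuous_on_const
        continuous_on_compose2[OF smooth_continuous[OF smooth_partial_deriv[OF k], of UNIV] caff]) simp
  obtain L where L: "L \<ge> 0" "\<And>x y. norm x \<le> 3 \<Longrightarrow> norm y \<le> 3 \<Longrightarrow> norm (kk x - kk y) \<le> L * norm (x - y)"
    using lipschitz_cball_if_C1[OF dkk ckk', of 3] by blast
  have "bounded (kk ` cball 0 3)"
    by (intro compact_imp_bounded compact_continuous_image compact_cball continuous_on_subset[OF ckk]) auto
  then obtain M where "\<forall>x\<in>kk ` cball 0 3. norm x \<le> M" unfolding bounded_iff by blast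
  then have M: "norm (kk y) \<le> M" if "norm y \<le> 3" for y using that by simp
  obtain B where B: "\<And>y. \<bar>\<omega> y\<bar> \<le> B" using w unfolding weight_def by blast
  have i1: "integrable lborel (\<lambda>y. \<omega>' y *\<^sub>R kk y)" by (rule weight_integrable[OF w' ckk])
  have i2: "integrable lborel (\<lambda>y. \<omega> y *\<^sub>R kk' i y)" by (rule weight_integrable[OF w ckk'])
  have [measurable]: "\<omega> \<in> borel_measurable borel" "\<omega>' \<in> borel_measurable borel"
    using w w' by (simp_all add: weight_def)
  have [measurable]: "kk \<in> borel_measurable borel" "kk' i \<in> borel_measurable borel"
    using ckk ckk' by (auto intro: borel_measurable_continuous_onI)
  have "(\<integral>y. \<omega>' y *\<^sub>R kk y + \<omega> y *\<^sub>R kk' i y \<partial>lborel) = 0"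
  proof (rule integral_directional_derivative_eq_0)
    show "integrable lborel (\<lambda>y. \<omega> y *\<^sub>R kk y)" by (rule weight_integrable[OF w ckk])
    show "\<omega> y *\<^sub>R kk y = 0" if "norm y > 1" for y using that w by (simp add: weight_def)
    show "(\<lambda>y. \<omega>' y *\<^sub>R kk y + \<omega> y *\<^sub>R kk' i y) \<in> borel_measurable borel" by measurable
    show "norm (\<omega> x *\<^sub>R kk x - \<omega> y *\<^sub>R kk y) \<le> (B * L + C * M) * norm (x - y)"
      if "norm x \<le> 1 + 2 * norm ?e" "norm y \<le> 1 + 2 * norm ?e" for x y
    proof -
      have x: "norm x \<le> 3" and y: "norm y \<le> 3" using that by (simp_all add: norm_axis_1)
      have "\<omega> x *\<^sub>R kk x - \<omega> y *\<^sub>R kk y = \<omega> x *\<^sub>R (kk x - kk y) + (\<omega> x - \<omega> y) *\<^sub>R kk y"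
        by (simp add: scaleR_diff_right scaleR_diff_left)
      also have "norm \<dots> \<le> \<bar>\<omega> x\<bar> * norm (kk x - kk y) + \<bar>\<omega> x - \<omega> y\<bar> * norm (kk y)"
        by (rule order_trans[OF norm_triangle_ineq]) simp
      also have "\<dots> \<le> B * (L * norm (x - y)) + (C * norm (x - y)) * M"
        using B[of x] L(2)[OF x y] lip[OF x y] M[OF y] B[of x]
        by (intro add_mono mult_mono) (auto intro: order_trans[OF abs_ge_zero])
      finally show ?thesis by (simp add: algebra_simps)
    qed
    show "AE y in lborel. ((\<lambda>s. \<omega> (y + s *\<^sub>R ?e) *\<^sub>R kk (y + s *\<^sub>R ?e)) has_vector_derivative
        \<omega>' y *\<^sub>R kk y + \<omega> y *\<^sub>R kk' i y) (at 0)"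
      using der
    proof eventually_elim
      case (elim y)
      have "((\<lambda>s. kk (y + s *\<^sub>R ?e)) has_vector_derivative kk' i y) (at 0)"
        using has_vector_derivative_along[OF dkk, of y ?e] by (simp only: sum_axis_scaleR)
      from has_vector_derivative_scaleR[OF elim this]
      show ?case by (simp add: add.commute)
    qed
  qed
  then have "(\<integral>y. \<omega>' y *\<^sub>R kk y \<partial>lborel) = - (\<integral>y. \<omega> y *\<^sub>R kk' i y \<partial>lborel)"
    using i1 i2 by (simp add: eq_neg_iff_add_eq_0)
  also have "(\<integral>y. \<omega> y *\<^sub>R kk' i y \<partial>lborel) = t *\<^sub>R wmean \<omega> (partial_deriv i k) t p"
    unfolding kk'_def wmean_def integral_scaleR_right[symmetric] by (simp only: scaleR_left_commute)
  finally show ?thesis by (simp add: kk_def wmean_def)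
qed

subsection \<open>Darboux's equation for ball and sphere means\<close>

definition ball_weight :: "real ^ 'q \<Rightarrow> real"
  where "ball_weight y = indicator (cball 0 1) y"

text \<open>Halving makes the gradient exactly \<open>- y\<close> inside the ball. The function
  vanishes on the sphere, so integrating by parts against it leaves no boundary term.\<close>

definition paraboloid :: "real ^ 'q \<Rightarrow> real"
  where "paraboloid y = ball_weight y * ((1 - y \<bullet> y) / 2)"

lemma paraboloid_eq: "paraboloid y = max 0 ((1 - y \<bullet> y) / 2)"
  by (auto simp: paraboloid_def ball_weight_def indicator_def norm_le_square norm_eq_sqrt_inner real_sqrt_le_1_iff)

lemma weight_ball_weight: "weight ball_weight"
  unfolding weight_def ball_weight_def by (auto intro!: exI[of _ 1] simp: indicator_def)

lemma weight_paraboloid: "weight paraboloid"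
  unfolding paraboloid_def by (intro weight_mult_continuous weight_ball_weight continuous_intros) auto

lemma paraboloid_lipschitz:
  assumes "norm x \<le> 3" "norm y \<le> 3"
  shows "\<bar>paraboloid x - paraboloid y\<bar> \<le> 3 * norm (x - y)"
proof -
  have "\<bar>paraboloid x - paraboloid y\<bar> \<le> \<bar>(1 - x \<bullet> x) / 2 - (1 - y \<bullet> y) / 2\<bar>"
  proof -
    have "\<bar>max 0 a - max 0 b\<bar> \<le> \<bar>a - b\<bar>" for a b :: real by (auto simp: max_def)
    then show ?thesis unfolding paraboloid_eq .
  qed
  also have "(1 - x \<bullet> x) / 2 - (1 - y \<bullet> y) / 2 = - (((x + y) \<bullet> (x - y)) / 2)"
  proof -
    have "(x + y) \<bullet> (x - y) = x \<bullet> x - y \<bullet> y"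
      by (simp add: inner_diff_right inner_add_left inner_commute[of y x])
    then show ?thesis by (simp add: field_simps)
  qed
  also have "\<bar>- (((x + y) \<bullet> (x - y)) / 2)\<bar> \<le> (norm (x + y) * norm (x - y)) / 2"
    using Cauchy_Schwarz_ineq2[of "x + y" "x - y"] by simp
  \<comment> \<open>Both points have norm at most 3.\<close>
  also have "\<dots> \<le> (6 * norm (x - y)) / 2"
    using norm_triangle_ineq[of x y] assms by (intro divide_right_mono mult_right_mono) auto
  finally show ?thesis by simp
qed

lemma AE_norm_neq_1: "AE y in lborel. norm (y :: real ^ 'q) \<noteq> 1"
proof -
  have "negligible (sphere 0 1 :: (real, 'q) vec set)" by (rule negligible_sphere)
  then have "(sphere 0 1 :: (real, 'q) vec set) \<in> null_sets lborel"
    by (simp add: negligible_iff_null_sets null_sets_completion_iff)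
  then show ?thesis by (rule AE_I') auto
qed

lemma paraboloid_has_real_derivative:
  assumes "norm y \<noteq> 1"
  shows "((\<lambda>s. paraboloid (y + s *\<^sub>R axis i 1)) has_real_derivative ball_weight y * - y $ i) (at 0)"
proof (cases "norm y < 1")
  case True
  let ?e = "axis i 1 :: (real, 'a) vec"
  have "((\<lambda>s. (1 - (y + s *\<^sub>R ?e) \<bullet> (y + s *\<^sub>R ?e)) / 2) has_real_derivative - y $ i) (at 0)"
  proof -
    have "(\<lambda>s. (1 - (y + s *\<^sub>R ?e) \<bullet> (y + s *\<^sub>R ?e)) / 2) = (\<lambda>s. (1 - (y \<bullet> y + 2 * s * y $ i + s * s)) / 2)"
    proof -
      have "?e \<bullet> ?e = 1" "y \<bullet> ?e = y $ i" "?e \<bullet> y = y $ i"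
        by (simp_all add: inner_axis inner_axis' inner_axis_axis)
      then show ?thesis by (simp add: fun_eq_iff inner_add_left inner_add_right algebra_simps)
    qed
    then show ?thesis by (auto intro!: derivative_eq_intros)
  qed
  moreover have "open {s. norm (y + s *\<^sub>R ?e) < 1}" by (intro open_Collect_less continuous_intros)
  moreover have "0 \<in> {s. norm (y + s *\<^sub>R ?e) < 1}" using True by simp
  moreover have "(1 - (y + s *\<^sub>R ?e) \<bullet> (y + s *\<^sub>R ?e)) / 2 = paraboloid (y + s *\<^sub>R ?e)"
    if "s \<in> {s. norm (y + s *\<^sub>R ?e) < 1}" for s
    using that by (simp add: paraboloid_def ball_weight_def)
  ultimately have "((\<lambda>s. paraboloid (y + s *\<^sub>R ?e)) has_real_derivative - y $ i) (at 0)"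
    by (rule has_field_derivative_transform_within_open)
  then show ?thesis using True by (simp add: ball_weight_def)
next
  case False
  let ?e = "axis i 1 :: (real, 'a) vec"
  have y: "norm y > 1" using False assms by simp
  have "((\<lambda>s. 0) has_real_derivative 0) (at 0)" by simp
  moreover have "open {s. 1 < norm (y + s *\<^sub>R ?e)}" by (intro open_Collect_less continuous_intros)
  moreover have "0 \<in> {s. 1 < norm (y + s *\<^sub>R ?e)}" using y by simp
  moreover have "0 = paraboloid (y + s *\<^sub>R ?e)" if "s \<in> {s. 1 < norm (y + s *\<^sub>R ?e)}" for s
    using that by (simp add: paraboloid_def ball_weight_def)
  ultimately have "((\<lambda>s. paraboloid (y + s *\<^sub>R ?e)) has_real_derivative 0) (at 0)"
    by (rule has_field_derivative_transform_within_open)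
  then show ?thesis using y by (simp add: ball_weight_def)
qed

lemma wmean_ball_component:
  fixes k :: "real ^ 'q \<Rightarrow> 'b::euclidean_space"
  assumes k: "smooth k"
  shows "wmean (\<lambda>y. ball_weight y * y $ i) k t p = t *\<^sub>R wmean paraboloid (partial_deriv i k) t p"
proof -
  have "wmean (\<lambda>y. ball_weight y * - y $ i) k t p = - t *\<^sub>R wmean paraboloid (partial_deriv i k) t p"
  proof (rule wmean_integration_by_parts[OF weight_paraboloid _ k paraboloid_lipschitz])
    show "weight (\<lambda>y. ball_weight y * - y $ i)"
      by (intro weight_mult_continuous weight_ball_weight continuous_intros)
    show "AE y in lborel. ((\<lambda>s. paraboloid (y + s *\<^sub>R axis i 1)) has_real_derivative ball_weight y * - y $ i) (at 0)"
      using AE_norm_neq_1 by eventually_elim (rule paraboloid_has_real_derivative)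
  qed
  then show ?thesis by (simp add: wmean_def)
qed

text \<open>Inside the ball the \<open>i\<close>-th derivative of
  \<open>paraboloid y * y $ i\<close> is \<open>paraboloid y - y $ i * y $ i\<close>; integration by
  parts turns this into the stated relation.\<close>

lemma wmean_paraboloid_component:
  fixes k :: "real ^ 'q \<Rightarrow> 'b::euclidean_space"
  assumes k: "smooth k"
  shows "t *\<^sub>R wmean (\<lambda>y. paraboloid y * y $ i) (partial_deriv i k) t p
    = wmean (\<lambda>y. ball_weight y * (y $ i * y $ i)) k t p - wmean paraboloid k t p"
proof -
  have wb: "weight (\<lambda>y :: (real, 'q) vec. ball_weight y * (y $ i * y $ i))"
    by (intro weight_mult_continuous weight_ball_weight continuous_intros)
  have w': "weight (\<lambda>y :: (real, 'q) vec. ball_weight y * ((1 - y \<bullet> y) / 2 - y $ i * y $ i))"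
    by (intro weight_mult_continuous weight_ball_weight continuous_intros) simp
  have eq: "(\<lambda>y. ball_weight y * ((1 - y \<bullet> y) / 2 - y $ i * y $ i)) = (\<lambda>y. 1 * paraboloid y + (- 1) * (ball_weight y * (y $ i * y $ i)))"
    by (simp add: fun_eq_iff paraboloid_def right_diff_distrib)
  have "wmean (\<lambda>y. ball_weight y * ((1 - y \<bullet> y) / 2 - y $ i * y $ i)) k t p
    = - t *\<^sub>R wmean (\<lambda>y. paraboloid y * y $ i) (partial_deriv i k) t p"
  proof (rule wmean_integration_by_parts[OF _ w' k])
    show "weight (\<lambda>y. paraboloid y * y $ i)"
      by (intro weight_mult_continuous weight_paraboloid continuous_intros)
    \<comment> \<open>The constant is \<open>1 + 3 * 3\<close>: the paraboloid is at most 1 and has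
      Lipschitz constant 3, while \<open>\<bar>y $ i\<bar> \<le> 3\<close>.\<close>
    show "\<bar>paraboloid x * x $ i - paraboloid y * y $ i\<bar> \<le> 10 * norm (x - y)"
      if xy: "norm x \<le> 3" "norm y \<le> 3" for x y :: "(real, 'q) vec"
    proof -
      have px: "\<bar>paraboloid x\<bar> \<le> 1" unfolding paraboloid_eq
        by simp (rule order_trans[OF _ inner_ge_zero], simp)
      have "\<bar>x $ i - y $ i\<bar> \<le> norm (x - y)" using component_le_norm_cart[of "x - y" i] by simp
      moreover have "\<bar>y $ i\<bar> \<le> 3" using component_le_norm_cart[of y i] xy by simp
      ultimately have "\<bar>paraboloid x\<bar> * \<bar>x $ i - y $ i\<bar> + \<bar>paraboloid x - paraboloid y\<bar> * \<bar>y $ i\<bar>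
        \<le> 1 * norm (x - y) + (3 * norm (x - y)) * 3"
        using px paraboloid_lipschitz[OF xy] by (intro add_mono mult_mono) auto
      moreover have "paraboloid x * x $ i - paraboloid y * y $ i
        = paraboloid x * (x $ i - y $ i) + (paraboloid x - paraboloid y) * y $ i"
        by (simp add: algebra_simps)
      moreover have "\<bar>paraboloid x * (x $ i - y $ i) + (paraboloid x - paraboloid y) * y $ i\<bar>
        \<le> \<bar>paraboloid x\<bar> * \<bar>x $ i - y $ i\<bar> + \<bar>paraboloid x - paraboloid y\<bar> * \<bar>y $ i\<bar>"
        unfolding abs_mult[symmetric] by (rule abs_triangle_ineq)
      ultimately show ?thesis by simp
    qed
    show "AE y in lborel. ((\<lambda>s. paraboloid (y + s *\<^sub>R axis i 1) * (y + s *\<^sub>R axis i 1) $ i)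
      has_real_derivative ball_weight y * ((1 - y \<bullet> y) / 2 - y $ i * y $ i)) (at 0)"
      using AE_norm_neq_1
    proof eventually_elim
      case (elim y)
      have "((\<lambda>s. (y + s *\<^sub>R axis i 1) $ i) has_real_derivative 1) (at 0)"
        by (auto simp: axis_def intro!: derivative_eq_intros)
      from DERIV_mult[OF paraboloid_has_real_derivative[OF elim, of i] this]
      have "((\<lambda>s. paraboloid (y + s *\<^sub>R axis i 1) * (y + s *\<^sub>R axis i 1) $ i)
        has_real_derivative ball_weight y * - y $ i * y $ i + 1 * paraboloid y) (at 0)"
        by simp
      also have "ball_weight y * - y $ i * y $ i + 1 * paraboloid y = ball_weight y * ((1 - y \<bullet> y) / 2 - y $ i * y $ i)"
        by (simp add: paraboloid_def right_diff_distrib mult.assoc)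
      finally show ?case .
    qed
  qed
  then show ?thesis
    unfolding eq wmean_add_weight[OF weight_paraboloid wb k] by (simp add: algebra_simps)
qed

section \<open>Evolution of the means in the radius\<close>

definition laplacian :: "(real ^ 'q \<Rightarrow> 'b::real_normed_vector) \<Rightarrow> real ^ 'q \<Rightarrow> 'b"
  where "laplacian h x = (\<Sum>i\<in>UNIV. partial_deriv i (partial_deriv i h) x)"

lemma smooth_laplacian: "smooth h \<Longrightarrow> smooth (laplacian h)"
  unfolding laplacian_def[abs_def] by (intro smooth_sum smooth_partial_deriv)

lemma compactly_supported_laplacian: "compactly_supported h \<Longrightarrow> compactly_supported (laplacian h)"
  unfolding laplacian_def[abs_def]
  by (intro compactly_supported_sum compactly_supported_partial_deriv) simp

text \<open>Differentiating in \<open>t\<close> brings down \<open>y $ i\<close>, the negative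
  gradient of the paraboloid, and integrating by parts produces a second derivative. The explicit
  factor \<open>t\<close> is what later absorbs the singular \<open>1 / t\<close>.\<close>

lemma wmean_ball_has_vector_derivative:
  fixes h :: "real ^ 'q \<Rightarrow> 'b::euclidean_space"
  assumes h: "smooth h"
  shows "((\<lambda>t. wmean ball_weight h t p) has_vector_derivative t *\<^sub>R wmean paraboloid (laplacian h) t p) (at t)"
proof -
  have "(\<Sum>i\<in>UNIV. wmean (\<lambda>y. ball_weight y * y $ i) (partial_deriv i h) t p)
    = (\<Sum>i\<in>UNIV. t *\<^sub>R wmean paraboloid (partial_deriv i (partial_deriv i h)) t p)"
    by (intro sum.cong refl wmean_ball_component smooth_partial_deriv h)
  also have "\<dots> = t *\<^sub>R wmean paraboloid (laplacian h) t p"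
    unfolding scaleR_sum_right[symmetric] laplacian_def[abs_def]
    by (subst wmean_sum[OF weight_paraboloid]) (intro smooth_partial_deriv h refl)+
  finally show ?thesis
    using wmean_has_vector_derivative[OF weight_ball_weight h, of p t] by simp
qed

definition wmean_paraboloid_deriv :: "(real ^ 'q \<Rightarrow> 'b::euclidean_space) \<Rightarrow> real \<Rightarrow> real ^ 'q \<Rightarrow> 'b"
  where "wmean_paraboloid_deriv k t p = (\<Sum>i\<in>UNIV. wmean (\<lambda>y. paraboloid y * y $ i) (partial_deriv i k) t p)"

lemma wmean_paraboloid_has_vector_derivative:
  fixes k :: "real ^ 'q \<Rightarrow> 'b::euclidean_space"
  assumes "smooth k"
  shows "((\<lambda>t. wmean paraboloid k t p) has_vector_derivative wmean_paraboloid_deriv k t p) (at t)"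
  unfolding wmean_paraboloid_deriv_def by (rule wmean_has_vector_derivative[OF weight_paraboloid assms])

text \<open>Sum \<open>wmean_paraboloid_component\<close> over \<open>i\<close>. The right-hand
  sides contribute q copies of the paraboloid mean, and \<open>ball_weight y * (y \<bullet> y) =
  ball_weight y - 2 * paraboloid y\<close> contributes two more.\<close>

lemma wmean_paraboloid_darboux:
  fixes k :: "real ^ 'q \<Rightarrow> 'b::euclidean_space"
  assumes k: "smooth k"
  shows "(real CARD('q) + 2) *\<^sub>R wmean paraboloid k t p + t *\<^sub>R wmean_paraboloid_deriv k t p = wmean ball_weight k t p"
proof -
  have i: "integrable lborel (\<lambda>y. (ball_weight y * (y $ i * y $ i)) *\<^sub>R k (p + t *\<^sub>R y))" for i
    by (intro wmean_integrable weight_mult_continuous weight_ball_weight continuous_intros k)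
  have "(\<Sum>i\<in>UNIV. wmean (\<lambda>y. ball_weight y * (y $ i * y $ i)) k t p)
    = (\<integral>y. (\<Sum>i\<in>UNIV. (ball_weight y * (y $ i * y $ i)) *\<^sub>R k (p + t *\<^sub>R y)) \<partial>lborel)"
    unfolding wmean_def by (rule Bochner_Integration.integral_sum[symmetric]) (rule i)
  also have "\<dots> = wmean (\<lambda>y. 1 * ball_weight y + (- 2) * paraboloid y) k t p"
    unfolding wmean_def
  proof (rule Bochner_Integration.integral_cong[OF refl])
    fix y :: "(real, 'q) vec"
    have "(\<Sum>i\<in>UNIV. ball_weight y * (y $ i * y $ i)) = ball_weight y * (y \<bullet> y)"
      by (simp add: inner_vec_def sum_distrib_left)
    also have "\<dots> = 1 * ball_weight y + (- 2) * paraboloid y"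
      by (simp add: paraboloid_def field_simps)
    finally show "(\<Sum>i\<in>UNIV. (ball_weight y * (y $ i * y $ i)) *\<^sub>R k (p + t *\<^sub>R y))
      = (1 * ball_weight y + (- 2) * paraboloid y) *\<^sub>R k (p + t *\<^sub>R y)"
      by (simp only: scaleR_sum_left[symmetric])
  qed
  also have "\<dots> = wmean ball_weight k t p - 2 *\<^sub>R wmean paraboloid k t p"
    using wmean_add_weight[OF weight_ball_weight weight_paraboloid k, of 1 "- 2" t p] by simp
  finally have "(\<Sum>i\<in>UNIV. wmean (\<lambda>y. ball_weight y * (y $ i * y $ i)) k t p)
    = wmean ball_weight k t p - 2 *\<^sub>R wmean paraboloid k t p" .
  moreover have "t *\<^sub>R wmean_paraboloid_deriv k t p
    = (\<Sum>i\<in>UNIV. wmean (\<lambda>y. ball_weight y * (y $ i * y $ i)) k t p) - real CARD('q) *\<^sub>R wmean paraboloid k t p"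
    unfolding wmean_paraboloid_deriv_def scaleR_sum_right wmean_paraboloid_component[OF k] sum_subtractf
    by (simp only: sum_constant_scaleR)
  ultimately show ?thesis by (simp add: scaleR_add_left)
qed

lemma partial_deriv_lincomb:
  fixes f g :: "real ^ 'q \<Rightarrow> 'b::euclidean_space"
  assumes "smooth f" "smooth g"
  shows "partial_deriv i (\<lambda>x. a *\<^sub>R f x + b *\<^sub>R g x) = (\<lambda>x. a *\<^sub>R partial_deriv i f x + b *\<^sub>R partial_deriv i g x)"
proof
  fix x
  have "((\<lambda>x. a *\<^sub>R f x + b *\<^sub>R g x) has_derivative
      (\<lambda>v. a *\<^sub>R (\<Sum>i\<in>UNIV. v $ i *\<^sub>R partial_deriv i f x) + b *\<^sub>R (\<Sum>i\<in>UNIV. v $ i *\<^sub>R partial_deriv i g x))) (at x)"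
    by (intro has_derivative_add has_derivative_scaleR_right smooth_has_derivative assms)
  from partial_deriv_eq[OF this, of i]
  show "partial_deriv i (\<lambda>x. a *\<^sub>R f x + b *\<^sub>R g x) x = a *\<^sub>R partial_deriv i f x + b *\<^sub>R partial_deriv i g x"
    by (simp only: sum_axis_scaleR)
qed

lemma laplacian_lincomb:
  fixes f g :: "real ^ 'q \<Rightarrow> 'b::euclidean_space"
  assumes "smooth f" "smooth g"
  shows "laplacian (\<lambda>x. a *\<^sub>R f x + b *\<^sub>R g x) x = a *\<^sub>R laplacian f x + b *\<^sub>R laplacian g x"
  unfolding laplacian_def partial_deriv_lincomb[OF assms]
    partial_deriv_lincomb[OF smooth_partial_deriv[OF assms(1)] smooth_partial_deriv[OF assms(2)]]
  by (simp only: sum.distrib scaleR_sum_right)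

lemma laplacian_wmean:
  fixes h :: "real ^ 'q \<Rightarrow> 'b::euclidean_space"
  assumes w: "weight \<omega>" and h: "smooth h"
  shows "laplacian (wmean \<omega> h t) p = wmean \<omega> (laplacian h) t p"
  unfolding laplacian_def[abs_def] partial_deriv_wmean[OF w h] partial_deriv_wmean[OF w smooth_partial_deriv[OF h]]
  by (rule wmean_sum[OF w, symmetric]) (intro smooth_partial_deriv h)

definition ball_mean :: "(real ^ 'q \<Rightarrow> 'b::euclidean_space) \<Rightarrow> real \<Rightarrow> real ^ 'q \<Rightarrow> 'b"
  where "ball_mean h t p = (1 / measure lborel (cball (0 :: real ^ 'q) 1)) *\<^sub>R wmean ball_weight h t p"

definition paraboloid_mean :: "(real ^ 'q \<Rightarrow> 'b::euclidean_space) \<Rightarrow> real \<Rightarrow> real ^ 'q \<Rightarrow> 'b"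
  where "paraboloid_mean h t p = (1 / measure lborel (cball (0 :: real ^ 'q) 1)) *\<^sub>R wmean paraboloid h t p"

definition paraboloid_mean_deriv :: "(real ^ 'q \<Rightarrow> 'b::euclidean_space) \<Rightarrow> real \<Rightarrow> real ^ 'q \<Rightarrow> 'b"
  where "paraboloid_mean_deriv h t p = (1 / measure lborel (cball (0 :: real ^ 'q) 1)) *\<^sub>R wmean_paraboloid_deriv h t p"

text \<open>The mean of \<open>h\<close> over the sphere of radius \<open>t\<close> around \<open>p\<close>, written as
  \<open>M + (t / q) dM/dt\<close> in terms of the ball mean \<open>M\<close>.\<close>

definition sphere_mean :: "(real ^ 'q \<Rightarrow> 'b::euclidean_space) \<Rightarrow> real \<Rightarrow> real ^ 'q \<Rightarrow> 'b"
  where "sphere_mean h t p = ball_mean h t p + (t\<^sup>2 / real CARD('q)) *\<^sub>R paraboloid_mean (laplacian h) t p"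

lemma scaleR_has_vector_derivative:
  fixes f :: "real \<Rightarrow> 'b::real_normed_vector"
  assumes "(c has_real_derivative c') (at t)" "(f has_vector_derivative f') (at t)"
    and "d = c t *\<^sub>R f' + c' *\<^sub>R f t"
  shows "((\<lambda>t. c t *\<^sub>R f t) has_vector_derivative d) (at t)"
  using has_vector_derivative_scaleR[OF assms(1,2)] unfolding assms(3) .

context
  fixes h :: "real ^ 'q \<Rightarrow> 'b::euclidean_space"
  assumes h: "smooth h"
begin

lemma ball_mean_has_vector_derivative:
  "((\<lambda>t. ball_mean h t p) has_vector_derivative t *\<^sub>R paraboloid_mean (laplacian h) t p) (at t)"
  unfolding ball_mean_def paraboloid_mean_def
  by (rule scaleR_has_vector_derivative[OF DERIV_const wmean_ball_has_vector_derivative[OF h]])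
     (simp add: mult.commute)

lemma paraboloid_mean_has_vector_derivative:
  "((\<lambda>t. paraboloid_mean h t p) has_vector_derivative paraboloid_mean_deriv h t p) (at t)"
  unfolding paraboloid_mean_def paraboloid_mean_deriv_def
  by (rule scaleR_has_vector_derivative[OF DERIV_const wmean_paraboloid_has_vector_derivative[OF h]]) simp

lemma ball_mean_darboux:
  "(real CARD('q) + 2) *\<^sub>R paraboloid_mean h t p + t *\<^sub>R paraboloid_mean_deriv h t p = ball_mean h t p"
  unfolding ball_mean_def paraboloid_mean_def paraboloid_mean_deriv_def
    wmean_paraboloid_darboux[OF h, symmetric]
  by (simp add: scaleR_add_right mult.commute)

lemma smooth_ball_mean: "smooth (ball_mean h t)"
  unfolding ball_mean_def[abs_def] by (intro smooth_scaleR_const smooth_wmean weight_ball_weight h)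

lemma smooth_paraboloid_mean: "smooth (paraboloid_mean h t)"
  unfolding paraboloid_mean_def[abs_def] by (intro smooth_scaleR_const smooth_wmean weight_paraboloid h)

lemma laplacian_ball_mean: "laplacian (ball_mean h t) p = ball_mean (laplacian h) t p"
  using laplacian_lincomb[OF smooth_wmean[OF weight_ball_weight h] smooth_wmean[OF weight_ball_weight h], of _ t 0 t p]
  unfolding ball_mean_def[abs_def] by (simp add: laplacian_wmean[OF weight_ball_weight h])

lemma laplacian_paraboloid_mean: "laplacian (paraboloid_mean h t) p = paraboloid_mean (laplacian h) t p"
  using laplacian_lincomb[OF smooth_wmean[OF weight_paraboloid h] smooth_wmean[OF weight_paraboloid h], of _ t 0 t p]
  unfolding paraboloid_mean_def[abs_def] by (simp add: laplacian_wmean[OF weight_paraboloid h])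

end

context
  fixes h :: "real ^ 'q \<Rightarrow> 'b::euclidean_space"
  assumes h: "smooth h"
begin

lemma smooth_sphere_mean: "smooth (sphere_mean h t)"
  unfolding sphere_mean_def[abs_def]
  by (intro smooth_add smooth_scaleR_const smooth_ball_mean smooth_paraboloid_mean smooth_laplacian h)

text \<open>The divergence theorem for the sphere mean. It comes out of the product rule once
  \<open>ball_mean_darboux\<close>, applied to the Laplacian of \<open>h\<close>, collects the
  paraboloid terms into a ball mean.\<close>

lemma sphere_mean_has_vector_derivative:
  "((\<lambda>t. sphere_mean h t p) has_vector_derivative (t / real CARD('q)) *\<^sub>R ball_mean (laplacian h) t p) (at t)"
proof -
  let ?q = "real CARD('q)" and ?V = "paraboloid_mean (laplacian h) t p" and ?Z = "paraboloid_mean_deriv (laplacian h) t p"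
  have "((\<lambda>t. (t\<^sup>2 / ?q) *\<^sub>R paraboloid_mean (laplacian h) t p) has_vector_derivative (t\<^sup>2 / ?q) *\<^sub>R ?Z + (2 * t / ?q) *\<^sub>R ?V) (at t)"
    by (rule scaleR_has_vector_derivative[OF _ paraboloid_mean_has_vector_derivative[OF smooth_laplacian[OF h]] refl])
       (auto intro!: derivative_eq_intros)
  from has_vector_derivative_add[OF ball_mean_has_vector_derivative[OF h] this]
  have "((\<lambda>t. sphere_mean h t p) has_vector_derivative t *\<^sub>R ?V + ((t\<^sup>2 / ?q) *\<^sub>R ?Z + (2 * t / ?q) *\<^sub>R ?V)) (at t)"
    by (simp only: sphere_mean_def)
  also have "t *\<^sub>R ?V + ((t\<^sup>2 / ?q) *\<^sub>R ?Z + (2 * t / ?q) *\<^sub>R ?V) = (t / ?q) *\<^sub>R ((?q + 2) *\<^sub>R ?V + t *\<^sub>R ?Z)"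
  proof -
    have "t = (t / ?q) * ?q" by simp
    then have "t *\<^sub>R ?V = ((t / ?q) * ?q) *\<^sub>R ?V" by simp
    then show ?thesis
      by (simp only: scaleR_add_right scaleR_add_left scaleR_scaleR distrib_left power2_eq_square
          times_divide_eq_left times_divide_eq_right mult.commute[of t 2] add_ac)
  qed
  also have "\<dots> = (t / ?q) *\<^sub>R ball_mean (laplacian h) t p"
    by (simp only: ball_mean_darboux[OF smooth_laplacian[OF h]])
  finally show ?thesis .
qed

lemma sphere_mean_deriv_has_vector_derivative:
  "((\<lambda>t. (t / real CARD('q)) *\<^sub>R ball_mean (laplacian h) t p) has_vector_derivative
    (t / real CARD('q)) *\<^sub>R (t *\<^sub>R paraboloid_mean (laplacian (laplacian h)) t p)
    + (1 / real CARD('q)) *\<^sub>R ball_mean (laplacian h) t p) (at t)"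
  by (rule scaleR_has_vector_derivative[OF _ ball_mean_has_vector_derivative[OF smooth_laplacian[OF h]] refl])
     (auto intro!: derivative_eq_intros)

text \<open>The Euler-Poisson-Darboux equation for sphere means. The ball mean occurs with weights
  \<open>1 / q\<close> and \<open>(q - 1) / q\<close>, which add up to 1.\<close>

lemma sphere_mean_darboux:
  assumes "t \<noteq> 0"
  shows "(t / real CARD('q)) *\<^sub>R (t *\<^sub>R paraboloid_mean (laplacian (laplacian h)) t p)
      + (1 / real CARD('q)) *\<^sub>R ball_mean (laplacian h) t p
      + (real CARD('q) - 1) *\<^sub>R (((t / real CARD('q)) *\<^sub>R ball_mean (laplacian h) t p) /\<^sub>R t)
    = sphere_mean (laplacian h) t p"
proof -
  let ?q = "real CARD('q)" and ?M = "ball_mean (laplacian h) t p" and ?V = "paraboloid_mean (laplacian (laplacian h)) t p"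
  have 1: "(?q - 1) *\<^sub>R (((t / ?q) *\<^sub>R ?M) /\<^sub>R t) = ((?q - 1) / ?q) *\<^sub>R ?M" using assms by simp
  have 2: "(1 / ?q) *\<^sub>R ?M + ((?q - 1) / ?q) *\<^sub>R ?M = ?M"
    unfolding scaleR_add_left[symmetric] add_divide_distrib[symmetric] by simp
  have 3: "(t / ?q) *\<^sub>R (t *\<^sub>R ?V) = (t\<^sup>2 / ?q) *\<^sub>R ?V" by (simp add: power2_eq_square)
  show ?thesis unfolding 1 3 sphere_mean_def add.assoc 2 by (rule add.commute)
qed

lemma laplacian_sphere_mean: "laplacian (sphere_mean h t) p = sphere_mean (laplacian h) t p"
  using laplacian_lincomb[OF smooth_ball_mean[OF h] smooth_paraboloid_mean[OF smooth_laplacian[OF h]], of 1 t _ t p]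
  unfolding sphere_mean_def[abs_def]
  by (simp add: laplacian_ball_mean[OF h] laplacian_paraboloid_mean[OF smooth_laplacian[OF h]])

end

lemma compactly_supported_means:
  fixes h :: "real ^ 'q \<Rightarrow> 'b::euclidean_space"
  assumes c: "compactly_supported h"
  shows "compactly_supported (ball_mean h t)" "compactly_supported (sphere_mean h t)"
proof -
  have sc: "compactly_supported (\<lambda>p. a *\<^sub>R wmean \<omega> k t p)" if "weight \<omega>" "compactly_supported k"
    for a \<omega> and k :: "(real, 'q) vec \<Rightarrow> 'b"
    using compactly_supported_linear[OF compactly_supported_wmean[OF that], of "\<lambda>v. a *\<^sub>R v"]
    by (simp add: linear_scale_self)
  show b: "compactly_supported (ball_mean h t)"
    unfolding ball_mean_def[abs_def] by (rule sc[OF weight_ball_weight c])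
  have p: "compactly_supported (\<lambda>p. (t\<^sup>2 / real CARD('q)) *\<^sub>R paraboloid_mean (laplacian h) t p)"
    using sc[OF weight_paraboloid compactly_supported_laplacian[OF c]]
    unfolding paraboloid_mean_def scaleR_scaleR .
  have "{x. sphere_mean h t x \<noteq> 0} \<subseteq> {x. ball_mean h t x \<noteq> 0} \<union> {x. (t\<^sup>2 / real CARD('q)) *\<^sub>R paraboloid_mean (laplacian h) t x \<noteq> 0}"
    by (auto simp: sphere_mean_def)
  then show "compactly_supported (sphere_mean h t)"
    using b p unfolding compactly_supported_iff by (meson bounded_Un bounded_subset)
qed

lemma ball_mean_0: "ball_mean h 0 p = h p"
  for h :: "real ^ 'q \<Rightarrow> 'b::euclidean_space"
proof -
  have pos: "measure lborel (cball (0 :: (real, 'q) vec) 1) > 0"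
    using content_cball_pos[of 1 "0 :: (real, 'q) vec"] by simp
  have i: "integrable lborel (\<lambda>y :: (real, 'q) vec. ball_weight y)"
    using weight_integrable[OF weight_ball_weight continuous_on_const[of UNIV "1::real"]] by simp
  have "wmean ball_weight h 0 p = (\<integral>y. ball_weight (y :: (real, 'q) vec) *\<^sub>R h p \<partial>lborel)"
    by (simp add: wmean_def)
  also have "\<dots> = (\<integral>y. ball_weight (y :: (real, 'q) vec) \<partial>lborel) *\<^sub>R h p"
    by (rule integral_scaleR_left) (rule i)
  also have "(\<integral>y. ball_weight (y :: (real, 'q) vec) \<partial>lborel) = measure lborel (cball (0 :: (real, 'q) vec) 1)"
    unfolding ball_weight_def by simp
  finally show ?thesis using pos by (simp add: ball_mean_def)
qed

lemma sphere_mean_0: "sphere_mean h 0 p = h p"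
  by (simp add: sphere_mean_def ball_mean_0)

subsection \<open>The functions \<open>\<phi>\<^sub>n\<close> as means of plane waves\<close>

text \<open>The energy \<open>w\<^sup>2 + w'\<^sup>2\<close> of the difference of two solutions does not increase away from \<open>0\<close>.\<close>

lemma phi_solution_unique:
  assumes n: "n \<ge> 1" and f: "phi_solution n f" and g: "phi_solution n g"
  shows "f = g"
proof -
  obtain f' f'' where f: "\<And>r. (f has_real_derivative f' r) (at r)" "\<And>r. (f' has_real_derivative f'' r) (at r)"
    "\<And>r. r \<noteq> 0 \<Longrightarrow> f'' r + (real n - 1) * f' r / r + f r = 0" "f 0 = 1" "f' 0 = 0"
    using f unfolding phi_solution_def by blast
  obtain g' g'' where g: "\<And>r. (g has_real_derivative g' r) (at r)" "\<And>r. (g' has_real_derivative g'' r) (at r)"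
    "\<And>r. r \<noteq> 0 \<Longrightarrow> g'' r + (real n - 1) * g' r / r + g r = 0" "g 0 = 1" "g' 0 = 0"
    using g unfolding phi_solution_def by blast
  define w where "w r = f r - g r" for r
  define w' where "w' r = f' r - g' r" for r
  define w'' where "w'' r = f'' r - g'' r" for r
  have dw: "(w has_real_derivative w' r) (at r)" "(w' has_real_derivative w'' r) (at r)" for r
    unfolding w_def[abs_def] w'_def[abs_def] w''_def by (auto intro!: DERIV_diff f g)
  have ode: "w r + w'' r = - ((real n - 1) * w' r / r)" if "r \<noteq> 0" for r
    using f(3)[OF that] g(3)[OF that] unfolding w_def w'_def w''_def
    by (simp add: diff_divide_distrib right_diff_distrib)
  define E where "E r = (w r)\<^sup>2 + (w' r)\<^sup>2" for r
  have dE: "(E has_real_derivative 2 * w' r * (w r + w'' r)) (at r)" for r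
    unfolding E_def[abs_def] using dw[of r]
    by (auto intro!: derivative_eq_intros simp: algebra_simps)
  have w'0: "w' 0 = 0" and E0: "E 0 = 0"
    by (simp_all add: E_def w_def w'_def f g)
  have sign: "2 * w' r * (w r + w'' r) = - (2 * (real n - 1) * (w' r)\<^sup>2) / r" if "r \<noteq> 0" for r
    unfolding ode[OF that] by (simp add: power2_eq_square)
  have "E r \<le> 0" for r
  proof (cases "r \<ge> 0")
    case True
    have "E r \<le> E 0"
    proof (rule DERIV_nonpos_imp_nonincreasing[OF True])
      fix x assume "0 \<le> x" "x \<le> r"
      then have "2 * w' x * (w x + w'' x) \<le> 0"
        using sign[of x] w'0 n by (cases "x = 0") (simp_all add: divide_nonpos_pos)
      then show "\<exists>y. (E has_real_derivative y) (at x) \<and> y \<le> 0" using dE by blast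
    qed
    then show ?thesis using E0 by simp
  next
    case False
    have "E r \<le> E 0"
    proof (rule DERIV_nonneg_imp_nondecreasing[of r 0 E])
      show "r \<le> 0" using False by simp
      fix x assume x: "r \<le> x" "x \<le> 0"
      have "2 * w' x * (w x + w'' x) \<ge> 0"
      proof (cases "x = 0")
        case True
        then show ?thesis by (simp add: w'0)
      next
        case False
        have "0 \<le> - (2 * (real n - 1) * (w' x)\<^sup>2) / x"
          using x(2) False n by (intro divide_nonpos_neg) auto
        then show ?thesis by (simp only: sign[OF False])
      qed
      then show "\<exists>y. (E has_real_derivative y) (at x) \<and> 0 \<le> y" using dE by blast
    qed
    then show ?thesis using E0 by simp
  qed
  then have "(w r)\<^sup>2 \<le> 0" for r
    unfolding E_def using zero_le_power2[of "w' r"] by (meson add_increasing2 order_trans order_refl)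
  then show ?thesis by (simp add: fun_eq_iff w_def)
qed

lemma phi_eqI: "n \<ge> 1 \<Longrightarrow> phi_solution n f \<Longrightarrow> phi n = f"
  unfolding phi_def using phi_solution_unique by (intro the_equality) blast+

text \<open>Writing the sine as a shifted cosine keeps derivatives inside the two-parameter family
  \<open>c * cos (x \<bullet> e + d)\<close>, an invariant class for
  \<open>smooth_coinduct\<close>.\<close>

lemma plane_wave_partial_deriv:
  fixes e :: "real ^ 'q"
  shows "((\<lambda>x. c * cos (x \<bullet> e + d)) has_derivative (\<lambda>v. \<Sum>i\<in>UNIV. v $ i *\<^sub>R (c * e $ i * cos (x \<bullet> e + (d + pi / 2))))) (at x)"
    and "partial_deriv i (\<lambda>x. c * cos (x \<bullet> e + d)) = (\<lambda>x. c * e $ i * cos (x \<bullet> e + (d + pi / 2)))"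
proof -
  have D: "((\<lambda>x. c * cos (x \<bullet> e + d)) has_derivative (\<lambda>v. \<Sum>i\<in>UNIV. v $ i *\<^sub>R (c * e $ i * cos (x \<bullet> e + (d + pi / 2))))) (at x)" for x
  proof -
    have "((\<lambda>x. c * cos (x \<bullet> e + d)) has_derivative (\<lambda>v. c * ((v \<bullet> e) * - sin (x \<bullet> e + d)))) (at x)"
      by (auto intro!: derivative_eq_intros)
    moreover have "- sin (x \<bullet> e + d) = cos (x \<bullet> e + (d + pi / 2))"
      by (simp add: cos_add[of "x \<bullet> e + d" "pi / 2"] flip: add.assoc)
    moreover have "c * ((v \<bullet> e) * s) = (\<Sum>i\<in>UNIV. v $ i *\<^sub>R (c * e $ i * s))" for v s
      by (simp add: inner_vec_def sum_distrib_left sum_distrib_right mult_ac)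
    ultimately show ?thesis by (simp only:)
  qed
  show "((\<lambda>x. c * cos (x \<bullet> e + d)) has_derivative (\<lambda>v. \<Sum>i\<in>UNIV. v $ i *\<^sub>R (c * e $ i * cos (x \<bullet> e + (d + pi / 2))))) (at x)"
    by (rule D)
  show "partial_deriv i (\<lambda>x. c * cos (x \<bullet> e + d)) = (\<lambda>x. c * e $ i * cos (x \<bullet> e + (d + pi / 2)))"
    using partial_deriv_eq[OF D] by (intro ext) (simp only: sum_axis_scaleR)
qed

lemma smooth_plane_wave: "smooth (\<lambda>x. cos (x \<bullet> e))"
proof (rule smooth_coinduct[where P = "\<lambda>f. \<exists>c d. f = (\<lambda>x. c * cos (x \<bullet> e + d))"])
  show "\<exists>c d. (\<lambda>x. cos (x \<bullet> e)) = (\<lambda>x. c * cos (x \<bullet> e + d))"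
    by (rule exI[of _ 1], rule exI[of _ 0]) simp
  fix f :: "(real, 'a) vec \<Rightarrow> real" and x i
  assume "\<exists>c d. f = (\<lambda>x. c * cos (x \<bullet> e + d))"
  then obtain c d where f: "f = (\<lambda>x. c * cos (x \<bullet> e + d))" by blast
  show "f differentiable (at x)" unfolding f by (rule differentiableI[OF plane_wave_partial_deriv(1)])
  show "\<exists>c d. partial_deriv i f = (\<lambda>x. c * cos (x \<bullet> e + d))"
    unfolding f plane_wave_partial_deriv(2) by blast
qed

lemma laplacian_plane_wave:
  fixes e :: "real ^ 'q"
  shows "laplacian (\<lambda>x. cos (x \<bullet> e)) = (\<lambda>x. - (e \<bullet> e) *\<^sub>R cos (x \<bullet> e))"
proof
  fix x
  have "partial_deriv i (partial_deriv i (\<lambda>x. 1 * cos (x \<bullet> e + 0))) x = - (e $ i * e $ i) * cos (x \<bullet> e)" for i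
  proof -
    have "cos (x \<bullet> e + (0 + pi / 2 + pi / 2)) = - cos (x \<bullet> e)" by simp
    then show ?thesis unfolding plane_wave_partial_deriv(2) by simp
  qed
  then have "laplacian (\<lambda>x. 1 * cos (x \<bullet> e + 0)) x = (\<Sum>i\<in>UNIV. - (e $ i * e $ i) * cos (x \<bullet> e))"
    by (simp only: laplacian_def)
  then show "laplacian (\<lambda>x. cos (x \<bullet> e)) x = - (e \<bullet> e) *\<^sub>R cos (x \<bullet> e)"
    by (simp add: inner_vec_def sum_negf sum_distrib_right)
qed

lemma wmean_scaleR: "wmean \<omega> (\<lambda>x. c *\<^sub>R h x) t p = c *\<^sub>R wmean \<omega> h t p"
  unfolding wmean_def integral_scaleR_right[symmetric]
  by (rule Bochner_Integration.integral_cong[OF refl]) (rule scaleR_left_commute)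

lemma ball_mean_scaleR: "ball_mean (\<lambda>x. c *\<^sub>R h x) t p = c *\<^sub>R ball_mean h t p"
  for h :: "real ^ 'q \<Rightarrow> 'b::euclidean_space"
  unfolding ball_mean_def wmean_scaleR by (rule scaleR_left_commute)

lemma paraboloid_mean_scaleR: "paraboloid_mean (\<lambda>x. c *\<^sub>R h x) t p = c *\<^sub>R paraboloid_mean h t p"
  for h :: "real ^ 'q \<Rightarrow> 'b::euclidean_space"
  unfolding paraboloid_mean_def wmean_scaleR by (rule scaleR_left_commute)

lemma sphere_mean_scaleR:
  fixes h :: "real ^ 'q \<Rightarrow> 'b::euclidean_space"
  assumes "smooth h"
  shows "sphere_mean (\<lambda>x. c *\<^sub>R h x) t p = c *\<^sub>R sphere_mean h t p"
proof -
  have lap: "laplacian (\<lambda>x. c *\<^sub>R h x) = (\<lambda>x. c *\<^sub>R laplacian h x)"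
    using laplacian_lincomb[OF assms assms, of c 0] by (simp add: fun_eq_iff)
  show ?thesis
    unfolding sphere_mean_def lap ball_mean_scaleR paraboloid_mean_scaleR
    by (simp add: scaleR_add_right mult.commute)
qed

context
  fixes e :: "real ^ 'q"
  assumes e: "e \<bullet> e = 1"
begin

text \<open>For a unit vector \<open>e\<close> the wave is an eigenfunction of the Laplacian with
  eigenvalue -1, and Darboux's equation becomes the defining equation of \<open>phi\<close> with
  \<open>n - 1 = q + 1\<close>.\<close>

lemma phi_ball_mean: "phi (CARD('q) + 2) = (\<lambda>r. ball_mean (\<lambda>x. cos (x \<bullet> e)) r 0)"
proof (rule phi_eqI)
  let ?h = "\<lambda>x. cos (x \<bullet> e)"
  note s = smooth_plane_wave[of e]
  have lap: "laplacian ?h = (\<lambda>x. - 1 *\<^sub>R ?h x)" by (simp add: laplacian_plane_wave e)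
  define f' where "f' r = - (r * paraboloid_mean ?h r 0)" for r
  define f'' where "f'' r = - (r * paraboloid_mean_deriv ?h r 0 + paraboloid_mean ?h r 0)" for r
  show "phi_solution (CARD('q) + 2) (\<lambda>r. ball_mean ?h r 0)"
    unfolding phi_solution_def
  proof (rule exI[of _ f'], rule exI[of _ f''], intro conjI allI impI)
    fix r
    have "((\<lambda>r. ball_mean ?h r 0) has_vector_derivative r *\<^sub>R paraboloid_mean (laplacian ?h) r 0) (at r)"
      by (rule ball_mean_has_vector_derivative[OF s])
    then show "((\<lambda>r. ball_mean ?h r 0) has_real_derivative f' r) (at r)"
      unfolding lap paraboloid_mean_scaleR by (simp add: f'_def has_real_derivative_iff_has_vector_derivative)
    have "((\<lambda>r. paraboloid_mean ?h r 0) has_real_derivative paraboloid_mean_deriv ?h r 0) (at r)"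
      unfolding has_real_derivative_iff_has_vector_derivative by (rule paraboloid_mean_has_vector_derivative[OF s])
    from DERIV_minus[OF DERIV_mult[OF DERIV_ident this]]
    show "(f' has_real_derivative f'' r) (at r)"
      unfolding f'_def[abs_def] f''_def by (simp add: algebra_simps)
    have darboux: "(real CARD('q) + 2) * paraboloid_mean ?h r 0 + r * paraboloid_mean_deriv ?h r 0 = ball_mean ?h r 0"
      using ball_mean_darboux[OF s, of r 0] by simp
    show "f'' r + (real (CARD('q) + 2) - 1) * f' r / r + ball_mean ?h r 0 = 0" if "r \<noteq> 0"
    proof -
      have "(real (CARD('q) + 2) - 1) * f' r / r = - ((real CARD('q) + 1) * paraboloid_mean ?h r 0)"
        using that by (simp add: f'_def)
      then show ?thesis
        using darboux by (simp add: f''_def algebra_simps)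
    qed
  next
    show "ball_mean ?h 0 0 = 1" by (simp add: ball_mean_0)
    show "f' 0 = 0" by (simp add: f'_def)
  qed
qed simp

text \<open>The same eigenfunction in the equation for sphere means, where the coefficient is
  \<open>q - 1\<close>.\<close>

lemma phi_sphere_mean: "phi CARD('q) = (\<lambda>r. sphere_mean (\<lambda>x. cos (x \<bullet> e)) r 0)"
proof (rule phi_eqI)
  let ?h = "\<lambda>x. cos (x \<bullet> e)" and ?q = "real CARD('q)"
  note s = smooth_plane_wave[of e]
  have lap: "laplacian ?h = (\<lambda>x. - 1 *\<^sub>R ?h x)" by (simp add: laplacian_plane_wave e)
  have lap_sphere: "sphere_mean (laplacian ?h) r 0 = - sphere_mean ?h r 0" for r
    unfolding lap sphere_mean_scaleR[OF s] by simp
  define f' where "f' r = (r / ?q) *\<^sub>R ball_mean (laplacian ?h) r 0" for r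
  define f'' where "f'' r = (r / ?q) *\<^sub>R (r *\<^sub>R paraboloid_mean (laplacian (laplacian ?h)) r 0)
    + (1 / ?q) *\<^sub>R ball_mean (laplacian ?h) r 0" for r
  show "phi_solution CARD('q) (\<lambda>r. sphere_mean ?h r 0)"
    unfolding phi_solution_def
  proof (rule exI[of _ f'], rule exI[of _ f''], intro conjI allI impI)
    fix r
    show "((\<lambda>r. sphere_mean ?h r 0) has_real_derivative f' r) (at r)"
      unfolding has_real_derivative_iff_has_vector_derivative f'_def
      by (rule sphere_mean_has_vector_derivative[OF s])
    show "(f' has_real_derivative f'' r) (at r)"
      unfolding has_real_derivative_iff_has_vector_derivative f'_def[abs_def] f''_def
      by (rule sphere_mean_deriv_has_vector_derivative[OF s])
    assume "r \<noteq> 0"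
    from sphere_mean_darboux[OF s this, of 0]
    have "f'' r + (?q - 1) *\<^sub>R (f' r /\<^sub>R r) = - sphere_mean ?h r 0"
      unfolding lap_sphere f'_def f''_def .
    then show "f'' r + (?q - 1) * f' r / r + sphere_mean ?h r 0 = 0"
      by (simp add: divide_inverse mult_ac)
  next
    show "sphere_mean ?h 0 0 = 1" by (simp add: sphere_mean_0)
    show "f' 0 = 0" by (simp add: f'_def)
  qed
qed (use zero_less_card_finite[where 'a='q] in linarith)

end

lemma plane_wave_scaled:
  fixes e :: "real ^ 'q"
  shows "wmean \<omega> (\<lambda>x. cos (x \<bullet> (\<rho> *\<^sub>R e))) t 0 = wmean \<omega> (\<lambda>x. cos (x \<bullet> e)) (t * \<rho>) 0"
  by (simp add: wmean_def mult.assoc mult.left_commute)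

subsection \<open>The Hartley transform of means\<close>

text \<open>Translating \<open>h\<close> by \<open>t *\<^sub>R y\<close> yields a cosine multiple of
  its transform at \<open>\<xi>\<close> and a sine multiple of the transform at
  \<open>- \<xi>\<close>. An even weight integrates the sine part to 0, so the mean acts as a true
  multiplier.\<close>

lemma hartley_wmean:
  fixes h :: "real ^ 'q \<Rightarrow> 'b::euclidean_space"
  assumes w: "weight \<omega>" and even: "\<And>y. \<omega> (- y) = \<omega> y"
    and h: "smooth h" "compactly_supported h"
  shows "hartley (wmean \<omega> h t) \<xi> = wmean \<omega> (\<lambda>x. cos (x \<bullet> \<xi>)) t 0 *\<^sub>R hartley h \<xi>"
proof -
  have ih: "integrable lborel h" and [measurable]: "h \<in> borel_measurable borel"
    using bounded_integrable_smooth[OF h] by (auto simp: bounded_integrable_def)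
  obtain M where M: "\<And>x. norm (h x) \<le> M" using bounded_integrable_smooth[OF h] unfolding bounded_integrable_def by blast
  have M0: "M \<ge> 0" using M norm_ge_zero order_trans by blast
  obtain R where R: "\<And>x. norm x > R \<Longrightarrow> h x = 0" using compactly_supportedE[OF h(2)] by blast
  have [measurable]: "\<omega> \<in> borel_measurable borel" using w by (simp add: weight_def)
  define F where "F x y = (cas (x \<bullet> \<xi>) * \<omega> y) *\<^sub>R h (x + t *\<^sub>R y)" for x y
  let ?C = "sqrt (2 * pi) ^ CARD('q)"
  define A where "A = ?C *\<^sub>R hartley h \<xi>"
  define B where "B = ?C *\<^sub>R hartley h (- \<xi>)"
  have A: "(\<integral>x. cas (x \<bullet> \<xi>) *\<^sub>R h x \<partial>lborel) = A" and B: "(\<integral>x. cas (- (x \<bullet> \<xi>)) *\<^sub>R h x \<partial>lborel) = B"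
    by (simp_all add: A_def B_def hartley_def)
  have iA: "integrable lborel (\<lambda>x. cas (x \<bullet> \<xi>) *\<^sub>R h x)" and iB: "integrable lborel (\<lambda>x. cas (- (x \<bullet> \<xi>)) *\<^sub>R h x)"
    using integrable_cas[OF ih, of \<xi>] integrable_cas[OF ih, of "- \<xi>"] by simp_all
  have "(\<integral>x. cas (x \<bullet> \<xi>) *\<^sub>R wmean \<omega> h t x \<partial>lborel) = (\<integral>x. (\<integral>y. F x y \<partial>lborel) \<partial>lborel)"
    unfolding wmean_def integral_scaleR_right[symmetric] F_def scaleR_scaleR ..
  also have "\<dots> = (\<integral>y. (\<integral>x. F x y \<partial>lborel) \<partial>lborel)"
  proof (rule Fubini_integral_bounded[symmetric])
    show "case_prod F \<in> borel_measurable (lborel \<Otimes>\<^sub>M lborel)" unfolding F_def by measurable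
    \<comment> \<open>For \<open>norm y \<le> 1\<close> the value
      \<open>h (x + t *\<^sub>R y)\<close> vanishes unless
      \<open>norm x \<le> R + \<bar>t\<bar>\<close>; the 2 bounds \<open>cas\<close>.\<close>
    show "integrable lborel (\<lambda>x :: (real, 'q) vec. indicator (cball 0 (R + \<bar>t\<bar>)) x * (2 * M))"
      using emeasure_lborel_cball_finite[of "0 :: (real, 'q) vec" "R + \<bar>t\<bar>"] by auto
    show "integrable lborel (\<lambda>y. \<bar>\<omega> y\<bar>)"
      using integrable_norm[OF weight_integrable[OF w continuous_on_const[of UNIV "1::real"]]] by simp
    fix x y
    show "norm (F x y) \<le> indicator (cball 0 (R + \<bar>t\<bar>)) x * (2 * M) * \<bar>\<omega> y\<bar>"
    proof (cases "norm y \<le> 1 \<and> norm (x + t *\<^sub>R y) \<le> R")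
      case True
      have "\<bar>t\<bar> * norm y \<le> \<bar>t\<bar>" using True by (simp add: mult_left_le)
      then have "norm x \<le> R + \<bar>t\<bar>"
        using norm_triangle_ineq4[of "x + t *\<^sub>R y" "t *\<^sub>R y"] True by simp
      then have ind: "indicator (cball 0 (R + \<bar>t\<bar>)) x = (1 :: real)" by simp
      have "norm (F x y) = (\<bar>cas (x \<bullet> \<xi>)\<bar> * norm (h (x + t *\<^sub>R y))) * \<bar>\<omega> y\<bar>"
        by (simp add: F_def abs_mult)
      also have "\<dots> \<le> (2 * M) * \<bar>\<omega> y\<bar>"
        by (intro mult_right_mono mult_mono abs_cas_le M) auto
      finally show ?thesis unfolding ind by simp
    next
      case False
      then have "F x y = 0" using R w by (auto simp: F_def weight_def)
      then show ?thesis using M0 by simp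
    qed
  qed
  also have "\<dots> = (\<integral>y. (\<omega> y * cos ((0 + t *\<^sub>R y) \<bullet> \<xi>)) *\<^sub>R A - (\<omega> y * sin ((0 + t *\<^sub>R y) \<bullet> \<xi>)) *\<^sub>R B \<partial>lborel)"
  proof (rule Bochner_Integration.integral_cong[OF refl])
    fix y
    let ?c = "cos ((0 + t *\<^sub>R y) \<bullet> \<xi>)" and ?s = "sin ((0 + t *\<^sub>R y) \<bullet> \<xi>)"
    have "(\<integral>x. F x y \<partial>lborel) = \<omega> y *\<^sub>R (\<integral>x. cas (x \<bullet> \<xi>) *\<^sub>R h (x + t *\<^sub>R y) \<partial>lborel)"
      unfolding integral_scaleR_right[symmetric] F_def by (simp add: mult.commute)
    also have "(\<integral>x. cas (x \<bullet> \<xi>) *\<^sub>R h (x + t *\<^sub>R y) \<partial>lborel)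
      = (\<integral>x. cas ((t *\<^sub>R y + x - t *\<^sub>R y) \<bullet> \<xi>) *\<^sub>R h (t *\<^sub>R y + x) \<partial>lborel)"
      by (simp add: add.commute)
    also have "\<dots> = (\<integral>x. cas ((x - t *\<^sub>R y) \<bullet> \<xi>) *\<^sub>R h x \<partial>lborel)"
      by (rule lborel_integral_shift) measurable
    also have "\<dots> = (\<integral>x. ?c *\<^sub>R (cas (x \<bullet> \<xi>) *\<^sub>R h x) - ?s *\<^sub>R (cas (- (x \<bullet> \<xi>)) *\<^sub>R h x) \<partial>lborel)"
    proof (rule Bochner_Integration.integral_cong[OF refl])
      fix x
      have "cas ((x - t *\<^sub>R y) \<bullet> \<xi>) = cas (x \<bullet> \<xi>) * ?c - cas (- (x \<bullet> \<xi>)) * ?s"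
        using cas_add[of "x \<bullet> \<xi>" "- ((t *\<^sub>R y) \<bullet> \<xi>)"] by (simp add: inner_diff_left)
      then show "cas ((x - t *\<^sub>R y) \<bullet> \<xi>) *\<^sub>R h x = ?c *\<^sub>R (cas (x \<bullet> \<xi>) *\<^sub>R h x) - ?s *\<^sub>R (cas (- (x \<bullet> \<xi>)) *\<^sub>R h x)"
        by (simp only: scaleR_diff_left scaleR_scaleR mult.commute)
    qed
    also have "\<dots> = ?c *\<^sub>R A - ?s *\<^sub>R B"
      using Bochner_Integration.integral_diff[OF integrable_scaleR_right[OF iA, of ?c] integrable_scaleR_right[OF iB, of ?s]]
      by (simp only: integral_scaleR_right A B)
    finally show "(\<integral>x. F x y \<partial>lborel) = (\<omega> y * ?c) *\<^sub>R A - (\<omega> y * ?s) *\<^sub>R B"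
      by (simp only: scaleR_diff_right scaleR_scaleR)
  qed
  also have "\<dots> = (\<integral>y. \<omega> y * cos ((0 + t *\<^sub>R y) \<bullet> \<xi>) \<partial>lborel) *\<^sub>R A"
  proof -
    have ct: "continuous_on UNIV (\<lambda>y. cos ((0 + t *\<^sub>R y) \<bullet> \<xi>))" "continuous_on UNIV (\<lambda>y. sin ((0 + t *\<^sub>R y) \<bullet> \<xi>))"
      by (intro continuous_intros)+
    have ic: "integrable lborel (\<lambda>y. \<omega> y * cos ((0 + t *\<^sub>R y) \<bullet> \<xi>))"
      and is': "integrable lborel (\<lambda>y. \<omega> y * sin ((0 + t *\<^sub>R y) \<bullet> \<xi>))"
      using weight_integrable[OF w ct(1)] weight_integrable[OF w ct(2)] by simp_all
    have "(\<integral>y. \<omega> y * sin ((0 + t *\<^sub>R y) \<bullet> \<xi>) \<partial>lborel) = 0"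
      using integrable_reflect(2)[OF is'] even by simp
    then show ?thesis
      using ic is' by (simp only: Bochner_Integration.integral_diff integrable_scaleR_left integral_scaleR_left) simp
  qed
  also have "(\<integral>y. \<omega> y * cos ((0 + t *\<^sub>R y) \<bullet> \<xi>) \<partial>lborel) = wmean \<omega> (\<lambda>x. cos (x \<bullet> \<xi>)) t 0"
    by (simp add: wmean_def)
  finally have eq: "(\<integral>x. cas (x \<bullet> \<xi>) *\<^sub>R wmean \<omega> h t x \<partial>lborel) = wmean \<omega> (\<lambda>x. cos (x \<bullet> \<xi>)) t 0 *\<^sub>R A" .
  show ?thesis
    unfolding hartley_def[of "wmean \<omega> h t"] eq A_def by simp
qed

lemma hartley_scaleR:
  fixes f :: "'a::euclidean_space \<Rightarrow> 'b::euclidean_space"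
  shows "hartley (\<lambda>x. c *\<^sub>R f x) \<xi> = c *\<^sub>R hartley f \<xi>"
proof -
  have "(\<integral>x. cas (x \<bullet> \<xi>) *\<^sub>R (c *\<^sub>R f x) \<partial>lborel) = c *\<^sub>R (\<integral>x. cas (x \<bullet> \<xi>) *\<^sub>R f x \<partial>lborel)"
    unfolding integral_scaleR_right[symmetric]
    by (rule Bochner_Integration.integral_cong[OF refl]) (rule scaleR_left_commute)
  then show ?thesis unfolding hartley_def by (simp only: scaleR_left_commute)
qed

lemma hartley_laplacian:
  fixes h :: "real ^ 'q \<Rightarrow> 'b::euclidean_space"
  assumes h: "smooth h" "compactly_supported h"
  shows "hartley (laplacian h) \<xi> = - (\<xi> \<bullet> \<xi>) *\<^sub>R hartley h \<xi>"
proof -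
  note hd = h smooth_partial_deriv compactly_supported_partial_deriv
  have "hartley (laplacian h) \<xi> = (\<Sum>i\<in>UNIV. hartley (partial_deriv i (partial_deriv i h)) \<xi>)"
    unfolding laplacian_def[abs_def]
    by (intro hartley_sum bounded_integrable_imp_integrable bounded_integrable_smooth hd)
  also have "\<dots> = (\<Sum>i\<in>UNIV. - (\<xi> $ i * \<xi> $ i) *\<^sub>R hartley h \<xi>)"
    by (simp add: hartley_partial_deriv hd)
  finally show ?thesis
    by (simp add: inner_vec_def sum_negf scaleR_sum_left)
qed

lemma even_ball_weight: "ball_weight (- y) = ball_weight y"
  by (simp add: ball_weight_def indicator_def)

lemma even_paraboloid: "paraboloid (- y) = paraboloid y"
  by (simp add: paraboloid_def even_ball_weight)

lemma unit_vector_decomposition: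
  obtains e :: "real ^ 'q" where "e \<bullet> e = 1" "\<xi> = norm \<xi> *\<^sub>R e"
proof (cases "\<xi> = 0")
  case True
  then show ?thesis by (intro that[of "axis undefined 1"]) (simp_all add: inner_axis_axis)
next
  case False
  then show ?thesis
    by (intro that[of "\<xi> /\<^sub>R norm \<xi>"]) (simp_all add: power2_norm_eq_inner[symmetric] power2_eq_square)
qed

lemma hartley_ball_mean:
  fixes h :: "real ^ 'q \<Rightarrow> 'b::euclidean_space"
  assumes h: "smooth h" "compactly_supported h"
  shows "hartley (ball_mean h t) \<xi> = phi (CARD('q) + 2) (t * norm \<xi>) *\<^sub>R hartley h \<xi>"
proof -
  obtain e :: "real ^ 'q" where e: "e \<bullet> e = 1" "\<xi> = norm \<xi> *\<^sub>R e" by (rule unit_vector_decomposition)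
  have "hartley (ball_mean h t) \<xi> = (1 / measure lborel (cball (0 :: real ^ 'q) 1)) *\<^sub>R
    (wmean ball_weight (\<lambda>x. cos (x \<bullet> \<xi>)) t 0 *\<^sub>R hartley h \<xi>)"
    unfolding ball_mean_def[abs_def] hartley_scaleR
    by (simp only: hartley_wmean[OF weight_ball_weight even_ball_weight h])
  also have "wmean ball_weight (\<lambda>x. cos (x \<bullet> \<xi>)) t 0 = wmean ball_weight (\<lambda>x. cos (x \<bullet> e)) (t * norm \<xi>) 0"
    using plane_wave_scaled[of ball_weight "norm \<xi>" e t] by (simp only: e(2)[symmetric])
  finally show ?thesis
    unfolding phi_ball_mean[OF e(1)] ball_mean_def real_scaleR_def scaleR_scaleR .
qed

text \<open>The Laplacian contributes \<open>- (norm \<xi>)\<^sup>2\<close>, which merges with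
  \<open>t\<^sup>2\<close> to \<open>(t * norm \<xi>)\<^sup>2\<close>. The sum of the two
  multipliers is therefore the sphere mean of the unit wave at radius
  \<open>t * norm \<xi>\<close>.\<close>

lemma hartley_sphere_mean:
  fixes h :: "real ^ 'q \<Rightarrow> 'b::euclidean_space"
  assumes h: "smooth h" "compactly_supported h"
  shows "hartley (sphere_mean h t) \<xi> = phi CARD('q) (t * norm \<xi>) *\<^sub>R hartley h \<xi>"
proof -
  obtain e :: "real ^ 'q" where e: "e \<bullet> e = 1" "\<xi> = norm \<xi> *\<^sub>R e" by (rule unit_vector_decomposition)
  let ?m = "1 / measure lborel (cball (0 :: real ^ 'q) 1)" and ?q = "real CARD('q)"
  let ?P = "wmean paraboloid (\<lambda>x. cos (x \<bullet> e)) (t * norm \<xi>) 0"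
  have P: "hartley (paraboloid_mean (laplacian h) t) \<xi> = (- (norm \<xi>)\<^sup>2 * (?m * ?P)) *\<^sub>R hartley h \<xi>"
  proof -
    have "hartley (paraboloid_mean (laplacian h) t) \<xi> = ?m *\<^sub>R (wmean paraboloid (\<lambda>x. cos (x \<bullet> \<xi>)) t 0 *\<^sub>R hartley (laplacian h) \<xi>)"
      unfolding paraboloid_mean_def[abs_def] hartley_scaleR
      by (simp only: hartley_wmean[OF weight_paraboloid even_paraboloid smooth_laplacian[OF h(1)] compactly_supported_laplacian[OF h(2)]])
    also have "wmean paraboloid (\<lambda>x. cos (x \<bullet> \<xi>)) t 0 = ?P"
      using plane_wave_scaled[of paraboloid "norm \<xi>" e t] by (simp only: e(2)[symmetric])
    finally show ?thesis
      by (simp add: hartley_laplacian[OF h] power2_norm_eq_inner mult_ac)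
  qed
  have i1: "integrable lborel (ball_mean h t)"
    by (intro bounded_integrable_imp_integrable bounded_integrable_smooth smooth_ball_mean compactly_supported_means h)
  have cp: "compactly_supported (paraboloid_mean (laplacian h) t)"
    unfolding paraboloid_mean_def[abs_def]
    by (rule compactly_supported_linear[OF compactly_supported_wmean[OF weight_paraboloid compactly_supported_laplacian[OF h(2)]] linear_scale_self])
  have i2: "integrable lborel (\<lambda>x. (t\<^sup>2 / ?q) *\<^sub>R paraboloid_mean (laplacian h) t x)"
    by (intro integrable_scaleR_right bounded_integrable_imp_integrable bounded_integrable_smooth smooth_paraboloid_mean smooth_laplacian h cp)
  have "hartley (sphere_mean h t) \<xi> = hartley (ball_mean h t) \<xi> + (t\<^sup>2 / ?q) *\<^sub>R hartley (paraboloid_mean (laplacian h) t) \<xi>"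
    unfolding sphere_mean_def[abs_def] by (simp only: hartley_add[OF i1 i2] hartley_scaleR)
  also have "\<dots> = (ball_mean (\<lambda>x. cos (x \<bullet> e)) (t * norm \<xi>) 0 + (t\<^sup>2 / ?q) * (- (norm \<xi>)\<^sup>2 * (?m * ?P))) *\<^sub>R hartley h \<xi>"
    unfolding P hartley_ball_mean[OF h] phi_ball_mean[OF e(1)] by (simp only: scaleR_scaleR scaleR_add_left)
  also have "ball_mean (\<lambda>x. cos (x \<bullet> e)) (t * norm \<xi>) 0 + (t\<^sup>2 / ?q) * (- (norm \<xi>)\<^sup>2 * (?m * ?P))
    = sphere_mean (\<lambda>x. cos (x \<bullet> e)) (t * norm \<xi>) 0"
  proof -
    have "laplacian (\<lambda>x. cos (x \<bullet> e)) = (\<lambda>x. - 1 *\<^sub>R cos (x \<bullet> e))" by (simp add: laplacian_plane_wave e(1))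
    then show ?thesis
      unfolding sphere_mean_def by (simp only: paraboloid_mean_scaleR) (simp add: paraboloid_mean_def power_mult_distrib)
  qed
  finally show ?thesis unfolding phi_sphere_mean[OF e(1)] .
qed

lemma phi_even:
  shows "phi (CARD('q::finite) + 2) (- r) = phi (CARD('q) + 2) r" and "phi CARD('q) (- r) = phi CARD('q) r"
proof -
  obtain e :: "real ^ 'q" where e: "e \<bullet> e = 1" by (rule unit_vector_decomposition[of 0])
  have "wmean \<omega> (\<lambda>x. cos (x \<bullet> e)) (- r) 0 = wmean \<omega> (\<lambda>x. cos (x \<bullet> e)) r 0" for \<omega>
    by (simp add: wmean_def)
  then have b: "ball_mean (\<lambda>x. cos (x \<bullet> e)) (- r) 0 = ball_mean (\<lambda>x. cos (x \<bullet> e)) r 0"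
    and p: "paraboloid_mean (\<lambda>x. cos (x \<bullet> e)) (- r) 0 = paraboloid_mean (\<lambda>x. cos (x \<bullet> e)) r 0"
    by (simp_all only: ball_mean_def paraboloid_mean_def)
  show "phi (CARD('q) + 2) (- r) = phi (CARD('q) + 2) r"
    unfolding phi_ball_mean[OF e] by (rule b)
  have "laplacian (\<lambda>x. cos (x \<bullet> e)) = (\<lambda>x. - 1 *\<^sub>R cos (x \<bullet> e))" by (simp add: laplacian_plane_wave e)
  then show "phi CARD('q) (- r) = phi CARD('q) r"
    unfolding phi_sphere_mean[OF e] sphere_mean_def by (simp only: b p paraboloid_mean_scaleR power2_minus)
qed

lemma phi_measurable:
  shows "phi (CARD('q::finite) + 2) \<in> borel_measurable borel" and "phi CARD('q) \<in> borel_measurable borel"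
proof -
  obtain e :: "real ^ 'q" where e: "e \<bullet> e = 1" by (rule unit_vector_decomposition[of 0])
  show "phi (CARD('q) + 2) \<in> borel_measurable borel"
    unfolding phi_ball_mean[OF e]
    by (intro borel_measurable_continuous_onI continuous_at_imp_continuous_on ballI
        has_vector_derivative_continuous[OF ball_mean_has_vector_derivative[OF smooth_plane_wave]])
  show "phi CARD('q) \<in> borel_measurable borel"
    unfolding phi_sphere_mean[OF e]
    by (intro borel_measurable_continuous_onI continuous_at_imp_continuous_on ballI
        has_vector_derivative_continuous[OF sphere_mean_has_vector_derivative[OF smooth_plane_wave]])
qed

lemma dirac_calculus_means:
  fixes h :: "('q::{finite, linorder}, 'k::euclidean_space) form"
  assumes h: "test_form h"
  shows "dirac_calculus (\<lambda>r. phi (CARD('q) + 2) (t * r)) h (ball_mean h t)"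
    and "dirac_calculus (\<lambda>r. phi CARD('q) (t * r)) h (sphere_mean h t)"
proof -
  have h': "smooth h" "compactly_supported h" using h by (simp_all add: test_form_def)
  have tf: "test_form (ball_mean h t)" "test_form (sphere_mean h t)"
    unfolding test_form_def using smooth_ball_mean[OF h'(1)] smooth_sphere_mean[OF h'(1)] compactly_supported_means[OF h'(2)]
    by blast+
  have [measurable]: "phi (CARD('q) + 2) \<in> borel_measurable borel" "phi CARD('q) \<in> borel_measurable borel"
    by (rule phi_measurable)+
  show "dirac_calculus (\<lambda>r. phi (CARD('q) + 2) (t * r)) h (ball_mean h t)"
    by (rule dirac_calculusI[OF _ _ h tf(1) hartley_ball_mean[OF h']]) (measurable, simp only: mult_minus_right phi_even)
  show "dirac_calculus (\<lambda>r. phi CARD('q) (t * r)) h (sphere_mean h t)"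
    by (rule dirac_calculusI[OF _ _ h tf(2) hartley_sphere_mean[OF h']]) (measurable, simp only: mult_minus_right phi_even)
qed

theorem theorem1:
  fixes f :: "('q::{finite, linorder}, 'k::euclidean_space) form"
  assumes "smooth f" and "compactly_supported f"
  shows
    "(\<exists>(v :: real \<Rightarrow> ('q, 'k) form) u u' u''.
        (\<forall>t\<ge>0. dirac_calculus (\<lambda>r. phi (CARD('q) + 2) (t * r)) (ext_deriv f) (v t)) \<and>
        (\<forall>t\<ge>0. \<forall>p. u t p = t *\<^sub>R v t p) \<and>
        (\<forall>t\<ge>0. \<forall>p. ((\<lambda>s. u s p) has_vector_derivative u' t p) (at t within {0..})) \<and>
        (\<forall>t>0. \<forall>p. ((\<lambda>s. u' s p) has_vector_derivative u'' t p) (at t)) \<and>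
        (\<forall>t>0. \<forall>p. u'' t p
            + (real CARD('q) - 1) *\<^sub>R (u' t p /\<^sub>R t - u t p /\<^sub>R t\<^sup>2)
            + hodge_laplacian (u t) p = 0) \<and>
        (\<forall>p. u 0 p = 0) \<and>
        (\<forall>p. ((\<lambda>t. u' t p) \<longlongrightarrow> ext_deriv f p) (at_right 0)))
   \<and> (\<exists>(u :: real \<Rightarrow> ('q, 'k) form) u' u''.
        (\<forall>t\<ge>0. dirac_calculus (\<lambda>r. phi (CARD('q)) (t * r)) (ext_deriv f) (u t)) \<and>
        (\<forall>t\<ge>0. \<forall>p. ((\<lambda>s. u s p) has_vector_derivative u' t p) (at t within {0..})) \<and>
        (\<forall>t>0. \<forall>p. ((\<lambda>s. u' s p) has_vector_derivative u'' t p) (at t)) \<and>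
        (\<forall>t>0. \<forall>p. u'' t p
            + (real CARD('q) - 1) *\<^sub>R (u' t p /\<^sub>R t)
            + hodge_laplacian (u t) p = 0) \<and>
        (\<forall>p. u 0 p = ext_deriv f p) \<and>
        (\<forall>p. u' 0 p = 0))"
proof -
  define h where "h = ext_deriv f"
  let ?q = "real CARD('q)"
  have tf: "test_form h" unfolding h_def by (rule test_form_ext_deriv) (simp add: test_form_def assms)
  then have h: "smooth h" "compactly_supported h" by (simp_all add: test_form_def)
  note lh = smooth_laplacian[OF h(1)]
  let ?V = "paraboloid_mean (laplacian h)" and ?Z = "paraboloid_mean_deriv (laplacian h)"
  \<comment> \<open>With M for the ball mean, \<open>M' = t V\<close> and \<open>V' = Z\<close>, so
    the product rule gives \<open>u' = M + t\<^sup>2 V\<close> and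
    \<open>u'' = t V + 2 t V + t\<^sup>2 Z\<close>.\<close>
  define u where "u t p = t *\<^sub>R ball_mean h t p" for t p
  define u' where "u' t p = ball_mean h t p + t\<^sup>2 *\<^sub>R ?V t p" for t p
  define u'' where "u'' t p = (3 * t) *\<^sub>R ?V t p + t\<^sup>2 *\<^sub>R ?Z t p" for t p
  have du: "((\<lambda>s. u s p) has_vector_derivative u' t p) (at t)" for t p
    unfolding u_def u'_def
    by (rule scaleR_has_vector_derivative[OF DERIV_ident ball_mean_has_vector_derivative[OF h(1)]])
       (simp add: power2_eq_square)
  have du': "((\<lambda>s. u' s p) has_vector_derivative u'' t p) (at t)" for t p
  proof -
    have "((\<lambda>t. t\<^sup>2 *\<^sub>R ?V t p) has_vector_derivative t\<^sup>2 *\<^sub>R ?Z t p + (2 * t) *\<^sub>R ?V t p) (at t)"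
      by (rule scaleR_has_vector_derivative[OF _ paraboloid_mean_has_vector_derivative[OF lh] refl])
         (auto intro!: derivative_eq_intros)
    from has_vector_derivative_add[OF ball_mean_has_vector_derivative[OF h(1)] this]
    have "((\<lambda>s. u' s p) has_vector_derivative t *\<^sub>R ?V t p + (t\<^sup>2 *\<^sub>R ?Z t p + (2 * t) *\<^sub>R ?V t p)) (at t)"
      by (simp only: u'_def)
    moreover have "t *\<^sub>R ?V t p + (t\<^sup>2 *\<^sub>R ?Z t p + (2 * t) *\<^sub>R ?V t p) = u'' t p"
    proof -
      have "(3 * t) *\<^sub>R ?V t p = t *\<^sub>R ?V t p + (2 * t) *\<^sub>R ?V t p"
        unfolding scaleR_add_left[symmetric] by simp
      then show ?thesis by (simp add: u''_def)
    qed
    ultimately show ?thesis by simp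
  qed
  have hodge_u: "hodge_laplacian (u t) p = - (t *\<^sub>R ball_mean (laplacian h) t p)" for t p
  proof -
    \<comment> \<open>The zero summand only brings \<open>u t\<close> into the form of
      \<open>laplacian_lincomb\<close>.\<close>
    have eq: "u t = (\<lambda>p. t *\<^sub>R ball_mean h t p + 0 *\<^sub>R ball_mean h t p)" by (simp add: fun_eq_iff u_def)
    have "test_form (u t)"
      unfolding test_form_def u_def[abs_def]
      by (intro conjI smooth_scaleR_const smooth_ball_mean h(1)
          compactly_supported_linear[OF compactly_supported_means(1)[OF h(2)] linear_scale_self])
    then have "hodge_laplacian (u t) p = - laplacian (u t) p"
      by (simp only: hodge_laplacian_eq laplacian_def)
    also have "laplacian (u t) p = t *\<^sub>R ball_mean (laplacian h) t p"
      unfolding eq laplacian_lincomb[OF smooth_ball_mean[OF h(1)] smooth_ball_mean[OF h(1)]]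
      by (simp add: laplacian_ball_mean[OF h(1)])
    finally show ?thesis .
  qed
  have eq_a: "u'' t p + (?q - 1) *\<^sub>R (u' t p /\<^sub>R t - u t p /\<^sub>R t\<^sup>2) + hodge_laplacian (u t) p = 0" if "t > 0" for t p
  proof -
    \<comment> \<open>The singular part \<open>M / t\<close> of \<open>u' / t\<close> cancels
      against \<open>u / t\<^sup>2\<close>, leaving \<open>(q - 1) t V\<close>. With the
      \<open>3 t V\<close> of \<open>u''\<close> this is \<open>(q + 2) t V\<close>, so the equation
      is \<open>t\<close> times \<open>ball_mean_darboux\<close>.\<close>
    have "u t p /\<^sub>R t\<^sup>2 = ball_mean h t p /\<^sub>R t"
      using that by (simp add: u_def power2_eq_square)
    then have "u' t p /\<^sub>R t - u t p /\<^sub>R t\<^sup>2 = t *\<^sub>R ?V t p"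
      using that by (simp add: u'_def scaleR_add_right power2_eq_square)
    moreover have "t *\<^sub>R ball_mean (laplacian h) t p = (t * (?q + 2)) *\<^sub>R ?V t p + t\<^sup>2 *\<^sub>R ?Z t p"
      unfolding ball_mean_darboux[OF lh, symmetric] by (simp add: scaleR_add_right power2_eq_square)
    moreover have "(3 * t) *\<^sub>R ?V t p + (?q - 1) *\<^sub>R (t *\<^sub>R ?V t p) = (t * (?q + 2)) *\<^sub>R ?V t p"
      unfolding scaleR_scaleR scaleR_add_left[symmetric] by (rule arg_cong[where f = "\<lambda>c. c *\<^sub>R _"]) (simp add: algebra_simps)
    ultimately show ?thesis unfolding hodge_u u''_def by (simp add: algebra_simps)
  qed
  have u'_0: "((\<lambda>t. u' t p) \<longlongrightarrow> ext_deriv f p) (at_right 0)" for p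
  proof -
    \<comment> \<open>The formula for \<open>u'\<close> is differentiable at every real
      \<open>t\<close>, so the one-sided limit at 0 is just its value there.\<close>
    have "isCont (\<lambda>t. u' t p) 0" using has_vector_derivative_continuous[OF du'] .
    then have "((\<lambda>t. u' t p) \<longlongrightarrow> u' 0 p) (at_right 0)"
      by (simp add: isCont_def filterlim_at_split)
    moreover have "u' 0 p = ext_deriv f p" by (simp add: u'_def ball_mean_0 h_def)
    ultimately show ?thesis by simp
  qed
  have part_a: "(\<forall>t\<ge>0. dirac_calculus (\<lambda>r. phi (CARD('q) + 2) (t * r)) (ext_deriv f) (ball_mean h t)) \<and>
      (\<forall>t\<ge>0. \<forall>p. u t p = t *\<^sub>R ball_mean h t p) \<and>
      (\<forall>t\<ge>0. \<forall>p. ((\<lambda>s. u s p) has_vector_derivative u' t p) (at t within {0..})) \<and>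
      (\<forall>t>0. \<forall>p. ((\<lambda>s. u' s p) has_vector_derivative u'' t p) (at t)) \<and>
      (\<forall>t>0. \<forall>p. u'' t p + (?q - 1) *\<^sub>R (u' t p /\<^sub>R t - u t p /\<^sub>R t\<^sup>2) + hodge_laplacian (u t) p = 0) \<and>
      (\<forall>p. u 0 p = 0) \<and> (\<forall>p. ((\<lambda>t. u' t p) \<longlongrightarrow> ext_deriv f p) (at_right 0))"
    using dirac_calculus_means(1)[OF tf] has_vector_derivative_at_within[OF du] du' eq_a u'_0
    by (simp add: u_def h_def)
  define w' where "w' t p = (t / ?q) *\<^sub>R ball_mean (laplacian h) t p" for t p
  define w'' where "w'' t p = (t / ?q) *\<^sub>R (t *\<^sub>R paraboloid_mean (laplacian (laplacian h)) t p)
    + (1 / ?q) *\<^sub>R ball_mean (laplacian h) t p" for t p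
  have dw: "((\<lambda>s. sphere_mean h s p) has_vector_derivative w' t p) (at t)" for t p
    unfolding w'_def by (rule sphere_mean_has_vector_derivative[OF h(1)])
  have dw': "((\<lambda>s. w' s p) has_vector_derivative w'' t p) (at t)" for t p
    unfolding w'_def w''_def by (rule sphere_mean_deriv_has_vector_derivative[OF h(1)])
  have eq_b: "w'' t p + (?q - 1) *\<^sub>R (w' t p /\<^sub>R t) + hodge_laplacian (sphere_mean h t) p = 0" if "t > 0" for t p
  proof -
    have "test_form (sphere_mean h t)"
      unfolding test_form_def using smooth_sphere_mean[OF h(1)] compactly_supported_means(2)[OF h(2)] by blast
    then have "hodge_laplacian (sphere_mean h t) p = - laplacian (sphere_mean h t) p"
      by (simp only: hodge_laplacian_eq laplacian_def)
    also have "\<dots> = - sphere_mean (laplacian h) t p" by (simp only: laplacian_sphere_mean[OF h(1)])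
    also have "sphere_mean (laplacian h) t p = w'' t p + (?q - 1) *\<^sub>R (w' t p /\<^sub>R t)"
      unfolding w'_def w''_def using that by (intro sphere_mean_darboux[OF h(1), symmetric]) simp
    finally show ?thesis by simp
  qed
  have part_b: "(\<forall>t\<ge>0. dirac_calculus (\<lambda>r. phi (CARD('q)) (t * r)) (ext_deriv f) (sphere_mean h t)) \<and>
      (\<forall>t\<ge>0. \<forall>p. ((\<lambda>s. sphere_mean h s p) has_vector_derivative w' t p) (at t within {0..})) \<and>
      (\<forall>t>0. \<forall>p. ((\<lambda>s. w' s p) has_vector_derivative w'' t p) (at t)) \<and>
      (\<forall>t>0. \<forall>p. w'' t p + (?q - 1) *\<^sub>R (w' t p /\<^sub>R t) + hodge_laplacian (sphere_mean h t) p = 0) \<and>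
      (\<forall>p. sphere_mean h 0 p = ext_deriv f p) \<and> (\<forall>p. w' 0 p = 0)"
    using dirac_calculus_means(2)[OF tf] has_vector_derivative_at_within[OF dw] dw' eq_b
    by (simp add: sphere_mean_0 w'_def h_def)
  show ?thesis
    by (rule conjI, rule exI[of _ "ball_mean h"], rule exI[of _ u], rule exI[of _ u'], rule exI[of _ u''], rule part_a,
        rule exI[of _ "sphere_mean h"], rule exI[of _ w'], rule exI[of _ w''], rule part_b)
qed

end
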